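(* Let $n\in\{1,2\}$, $k>0$, and let $\Gamma\subset\Gamma_\infty=\mathbb{R}^n\times\{0\}$ be a compact $d$-set with $n-1<d\le n$. For $\Psi\in\mathbb{L}_\infty(\Gamma)$, $$\mathbb{S}\Psi(x)=\int_\Gamma\Phi(x,y)\Psi(y)\,d\mathcal{H}^d(y),\qquad\text{for }\mathcal{H}^d\text{-a.e. }x\in\Gamma.$$
   Context: Function spaces. $H^s(\mathbb{R}^n)$ has norm $\|\varphi\|^2_{H^s(\mathbb{R}^n)}=\int(1+|\xi|^2)^s|\widehat\varphi(\xi)|^2\,d\xi$ (unitary Fourier transform), with pairing $\langle\phi,\psi\rangle_{H^{-s}\times H^s}=\int\widehat\phi\,\overline{\widehat\psi}\,d\xi$ (and likewise $H^s\times H^{-s}$). For $\Omega$ open, $\widetilde H^s(\Omega)$ is the closure of $C_0^\infty(\Omega)$ in $H^s(\mathbb{R}^n)$; for $E$ closed, $H^s_E=\{u\in H^s(\mathbb{R}^n):\mathrm{supp}\,u\subset E\}$; ${}^\perp$ is orthogonal complement in $H^s(\mathbb{R}^n)$. A closed $\Gamma\subset\mathbb{R}^n$ is a $d$-set if $c_1r^d\le\mathcal{H}^d(\Gamma\cap B_r(x))\le c_2r^d$ for all $x\in\Gamma$, $0<r\le1$, some $c_1,c_2>0$ ($\mathcal{H}^d$ Hausdorff measure). $\mathbb{L}_2(\Gamma),\mathbb{L}_\infty(\Gamma)$ are the Lebesgue spaces of complex functions with respect to $\mathcal{H}^d|_\Gamma$. For $s>(n-d)/2$, $t=s-(n-d)/2>0$,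 $\mathrm{tr}_\Gamma:H^s(\mathbb{R}^n)\to\mathbb{L}_2(\Gamma)$ is the continuous extension of $\varphi\mapsto\varphi|_\Gamma$, $\varphi\in C_0^\infty(\mathbb{R}^n)$; $\mathbb{H}^t(\Gamma):=\mathrm{tr}_\Gamma(H^s(\mathbb{R}^n))$ with the quotient norm; $\mathbb{H}^{-t}(\Gamma):=(\mathbb{H}^t(\Gamma))^*$ (antilinear functionals), with $\mathbb{L}_2(\Gamma)$ embedded via $f\mapsto(f,\cdot)_{\mathbb{L}_2(\Gamma)}$; $\mathrm{tr}_\Gamma^*:\mathbb{H}^{-t}(\Gamma)\to H^{-s}(\mathbb{R}^n)$ is defined by $\langle\varphi,\mathrm{tr}_\Gamma^*f\rangle_{H^s\times H^{-s}}=\langle\mathrm{tr}_\Gamma\varphi,f\rangle_{\mathbb{H}^t(\Gamma)\times\mathbb{H}^{-t}(\Gamma)}$ for all $\varphi\in H^s(\mathbb{R}^n)$. For $0<t<1$, $\mathrm{tr}_\Gamma^*$ is known to be a unitary isomorphism onto $H^{-s}_\Gamma$. Operators. $\Gamma_\infty$ is identified with $\mathbb{R}^n$. $\Gamma^c=\Gamma_\infty\setminus\Gamma$, $D=\mathbb{R}^{n+1}\setminus\Gamma$, $U^\pm=\{\pm x_{n+1}>0\}$, $\gamma^\pm:W^1(U^\pm)\to H^{1/2}(\Gamma_\infty)$ are the Dirichlet traces, $C^\infty_{0,\Gamma}$ is the set of $\sigma\in C_0^\infty(\mathbb{R}^{n+1})$ equal to one in a neighbourhood of $\Gamma$, and $P:H^{1/2}(\Gamma_\infty)\to\widetilde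 H^{1/2}(\Gamma^c)^\perp$ is orthogonal projection. $\Phi(x,y)=e^{ik|x-y|}/(4\pi|x-y|)$ for $n=2$, $\Phi(x,y)=\frac i4H^{(1)}_0(k|x-y|)$ for $n=1$. The single-layer potential $\mathcal{S}:H^{-1/2}_\Gamma\to C^2(D)\cap W^{1,\mathrm{loc}}(\mathbb{R}^{n+1})$ is $\mathcal{S}\psi(x)=\langle\gamma^\pm(\sigma\Phi(x,\cdot)|_{U^\pm}),\overline\psi\rangle_{H^{1/2}(\Gamma_\infty)\times H^{-1/2}(\Gamma_\infty)}$, $x\in D$, for any $\sigma\in C^\infty_{0,\Gamma}$ with $x\notin\mathrm{supp}\,\sigma$; $S:H^{-1/2}_\Gamma\to\widetilde H^{1/2}(\Gamma^c)^\perp$ is $S\psi=P\gamma^\pm(\sigma\mathcal{S}\psi|_{U^\pm})$, $\sigma\in C^\infty_{0,\Gamma}$ arbitrary (either sign gives the same result). With $t_d=\frac12-\frac{n-d}2\in(0,\frac12]$, $\mathbb{S}:=\mathrm{tr}_\Gamma\,S\,\mathrm{tr}_\Gamma^*:\mathbb{H}^{-t_d}(\Gamma)\to\mathbb{H}^{t_d}(\Gamma)$. *)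

theory Defs
  imports "HOL-Analysis.Analysis"
begin

section \<open>Smooth functions\<close>

definition dir_deriv :: "'a::euclidean_space \<Rightarrow> ('a \<Rightarrow> complex) \<Rightarrow> 'a \<Rightarrow> complex" where
  "dir_deriv v f x = frechet_derivative f (at x) v"

fun iter_deriv :: "'a::euclidean_space list \<Rightarrow> ('a \<Rightarrow> complex) \<Rightarrow> 'a \<Rightarrow> complex" where
  "iter_deriv [] f = f"
| "iter_deriv (v # vs) f = dir_deriv v (iter_deriv vs f)"

definition smooth :: "('a::euclidean_space \<Rightarrow> complex) \<Rightarrow> bool" where
  "smooth f \<longleftrightarrow> (\<forall>vs x. iter_deriv vs f differentiable (at x))"

definition fun_supp :: "('a::euclidean_space \<Rightarrow> complex) \<Rightarrow> 'a set" where
  "fun_supp f = closure {x. f x \<noteq> 0}"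

definition test_functions :: "'a::euclidean_space set \<Rightarrow> ('a \<Rightarrow> complex) set" where
  "test_functions \<Omega> = {f. smooth f \<and> compact (fun_supp f) \<and> fun_supp f \<subseteq> \<Omega>}"

definition schwartz :: "('a::euclidean_space \<Rightarrow> complex) set" where
  "schwartz = {f. smooth f \<and>
     (\<forall>N vs. bounded (range (\<lambda>x. of_real (norm x ^ N) * iter_deriv vs f x)))}"

definition schwartz_seminorm :: "nat \<Rightarrow> ('a::euclidean_space \<Rightarrow> complex) \<Rightarrow> real" where
  "schwartz_seminorm N f =
     Sup {(1 + norm x) ^ N * norm (iter_deriv vs f x) | x vs. set vs \<subseteq> Basis \<and> length vs \<le> N}"

section \<open>Lebesgue spaces, as sets of representatives\<close>

definition L2 :: "'a measure \<Rightarrow> ('a \<Rightarrow> complex) set" where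
  "L2 M = {f \<in> borel_measurable M. integrable M (\<lambda>x. (norm (f x))\<^sup>2)}"

definition L2_norm :: "'a measure \<Rightarrow> ('a \<Rightarrow> complex) \<Rightarrow> real" where
  "L2_norm M f = sqrt (LINT x|M. (norm (f x))\<^sup>2)"

definition Linf :: "'a measure \<Rightarrow> ('a \<Rightarrow> complex) set" where
  "Linf M = {f \<in> borel_measurable M. \<exists>C. AE x in M. norm (f x) \<le> C}"

section \<open>Tempered distributions and the Fourier transform\<close>

text \<open>
  Distributions act linearly on Schwartz functions. As HOL functions are total, they are taken to
  vanish on arguments that are not Schwartz functions; this makes the representation unique.
\<close>

type_synonym 'a distr = "('a \<Rightarrow> complex) \<Rightarrow> complex"

definition tempered :: "'a::euclidean_space distr set" where
  "tempered = {u.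
     (\<forall>f. f \<notin> schwartz \<longrightarrow> u f = 0) \<and>
     (\<forall>f\<in>schwartz. \<forall>g\<in>schwartz. u (\<lambda>x. f x + g x) = u f + u g) \<and>
     (\<forall>c. \<forall>f\<in>schwartz. u (\<lambda>x. c * f x) = c * u f) \<and>
     (\<exists>C N. \<forall>f\<in>schwartz. norm (u f) \<le> C * schwartz_seminorm N f)}"

definition distr_of :: "('a::euclidean_space \<Rightarrow> complex) \<Rightarrow> 'a distr" where
  "distr_of f = (\<lambda>g. if g \<in> schwartz then LINT x|lborel. f x * g x else 0)"

definition distr_diff :: "'a distr \<Rightarrow> 'a distr \<Rightarrow> 'a distr" where
  "distr_diff u v = (\<lambda>f. u f - v f)"

definition distr_cnj :: "'a distr \<Rightarrow> 'a distr" where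
  "distr_cnj u = (\<lambda>f. cnj (u (\<lambda>x. cnj (f x))))"

definition distr_supp :: "'a::euclidean_space distr \<Rightarrow> 'a set" where
  "distr_supp u = - \<Union>{V. open V \<and> (\<forall>f\<in>test_functions V. u f = 0)}"

definition fourier :: "('a::euclidean_space \<Rightarrow> complex) \<Rightarrow> 'a \<Rightarrow> complex" where
  "fourier f \<xi> =
     of_real ((2 * pi) powr (- real DIM('a) / 2)) * (LINT x|lborel. exp (- \<i> * of_real (\<xi> \<bullet> x)) * f x)"

definition has_fourier :: "'a::euclidean_space distr \<Rightarrow> ('a \<Rightarrow> complex) \<Rightarrow> bool" where
  "has_fourier u h \<longleftrightarrow> u \<in> tempered \<and> h \<in> borel_measurable borel \<and>
     (\<forall>f\<in>schwartz. integrable lborel (\<lambda>\<xi>. h \<xi> * f \<xi>) \<and>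
        u (fourier f) = (LINT \<xi>|lborel. h \<xi> * f \<xi>))"

text \<open>The density of the transform is determined only up to null sets.\<close>

definition fourier_distr :: "'a::euclidean_space distr \<Rightarrow> 'a \<Rightarrow> complex" where
  "fourier_distr u = (SOME h. has_fourier u h)"

section \<open>Sobolev spaces on the whole space\<close>

definition sobolev :: "real \<Rightarrow> 'a::euclidean_space distr set" where
  "sobolev s = {u \<in> tempered. \<exists>h. has_fourier u h \<and>
     integrable lborel (\<lambda>\<xi>. (1 + (norm \<xi>)\<^sup>2) powr s * (norm (h \<xi>))\<^sup>2)}"

definition sobolev_norm :: "real \<Rightarrow> 'a::euclidean_space distr \<Rightarrow> real" where
  "sobolev_norm s u =
     sqrt (LINT \<xi>|lborel. (1 + (norm \<xi>)\<^sup>2) powr s * (norm (fourier_distr u \<xi>))\<^sup>2)"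

definition sobolev_inner :: "real \<Rightarrow> 'a::euclidean_space distr \<Rightarrow> 'a distr \<Rightarrow> complex" where
  "sobolev_inner s u v =
     (LINT \<xi>|lborel. of_real ((1 + (norm \<xi>)\<^sup>2) powr s) * fourier_distr u \<xi> * cnj (fourier_distr v \<xi>))"

definition sobolev_pairing :: "'a::euclidean_space distr \<Rightarrow> 'a distr \<Rightarrow> complex" where
  "sobolev_pairing u v = (LINT \<xi>|lborel. fourier_distr u \<xi> * cnj (fourier_distr v \<xi>))"

definition sobolev_tilde :: "real \<Rightarrow> 'a::euclidean_space set \<Rightarrow> 'a distr set" where
  "sobolev_tilde s \<Omega> = {u \<in> sobolev s.
     \<forall>\<epsilon>>0. \<exists>f\<in>test_functions \<Omega>. sobolev_norm s (distr_diff u (distr_of f)) < \<epsilon>}"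

definition sobolev_supp :: "real \<Rightarrow> 'a::euclidean_space set \<Rightarrow> 'a distr set" where
  "sobolev_supp s E = {u \<in> sobolev s. distr_supp u \<subseteq> E}"

definition orth_compl :: "real \<Rightarrow> 'a::euclidean_space distr set \<Rightarrow> 'a distr set" where
  "orth_compl s V = {u \<in> sobolev s. \<forall>v\<in>V. sobolev_inner s u v = 0}"

definition orth_proj :: "real \<Rightarrow> 'a::euclidean_space distr set \<Rightarrow> 'a distr \<Rightarrow> 'a distr" where
  "orth_proj s W = (\<lambda>u\<in>sobolev s.
     THE w. w \<in> W \<and> (\<forall>z\<in>W. sobolev_inner s (distr_diff u w) z = 0))"

section \<open>Hausdorff measure and d-sets\<close>

text \<open>
  The factor \<^term>\<open>unit_ball_vol d / 2 powr d\<close> normalises the measure so that it agrees with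
  Lebesgue measure when \<^term>\<open>d\<close> is the dimension of the space. The definition is meant for
  \<^term>\<open>d > 0\<close>, since \<^term>\<open>0 powr 0 = 0\<close>.
\<close>

definition hausdorff_pre :: "real \<Rightarrow> real \<Rightarrow> 'a::euclidean_space set \<Rightarrow> ennreal" where
  "hausdorff_pre d \<delta> A =
     Inf {(\<Sum>i. ennreal (unit_ball_vol d * (diameter (C i) / 2) powr d)) | C :: nat \<Rightarrow> 'a set.
            A \<subseteq> (\<Union>i. C i) \<and> (\<forall>i. bounded (C i) \<and> diameter (C i) \<le> \<delta>)}"

definition hausdorff_outer :: "real \<Rightarrow> 'a::euclidean_space set \<Rightarrow> ennreal" where
  "hausdorff_outer d A = (SUP \<delta>\<in>{0<..}. hausdorff_pre d \<delta> A)"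

definition hausdorff_measure :: "real \<Rightarrow> 'a::euclidean_space measure" where
  "hausdorff_measure d = measure_of UNIV (sets borel) (hausdorff_outer d)"

definition d_set :: "real \<Rightarrow> 'a::euclidean_space set \<Rightarrow> bool" where
  "d_set d \<Gamma> \<longleftrightarrow> closed \<Gamma> \<and> (\<exists>c1>0. \<exists>c2>0. \<forall>x\<in>\<Gamma>. \<forall>r. 0 < r \<and> r \<le> 1 \<longrightarrow>
     ennreal (c1 * r powr d) \<le> emeasure (hausdorff_measure d) (\<Gamma> \<inter> cball x r) \<and>
     emeasure (hausdorff_measure d) (\<Gamma> \<inter> cball x r) \<le> ennreal (c2 * r powr d))"

definition surface :: "real \<Rightarrow> 'a::euclidean_space set \<Rightarrow> 'a measure" where
  "surface d \<Gamma> = restrict_space (hausdorff_measure d) \<Gamma>"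

section \<open>Trace spaces on d-sets\<close>

text \<open>
  The continuous extension of the restriction map from test functions, obtained by taking limits
  along approximating sequences. Its values are representatives of classes in L2.
\<close>

definition trace_on :: "real \<Rightarrow> real \<Rightarrow> 'a::euclidean_space set \<Rightarrow> 'a distr \<Rightarrow> 'a \<Rightarrow> complex" where
  "trace_on d s \<Gamma> = (\<lambda>u\<in>sobolev s. SOME g. g \<in> L2 (surface d \<Gamma>) \<and>
     (\<forall>f :: nat \<Rightarrow> 'a \<Rightarrow> complex.
        (\<forall>j. f j \<in> test_functions UNIV) \<and>
        (\<lambda>j. sobolev_norm s (distr_diff (distr_of (f j)) u)) \<longlonglongrightarrow> 0
        \<longrightarrow> (\<lambda>j. L2_norm (surface d \<Gamma>) (\<lambda>x. f j x - g x)) \<longlonglongrightarrow> 0))"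

text \<open>The exponent on the whole space corresponding to the exponent t on the d-set.\<close>

definition lift_exponent :: "'a::euclidean_space itself \<Rightarrow> real \<Rightarrow> real \<Rightarrow> real" where
  "lift_exponent _ d t = t + (real DIM('a) - d) / 2"

definition trace_space :: "real \<Rightarrow> real \<Rightarrow> 'a::euclidean_space set \<Rightarrow> ('a \<Rightarrow> complex) set" where
  "trace_space d t \<Gamma> = {g \<in> L2 (surface d \<Gamma>). \<exists>u\<in>sobolev (lift_exponent TYPE('a) d t).
     AE x in surface d \<Gamma>. g x = trace_on d (lift_exponent TYPE('a) d t) \<Gamma> u x}"

definition trace_space_norm :: "real \<Rightarrow> real \<Rightarrow> 'a::euclidean_space set \<Rightarrow> ('a \<Rightarrow> complex) \<Rightarrow> real" where
  "trace_space_norm d t \<Gamma> g = Inf {sobolev_norm (lift_exponent TYPE('a) d t) u | u.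
     u \<in> sobolev (lift_exponent TYPE('a) d t) \<and>
     (AE x in surface d \<Gamma>. g x = trace_on d (lift_exponent TYPE('a) d t) \<Gamma> u x)}"

text \<open>
  Continuous antilinear functionals; they act on representatives, so invariance under changes on
  null sets is part of the definition.
\<close>

definition trace_dual :: "real \<Rightarrow> real \<Rightarrow> 'a::euclidean_space set \<Rightarrow> (('a \<Rightarrow> complex) \<Rightarrow> complex) set" where
  "trace_dual d t \<Gamma> = {F.
     (\<forall>g\<in>trace_space d t \<Gamma>. \<forall>h\<in>trace_space d t \<Gamma>.
        (AE x in surface d \<Gamma>. g x = h x) \<longrightarrow> F g = F h) \<and>
     (\<forall>g\<in>trace_space d t \<Gamma>. \<forall>h\<in>trace_space d t \<Gamma>. F (\<lambda>x. g x + h x) = F g + F h) \<and>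
     (\<forall>c. \<forall>g\<in>trace_space d t \<Gamma>. F (\<lambda>x. c * g x) = cnj c * F g) \<and>
     (\<exists>C. \<forall>g\<in>trace_space d t \<Gamma>. norm (F g) \<le> C * trace_space_norm d t \<Gamma> g)}"

definition L2_embed :: "real \<Rightarrow> 'a::euclidean_space set \<Rightarrow> ('a \<Rightarrow> complex) \<Rightarrow> ('a \<Rightarrow> complex) \<Rightarrow> complex" where
  "L2_embed d \<Gamma> f = (\<lambda>g. LINT x|surface d \<Gamma>. f x * cnj (g x))"

text \<open>
  A functional F pairs with g as F g when F is written first, hence as \<^term>\<open>cnj (F g)\<close> when g is
  written first, which is the order used to define the adjoint.
\<close>

definition trace_adj :: "real \<Rightarrow> real \<Rightarrow> 'a::euclidean_space set \<Rightarrow> (('a \<Rightarrow> complex) \<Rightarrow> complex) \<Rightarrow> 'a distr" where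
  "trace_adj d t \<Gamma> = (\<lambda>F\<in>trace_dual d t \<Gamma>.
     THE v. v \<in> sobolev (- lift_exponent TYPE('a) d t) \<and>
       (\<forall>u\<in>sobolev (lift_exponent TYPE('a) d t).
          sobolev_pairing u v = cnj (F (trace_on d (lift_exponent TYPE('a) d t) \<Gamma> u))))"

section \<open>Half-spaces and Dirichlet traces\<close>

text \<open>
  The ambient space of dimension n + 1 is rendered as \<^typ>\<open>'a \<times> real\<close>, the second component being
  the last coordinate. The two half-spaces correspond to \<^term>\<open>e = 1\<close> and \<^term>\<open>e = - 1\<close>.
\<close>

definition half_space :: "real \<Rightarrow> ('a::euclidean_space \<times> real) set" where
  "half_space e = {x. 0 < e * snd x}"

definition on_set :: "'a::euclidean_space set \<Rightarrow> 'a measure" where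
  "on_set U = restrict_space lborel U"

definition has_weak_deriv ::
    "'a::euclidean_space set \<Rightarrow> 'a \<Rightarrow> ('a \<Rightarrow> complex) \<Rightarrow> ('a \<Rightarrow> complex) \<Rightarrow> bool" where
  "has_weak_deriv U b f g \<longleftrightarrow> g \<in> L2 (on_set U) \<and>
     (\<forall>\<phi>\<in>test_functions U.
        (LINT x|on_set U. f x * dir_deriv b \<phi> x) = - (LINT x|on_set U. g x * \<phi> x))"

definition W1 :: "'a::euclidean_space set \<Rightarrow> ('a \<Rightarrow> complex) set" where
  "W1 U = {f \<in> L2 (on_set U). \<forall>b\<in>Basis. \<exists>g. has_weak_deriv U b f g}"

definition W1_norm :: "'a::euclidean_space set \<Rightarrow> ('a \<Rightarrow> complex) \<Rightarrow> real" where
  "W1_norm U f = sqrt ((L2_norm (on_set U) f)\<^sup>2 +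
     (\<Sum>b\<in>Basis. (L2_norm (on_set U) (SOME g. has_weak_deriv U b f g))\<^sup>2))"

text \<open>The continuous extension of restriction to the hyperplane, from restrictions of test functions.\<close>

definition dirichlet_trace :: "real \<Rightarrow> ('a::euclidean_space \<times> real \<Rightarrow> complex) \<Rightarrow> 'a distr" where
  "dirichlet_trace e = (\<lambda>u\<in>W1 (half_space e). THE g. g \<in> sobolev (1/2) \<and>
     (\<forall>f :: nat \<Rightarrow> 'a \<times> real \<Rightarrow> complex.
        (\<forall>j. f j \<in> test_functions UNIV) \<and>
        (\<lambda>j. W1_norm (half_space e) (\<lambda>x. f j x - u x)) \<longlonglongrightarrow> 0
        \<longrightarrow> (\<lambda>j. sobolev_norm (1/2) (distr_diff (distr_of (\<lambda>y. f j (y, 0))) g)) \<longlonglongrightarrow> 0))"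

section \<open>Fundamental solution\<close>

definition bessel_J0 :: "real \<Rightarrow> real" where
  "bessel_J0 z = (\<Sum>m. (- 1) ^ m * (z / 2) ^ (2 * m) / (fact m)\<^sup>2)"

definition bessel_Y0 :: "real \<Rightarrow> real" where
  "bessel_Y0 z = 2 / pi * (ln (z / 2) + euler_mascheroni) * bessel_J0 z
     - 2 / pi * (\<Sum>m. (- 1) ^ m * harm m * (z / 2) ^ (2 * m) / (fact m)\<^sup>2)"

definition hankel1_0 :: "real \<Rightarrow> complex" where
  "hankel1_0 z = Complex (bessel_J0 z) (bessel_Y0 z)"

text \<open>Here n is the dimension of \<^typ>\<open>'a\<close>; the second branch is intended for n = 2 only.\<close>

definition fund_sol :: "real \<Rightarrow> 'a::euclidean_space \<times> real \<Rightarrow> 'a \<times> real \<Rightarrow> complex" where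
  "fund_sol k x y =
     (if DIM('a) = 1 then \<i> / 4 * hankel1_0 (k * dist x y)
      else exp (\<i> * of_real (k * dist x y)) / of_real (4 * pi * dist x y))"

section \<open>Single-layer potential and boundary operators\<close>

text \<open>
  Subsets of the hyperplane are given as subsets of \<^typ>\<open>'a\<close>. A phrase such as ``for any cut-off
  function and either sign'' is rendered by a definite description of the common value.
\<close>

definition screen :: "'a::euclidean_space set \<Rightarrow> ('a \<times> real) set" where
  "screen \<Gamma> = \<Gamma> \<times> {0}"

definition cutoffs :: "'a::euclidean_space set \<Rightarrow> ('a \<times> real \<Rightarrow> complex) set" where
  "cutoffs \<Gamma> = {\<sigma> \<in> test_functions UNIV. \<exists>V. open V \<and> screen \<Gamma> \<subseteq> V \<and> (\<forall>x\<in>V. \<sigma> x = 1)}"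

definition single_layer_pot ::
    "real \<Rightarrow> 'a::euclidean_space set \<Rightarrow> 'a distr \<Rightarrow> 'a \<times> real \<Rightarrow> complex" where
  "single_layer_pot k \<Gamma> = (\<lambda>\<psi>\<in>sobolev_supp (- 1/2) \<Gamma>. \<lambda>x\<in>- screen \<Gamma>.
     THE c. \<forall>\<sigma>\<in>cutoffs \<Gamma>. x \<notin> fun_supp \<sigma> \<longrightarrow> (\<forall>e\<in>{- 1, 1}.
       c = sobolev_pairing (dirichlet_trace e (\<lambda>y. \<sigma> y * fund_sol k x y)) (distr_cnj \<psi>)))"

definition single_layer_op :: "real \<Rightarrow> 'a::euclidean_space set \<Rightarrow> 'a distr \<Rightarrow> 'a distr" where
  "single_layer_op k \<Gamma> = (\<lambda>\<psi>\<in>sobolev_supp (- 1/2) \<Gamma>.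
     THE v. \<forall>\<sigma>\<in>cutoffs \<Gamma>. \<forall>e\<in>{- 1, 1}.
       v = orth_proj (1/2) (orth_compl (1/2) (sobolev_tilde (1/2) (- \<Gamma>)))
             (dirichlet_trace e (\<lambda>x. \<sigma> x * single_layer_pot k \<Gamma> \<psi> x)))"

definition single_layer_dset ::
    "real \<Rightarrow> real \<Rightarrow> 'a::euclidean_space set \<Rightarrow> (('a \<Rightarrow> complex) \<Rightarrow> complex) \<Rightarrow> 'a \<Rightarrow> complex" where
  "single_layer_dset k d \<Gamma> F =
     trace_on d (1/2) \<Gamma> (single_layer_op k \<Gamma> (trace_adj d (1/2 - (real DIM('a) - d) / 2) \<Gamma> F))"

end

theory Submission
  imports Defs "HOL-Probability.Probability" "HOL-Complex_Analysis.Complex_Analysis"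
begin

text \<open>
  Since the measure \<open>\<mu>\<close> on \<open>\<Gamma>\<close> has growth \<open>\<mu>(B(x, r)) \<le> c r\<^sup>d\<close> with \<open>d > n - 1\<close>, Riesz potentials of \<open>\<mu>\<close> of an
  exponent between \<open>n - 1\<close> and \<open>d\<close> are bounded. As the Sobolev weight of order \<open>-1/2\<close> is dominated by a dyadic
  sum of Gaussians, this bounds the Sobolev norm of \<open>\<Psi> \<mu>\<close> of that order. By duality test
  functions satisfy the trace inequality, so the adjoint trace of \<open>\<Psi>\<close> is the distribution
  \<open>\<Psi> \<mu>\<close>, and off the screen its single-layer potential is the integral of the fundamental solution
  against \<open>\<Psi> \<mu>\<close>.

  The fundamental solution is a function of \<open>|x - y|\<^sup>2\<close> that is holomorphic on the right half-plane. Replacing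
  \<open>|x - y|\<^sup>2\<close> by \<open>|x - y|\<^sup>2 + \<epsilon>\<^sup>2\<close> gives smooth potentials that converge, after a cut-off, in \<open>W\<^sup>1\<close> of both
  half-spaces (by a Schur test, as the gradient of the kernel is at most of order \<open>|x - y|\<close> to the power \<open>-n\<close>), and
  boundedly and pointwise on \<open>\<Gamma>\<close>. Hence the Dirichlet trace is the limit of the restrictions of the smooth
  potentials to the hyperplane. The projection changes it only by a limit of test functions supported
  off \<open>\<Gamma>\<close>, whose restrictions to \<open>\<Gamma>\<close> vanish, so the trace on \<open>\<Gamma>\<close> is the pointwise limit of the smooth
  potentials.
\<close>

section \<open>Calculus of smooth functions\<close>

text \<open>Every operator in the statement is a \<open>SOME\<close> or \<open>THE\<close>, either
  over all approximating sequences of test functions or over all cut-offs and both signs. Evaluating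
  such a description takes three things: an a priori inequality that makes the limit independent of
  the sequence, completeness to have a limit, and one explicit sequence. The inequalities are
  \<open>trace_inequality\<close> on \<Gamma> and \<open>half_space_trace_inequality\<close> on the
  hyperplane. The explicit sequence has to serve both traces at once, although the potential is not
  smooth across \<Gamma>; this is the purpose of the regularisation by \<epsilon>, whose cut-off
  potentials are test functions of the ambient space. The condition d > n - 1 says that the order
  1/2 exceeds (n - d)/2, the threshold for traces on \<Gamma>. The open interval between n - 1 and d
  is also the room for the exponent \<open>\<beta>\<close> on which all estimates depend.\<close>

definition smooth_in :: "'a::euclidean_space set \<Rightarrow> ('a \<Rightarrow> complex) \<Rightarrow> bool" where
  "smooth_in U f \<longleftrightarrow> (\<forall>vs. \<forall>x\<in>U. iter_deriv vs f differentiable (at x))"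

lemma smooth_iff_smooth_in: "smooth f \<longleftrightarrow> smooth_in UNIV f"
  by (simp add: smooth_def smooth_in_def)

lemma dir_deriv_eqI: "(f has_derivative f') (at x) \<Longrightarrow> dir_deriv v f x = f' v"
  by (simp add: dir_deriv_def frechet_derivative_at[symmetric])

lemma has_derivative_dir_deriv:
  "f differentiable (at x) \<Longrightarrow> (f has_derivative (\<lambda>v. dir_deriv v f x)) (at x)"
  by (simp add: dir_deriv_def[abs_def] frechet_derivative_works)

lemma dir_deriv_cong_open:
  assumes "open U" "x \<in> U" "\<And>y. y \<in> U \<Longrightarrow> f y = g y"
  shows "dir_deriv v f x = dir_deriv v g x"
proof -
  have "(f has_derivative f') (at x) \<longleftrightarrow> (g has_derivative f') (at x)" for f'
    using has_derivative_transform_within_open[OF _ assms(1,2), of f f' UNIV g]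
      has_derivative_transform_within_open[OF _ assms(1,2), of g f' UNIV f] assms(3) by auto
  then show ?thesis by (simp add: dir_deriv_def frechet_derivative_def)
qed

lemma differentiable_cong_open:
  assumes "open U" "x \<in> U" "\<And>y. y \<in> U \<Longrightarrow> f y = g y" "f differentiable (at x)"
  shows "g differentiable (at x)"
  using assms has_derivative_transform_within_open[OF _ assms(1,2), of f _ UNIV g]
  unfolding differentiable_def by auto

text \<open>Lists of directions are processed by induction, with membership in \<open>F\<close> up
  to equality on \<open>U\<close> as the invariant; openness of \<open>U\<close> lets that equality
  survive one more derivative. Equality is asked for on \<open>U\<close> only, because the
  derivative of a function that is not differentiable off \<open>U\<close> is unspecified
  there.\<close>

lemma smooth_in_coinduct:
  assumes U: "open U" and f: "f \<in> F"
    and diff: "\<And>g x. g \<in> F \<Longrightarrow> x \<in> U \<Longrightarrow> g differentiable (at x)"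
    and step: "\<And>g v. g \<in> F \<Longrightarrow> \<exists>h\<in>F. \<forall>x\<in>U. dir_deriv v g x = h x"
  shows "smooth_in U f"
proof -
  have "\<exists>h\<in>F. \<forall>x\<in>U. iter_deriv vs f x = h x" for vs
  proof (induction vs)
    case (Cons v vs)
    then obtain h where h: "h \<in> F" "\<And>x. x \<in> U \<Longrightarrow> iter_deriv vs f x = h x" by auto
    from step[OF h(1)] obtain h' where "h' \<in> F" "\<forall>x\<in>U. dir_deriv v h x = h' x" by blast
    then show ?case using dir_deriv_cong_open[OF U _ h(2)] by (intro bexI[of _ h']) auto
  qed (use f in auto)
  then have "iter_deriv vs f differentiable (at x)" if "x \<in> U" for vs x
    using differentiable_cong_open[OF U that, of _ "iter_deriv vs f"] diff[OF _ that] by metis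
  then show ?thesis unfolding smooth_in_def by blast
qed

lemma smooth_in_differentiable: "smooth_in U f \<Longrightarrow> x \<in> U \<Longrightarrow> f differentiable (at x)"
  unfolding smooth_in_def by (metis iter_deriv.simps(1))

lemma smooth_in_has_derivative:
  "smooth_in U f \<Longrightarrow> x \<in> U \<Longrightarrow> (f has_derivative (\<lambda>v. dir_deriv v f x)) (at x)"
  by (simp add: smooth_in_differentiable has_derivative_dir_deriv)

lemma smooth_in_continuous_on: "smooth_in U f \<Longrightarrow> continuous_on U f"
  by (meson continuous_at_imp_continuous_on differentiable_imp_continuous_within smooth_in_differentiable)

lemma iter_deriv_append: "iter_deriv (vs @ ws) f = iter_deriv vs (iter_deriv ws f)"
  by (induction vs) auto

lemma smooth_in_dir_deriv: "smooth_in U f \<Longrightarrow> smooth_in U (dir_deriv v f)"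
  unfolding smooth_in_def by (metis iter_deriv_append iter_deriv.simps)

lemma smooth_in_subset: "smooth_in U f \<Longrightarrow> V \<subseteq> U \<Longrightarrow> smooth_in V f"
  by (auto simp: smooth_in_def)

lemma smooth_in_cong:
  assumes "open U" "\<And>x. x \<in> U \<Longrightarrow> f x = g x" "smooth_in U f"
  shows "smooth_in U g"
proof (rule smooth_in_coinduct[where F = "{h. \<exists>k. smooth_in U k \<and> (\<forall>x\<in>U. k x = h x)}"])
  fix h v assume "h \<in> {h. \<exists>k. smooth_in U k \<and> (\<forall>x\<in>U. k x = h x)}"
  then obtain k where k: "smooth_in U k" "\<And>x. x \<in> U \<Longrightarrow> k x = h x" by auto
  show "h differentiable (at x)" if "x \<in> U" for x
    using differentiable_cong_open[OF assms(1) that, of k h] k(2) smooth_in_differentiable[OF k(1) that] by blast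
  show "\<exists>h'\<in>{h. \<exists>k. smooth_in U k \<and> (\<forall>x\<in>U. k x = h x)}. \<forall>x\<in>U. dir_deriv v h x = h' x"
    using dir_deriv_cong_open[OF assms(1) _ k(2)] smooth_in_dir_deriv[OF k(1)]
    by (intro bexI[of _ "dir_deriv v k"] CollectI exI[of _ "dir_deriv v k"]) auto
qed (use assms in auto)

lemma smooth_in_local:
  assumes "\<And>x. x \<in> U \<Longrightarrow> \<exists>V. open V \<and> x \<in> V \<and> smooth_in V f"
  shows "smooth_in U f"
  using assms unfolding smooth_in_def by metis

text \<open>The product and chain rules turn one term into two, so natural generating classes such
  as products are closed under differentiation only after finite sums are adjoined.\<close>

inductive_set fin_sums :: "('a \<Rightarrow> complex) set \<Rightarrow> ('a \<Rightarrow> complex) set" for G where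
  base: "g \<in> G \<Longrightarrow> g \<in> fin_sums G"
| add: "p \<in> fin_sums G \<Longrightarrow> q \<in> fin_sums G \<Longrightarrow> (\<lambda>x. p x + q x) \<in> fin_sums G"

lemma smooth_in_fin_sums:
  assumes U: "open U" and f: "f \<in> G"
    and diff: "\<And>g x. g \<in> G \<Longrightarrow> x \<in> U \<Longrightarrow> g differentiable (at x)"
    and step: "\<And>g v. g \<in> G \<Longrightarrow> \<exists>h\<in>fin_sums G. \<forall>x\<in>U. dir_deriv v g x = h x"
  shows "smooth_in U f"
proof -
  have D: "g differentiable (at x)" if "g \<in> fin_sums G" "x \<in> U" for g x
    using that by (induction) (auto intro: diff)
  show ?thesis
  proof (rule smooth_in_coinduct[OF U fin_sums.base[OF f] D])
    fix g v assume "g \<in> fin_sums G"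
    then show "\<exists>h\<in>fin_sums G. \<forall>x\<in>U. dir_deriv v g x = h x"
    proof induction
      case (add p q)
      then obtain p' q' where pq: "p' \<in> fin_sums G" "\<forall>x\<in>U. dir_deriv v p x = p' x"
        "q' \<in> fin_sums G" "\<forall>x\<in>U. dir_deriv v q x = q' x" by blast
      have "dir_deriv v (\<lambda>x. p x + q x) x = dir_deriv v p x + dir_deriv v q x" if "x \<in> U" for x
        by (rule dir_deriv_eqI)
          (use D add that in \<open>auto intro!: has_derivative_add has_derivative_dir_deriv\<close>)
      then show ?case using pq by (intro bexI[of _ "\<lambda>x. p' x + q' x"]) (auto intro: fin_sums.add)
    qed (use step in auto)
  qed auto
qed

lemma smooth_in_const: "open U \<Longrightarrow> smooth_in U (\<lambda>x. c)"
  by (rule smooth_in_coinduct[where F = "range (\<lambda>c x. c)"])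
    (auto simp: dir_deriv_eqI[OF has_derivative_const])

lemma smooth_in_linear:
  assumes "open U" "bounded_linear f" shows "smooth_in U f"
  by (rule smooth_in_coinduct[where F = "insert f (range (\<lambda>c x. c))"])
    (use assms in \<open>auto simp: dir_deriv_eqI[OF has_derivative_const]
       dir_deriv_eqI[OF bounded_linear_imp_has_derivative] bounded_linear_imp_differentiable\<close>)

lemma dir_deriv_add:
  "f differentiable (at x) \<Longrightarrow> g differentiable (at x) \<Longrightarrow>
    dir_deriv v (\<lambda>x. f x + g x) x = dir_deriv v f x + dir_deriv v g x"
  by (rule dir_deriv_eqI) (auto intro!: has_derivative_add has_derivative_dir_deriv)

lemma dir_deriv_mult:
  "f differentiable (at x) \<Longrightarrow> g differentiable (at x) \<Longrightarrow>
    dir_deriv v (\<lambda>x. f x * g x) x = f x * dir_deriv v g x + dir_deriv v f x * g x"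
  by (rule dir_deriv_eqI) (auto intro!: has_derivative_mult has_derivative_dir_deriv)

lemma smooth_in_add:
  assumes "open U" "smooth_in U f" "smooth_in U g"
  shows "smooth_in U (\<lambda>x. f x + g x)"
proof (rule smooth_in_coinduct[where F = "{\<lambda>x. f x + g x |f g. smooth_in U f \<and> smooth_in U g}"])
  let ?F = "{\<lambda>x. f x + g x |f g. smooth_in U f \<and> smooth_in U g}"
  fix h v assume "h \<in> ?F"
  then obtain f g where h: "h = (\<lambda>x. f x + g x)" "smooth_in U f" "smooth_in U g" by auto
  show "h differentiable (at x)" if "x \<in> U" for x
    unfolding h(1) using h(2,3) that by (intro differentiable_add smooth_in_differentiable)
  show "\<exists>h'\<in>?F. \<forall>x\<in>U. dir_deriv v h x = h' x"
    unfolding h(1) using h(2,3)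
    by (intro bexI[of _ "\<lambda>x. dir_deriv v f x + dir_deriv v g x"])
      (auto simp: dir_deriv_add smooth_in_differentiable intro: smooth_in_dir_deriv)
qed (use assms in blast)+

lemma smooth_in_mult:
  assumes U: "open U" and "smooth_in U f" "smooth_in U g"
  shows "smooth_in U (\<lambda>x. f x * g x)"
proof (rule smooth_in_fin_sums[where G = "{\<lambda>x. f x * g x |f g. smooth_in U f \<and> smooth_in U g}", OF U])
  let ?G = "{\<lambda>x. f x * g x |f g. smooth_in U f \<and> smooth_in U g}"
  fix h v assume "h \<in> ?G"
  then obtain f g where h: "h = (\<lambda>x. f x * g x)" "smooth_in U f" "smooth_in U g" by auto
  show "\<exists>h'\<in>fin_sums ?G. \<forall>x\<in>U. dir_deriv v h x = h' x"
  proof (intro bexI ballI)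
    have "(\<lambda>x. f x * dir_deriv v g x) \<in> ?G" "(\<lambda>x. dir_deriv v f x * g x) \<in> ?G"
      using h(2,3) smooth_in_dir_deriv by blast+
    then show "(\<lambda>x. f x * dir_deriv v g x + dir_deriv v f x * g x) \<in> fin_sums ?G"
      by (intro fin_sums.intros)
  qed (use h in \<open>auto simp: dir_deriv_mult smooth_in_differentiable\<close>)
  show "h differentiable (at x)" if "x \<in> U" for x
    unfolding h(1) using h(2,3) that by (intro differentiable_mult smooth_in_differentiable)
qed (use assms in blast)

lemma smooth_in_cmult: "open U \<Longrightarrow> smooth_in U f \<Longrightarrow> smooth_in U (\<lambda>x. c * f x)"
  by (intro smooth_in_mult smooth_in_const)

lemma smooth_in_minus: "open U \<Longrightarrow> smooth_in U f \<Longrightarrow> smooth_in U (\<lambda>x. - f x)"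
  using smooth_in_cmult[of U f "-1"] by simp

lemma smooth_in_diff:
  "open U \<Longrightarrow> smooth_in U f \<Longrightarrow> smooth_in U g \<Longrightarrow> smooth_in U (\<lambda>x. f x - g x)"
  using smooth_in_add[of U f "\<lambda>x. - g x"] smooth_in_minus by fastforce

lemma smooth_in_sum:
  "open U \<Longrightarrow> (\<And>i. i \<in> I \<Longrightarrow> smooth_in U (f i)) \<Longrightarrow> smooth_in U (\<lambda>x. \<Sum>i\<in>I. f i x)"
  by (induction I rule: infinite_finite_induct) (auto intro!: smooth_in_const smooth_in_add)

lemma smooth_in_prod:
  "open U \<Longrightarrow> (\<And>i. i \<in> I \<Longrightarrow> smooth_in U (f i)) \<Longrightarrow> smooth_in U (\<lambda>x. \<Prod>i\<in>I. f i x)"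
  by (induction I rule: infinite_finite_induct) (auto intro!: smooth_in_const smooth_in_mult)

lemma dir_deriv_bounded_linear_comp:
  assumes "bounded_linear L" "f differentiable (at x)"
  shows "dir_deriv v (\<lambda>x. L (f x)) x = L (dir_deriv v f x)"
  by (rule dir_deriv_eqI) (use bounded_linear.has_derivative[OF assms(1) has_derivative_dir_deriv[OF assms(2)]] in simp)

lemma has_derivative_affine_comp:
  assumes "bounded_linear L" "f differentiable (at (a + L x))"
  shows "((\<lambda>x. f (a + L x)) has_derivative (\<lambda>v. dir_deriv (L v) f (a + L x))) (at x)"
proof -
  have "((\<lambda>x. a + L x) has_derivative L) (at x)"
    using assms by (auto intro!: derivative_eq_intros bounded_linear_imp_has_derivative)
  from has_derivative_compose[OF this has_derivative_dir_deriv[OF assms(2)]] show ?thesis by simp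
qed

lemma smooth_in_affine_comp:
  assumes U: "open U" and L: "bounded_linear L" and V: "\<And>x. x \<in> U \<Longrightarrow> a + L x \<in> V" and "smooth_in V f"
  shows "smooth_in U (\<lambda>x. f (a + L x))"
proof (rule smooth_in_coinduct[where F = "{\<lambda>x. f (a + L x) |f. smooth_in V f}", OF U])
  fix g v assume "g \<in> {\<lambda>x. f (a + L x) |f. smooth_in V f}"
  then obtain f where f: "g = (\<lambda>x. f (a + L x))" "smooth_in V f" by auto
  have D: "(g has_derivative (\<lambda>v. dir_deriv (L v) f (a + L x))) (at x)" if "x \<in> U" for x
    unfolding f using has_derivative_affine_comp[OF L] smooth_in_differentiable[OF f(2)] V that by auto
  show "\<exists>h\<in>{\<lambda>x. f (a + L x) |f. smooth_in V f}. \<forall>x\<in>U. dir_deriv v g x = h x"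
    by (intro bexI[of _ "\<lambda>x. dir_deriv (L v) f (a + L x)"])
      (use f dir_deriv_eqI[OF D] in \<open>auto intro: smooth_in_dir_deriv\<close>)
  show "g differentiable (at x)" if "x \<in> U" for x using D[OF that] differentiable_def by blast
qed (use assms in auto)

text \<open>The sequence \<open>hs\<close> is a tower of successive derivatives of one function of a
  real variable. The generating terms carry an arbitrary smooth factor \<open>p\<close>, which
  absorbs the inner derivatives of \<open>q\<close> and so keeps the class closed under the chain
  rule.\<close>

lemma smooth_in_compose:
  fixes q :: "'a::euclidean_space \<Rightarrow> real" and hs :: "nat \<Rightarrow> real \<Rightarrow> complex"
  assumes U: "open U" and q: "smooth_in U (\<lambda>x. of_real (q x))" and qI: "\<And>x. x \<in> U \<Longrightarrow> q x \<in> I"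
    and hs: "\<And>n t. t \<in> I \<Longrightarrow> (hs n has_vector_derivative hs (Suc n) t) (at t)"
  shows "smooth_in U (\<lambda>x. hs n (q x))"
    and "x \<in> U \<Longrightarrow> dir_deriv v (\<lambda>x. hs n (q x)) x = dir_deriv v (\<lambda>x. of_real (q x)) x * hs (Suc n) (q x)"
    and "x \<in> U \<Longrightarrow> (\<lambda>x. hs n (q x)) differentiable (at x)"
proof -
  let ?G = "{\<lambda>x. hs n (q x) * p x |n p. smooth_in U p}"
  have D: "((\<lambda>x. hs n (q x)) has_derivative
      (\<lambda>v. dir_deriv v (\<lambda>x. of_real (q x)) x * hs (Suc n) (q x))) (at x)" if x: "x \<in> U" for n x
  proof -
    have q': "((\<lambda>x. of_real (q x)) has_derivative (\<lambda>v. dir_deriv v (\<lambda>x. of_real (q x)) x)) (at x)"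
      using smooth_in_has_derivative[OF q x] .
    \<comment> \<open>Smoothness is expressed for complex-valued functions, so \<open>q\<close>
      enters through \<open>of_real\<close>. Taking real parts and embedding again shows that its
      complex derivative is real.\<close>
    have qr: "(q has_derivative (\<lambda>v. Re (dir_deriv v (\<lambda>x. of_real (q x)) x))) (at x)"
      using bounded_linear.has_derivative[OF bounded_linear_Re q'] by simp
    have "((\<lambda>x. of_real (q x)) has_derivative (\<lambda>v. of_real (Re (dir_deriv v (\<lambda>x. of_real (q x)) x)) :: complex)) (at x)"
      using has_derivative_of_real[OF qr] .
    then have eq: "dir_deriv v (\<lambda>x. of_real (q x)) x = of_real (Re (dir_deriv v (\<lambda>x. of_real (q x)) x))" for v
      by (rule dir_deriv_eqI)
    have "((\<lambda>x. hs n (q x)) has_derivative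
      (\<lambda>v. Re (dir_deriv v (\<lambda>x. of_real (q x)) x) *\<^sub>R hs (Suc n) (q x))) (at x)"
      using has_derivative_compose[OF qr hs[OF qI[OF x], of n, unfolded has_vector_derivative_def]]
      by simp
    then show ?thesis
      by (subst eq) (simp add: scaleR_conv_of_real)
  qed
  have Dp: "((\<lambda>x. hs n (q x) * p x) has_derivative (\<lambda>v. hs n (q x) * dir_deriv v p x +
      dir_deriv v (\<lambda>x. of_real (q x)) x * hs (Suc n) (q x) * p x)) (at x)"
    if "x \<in> U" "smooth_in U p" for n x p
    by (rule has_derivative_mult[OF D[OF that(1)] smooth_in_has_derivative[OF that(2,1)]])
  show "smooth_in U (\<lambda>x. hs n (q x))"
  proof (rule smooth_in_fin_sums[where G = ?G, OF U])
    show "(\<lambda>x. hs n (q x)) \<in> ?G"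
      using smooth_in_const[OF U, of 1] by (auto intro!: exI[of _ n] exI[of _ "\<lambda>_. 1"])
    fix g v assume "g \<in> ?G"
    then obtain n p where g: "g = (\<lambda>x. hs n (q x) * p x)" "smooth_in U p" by auto
    show "g differentiable (at x)" if "x \<in> U" for x
      using Dp[OF that g(2)] unfolding g(1) differentiable_def by blast
    show "\<exists>h\<in>fin_sums ?G. \<forall>x\<in>U. dir_deriv v g x = h x"
    proof (intro bexI ballI)
      let ?h1 = "\<lambda>x. hs n (q x) * dir_deriv v p x"
      let ?h2 = "\<lambda>x. hs (Suc n) (q x) * (dir_deriv v (\<lambda>x. of_real (q x)) x * p x)"
      have "?h1 \<in> ?G" using smooth_in_dir_deriv[OF g(2)] by blast
      moreover have "?h2 \<in> ?G" 
        using smooth_in_mult[OF U smooth_in_dir_deriv[OF q, of v] g(2)]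
        by (intro CollectI exI[of _ "Suc n"] exI[of _ "\<lambda>x. dir_deriv v (\<lambda>x. of_real (q x)) x * p x"] conjI refl)
      ultimately show "(\<lambda>x. ?h1 x + ?h2 x) \<in> fin_sums ?G" by (intro fin_sums.intros)
      show "dir_deriv v g x = ?h1 x + ?h2 x" if "x \<in> U" for x
        unfolding g(1) using dir_deriv_eqI[OF Dp[OF that g(2)]] by simp
    qed
  qed
  show "x \<in> U \<Longrightarrow> dir_deriv v (\<lambda>x. hs n (q x)) x = dir_deriv v (\<lambda>x. of_real (q x)) x * hs (Suc n) (q x)"
    by (rule dir_deriv_eqI[OF D])
  show "x \<in> U \<Longrightarrow> (\<lambda>x. hs n (q x)) differentiable (at x)" using D differentiable_def by blast
qed

lemma smooth_in_inner: "open U \<Longrightarrow> smooth_in U (\<lambda>x. of_real (x \<bullet> v))"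
  by (rule smooth_in_linear)
    (auto intro!: bounded_linear_compose[OF bounded_linear_of_real] bounded_linear_inner_left)

lemma smooth_in_norm_sq:
  assumes "open U" shows "smooth_in U (\<lambda>x. of_real ((norm (x - a))\<^sup>2))"
proof -
  have "smooth_in U (\<lambda>x. \<Sum>b\<in>Basis. (of_real (x \<bullet> b) - of_real (a \<bullet> b)) * (of_real (x \<bullet> b) - of_real (a \<bullet> b)))"
    using assms by (intro smooth_in_sum smooth_in_mult smooth_in_diff smooth_in_inner smooth_in_const) auto
  moreover have "(norm (x - a))\<^sup>2 = (\<Sum>b\<in>Basis. (x \<bullet> b - a \<bullet> b) * (x \<bullet> b - a \<bullet> b))" for x
    unfolding power2_norm_eq_inner euclidean_inner[of "x - a" "x - a"] by (simp add: inner_diff_left)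
  ultimately show ?thesis by (simp add: of_real_diff[symmetric] del: of_real_diff)
qed

text \<open>On the real line every directional derivative is a multiple of the one in direction 1,
  so iterating that direction gives the tower required by \<open>smooth_in_compose\<close>.\<close>

lemma smooth_in_compose_smooth:
  fixes q :: "'a::euclidean_space \<Rightarrow> real" and h :: "real \<Rightarrow> complex"
  assumes U: "open U" and q: "smooth_in U (\<lambda>x. of_real (q x))" and qI: "\<And>x. x \<in> U \<Longrightarrow> q x \<in> I"
    and h: "smooth_in I h"
  shows "smooth_in U (\<lambda>x. h (q x))"
proof -
  have "(iter_deriv (replicate n 1) h has_vector_derivative iter_deriv (replicate (Suc n) 1) h t) (at t)"
    if "t \<in> I" for n t
  proof -
    have "iter_deriv (replicate n 1) h differentiable (at t)" using h that by (auto simp: smooth_in_def)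
    from has_derivative_dir_deriv[OF this]
    have d: "(iter_deriv (replicate n 1) h has_derivative (\<lambda>v. dir_deriv v (iter_deriv (replicate n 1) h) t)) (at t)" .
    have "(\<lambda>v. dir_deriv v (iter_deriv (replicate n 1) h) t) = (\<lambda>v. v *\<^sub>R dir_deriv 1 (iter_deriv (replicate n 1) h) t)"
      using linear_scale[OF has_derivative_linear[OF d], of _ 1]
      by (intro ext) (metis mult.right_neutral real_scaleR_def)
    then show ?thesis using d unfolding has_vector_derivative_def by simp
  qed
  from smooth_in_compose(1)[where hs = "\<lambda>n. iter_deriv (replicate n 1) h" and n = 0, OF U q qI this] show ?thesis by simp
qed

text \<open>The tower consists of the complex higher derivatives restricted to the real axis. This
  is how the regularised kernels, holomorphic functions of a squared distance, become smooth
  functions of position.\<close>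

lemma smooth_in_holomorphic:
  fixes f :: "complex \<Rightarrow> complex" and q :: "'a::euclidean_space \<Rightarrow> real"
  assumes f: "f holomorphic_on S" "open S" and U: "open U" and q: "smooth_in U (\<lambda>x. of_real (q x))"
    and qI: "\<And>x. x \<in> U \<Longrightarrow> of_real (q x) \<in> S"
  shows "smooth_in U (\<lambda>x. f (of_real (q x)))"
    and "x \<in> U \<Longrightarrow> dir_deriv v (\<lambda>x. f (of_real (q x))) x = dir_deriv v (\<lambda>x. of_real (q x)) x * deriv f (of_real (q x))"
proof -
  let ?hs = "\<lambda>n t. (deriv ^^ n) f (of_real t)"
  have "((\<lambda>t. (deriv ^^ n) f (of_real t)) has_vector_derivative (deriv ^^ Suc n) f (of_real t)) (at t)"
    if "t \<in> {t. complex_of_real t \<in> S}" for n t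
    using holomorphic_derivI[OF holomorphic_higher_deriv[OF f, of n] f(2), of "of_real t"] that
    by (auto dest!: field_differentiable_derivI field_vector_diff_chain_at[rotated]
        intro!: has_vector_derivative_real_field simp del: funpow.simps) (simp add: o_def)
  note H = smooth_in_compose[where hs = ?hs and n = 0 and I = "{t. complex_of_real t \<in> S}", OF U q _ this]
  show "smooth_in U (\<lambda>x. f (of_real (q x)))" using H(1) qI by simp
  show "x \<in> U \<Longrightarrow> dir_deriv v (\<lambda>x. f (of_real (q x))) x = dir_deriv v (\<lambda>x. of_real (q x)) x * deriv f (of_real (q x))"
    using H(2)[of x v] qI by simp
qed

section \<open>Cut-off functions\<close>

text \<open>The functions t^(-k) exp(-1/t), extended by zero. The whole family is needed because the
  derivatives of \<open>flat_pow 0\<close> are linear combinations of its members.\<close>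

definition flat_pow :: "nat \<Rightarrow> real \<Rightarrow> real" where
  "flat_pow k t = (if t > 0 then (1 / t) ^ k * exp (- (1 / t)) else 0)"

lemma flat_pow_lim: "(flat_pow k \<longlongrightarrow> 0) (at 0)"
proof -
  have "((\<lambda>x::real. x ^ k / exp x) \<longlongrightarrow> 0) at_top" by (rule tendsto_power_div_exp_0)
  then have "((\<lambda>t::real. inverse t ^ k / exp (inverse t)) \<longlongrightarrow> 0) (at_right 0)"
    by (rule filterlim_compose[OF _ filterlim_inverse_at_top_right])
  then have R: "(flat_pow k \<longlongrightarrow> 0) (at_right 0)"
    by (rule Lim_transform_eventually)
      (auto simp: eventually_at_right_field flat_pow_def exp_minus field_simps intro!: exI[of _ 1])
  have "(flat_pow k \<longlongrightarrow> 0) (at_left 0)"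
    by (rule tendsto_eventually) (auto simp: eventually_at_left_field flat_pow_def intro!: exI[of _ "-1"])
  with R show ?thesis by (simp add: filterlim_split_at)
qed

lemma flat_pow_deriv:
  "(flat_pow k has_real_derivative (flat_pow (k + 2) t - real k * flat_pow (k + 1) t)) (at t)"
proof -
  consider "t > 0" | "t < 0" | "t = 0" by linarith
  then show ?thesis
  proof cases
    case 1
    \<comment> \<open>For k = 0 the exponent \<open>k - 1\<close> is truncated to 0; the equation
      survives because of the factor \<open>real k\<close>.\<close>
    have e: "real k * (1 / t) ^ (k - 1) * (1 / t) = real k * (1 / t) ^ k"
      by (cases k) auto
    have "((\<lambda>t. (1 / t) ^ k * exp (- (1 / t))) has_real_derivative
        (1 / t) ^ k * (exp (- (1 / t)) * (1 / t)\<^sup>2) + (real k * (1 / t) ^ (k - 1) * - ((1 / t)\<^sup>2)) * exp (- (1 / t))) (at t)"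
      using 1 by (auto intro!: derivative_eq_intros simp: power2_eq_square)
    also have "(1 / t) ^ k * (exp (- (1 / t)) * (1 / t)\<^sup>2) + (real k * (1 / t) ^ (k - 1) * - ((1 / t)\<^sup>2)) * exp (- (1 / t))
       = (1 / t) ^ (k+2) * exp (- (1 / t)) - (real k * (1 / t) ^ (k - 1) * (1 / t)) * (1 / t) * exp (- (1 / t))"
      by (simp add: power2_eq_square power_add)
    also have "\<dots> = flat_pow (k + 2) t - real k * flat_pow (k + 1) t"
      unfolding e using 1 by (simp add: flat_pow_def)
    finally show ?thesis
      by (rule has_field_derivative_transform_within_open[where S = "{0<..}"]) (use 1 in \<open>auto simp: flat_pow_def\<close>)
  next
    case 2
    then show ?thesis
      by (auto simp: flat_pow_def intro: has_field_derivative_transform_within_open[where f = "\<lambda>_. 0" and S = "{..<0}"])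
  next
    case 3
    \<comment> \<open>The difference quotient at 0 is \<open>flat_pow (Suc k)\<close>, which tends
      to 0.\<close>
    have "((\<lambda>h. (flat_pow k (0 + h) - flat_pow k 0) / h) \<longlongrightarrow> 0) (at 0)"
      using flat_pow_lim[of "Suc k"] by (rule Lim_transform_eventually)
        (auto simp: eventually_at flat_pow_def field_simps intro!: exI[of _ 1])
    then show ?thesis by (simp add: 3 DERIV_def flat_pow_def)
  qed
qed

lemma smooth_in_flat_pow: "smooth_in UNIV (\<lambda>t. of_real (flat_pow k t))"
proof (rule smooth_in_fin_sums[where G = "{\<lambda>t. of_real c * of_real (flat_pow k t) |c k. True}"])
  let ?G = "{\<lambda>t. of_real c * complex_of_real (flat_pow k t) |c k. True}"
  show "(\<lambda>t. complex_of_real (flat_pow k t)) \<in> ?G" by (auto intro!: exI[of _ 1] exI[of _ k])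
  fix g v assume "g \<in> ?G"
  then obtain c k where g: "g = (\<lambda>t. of_real c * complex_of_real (flat_pow k t))" by auto
  have D: "(g has_derivative (\<lambda>v. of_real (c * (v * (flat_pow (k + 2) t - real k * flat_pow (k + 1) t))))) (at t)" for t
    unfolding g using flat_pow_deriv[of k t, THEN has_field_derivative_imp_has_derivative]
    by (auto intro!: derivative_eq_intros simp: mult_ac)
  show "g differentiable (at x)" for x using D differentiable_def by blast
  let ?h1 = "\<lambda>t. of_real (c * v) * complex_of_real (flat_pow (k + 2) t)"
  let ?h2 = "\<lambda>t. of_real (- c * v * real k) * complex_of_real (flat_pow (k + 1) t)"
  have "?h1 \<in> ?G" "?h2 \<in> ?G" by blast+
  then have "(\<lambda>t. ?h1 t + ?h2 t) \<in> fin_sums ?G" by (intro fin_sums.intros)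
  moreover have "\<forall>t\<in>UNIV. dir_deriv v g t = ?h1 t + ?h2 t"
    by (simp add: dir_deriv_eqI[OF D] algebra_simps)
  ultimately show "\<exists>h\<in>fin_sums ?G. \<forall>x\<in>UNIV. dir_deriv v g x = h x" by - (rule bexI)
qed auto

lemma test_functionsI:
  assumes "smooth f" "compact K" "K \<subseteq> \<Omega>" "\<And>x. x \<notin> K \<Longrightarrow> f x = 0"
  shows "f \<in> test_functions \<Omega>"
proof -
  have "fun_supp f \<subseteq> K"
    unfolding fun_supp_def using assms by (intro closure_minimal) (auto simp: compact_imp_closed)
  then show ?thesis using assms(1,2,3) bounded_subset[of K "fun_supp f"]
    by (auto simp: test_functions_def compact_eq_bounded_closed) (simp add: fun_supp_def)
qed

lemma test_functions_smooth: "f \<in> test_functions \<Omega> \<Longrightarrow> smooth_in UNIV f"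
  by (simp add: test_functions_def smooth_iff_smooth_in)

lemma fun_supp_zero: "x \<notin> fun_supp f \<Longrightarrow> f x = 0"
  unfolding fun_supp_def using closure_subset[of "{x. f x \<noteq> 0}"] by blast

lemma closed_fun_supp: "closed (fun_supp f)"
  by (simp add: fun_supp_def)

lemma test_functions_mono: "A \<subseteq> B \<Longrightarrow> f \<in> test_functions A \<Longrightarrow> f \<in> test_functions B"
  by (auto simp: test_functions_def)

lemma test_functions_supp:
  "f \<in> test_functions \<Omega> \<Longrightarrow> compact (fun_supp f)" "f \<in> test_functions \<Omega> \<Longrightarrow> fun_supp f \<subseteq> \<Omega>"
  by (simp_all add: test_functions_def)

lemma test_functions_mult_left:
  assumes "f \<in> test_functions \<Omega>" "smooth_in UNIV g"
  shows "(\<lambda>x. g x * f x) \<in> test_functions \<Omega>"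
  by (intro test_functionsI[where K = "fun_supp f"])
    (use test_functions_supp[OF assms(1)] in \<open>auto simp: smooth_iff_smooth_in fun_supp_zero
      intro!: smooth_in_mult assms(2) test_functions_smooth[OF assms(1)]\<close>)

lemma test_functions_add:
  assumes "f \<in> test_functions \<Omega>" "g \<in> test_functions \<Omega>"
  shows "(\<lambda>x. f x + g x) \<in> test_functions \<Omega>"
  by (intro test_functionsI[where K = "fun_supp f \<union> fun_supp g"])
    (use test_functions_supp[OF assms(1)] test_functions_supp[OF assms(2)] in \<open>auto simp: smooth_iff_smooth_in
      fun_supp_zero intro!: smooth_in_add assms[THEN test_functions_smooth]\<close>)

lemma test_functions_cmult: "f \<in> test_functions \<Omega> \<Longrightarrow> (\<lambda>x. c * f x) \<in> test_functions \<Omega>"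
  by (intro test_functions_mult_left smooth_in_const) auto

lemma test_functions_diff:
  "f \<in> test_functions \<Omega> \<Longrightarrow> g \<in> test_functions \<Omega> \<Longrightarrow> (\<lambda>x. f x - g x) \<in> test_functions \<Omega>"
  using test_functions_add[of f \<Omega> "\<lambda>x. - 1 * g x"] test_functions_cmult[of g \<Omega> "-1"] by simp

lemma test_functions_dir_deriv:
  assumes "f \<in> test_functions \<Omega>"
  shows "dir_deriv v f \<in> test_functions \<Omega>"
proof (rule test_functionsI[where K = "fun_supp f"])
  show "smooth (dir_deriv v f)"
    unfolding smooth_iff_smooth_in by (rule smooth_in_dir_deriv[OF test_functions_smooth[OF assms]])
  fix x assume x: "x \<notin> fun_supp f"
  have "dir_deriv v f x = dir_deriv v (\<lambda>x. 0) x"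
    by (rule dir_deriv_cong_open[of "- fun_supp f"]) (use x fun_supp_zero[of _ f] in \<open>auto simp: closed_fun_supp\<close>)
  then show "dir_deriv v f x = 0" using dir_deriv_eqI[OF has_derivative_const] by metis
qed (use test_functions_supp[OF assms] in auto)

lemma test_functions_continuous: "f \<in> test_functions \<Omega> \<Longrightarrow> continuous_on UNIV f"
  by (rule smooth_in_continuous_on[OF test_functions_smooth])

lemma test_functions_bounded:
  assumes "f \<in> test_functions \<Omega>" obtains C where "\<And>x. norm (f x) \<le> C" "C \<ge> 0"
proof -
  have "compact (f ` fun_supp f)"
    by (intro compact_continuous_image continuous_on_subset[OF test_functions_continuous[OF assms]]
      test_functions_supp(1)[OF assms]) auto
  then obtain C where C: "\<And>y. y \<in> f ` fun_supp f \<Longrightarrow> norm y \<le> C"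
    using compact_imp_bounded bounded_iff by metis
  have "norm (f x) \<le> max C 0" for x
    using C[of "f x"] fun_supp_zero[of x f] by (cases "x \<in> fun_supp f") (auto simp: le_max_iff_disj)
  then show thesis using that[of "max C 0"] by simp
qed

text \<open>The bump is u / (u + w): the flat function u is positive exactly where |x - p| < 2r, and
  w exactly where |x - p| > r. Hence the denominator never vanishes, and the quotient is 1 on the
  small ball and 0 off the large one.\<close>

lemma smooth_bump_ball:
  assumes r: "0 < r"
  obtains b :: "'a::euclidean_space \<Rightarrow> real" where "smooth_in UNIV (\<lambda>x. of_real (b x))"
    "\<And>x. 0 \<le> b x" "\<And>x. b x \<le> 1" "\<And>x. x \<in> ball p r \<Longrightarrow> b x = 1" "\<And>x. x \<notin> cball p (2 * r) \<Longrightarrow> b x = 0"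
proof -
  define u where "u x = flat_pow 0 (4 * r\<^sup>2 - (norm (x - p))\<^sup>2)" for x :: 'a
  define w where "w x = flat_pow 0 ((norm (x - p))\<^sup>2 - r\<^sup>2)" for x :: 'a
  have pos: "u x \<ge> 0" "w x \<ge> 0" for x by (auto simp: u_def w_def flat_pow_def)
  have sum_pos: "u x + w x > 0" for x
  proof -
    have "4 * r\<^sup>2 > r\<^sup>2" using r by simp
    then have "4 * r\<^sup>2 - (norm (x - p))\<^sup>2 > 0 \<or> (norm (x - p))\<^sup>2 - r\<^sup>2 > 0" by linarith
    then show ?thesis using pos[of x] by (auto simp: u_def w_def flat_pow_def add_pos_nonneg add_nonneg_pos)
  qed
  have su: "smooth_in UNIV (\<lambda>x. complex_of_real (u x))" unfolding u_def
    by (rule smooth_in_compose_smooth[where I = UNIV, OF _ _ _ smooth_in_flat_pow])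
      (auto simp: of_real_power[symmetric] simp del: of_real_power intro!: smooth_in_diff smooth_in_norm_sq smooth_in_const)
  have sw: "smooth_in UNIV (\<lambda>x. complex_of_real (w x))" unfolding w_def
    by (rule smooth_in_compose_smooth[where I = UNIV, OF _ _ _ smooth_in_flat_pow])
      (auto simp: of_real_power[symmetric] simp del: of_real_power intro!: smooth_in_diff smooth_in_norm_sq smooth_in_const)
  have "smooth_in UNIV (\<lambda>x. inverse (complex_of_real (u x + w x)))"
  proof (rule smooth_in_holomorphic(1)[where S = "- {0}" and f = inverse and q = "\<lambda>x. u x + w x"])
    show "smooth_in UNIV (\<lambda>x. complex_of_real (u x + w x))"
      unfolding of_real_add by (rule smooth_in_add[OF open_UNIV su sw])
    show "complex_of_real (u x + w x) \<in> - {0}" for x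
      using sum_pos[of x] by (simp only: Compl_iff singleton_iff of_real_eq_0_iff)
  qed (auto intro!: holomorphic_intros)
  from smooth_in_mult[OF _ su this]
  have s: "smooth_in UNIV (\<lambda>x. complex_of_real (u x / (u x + w x)))" by (simp add: divide_inverse)
  show thesis
  proof (rule that[OF s])
    show "0 \<le> u x / (u x + w x)" "u x / (u x + w x) \<le> 1" for x using pos[of x] sum_pos[of x] by auto
    show "u x / (u x + w x) = 1" if "x \<in> ball p r" for x
    proof -
      have "(norm (x - p))\<^sup>2 < r\<^sup>2" using that r by (intro power_strict_mono) (auto simp: dist_norm norm_minus_commute)
      then have "w x = 0" by (simp add: w_def flat_pow_def)
      then show ?thesis using sum_pos[of x] by simp
    qed
    show "u x / (u x + w x) = 0" if "x \<notin> cball p (2 * r)" for x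
    proof -
      have "(2 * r)\<^sup>2 < (norm (x - p))\<^sup>2" using that r by (intro power_strict_mono) (auto simp: dist_norm norm_minus_commute)
      then show ?thesis by (simp add: u_def flat_pow_def power2_eq_square)
    qed
  qed
qed

text \<open>The bumps b of a finite cover are combined as 1 minus the product of the factors 1 - b,
  which lies in [0, 1] and equals 1 as soon as one bump does. It is 1 on an open neighbourhood of
  \<open>K\<close>, as the definition of \<open>cutoffs\<close> demands.\<close>

lemma smooth_cutoff:
  fixes K U :: "'a::euclidean_space set"
  assumes K: "compact K" and U: "open U" "K \<subseteq> U"
  obtains \<rho> :: "'a \<Rightarrow> real" and V where "(\<lambda>x. complex_of_real (\<rho> x)) \<in> test_functions U"
    "\<And>x. 0 \<le> \<rho> x" "\<And>x. \<rho> x \<le> 1" "open V" "K \<subseteq> V" "\<And>x. x \<in> V \<Longrightarrow> \<rho> x = 1"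
proof -
  have "\<exists>r>0. cball p (2 * r) \<subseteq> U" if p: "p \<in> K" for p
  proof -
    obtain e where "e > 0" "cball p e \<subseteq> U" using open_contains_cball_eq[OF U(1)] U(2) p by (meson subsetD)
    then show ?thesis by (intro exI[of _ "e/2"]) auto
  qed
  then obtain r where r: "\<And>p. p \<in> K \<Longrightarrow> r p > 0" "\<And>p. p \<in> K \<Longrightarrow> cball p (2 * r p) \<subseteq> U" by metis
  obtain T where T: "T \<subseteq> K" "finite T" "K \<subseteq> (\<Union>p\<in>T. ball p (r p))"
  proof (rule compactE_image[OF K, of K "\<lambda>p. ball p (r p)"])
    show "K \<subseteq> (\<Union>p\<in>K. ball p (r p))" using r(1) by (intro subsetI UN_I) auto
  qed auto
  have "\<forall>p\<in>T. \<exists>b::'a \<Rightarrow> real. smooth_in UNIV (\<lambda>x. of_real (b x)) \<and> (\<forall>x. 0 \<le> b x \<and> b x \<le> 1) \<and>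
     (\<forall>x\<in>ball p (r p). b x = 1) \<and> (\<forall>x. x \<notin> cball p (2 * r p) \<longrightarrow> b x = 0)" (is "\<forall>p\<in>T. \<exists>b. ?Q p b")
  proof
    fix p assume "p \<in> T"
    then have "0 < r p" using r(1) T(1) by auto
    from smooth_bump_ball[OF this, of p] obtain b :: "'a \<Rightarrow> real" where "smooth_in UNIV (\<lambda>x. of_real (b x))"
      "\<And>x. 0 \<le> b x" "\<And>x. b x \<le> 1" "\<And>x. x \<in> ball p (r p) \<Longrightarrow> b x = 1" "\<And>x. x \<notin> cball p (2 * r p) \<Longrightarrow> b x = 0"
      by blast
    then show "\<exists>b. ?Q p b" by (intro exI[of _ b]) simp
  qed
  from bchoice[OF this] obtain b where B: "\<forall>p\<in>T. ?Q p (b p)" ..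
  then have b: "\<And>p. p \<in> T \<Longrightarrow> smooth_in UNIV (\<lambda>x. of_real (b p x))"
    "\<And>p x. p \<in> T \<Longrightarrow> 0 \<le> b p x \<and> b p x \<le> 1" "\<And>p x. p \<in> T \<Longrightarrow> x \<in> ball p (r p) \<Longrightarrow> b p x = 1"
    "\<And>p x. p \<in> T \<Longrightarrow> x \<notin> cball p (2 * r p) \<Longrightarrow> b p x = 0" by simp_all
  define \<rho> where "\<rho> x = 1 - (\<Prod>p\<in>T. 1 - b p x)" for x
  show thesis
  proof (rule that[of \<rho> "\<Union>p\<in>T. ball p (r p)"])
    show "(\<lambda>x. complex_of_real (\<rho> x)) \<in> test_functions U"
    proof (rule test_functionsI[where K = "\<Union>p\<in>T. cball p (2 * r p)"])
      show "smooth (\<lambda>x. complex_of_real (\<rho> x))" unfolding smooth_iff_smooth_in \<rho>_def of_real_diff of_real_prod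
        by (intro smooth_in_diff smooth_in_prod smooth_in_const b) auto
      show "compact (\<Union>p\<in>T. cball p (2 * r p))" using T(2) by (intro compact_UN) auto
      show "(\<Union>p\<in>T. cball p (2 * r p)) \<subseteq> U" using r(2) T(1) by blast
      show "complex_of_real (\<rho> x) = 0" if "x \<notin> (\<Union>p\<in>T. cball p (2 * r p))" for x
        using b(4) that by (simp add: \<rho>_def)
    qed
    have "0 \<le> (\<Prod>p\<in>T. 1 - b p x)" for x using b(2) by (intro prod_nonneg) auto
    moreover have "(\<Prod>p\<in>T. 1 - b p x) \<le> 1" for x using b(2) by (intro prod_le_1) auto
    ultimately show "0 \<le> \<rho> x" "\<rho> x \<le> 1" for x by (auto simp: \<rho>_def)
    show "\<rho> x = 1" if "x \<in> (\<Union>p\<in>T. ball p (r p))" for x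
    proof -
      have "(\<Prod>p\<in>T. 1 - b p x) = 0" using that b(3) T(2) by (intro prod_zero) auto
      then show ?thesis by (simp add: \<rho>_def)
    qed
  qed (use T in auto)
qed

section \<open>Differentiation under the integral sign\<close>

lemma norm_integral_le:
  fixes f :: "'a \<Rightarrow> 'b::{banach, second_countable_topology}"
  assumes "integrable M f" "integrable M g" "\<And>x. x \<in> space M \<Longrightarrow> norm (f x) \<le> g x"
  shows "norm (integral\<^sup>L M f) \<le> integral\<^sup>L M g"
  by (rule order_trans[OF integral_norm_bound integral_mono]) (use assms in auto)

text \<open>The mean value inequality bounds the increment of g by w |h|, and the linear part
  satisfies the same bound, so the remainder divided by |h| is dominated by 2 w. The limit is taken
  along sequences because dominated convergence is a statement about sequences.\<close>

lemma has_derivative_integral_param: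
  fixes g :: "'a::euclidean_space \<Rightarrow> 'b \<Rightarrow> complex"
  assumes r: "0 < r" and int: "\<And>x. x \<in> ball x0 r \<Longrightarrow> integrable M (g x)"
    and der: "\<And>x y. x \<in> ball x0 r \<Longrightarrow> y \<in> space M \<Longrightarrow> ((\<lambda>x. g x y) has_derivative (\<lambda>v. g' x y v)) (at x)"
    and bd: "\<And>x y v. x \<in> ball x0 r \<Longrightarrow> y \<in> space M \<Longrightarrow> norm (g' x y v) \<le> w y * norm v"
    and w: "integrable M w" and meas: "\<And>v. (\<lambda>y. g' x0 y v) \<in> borel_measurable M"
  shows "((\<lambda>x. LINT y|M. g x y) has_derivative (\<lambda>v. LINT y|M. g' x0 y v)) (at x0)"
    and "integrable M (\<lambda>y. g' x0 y v)"
proof -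
  have x0: "x0 \<in> ball x0 r" using r by simp
  have w0: "0 \<le> w y" if "y \<in> space M" for y
    using bd[OF x0 that, of "SOME b. b \<in> Basis"] norm_Basis[OF someI_ex[of "\<lambda>b. b \<in> Basis"]] nonempty_Basis
    by (metis ex_in_conv mult.right_neutral norm_ge_zero order_trans)
  have int': "integrable M (\<lambda>y. g' x0 y v)" for v
    by (rule Bochner_Integration.integrable_bound[OF integrable_mult_left[OF w, of "norm v"] meas])
      (use bd[OF x0] w0 in \<open>auto intro!: AE_I2\<close>)
  then show "integrable M (\<lambda>y. g' x0 y v)" .
  have lin: "linear (g' x0 y)" if "y \<in> space M" for y
    using has_derivative_linear[OF der[OF x0 that]] .
  show "((\<lambda>x. LINT y|M. g x y) has_derivative (\<lambda>v. LINT y|M. g' x0 y v)) (at x0)"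
    unfolding has_derivative_at
  proof
    show "bounded_linear (\<lambda>v. LINT y|M. g' x0 y v)"
    proof (rule bounded_linear_intro[where K = "integral\<^sup>L M w"])
      show "(LINT y|M. g' x0 y (a + b)) = (LINT y|M. g' x0 y a) + (LINT y|M. g' x0 y b)" for a b
        by (subst Bochner_Integration.integral_add[symmetric, OF int' int'])
          (auto intro!: Bochner_Integration.integral_cong simp: linear_add[OF lin])
      show "(LINT y|M. g' x0 y (c *\<^sub>R a)) = c *\<^sub>R (LINT y|M. g' x0 y a)" for c a
        unfolding integral_scaleR_right[symmetric]
        by (rule Bochner_Integration.integral_cong) (auto simp: linear_scale[OF lin])
      show "norm (LINT y|M. g' x0 y a) \<le> norm a * integral\<^sup>L M w" for a
      proof -
        have "norm (LINT y|M. g' x0 y a) \<le> (LINT y|M. w y * norm a)"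
          by (rule norm_integral_le) (use int' w bd[OF x0] in auto)
        then show ?thesis by (simp add: mult.commute)
      qed
    qed
    show "((\<lambda>h. norm ((LINT y|M. g (x0 + h) y) - (LINT y|M. g x0 y) - (LINT y|M. g' x0 y h)) / norm h) \<longlongrightarrow> 0) (at 0)"
      unfolding tendsto_at_iff_sequentially o_def
    proof (intro allI impI)
      fix X :: "nat \<Rightarrow> 'a" assume X0: "\<forall>i. X i \<in> UNIV - {0}" and X: "X \<longlonglongrightarrow> 0"
      \<comment> \<open>Increments that leave the ball are replaced by 0, so that measurability and
        domination hold for every n and not merely eventually.\<close>
      define s where "s n y = (if norm (X n) < r then (1 / norm (X n)) *\<^sub>R (g (x0 + X n) y - g x0 y - g' x0 y (X n)) else 0)" for n y
      have inball: "x0 + X n \<in> ball x0 r" if "norm (X n) < r" for n using that by (simp add: dist_norm)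
      have "(\<lambda>n. LINT y|M. s n y) \<longlonglongrightarrow> (LINT y|M. 0)"
      proof (rule integral_dominated_convergence[where w = "\<lambda>y. 2 * w y"])
        show "s n \<in> borel_measurable M" for n
          using borel_measurable_integrable[OF int[OF inball[of n]]] borel_measurable_integrable[OF int[OF x0]] meas
          by (cases "norm (X n) < r") (auto simp: s_def[abs_def])
        show "AE y in M. norm (s n y) \<le> 2 * w y" for n
        proof (rule AE_I2)
          fix y assume y: "y \<in> space M"
          show "norm (s n y) \<le> 2 * w y"
          proof (cases "norm (X n) < r")
            case True
            have "norm (g (x0 + X n) y - g x0 y) \<le> w y * norm (x0 + X n - x0)"
              by (rule differentiable_bound[where S = "ball x0 r" and f' = "\<lambda>x v. g' x y v"])
                (use True y r w0 bd inball in \<open>auto intro!: has_derivative_at_withinI[OF der] onorm_le\<close>)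
            moreover have "norm (g' x0 y (X n)) \<le> w y * norm (X n)" by (rule bd[OF x0 y])
            ultimately have "norm (g (x0 + X n) y - g x0 y - g' x0 y (X n)) \<le> 2 * w y * norm (X n)"
              using norm_triangle_ineq4[of "g (x0 + X n) y - g x0 y" "g' x0 y (X n)"] by simp
            moreover have "norm (s n y) = norm (g (x0 + X n) y - g x0 y - g' x0 y (X n)) / norm (X n)"
              using True by (simp only: s_def if_True norm_scaleR) simp
            moreover have "0 < norm (X n)" using X0 by simp
            ultimately show ?thesis by (simp only: pos_divide_le_eq)
          qed (use w0[OF y] in \<open>simp add: s_def\<close>)
        qed
        show "AE y in M. (\<lambda>n. s n y) \<longlonglongrightarrow> 0"
        proof (rule AE_I2)
          fix y assume y: "y \<in> space M"
          from der[OF x0 y] have "((\<lambda>h. norm (g (x0 + h) y - g x0 y - g' x0 y h) / norm h) \<longlongrightarrow> 0) (at 0)"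
            by (simp add: has_derivative_at)
          then have l: "(\<lambda>n. norm (g (x0 + X n) y - g x0 y - g' x0 y (X n)) / norm (X n)) \<longlonglongrightarrow> 0"
            using X X0 unfolding tendsto_at_iff_sequentially o_def by blast
          show "(\<lambda>n. s n y) \<longlonglongrightarrow> 0"
            by (rule Lim_null_comparison[OF _ l]) (auto simp: s_def)
        qed
      qed (use w in auto)
      then have l: "(\<lambda>n. norm (LINT y|M. s n y)) \<longlonglongrightarrow> 0" by (simp add: tendsto_norm_zero_iff)
      have "\<forall>\<^sub>F n in sequentially. norm (X n) < r"
        using X r by (metis tendsto_norm_zero order_tendstoD(2))
      then show "(\<lambda>n. norm ((LINT y|M. g (x0 + X n) y) - (LINT y|M. g x0 y) - (LINT y|M. g' x0 y (X n))) / norm (X n)) \<longlonglongrightarrow> 0"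
      proof (intro Lim_transform_eventually[OF l], elim eventually_mono)
        fix n assume n: "norm (X n) < r"
        have "(LINT y|M. s n y) = (1 / norm (X n)) *\<^sub>R ((LINT y|M. g (x0 + X n) y) - (LINT y|M. g x0 y) - (LINT y|M. g' x0 y (X n)))"
          using int[OF inball[OF n]] int[OF x0] int' n by (simp add: s_def)
        then show "norm (LINT y|M. s n y) = norm ((LINT y|M. g (x0 + X n) y) - (LINT y|M. g x0 y) - (LINT y|M. g' x0 y (X n))) / norm (X n)"
          by simp
      qed
    qed
  qed
qed

lemma dir_deriv_sum_Basis:
  assumes "f differentiable (at x)"
  shows "dir_deriv v f x = (\<Sum>b\<in>Basis. of_real (v \<bullet> b) * dir_deriv b f x)"
proof -
  have L: "linear (\<lambda>v. dir_deriv v f x)" by (rule has_derivative_linear[OF has_derivative_dir_deriv[OF assms]])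
  have "dir_deriv v f x = dir_deriv (\<Sum>b\<in>Basis. (v \<bullet> b) *\<^sub>R b) f x" by (simp add: euclidean_representation)
  also have "\<dots> = (\<Sum>b\<in>Basis. (v \<bullet> b) *\<^sub>R dir_deriv b f x)" by (simp add: linear_sum[OF L] linear_scale[OF L])
  finally show ?thesis by (simp add: scaleR_conv_of_real)
qed

lemma norm_dir_deriv_le:
  assumes "f differentiable (at x)"
  shows "norm (dir_deriv v f x) \<le> (\<Sum>b\<in>Basis. norm (dir_deriv b f x)) * norm v"
proof -
  have "norm (dir_deriv v f x) \<le> (\<Sum>b\<in>Basis. \<bar>v \<bullet> b\<bar> * norm (dir_deriv b f x))"
    by (subst dir_deriv_sum_Basis[OF assms]) (rule order_trans[OF norm_sum], simp add: norm_mult)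
  also have "\<dots> \<le> (\<Sum>b\<in>Basis. norm v * norm (dir_deriv b f x))"
    by (intro sum_mono mult_right_mono Basis_le_norm) auto
  finally show ?thesis by (simp add: sum_distrib_left mult.commute)
qed

text \<open>The points \<open>a y\<close> stay in a bounded set, so for x near x0 the kernel and its
  derivatives are evaluated on a compact set, and a constant times |\<Psi>| dominates. The map
  \<open>a\<close> will be the embedding of the hyperplane into the ambient space.\<close>

lemma smooth_in_convolution:
  fixes K :: "'a::euclidean_space \<Rightarrow> complex" and a :: "'b \<Rightarrow> 'a"
  assumes a: "a \<in> borel_measurable M" "bounded (a ` space M)" and \<Psi>: "integrable M \<Psi>"
    and K: "smooth_in UNIV K"
  shows "smooth_in UNIV (\<lambda>x. LINT y|M. K (x - a y) * \<Psi> y)"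
    and "dir_deriv v (\<lambda>x. LINT y|M. K (x - a y) * \<Psi> y) x = (LINT y|M. dir_deriv v K (x - a y) * \<Psi> y)"
    and "integrable M (\<lambda>y. K (x - a y) * \<Psi> y)"
proof -
  obtain R where R: "\<And>y. y \<in> space M \<Longrightarrow> norm (a y) \<le> R" using a(2) by (auto simp: bounded_iff)
  have bdd: "\<exists>C. \<forall>x\<in>ball x0 1. \<forall>y\<in>space M. norm (K (x - a y)) \<le> C" if "smooth_in UNIV K" for K and x0
  proof -
    have "compact (K ` cball 0 (norm x0 + 1 + R))"
      by (intro compact_continuous_image continuous_on_subset[OF smooth_in_continuous_on[OF that]]) auto
    then obtain C where C: "\<And>z. z \<in> cball 0 (norm x0 + 1 + R) \<Longrightarrow> norm (K z) \<le> C"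
      by (metis bounded_iff compact_imp_bounded imageI)
    have "norm (x - a y) \<le> norm x0 + 1 + R" if "x \<in> ball x0 1" "y \<in> space M" for x y
    proof -
      have "norm x \<le> norm x0 + 1" using that(1) norm_triangle_sub[of x x0] by (simp add: dist_norm norm_minus_commute)
      then show ?thesis using norm_triangle_ineq4[of x "a y"] R[OF that(2)] by simp
    qed
    then show ?thesis by (intro exI[of _ C] ballI C) simp
  qed
  have ms: "(\<lambda>y. K (x - a y) * \<Psi> y) \<in> borel_measurable M" if "smooth_in UNIV K" for K x
    using smooth_in_continuous_on[OF that, THEN borel_measurable_continuous_onI] a(1) \<Psi> by measurable
  have int: "integrable M (\<lambda>y. K (x - a y) * \<Psi> y)" if sK: "smooth_in UNIV K" for K x
  proof -
    obtain C where C: "\<forall>z\<in>ball x 1. \<forall>y\<in>space M. norm (K (z - a y)) \<le> C" using bdd[OF sK, of x] by blast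
    show ?thesis
      by (rule Bochner_Integration.integrable_bound[OF integrable_mult_right[OF integrable_norm[OF \<Psi>], of C] ms[OF sK]])
        (use C in \<open>auto intro!: AE_I2 mult_mono simp: norm_mult abs_mult order_trans[OF _ abs_ge_self]\<close>)
  qed
  then show "integrable M (\<lambda>y. K (x - a y) * \<Psi> y)" using K by blast
  have D: "((\<lambda>x. LINT y|M. K (x - a y) * \<Psi> y) has_derivative (\<lambda>v. LINT y|M. dir_deriv v K (x0 - a y) * \<Psi> y)) (at x0)"
    if sK: "smooth_in UNIV K" for K x0
  proof -
    have "smooth_in UNIV (dir_deriv b K)" for b by (rule smooth_in_dir_deriv[OF sK])
    from bdd[OF this, of x0] obtain C where
      C: "\<And>b x y. x \<in> ball x0 1 \<Longrightarrow> y \<in> space M \<Longrightarrow> norm (dir_deriv b K (x - a y)) \<le> C b" by metis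
    show ?thesis
    proof (rule has_derivative_integral_param(1)[where r = 1 and g' = "\<lambda>x y v. dir_deriv v K (x - a y) * \<Psi> y" and w = "\<lambda>y. (\<Sum>b\<in>Basis. C b) * norm (\<Psi> y)"])
      show "((\<lambda>x. K (x - a y) * \<Psi> y) has_derivative (\<lambda>v. dir_deriv v K (x - a y) * \<Psi> y)) (at x)" for x y
        using has_derivative_affine_comp[OF bounded_linear_ident, of K "- a y" x] smooth_in_differentiable[OF sK]
        by (auto intro!: has_derivative_mult_left)
      fix x y v assume xy: "x \<in> ball x0 1" "y \<in> space M"
      have "norm (dir_deriv v K (x - a y)) \<le> (\<Sum>b\<in>Basis. norm (dir_deriv b K (x - a y))) * norm v"
        by (rule norm_dir_deriv_le) (use smooth_in_differentiable[OF sK] in auto)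
      also have "\<dots> \<le> (\<Sum>b\<in>Basis. C b) * norm v" using C[OF xy] by (intro mult_right_mono sum_mono) auto
      finally show "norm (dir_deriv v K (x - a y) * \<Psi> y) \<le> (\<Sum>b\<in>Basis. C b) * norm (\<Psi> y) * norm v"
        using mult_right_mono[of _ _ "norm (\<Psi> y)"] by (fastforce simp: norm_mult mult_ac)
    qed (use int[OF sK] \<Psi> ms[OF smooth_in_dir_deriv[OF sK]] in auto)
  qed
  show "smooth_in UNIV (\<lambda>x. LINT y|M. K (x - a y) * \<Psi> y)"
  proof (rule smooth_in_coinduct[where F = "{\<lambda>x. LINT y|M. K (x - a y) * \<Psi> y |K. smooth_in UNIV K}"])
    let ?F = "{\<lambda>x. LINT y|M. K (x - a y) * \<Psi> y |K. smooth_in UNIV K}"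
    fix h v assume "h \<in> ?F"
    then obtain K where h: "h = (\<lambda>x. LINT y|M. K (x - a y) * \<Psi> y)" "smooth_in UNIV K" by auto
    show "h differentiable (at x)" for x unfolding h(1) using D[OF h(2)] differentiable_def by blast
    show "\<exists>h'\<in>?F. \<forall>x\<in>UNIV. dir_deriv v h x = h' x"
      unfolding h(1) by (intro bexI[of _ "\<lambda>x. LINT y|M. dir_deriv v K (x - a y) * \<Psi> y"])
        (use dir_deriv_eqI[OF D[OF h(2)]] smooth_in_dir_deriv[OF h(2)] in auto)
  qed (use K in auto)
  show "dir_deriv v (\<lambda>x. LINT y|M. K (x - a y) * \<Psi> y) x = (LINT y|M. dir_deriv v K (x - a y) * \<Psi> y)"
    by (rule dir_deriv_eqI[OF D[OF K]])
qed

section \<open>Integration over Euclidean spaces\<close>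

lemma lborel_integrable_affine:
  fixes f :: "'a::euclidean_space \<Rightarrow> 'b::{banach, second_countable_topology}"
  assumes "c \<noteq> 0" "integrable lborel f" shows "integrable lborel (\<lambda>x. f (t + c *\<^sub>R x))"
proof -
  have "f \<in> borel_measurable lborel" using assms(2) by auto
  then have "integrable (distr lborel borel (\<lambda>x. t + c *\<^sub>R x)) (\<lambda>x. \<bar>c\<bar> ^ DIM('a) *\<^sub>R f x)"
    using assms(2) by (subst (asm) lborel_affine[OF assms(1), of t])
      (subst (asm) integrable_density, auto)
  then have "integrable lborel (\<lambda>x. \<bar>c\<bar> ^ DIM('a) *\<^sub>R f (t + c *\<^sub>R x))"
    by (subst (asm) integrable_distr_eq) (use \<open>f \<in> _\<close> in auto)
  from integrable_scaleR_right[OF this, of "inverse (\<bar>c\<bar> ^ DIM('a))"] show ?thesis using assms(1) by simp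
qed

lemma lborel_integral_affine:
  fixes f :: "'a::euclidean_space \<Rightarrow> 'b::{banach, second_countable_topology}"
  assumes "c \<noteq> 0" and f[measurable]: "f \<in> borel_measurable borel"
  shows "(LINT x|lborel. f x) = \<bar>c\<bar> ^ DIM('a) *\<^sub>R (LINT x|lborel. f (t + c *\<^sub>R x))"
  by (subst lborel_affine[OF assms(1), of t], subst integral_density)
    (auto simp: integral_distr)

lemma lborel_integral_translate:
  fixes f :: "'a::euclidean_space \<Rightarrow> 'b::{banach, second_countable_topology}"
  assumes "f \<in> borel_measurable borel"
  shows "(LINT x|lborel. f (x + t)) = (LINT x|lborel. f x)"
  using lborel_integral_affine[of 1 f t] assms by (simp add: add.commute)

lemma lborel_integral_uminus:
  fixes f :: "'a::euclidean_space \<Rightarrow> 'b::{banach, second_countable_topology}"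
  assumes "f \<in> borel_measurable borel"
  shows "(LINT x|lborel. f (- x)) = (LINT x|lborel. f x)"
  using lborel_integral_affine[of "-1" f 0] assms by simp

text \<open>A product weight, so that its integrability reduces to that of 1 / (1 + t^2) on the
  line. By \<open>one_le_wt\<close> it dominates a negative power of 1 + |x| and thus serves as an
  integrable majorant of Schwartz functions.\<close>

definition wt :: "'a::euclidean_space \<Rightarrow> real" where
  "wt x = (\<Prod>b\<in>Basis. 1 / (1 + (x \<bullet> b)\<^sup>2))"

lemma integrable_prod_Basis:
  fixes f :: "'a::euclidean_space \<Rightarrow> real \<Rightarrow> 'b::{real_normed_field, banach, second_countable_topology}"
  assumes "\<And>b. b \<in> Basis \<Longrightarrow> integrable lborel (f b)"
  shows "integrable lborel (\<lambda>x::'a. \<Prod>b\<in>Basis. f b (x \<bullet> b))"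
    and "(LINT x|lborel. (\<Prod>b\<in>Basis. f b ((x::'a) \<bullet> b))) = (\<Prod>b\<in>Basis. integral\<^sup>L lborel (f b))"
proof -
  interpret product_sigma_finite "\<lambda>b::'a. lborel :: real measure" ..
  have [measurable]: "\<And>b. b \<in> Basis \<Longrightarrow> f b \<in> borel_measurable borel" using assms by (auto dest: borel_measurable_integrable)
  have eq: "(\<Prod>b\<in>Basis. f b ((\<Sum>b\<in>Basis. y b *\<^sub>R b) \<bullet> b)) = (\<Prod>b\<in>Basis. f b (y b))" for y :: "'a \<Rightarrow> real"
    by (rule prod.cong) (auto simp: inner_sum_left inner_Basis if_distrib cong: if_cong)
  show "integrable lborel (\<lambda>x::'a. \<Prod>b\<in>Basis. f b (x \<bullet> b))"
    by (subst lborel_eq, subst integrable_distr_eq) (auto simp: eq intro!: product_integrable_prod assms)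
  show "(LINT x|lborel. (\<Prod>b\<in>Basis. f b ((x::'a) \<bullet> b))) = (\<Prod>b\<in>Basis. integral\<^sup>L lborel (f b))"
    by (subst lborel_eq, subst integral_distr) (auto simp: eq intro!: product_integral_prod assms)
qed

lemma integrable_one_over_square: "integrable lborel (\<lambda>x::real. 1 / (1 + x\<^sup>2))"
proof -
  let ?g = "\<lambda>x::real. indicator {0<..} x *\<^sub>R (1 / (1 + x\<^sup>2))"
  have g: "integrable lborel ?g"
    using integrable_I0i_1_div_plus_square
    by (simp add: interval_lebesgue_integrable_def set_integrable_def einterval_def zero_ereal_def greaterThan_def)
  have "integrable lborel (\<lambda>x. ?g (0 + (-1) *\<^sub>R x))" by (rule lborel_integrable_affine[OF _ g]) simp
  from Bochner_Integration.integrable_add[OF g this] show ?thesis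
  proof (rule Bochner_Integration.integrable_bound)
    have "AE x in lborel. x \<noteq> (0::real)" by (rule AE_lborel_singleton)
    then show "AE x in lborel. norm (1 / (1 + x\<^sup>2)) \<le> norm (?g x + ?g (0 + (-1) *\<^sub>R x))"
      by eventually_elim (auto simp: indicator_def)
  qed simp
qed

lemma integrable_wt: "integrable lborel (wt :: 'a::euclidean_space \<Rightarrow> real)"
  unfolding wt_def[abs_def] by (rule integrable_prod_Basis(1)[OF integrable_one_over_square])

lemma wt_pos: "0 < wt x"
  unfolding wt_def by (intro prod_pos) (simp add: add_pos_nonneg)

lemma wt_le_1: "wt x \<le> 1"
  unfolding wt_def by (intro prod_le_1) (auto simp: divide_le_eq_1 add_pos_nonneg)

lemma one_le_wt: "1 \<le> (1 + norm x) ^ (2 * DIM('a)) * wt (x :: 'a::euclidean_space)"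
proof -
  have "1 / (1 + norm x)\<^sup>2 \<le> 1 / (1 + (x \<bullet> b)\<^sup>2)" if "b \<in> Basis" for b
  proof (rule divide_left_mono)
    have "(x \<bullet> b)\<^sup>2 \<le> (norm x)\<^sup>2" using Basis_le_norm[OF that, of x] by (simp add: abs_le_square_iff[symmetric])
    then show "1 + (x \<bullet> b)\<^sup>2 \<le> (1 + norm x)\<^sup>2" using norm_ge_zero[of x] unfolding power2_sum one_power2 mult_1_right by linarith
    have "0 < 1 + norm x" using norm_ge_zero[of x] by linarith
    then show "0 < (1 + norm x)\<^sup>2 * (1 + (x \<bullet> b)\<^sup>2)" by (intro mult_pos_pos) (auto intro: add_pos_nonneg)
  qed auto
  then have "(\<Prod>b\<in>(Basis::'a set). 1 / (1 + norm x)\<^sup>2) \<le> wt x" unfolding wt_def by (intro prod_mono) auto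
  then have "(1 + norm x) ^ (2 * DIM('a)) * (1 / ((1 + norm x)\<^sup>2) ^ DIM('a)) \<le> (1 + norm x) ^ (2 * DIM('a)) * wt x"
    by (intro mult_left_mono) (auto simp: power_divide)
  moreover have "(1 + norm x) ^ (2 * DIM('a)) * (1 / ((1 + norm x)\<^sup>2) ^ DIM('a)) = 1"
    using norm_ge_zero[of x] by (simp add: power_mult add_nonneg_eq_0_iff)
  ultimately show ?thesis by simp
qed

section \<open>Schwartz functions\<close>

lemma schwartz_coinduct:
  assumes f: "f \<in> F" and diff: "\<And>g x. g \<in> F \<Longrightarrow> g differentiable (at x)"
    and bd: "\<And>g N. g \<in> F \<Longrightarrow> bounded (range (\<lambda>x. of_real (norm x ^ N) * g x))"
    and step: "\<And>g v. g \<in> F \<Longrightarrow> dir_deriv v g \<in> F"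
  shows "f \<in> schwartz"
proof -
  have "iter_deriv vs f \<in> F" for vs by (induction vs) (use f step in auto)
  then show ?thesis using diff bd by (auto simp: schwartz_def smooth_def)
qed

lemma schwartz_smooth: "f \<in> schwartz \<Longrightarrow> smooth_in UNIV f"
  by (simp add: schwartz_def smooth_iff_smooth_in)

lemma schwartz_differentiable: "f \<in> schwartz \<Longrightarrow> f differentiable (at x)"
  by (rule smooth_in_differentiable[OF schwartz_smooth]) auto

lemma schwartz_bounded_iter:
  "f \<in> schwartz \<Longrightarrow> bounded (range (\<lambda>x. of_real (norm x ^ N) * iter_deriv vs f x))"
  by (simp add: schwartz_def)

lemma schwartz_bounded: "f \<in> schwartz \<Longrightarrow> bounded (range (\<lambda>x. of_real (norm x ^ N) * f x))"
  using schwartz_bounded_iter[of f N "[]"] by simp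

lemma schwartz_dir_deriv:
  assumes f: "f \<in> schwartz" shows "dir_deriv v f \<in> schwartz"
proof -
  have eq: "iter_deriv vs (dir_deriv v f) = iter_deriv (vs @ [v]) f" for vs by (simp add: iter_deriv_append)
  show ?thesis using f unfolding schwartz_def mem_Collect_eq smooth_iff_smooth_in eq
    by (simp add: smooth_in_dir_deriv)
qed

lemma schwartz_continuous: "f \<in> schwartz \<Longrightarrow> continuous_on UNIV f"
  by (rule smooth_in_continuous_on[OF schwartz_smooth])

lemma schwartz_measurable: "f \<in> schwartz \<Longrightarrow> f \<in> borel_measurable borel"
  by (intro borel_measurable_continuous_onI schwartz_continuous)

lemma bounded_range_add:
  fixes f g :: "'a \<Rightarrow> 'b::real_normed_vector"
  assumes "bounded (range f)" "bounded (range g)" shows "bounded (range (\<lambda>x. f x + g x))"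
  using assms by (rule bounded_plus_comp[of f UNIV g, simplified])

lemma schwartz_add: "f \<in> schwartz \<Longrightarrow> g \<in> schwartz \<Longrightarrow> (\<lambda>x. f x + g x) \<in> schwartz"
proof (rule schwartz_coinduct[where F = "{\<lambda>x. f x + g x |f g. f \<in> schwartz \<and> g \<in> schwartz}"])
  let ?F = "{\<lambda>x. f x + g x |f g. f \<in> schwartz \<and> g \<in> schwartz}"
  fix h assume "h \<in> ?F"
  then obtain f g where h: "h = (\<lambda>x. f x + g x)" "f \<in> schwartz" "g \<in> schwartz" by auto
  show "h differentiable (at x)" for x unfolding h(1) by (intro differentiable_add schwartz_differentiable h)
  show "bounded (range (\<lambda>x. of_real (norm x ^ N) * h x))" for N
    unfolding h(1) distrib_left by (intro bounded_range_add schwartz_bounded h)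
  have "dir_deriv v h = (\<lambda>x. dir_deriv v f x + dir_deriv v g x)" for v
    unfolding h(1) by (intro ext dir_deriv_add schwartz_differentiable h)
  then show "dir_deriv v h \<in> ?F" for v using h(2,3) schwartz_dir_deriv by blast
qed blast

lemma schwartz_linear_comp:
  assumes "bounded_linear L" "f \<in> schwartz"
  shows "(\<lambda>x. L (f x)) \<in> schwartz"
proof (rule schwartz_coinduct[where F = "{\<lambda>x. L (f x) |f. f \<in> schwartz}"])
  let ?F = "{\<lambda>x. L (f x) |f. f \<in> schwartz}"
  fix h assume "h \<in> ?F"
  then obtain f where h: "h = (\<lambda>x. L (f x))" "f \<in> schwartz" by auto
  interpret L: bounded_linear L by fact
  show "h differentiable (at x)" for x
    unfolding h(1) using L.has_derivative[OF has_derivative_dir_deriv[OF schwartz_differentiable[OF h(2)]]]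
    by (auto simp: differentiable_def)
  have "of_real (norm x ^ N) * h x = L (of_real (norm x ^ N) * f x)" for x N
    unfolding h(1) by (simp add: scaleR_conv_of_real[symmetric] L.scaleR del: of_real_power)
  then have "range (\<lambda>x. of_real (norm x ^ N) * h x) = L ` range (\<lambda>x. of_real (norm x ^ N) * f x)" for N
    by (simp add: image_image)
  then show "bounded (range (\<lambda>x. of_real (norm x ^ N) * h x))" for N
    using bounded_linear_image[OF schwartz_bounded[OF h(2)] assms(1)] by simp
  have "dir_deriv v h = (\<lambda>x. L (dir_deriv v f x))" for v
    unfolding h(1) by (intro ext dir_deriv_bounded_linear_comp assms schwartz_differentiable h)
  then show "dir_deriv v h \<in> ?F" for v using h(2) schwartz_dir_deriv by blast
qed (use assms in blast)

lemma schwartz_cmult: "f \<in> schwartz \<Longrightarrow> (\<lambda>x. c * f x) \<in> schwartz"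
  by (rule schwartz_linear_comp[OF bounded_linear_mult_right])

lemma schwartz_cnj: "f \<in> schwartz \<Longrightarrow> (\<lambda>x. cnj (f x)) \<in> schwartz"
  by (rule schwartz_linear_comp[OF bounded_linear_cnj])

lemma schwartz_diff: "f \<in> schwartz \<Longrightarrow> g \<in> schwartz \<Longrightarrow> (\<lambda>x. f x - g x) \<in> schwartz"
  using schwartz_add[of f "\<lambda>x. - 1 * g x"] schwartz_cmult[of g "-1"] by simp

lemma schwartz_reflect: "f \<in> schwartz \<Longrightarrow> (\<lambda>x. f (- x)) \<in> schwartz"
proof (rule schwartz_coinduct[where F = "{\<lambda>x. f (- x) |f. f \<in> schwartz}"])
  let ?F = "{\<lambda>x. f (- x) |f. f \<in> schwartz}"
  fix h assume "h \<in> ?F"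
  then obtain f where h: "h = (\<lambda>x. f (- x))" "f \<in> schwartz" by auto
  have D: "(h has_derivative (\<lambda>v. dir_deriv (- v) f (- x))) (at x)" for x
    unfolding h(1) using has_derivative_affine_comp[of uminus f 0 x] schwartz_differentiable[OF h(2)]
    by (auto simp: bounded_linear_minus bounded_linear_ident)
  show "h differentiable (at x)" for x using D differentiable_def by blast
  have "range (\<lambda>x. of_real (norm x ^ N) * h x) = range (\<lambda>x. of_real (norm x ^ N) * f x)" for N
    unfolding h(1) by (auto simp: image_def) (metis minus_minus norm_minus_cancel)+
  then show "bounded (range (\<lambda>x. of_real (norm x ^ N) * h x))" for N using schwartz_bounded[OF h(2)] by simp
  have "dir_deriv v h = (\<lambda>x. dir_deriv (- v) f (- x))" for v using dir_deriv_eqI[OF D] by (intro ext)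
  then show "dir_deriv v h \<in> ?F" for v using schwartz_dir_deriv[OF h(2)] by blast
qed blast

text \<open>Differentiating the multiplier leaves the term (w . v) f without it. The class therefore
  contains an additive Schwartz function g that collects such terms.\<close>

lemma schwartz_mult_inner: "f \<in> schwartz \<Longrightarrow> (\<lambda>x. of_real (x \<bullet> v) * f x) \<in> schwartz"
proof (rule schwartz_coinduct[where F = "{\<lambda>x. of_real (x \<bullet> v) * f x + g x |f g. f \<in> schwartz \<and> g \<in> schwartz}"])
  let ?F = "{\<lambda>x. of_real (x \<bullet> v) * f x + g x |f g. f \<in> schwartz \<and> g \<in> schwartz}"
  show "(\<lambda>x. of_real (x \<bullet> v) * f x) \<in> ?F" if "f \<in> schwartz"
    using that schwartz_cmult[OF that, of 0] by (intro CollectI exI[of _ f] exI[of _ "\<lambda>x. 0 * f x"]) simp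
  fix h assume "h \<in> ?F"
  then obtain f g where h: "h = (\<lambda>x. of_real (x \<bullet> v) * f x + g x)" "f \<in> schwartz" "g \<in> schwartz" by auto
  have D: "(h has_derivative (\<lambda>w. of_real (x \<bullet> v) * dir_deriv w f x + of_real (w \<bullet> v) * f x + dir_deriv w g x)) (at x)" for x
    unfolding h(1) by (intro has_derivative_add has_derivative_mult has_derivative_dir_deriv schwartz_differentiable h(2,3))
      (auto intro!: derivative_eq_intros)
  show "h differentiable (at x)" for x using D differentiable_def by blast
  show "bounded (range (\<lambda>x. of_real (norm x ^ N) * h x))" for N
  proof -
    have "bounded (range (\<lambda>x. of_real (norm x ^ N) * (of_real (x \<bullet> v) * f x)))"
    proof -
      from schwartz_bounded[OF h(2), of "Suc N"] obtain C where C: "\<And>x. norm (of_real (norm x ^ Suc N) * f x) \<le> C"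
        by (auto simp: bounded_iff simp del: power_Suc)
      have "norm (of_real (norm x ^ N) * (of_real (x \<bullet> v) * f x)) \<le> norm v * C" for x
      proof -
        have "norm (of_real (norm x ^ N) * (of_real (x \<bullet> v) * f x)) = norm x ^ N * \<bar>x \<bullet> v\<bar> * norm (f x)"
          by (simp add: norm_mult norm_power)
        also have "\<dots> \<le> norm x ^ N * (norm x * norm v) * norm (f x)"
          by (intro mult_right_mono mult_left_mono Cauchy_Schwarz_ineq2) auto
        also have "\<dots> = norm v * norm (of_real (norm x ^ Suc N) * f x)" by (simp add: norm_mult norm_power)
        also have "\<dots> \<le> norm v * C" by (intro mult_left_mono C) auto
        finally show ?thesis .
      qed
      then show ?thesis by (auto simp: bounded_iff)
    qed
    then show ?thesis unfolding h(1) distrib_left by (rule bounded_range_add[OF _ schwartz_bounded[OF h(3)]])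
  qed
  have "dir_deriv w h = (\<lambda>x. of_real (x \<bullet> v) * dir_deriv w f x + (of_real (w \<bullet> v) * f x + dir_deriv w g x))" for w
    using dir_deriv_eqI[OF D] by (intro ext) (simp add: add.assoc)
  moreover have "(\<lambda>x. of_real (w \<bullet> v) * f x + dir_deriv w g x) \<in> schwartz" for w
    by (intro schwartz_add schwartz_cmult schwartz_dir_deriv h)
  ultimately show "dir_deriv w h \<in> ?F" for w
    using schwartz_dir_deriv[OF h(2)] by (intro CollectI) (rule exI, rule exI, rule conjI, assumption, auto)
qed

lemma test_functions_schwartz: "f \<in> test_functions \<Omega> \<Longrightarrow> f \<in> schwartz"
proof (rule schwartz_coinduct[where F = "test_functions \<Omega>"])
  fix g assume g: "g \<in> test_functions \<Omega>"
  show "g differentiable (at x)" for x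
    using smooth_in_differentiable[OF test_functions_smooth[OF g]] by simp
  show "bounded (range (\<lambda>x. of_real (norm x ^ N) * g x))" for N
  proof -
    have "bounded ((\<lambda>x. of_real (norm x ^ N) * g x) ` fun_supp g)"
      by (intro compact_imp_bounded compact_continuous_image continuous_intros
        continuous_on_subset[OF test_functions_continuous[OF g]] test_functions_supp(1)[OF g]) auto
    then have "bounded (insert 0 ((\<lambda>x. of_real (norm x ^ N) * g x) ` fun_supp g))" by simp
    then show ?thesis by (rule bounded_subset) (use fun_supp_zero[of _ g] in fastforce)
  qed
qed (auto intro: test_functions_dir_deriv)

text \<open>Only finitely many lists of basis vectors have length at most N, so it suffices to bound
  each derivative separately. Boundedness is what gives the real \<open>Sup\<close> in
  \<open>schwartz_seminorm\<close> its meaning.\<close>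

lemma schwartz_seminorm_bdd:
  assumes f: "f \<in> schwartz"
  shows "bdd_above {(1 + norm x) ^ N * norm (iter_deriv vs f x) | x vs. set vs \<subseteq> Basis \<and> length vs \<le> N}"
proof -
  have B: "bdd_above (range (\<lambda>x. (1 + norm x) ^ N * norm (g x)))" if g: "g \<in> schwartz" for g :: "'a \<Rightarrow> complex"
  proof -
    obtain C0 where C0: "\<And>x. norm (g x) \<le> C0" using schwartz_bounded[OF g, of 0] by (auto simp: bounded_iff)
    obtain C1 where C1: "\<And>x. norm x ^ N * norm (g x) \<le> C1" using schwartz_bounded[OF g, of N]
      by (auto simp: bounded_iff norm_mult norm_power)
    have "(1 + norm x) ^ N * norm (g x) \<le> 2 ^ N * (C0 + C1)" for x
    proof -
      have "(1 + norm x) ^ N \<le> (2 * max 1 (norm x)) ^ N" by (intro power_mono) auto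
      also have "\<dots> \<le> 2 ^ N * (1 + norm x ^ N)"
        unfolding power_mult_distrib by (intro mult_left_mono) (auto simp: max_def)
      finally have "(1 + norm x) ^ N * norm (g x) \<le> 2 ^ N * (1 + norm x ^ N) * norm (g x)" by (rule mult_right_mono) auto
      also have "\<dots> \<le> 2 ^ N * (C0 + C1)" using C0[of x] C1[of x] by (simp add: algebra_simps add_mono)
      finally show ?thesis .
    qed
    then show ?thesis by (auto simp: bdd_above_def)
  qed
  have I: "iter_deriv vs f \<in> schwartz" for vs by (induction vs) (auto intro: f schwartz_dir_deriv)
  have "{(1 + norm x) ^ N * norm (iter_deriv vs f x) | x vs. set vs \<subseteq> Basis \<and> length vs \<le> N} =
    (\<Union>vs\<in>{vs. set vs \<subseteq> Basis \<and> length vs \<le> N}. range (\<lambda>x. (1 + norm x) ^ N * norm (iter_deriv vs f x)))" by auto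
  also have "bdd_above \<dots>" using B[OF I] by (subst bdd_above_UN) (auto intro: finite_lists_length_le)
  finally show ?thesis .
qed

lemma schwartz_seminorm_ge:
  assumes "f \<in> schwartz" shows "(1 + norm x) ^ N * norm (f x) \<le> schwartz_seminorm N f"
  unfolding schwartz_seminorm_def by (rule cSup_upper[OF _ schwartz_seminorm_bdd[OF assms]])
    (force intro!: exI[of _ x] exI[of _ "[]"])

lemma schwartz_seminorm_nonneg: "f \<in> schwartz \<Longrightarrow> 0 \<le> schwartz_seminorm N f"
  using schwartz_seminorm_ge[of f 0 N] order_trans by (metis mult_nonneg_nonneg norm_ge_zero add_nonneg_nonneg zero_le_one zero_le_power)

lemma schwartz_le_wt:
  fixes f :: "'a::euclidean_space \<Rightarrow> complex"
  assumes f: "f \<in> schwartz" shows "norm (f x) \<le> schwartz_seminorm (2 * DIM('a)) f * wt x"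
proof -
  have "norm (f x) \<le> norm (f x) * ((1 + norm x) ^ (2 * DIM('a)) * wt x)"
    using mult_left_mono[OF one_le_wt[of x], of "norm (f x)"] by simp
  also have "\<dots> = ((1 + norm x) ^ (2 * DIM('a)) * norm (f x)) * wt x" by simp
  also have "\<dots> \<le> schwartz_seminorm (2 * DIM('a)) f * wt x"
    by (intro mult_right_mono schwartz_seminorm_ge f less_imp_le wt_pos)
  finally show ?thesis .
qed

lemma schwartz_integrable:
  fixes f :: "'a::euclidean_space \<Rightarrow> complex"
  assumes f: "f \<in> schwartz" shows "integrable lborel f"
proof (rule Bochner_Integration.integrable_bound[OF integrable_mult_right[OF integrable_wt, of "schwartz_seminorm (2 * DIM('a)) f"]])
  show "AE x in lborel. norm (f x) \<le> norm (schwartz_seminorm (2 * DIM('a)) f * wt x)"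
    by (intro AE_I2) (simp add: schwartz_le_wt[OF f] order_trans[OF _ abs_ge_self] del: abs_mult)
qed (simp add: schwartz_measurable[OF f])

lemma schwartz_norm_le:
  assumes "f \<in> schwartz" obtains C where "\<And>x. norm (f x) \<le> C" "0 \<le> C"
  using schwartz_seminorm_ge[OF assms, of _ 0] schwartz_seminorm_nonneg[OF assms] that by auto

lemma schwartz_times_bounded_integrable:
  assumes "f \<in> schwartz" "integrable lborel g" shows "integrable lborel (\<lambda>x. g x * f x)"
proof -
  obtain C where C: "\<And>x. norm (f x) \<le> C" "0 \<le> C" using schwartz_norm_le[OF assms(1)] by blast
  show ?thesis
    by (rule Bochner_Integration.integrable_bound[OF integrable_mult_right[OF integrable_norm[OF assms(2)], of C]])
      (use C schwartz_measurable[OF assms(1)] assms(2) in \<open>auto simp: norm_mult abs_mult mult.commute intro!: AE_I2 mult_mono\<close>)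
qed

lemma schwartz_mult_integrable: "f \<in> schwartz \<Longrightarrow> g \<in> schwartz \<Longrightarrow> integrable lborel (\<lambda>x. g x * f x)"
  by (intro schwartz_times_bounded_integrable schwartz_integrable)

section \<open>The Fourier transform\<close>

lemma Fubini_bounded_kernel:
  fixes g :: "'a \<Rightarrow> complex" and h :: "'b \<Rightarrow> complex" and k :: "'a \<Rightarrow> 'b \<Rightarrow> complex"
  assumes sf: "sigma_finite_measure M1" "sigma_finite_measure M2"
    and g: "integrable M1 g" and h: "integrable M2 h"
    and k: "(\<lambda>(x, y). k x y) \<in> borel_measurable (M1 \<Otimes>\<^sub>M M2)" "\<And>x y. norm (k x y) \<le> C"
  shows "(LINT x|M1. LINT y|M2. k x y * g x * h y) = (LINT y|M2. LINT x|M1. k x y * g x * h y)"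
    and "integrable M1 (\<lambda>x. LINT y|M2. k x y * g x * h y)"
    and "integrable M2 (\<lambda>y. LINT x|M1. k x y * g x * h y)"
proof -
  interpret M1: sigma_finite_measure M1 by fact
  interpret M2: sigma_finite_measure M2 by fact
  interpret pair_sigma_finite M1 M2 ..
  note [measurable] = borel_measurable_integrable[OF g] borel_measurable_integrable[OF h] k(1)
  have C0: "0 \<le> C" using k(2) norm_ge_zero order_trans by blast
  have gh: "integrable (M1 \<Otimes>\<^sub>M M2) (\<lambda>(x, y). g x * h y)"
    by (rule Fubini_integrable) (use g h in \<open>auto simp: norm_mult\<close>)
  have "(\<lambda>p. (\<lambda>(x, y). k x y) p * (\<lambda>(x, y). g x * h y) p) \<in> borel_measurable (M1 \<Otimes>\<^sub>M M2)"
    by measurable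
  then have "(\<lambda>(x, y). k x y * g x * h y) \<in> borel_measurable (M1 \<Otimes>\<^sub>M M2)"
    by (simp add: case_prod_beta' mult.assoc)
  then have I: "integrable (M1 \<Otimes>\<^sub>M M2) (\<lambda>(x, y). k x y * g x * h y)"
    by (rule Bochner_Integration.integrable_bound[OF integrable_mult_right[OF integrable_norm[OF gh], of C]])
      (use k(2) C0 in \<open>auto intro!: AE_I2 mult_right_mono simp: norm_mult abs_mult mult.assoc\<close>)
  show "(LINT x|M1. LINT y|M2. k x y * g x * h y) = (LINT y|M2. LINT x|M1. k x y * g x * h y)"
    using integral_fst[OF I] integral_snd[OF I] by simp
  show "integrable M1 (\<lambda>x. LINT y|M2. k x y * g x * h y)" by (rule integrable_fst[OF I])
  show "integrable M2 (\<lambda>y. LINT x|M1. k x y * g x * h y)" by (rule integrable_snd[OF I])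
qed

text \<open>Averaging over translates: the integral over s in [0, 1] of the derivative at x + s v is
  h (x + v) - h x. Integrated over x, the right side vanishes by translation invariance and the left
  side is the integral of the derivative itself, by Fubini and translation invariance again.\<close>

lemma integral_dir_deriv_zero:
  fixes h :: "'a::euclidean_space \<Rightarrow> complex"
  assumes h: "\<And>x. h differentiable (at x)" "continuous_on UNIV (dir_deriv v h)"
    "integrable lborel h" "integrable lborel (dir_deriv v h)"
  shows "(LINT x|lborel. dir_deriv v h x) = 0"
proof -
  let ?D = "dir_deriv v h"
  have [measurable]: "?D \<in> borel_measurable borel" using h(2) by (rule borel_measurable_continuous_onI)
  have hm[measurable]: "h \<in> borel_measurable borel"
    using h(3) borel_measurable_integrable by force
  have der: "((\<lambda>s. h (x + s *\<^sub>R v)) has_vector_derivative ?D (x + s *\<^sub>R v)) (at s within A)" for x s A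
  proof -
    have "((\<lambda>s. h (x + s *\<^sub>R v)) has_derivative (\<lambda>s'. dir_deriv (s' *\<^sub>R v) h (x + s *\<^sub>R v))) (at s)"
      using has_derivative_affine_comp[OF bounded_linear_scaleR_left h(1)] .
    moreover have "dir_deriv (s' *\<^sub>R v) h y = s' *\<^sub>R ?D y" for s' y
      using linear_scale[OF has_derivative_linear[OF has_derivative_dir_deriv[OF h(1)]]] .
    ultimately show ?thesis by (simp add: has_vector_derivative_def has_derivative_at_withinI)
  qed
  have ftc: "(LINT s|lborel. indicator {0..1} s *\<^sub>R ?D (x + s *\<^sub>R v)) = h (x + v) - h x" for x
  proof -
    have "continuous_on {0..1} (\<lambda>s. x + s *\<^sub>R v)" by (intro continuous_intros)
    from continuous_on_compose2[OF h(2) this]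
    have "continuous_on {0..1} (\<lambda>s. ?D (x + s *\<^sub>R v))" by simp
    from integral_FTC_Icc[where a = 0 and b = 1, OF _ der this] show ?thesis by simp
  qed
  have tr: "integrable lborel (\<lambda>x. ?D (x + s *\<^sub>R v))" for s
    using lborel_integrable_affine[of 1 ?D "s *\<^sub>R v"] h(4) by (simp add: add.commute)
  have trn: "(LINT x|lborel. norm (?D (x + s *\<^sub>R v))) = (LINT x|lborel. norm (?D x))" for s
    by (rule lborel_integral_translate) measurable
  have I: "integrable (lborel \<Otimes>\<^sub>M lborel) (\<lambda>(s, x). indicator {0..1::real} s *\<^sub>R ?D (x + s *\<^sub>R v))"
  proof (rule lborel_pair.Fubini_integrable)
    show "integrable lborel (\<lambda>s. LINT x|lborel. norm (case (s, x) of (s, x) \<Rightarrow> indicator {0..1::real} s *\<^sub>R ?D (x + s *\<^sub>R v)))"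
      by (simp add: trn)
    show "AE s in lborel. integrable lborel (\<lambda>x. case (s, x) of (s, x) \<Rightarrow> indicator {0..1::real} s *\<^sub>R ?D (x + s *\<^sub>R v))"
      using tr by auto
  qed measurable
  have "(LINT x|lborel. LINT s|lborel. indicator {0..1::real} s *\<^sub>R ?D (x + s *\<^sub>R v)) =
      (LINT s|lborel. LINT x|lborel. indicator {0..1::real} s *\<^sub>R ?D (x + s *\<^sub>R v))"
    using lborel_pair.integral_fst[OF I] lborel_pair.integral_snd[OF I] by simp
  also have "\<dots> = (LINT s|lborel. indicator {0..1::real} s *\<^sub>R (LINT x|lborel. ?D x))"
    by (intro Bochner_Integration.integral_cong refl) (simp add: lborel_integral_translate)
  also have "\<dots> = (LINT x|lborel. ?D x)" by simp
  also have "(LINT x|lborel. LINT s|lborel. indicator {0..1::real} s *\<^sub>R ?D (x + s *\<^sub>R v)) = 0"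
    using lborel_integrable_affine[of 1 h v] h(3)
    by (simp add: ftc Bochner_Integration.integral_diff lborel_integral_translate add.commute)
  finally show ?thesis by simp
qed

definition ek :: "'a::euclidean_space \<Rightarrow> 'a \<Rightarrow> complex" where
  "ek \<xi> x = exp (- \<i> * of_real (\<xi> \<bullet> x))"

lemma norm_ek [simp]: "norm (ek \<xi> x) = 1"
  by (simp add: ek_def norm_exp_eq_Re)

lemma cnj_ek: "cnj (ek \<xi> x) = ek (- \<xi>) x"
  by (simp add: ek_def exp_cnj)

lemma ek_uminus: "ek (- \<xi>) x = ek \<xi> (- x)"
  by (simp add: ek_def)

lemma ek_commute: "ek \<xi> x = ek x \<xi>"
  by (simp add: ek_def inner_commute)

lemma ek_add: "ek \<xi> (x + y) = ek \<xi> x * ek \<xi> y"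
  by (simp add: ek_def inner_add_right exp_add[symmetric] algebra_simps)

lemma measurable_ek [measurable (raw)]:
  "f \<in> borel_measurable M \<Longrightarrow> g \<in> borel_measurable M \<Longrightarrow> (\<lambda>x. ek (f x) (g x)) \<in> borel_measurable M"
  unfolding ek_def by measurable

abbreviation fconst :: "'a::euclidean_space itself \<Rightarrow> real" where
  "fconst _ \<equiv> (2 * pi) powr (- real DIM('a) / 2)"

lemma fourier_ek:
  "fourier f \<xi> = of_real (fconst TYPE('a)) * (LINT x|lborel. ek \<xi> x * f (x :: 'a::euclidean_space))"
  by (simp add: fourier_def ek_def)

lemma integrable_ek: "integrable M f \<Longrightarrow> (\<lambda>x. x) \<in> borel_measurable M \<Longrightarrow> integrable M (\<lambda>x. ek \<xi> x * f x)"
  by (rule Bochner_Integration.integrable_bound[of M f]) (auto simp: norm_mult)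

lemma norm_fourier_le:
  assumes "integrable lborel f"
  shows "norm (fourier f \<xi>) \<le> fconst TYPE('a) * (LINT x|lborel. norm (f (x :: 'a::euclidean_space)))"
proof -
  have "norm (LINT x|lborel. ek \<xi> x * f x) \<le> (LINT x|lborel. norm (f x))"
    by (rule norm_integral_le) (use assms in \<open>auto intro!: integrable_ek simp: norm_mult\<close>)
  then show ?thesis by (simp add: fourier_ek norm_mult)
qed

lemma has_derivative_ek:
  "((\<lambda>\<xi>. ek \<xi> x) has_derivative (\<lambda>v. - \<i> * of_real (v \<bullet> x) * ek \<xi> x)) (at \<xi>)"
proof -
  have "((\<lambda>\<xi>. - \<i> * of_real (\<xi> \<bullet> x)) has_derivative (\<lambda>v. - \<i> * of_real (v \<bullet> x))) (at \<xi>)"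
    by (auto intro!: derivative_eq_intros)
  from has_derivative_compose[OF this DERIV_exp[THEN has_field_derivative_imp_has_derivative]]
  show ?thesis by (simp add: ek_def[abs_def] mult_ac)
qed

lemma has_derivative_fourier:
  fixes f :: "'a::euclidean_space \<Rightarrow> complex"
  assumes f: "integrable lborel f" and xf: "integrable lborel (\<lambda>x. norm x * norm (f x))"
  shows "(fourier f has_derivative (\<lambda>v. fourier (\<lambda>x. - \<i> * (of_real (x \<bullet> v) * f x)) \<xi>)) (at \<xi>)"
proof -
  have [measurable]: "f \<in> borel_measurable borel" using f borel_measurable_integrable by force
  have "((\<lambda>\<xi>. LINT x|lborel. ek \<xi> x * f x) has_derivative (\<lambda>v. LINT x|lborel. (- \<i> * of_real (v \<bullet> x) * ek \<xi> x) * f x)) (at \<xi>)"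
  proof (rule has_derivative_integral_param(1)[where r = 1 and w = "\<lambda>x. norm x * norm (f x)" and
      g' = "\<lambda>\<xi> x v. (- \<i> * of_real (v \<bullet> x) * ek \<xi> x) * f x"])
    show "((\<lambda>\<xi>. ek \<xi> x * f x) has_derivative (\<lambda>v. - \<i> * of_real (v \<bullet> x) * ek \<xi> x * f x)) (at \<xi>)" for \<xi> x
      by (intro has_derivative_mult_left has_derivative_ek)
    show "norm (- \<i> * of_real (v \<bullet> x) * ek \<xi> x * f x) \<le> norm x * norm (f x) * norm v" for \<xi> x v
      using mult_right_mono[OF Cauchy_Schwarz_ineq2[of v x], of "norm (f x)"] by (simp add: norm_mult mult_ac)
  qed (use f xf in \<open>auto intro!: integrable_ek\<close>)
  from has_derivative_mult_right[OF this, of "of_real (fconst TYPE('a))"] show ?thesis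
    unfolding fourier_ek[abs_def] by (simp add: inner_commute mult_ac)
qed

lemma fourier_cmult: "fourier (\<lambda>x. c * f x) \<xi> = c * fourier f \<xi>"
  by (simp add: fourier_ek mult.left_commute[of _ c])

lemma fourier_add:
  "integrable lborel f \<Longrightarrow> integrable lborel g \<Longrightarrow> fourier (\<lambda>x. f x + g x) \<xi> = fourier f \<xi> + fourier g \<xi>"
  by (simp add: fourier_ek distrib_left Bochner_Integration.integral_add integrable_ek)

lemma integrable_norm_mult_schwartz:
  fixes f :: "'a::euclidean_space \<Rightarrow> complex"
  assumes f: "f \<in> schwartz"
  shows "integrable lborel (\<lambda>x. norm x * norm (f x))"
proof (rule Bochner_Integration.integrable_bound)
  show "integrable lborel (\<lambda>x. \<Sum>b\<in>Basis. norm (of_real (x \<bullet> b) * f x))"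
    by (intro Bochner_Integration.integrable_sum integrable_norm schwartz_integrable schwartz_mult_inner f)
  show "AE x in lborel. norm (norm x * norm (f x)) \<le> norm (\<Sum>b\<in>Basis. norm (of_real (x \<bullet> b) * f x))"
  proof (rule AE_I2)
    fix x :: 'a
    have "norm x * norm (f x) \<le> (\<Sum>b\<in>Basis. \<bar>x \<bullet> b\<bar>) * norm (f x)"
      by (intro mult_right_mono norm_le_l1) auto
    then show "norm (norm x * norm (f x)) \<le> norm (\<Sum>b\<in>Basis. norm (of_real (x \<bullet> b) * f x))"
      by (simp add: norm_mult sum_distrib_right abs_of_nonneg sum_nonneg)
  qed
qed (use schwartz_measurable[OF f] in measurable)

text \<open>Integration by parts, in the form that the derivative of \<open>ek \<xi> x * f x\<close>
  integrates to zero.\<close>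

lemma fourier_dir_deriv:
  fixes f :: "'a::euclidean_space \<Rightarrow> complex"
  assumes f: "f \<in> schwartz"
  shows "fourier (dir_deriv v f) \<xi> = \<i> * of_real (\<xi> \<bullet> v) * fourier f \<xi>"
proof -
  let ?h = "\<lambda>x. ek \<xi> x * f x"
  have D: "(?h has_derivative (\<lambda>v. ek \<xi> x * dir_deriv v f x + (- \<i> * of_real (v \<bullet> \<xi>) * ek \<xi> x) * f x)) (at x)" for x
    using has_derivative_mult[OF has_derivative_ek[of \<xi> x] has_derivative_dir_deriv[OF schwartz_differentiable[OF f]]]
    by (simp add: ek_commute[of \<xi>])
  have eq: "dir_deriv v ?h x = ek \<xi> x * dir_deriv v f x - \<i> * of_real (\<xi> \<bullet> v) * (ek \<xi> x * f x)" for x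
    using dir_deriv_eqI[OF D] by (simp add: inner_commute)
  then have eq: "dir_deriv v ?h = (\<lambda>x. ek \<xi> x * dir_deriv v f x - \<i> * of_real (\<xi> \<bullet> v) * (ek \<xi> x * f x))" by (intro ext)
  have i: "integrable lborel (\<lambda>x. ek \<xi> x * f x)" "integrable lborel (\<lambda>x. ek \<xi> x * dir_deriv v f x)"
    by (intro integrable_ek schwartz_integrable schwartz_dir_deriv f, simp)+
  have "continuous_on UNIV (ek \<xi>)" unfolding ek_def by (intro continuous_intros)
  then have "continuous_on UNIV (dir_deriv v ?h)"
    unfolding eq using schwartz_continuous[OF f] schwartz_continuous[OF schwartz_dir_deriv[OF f]]
    by (intro continuous_intros)
  then have "(LINT x|lborel. dir_deriv v ?h x) = 0"
  proof (rule integral_dir_deriv_zero[rotated])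
    show "integrable lborel (dir_deriv v ?h)"
      unfolding eq by (intro Bochner_Integration.integrable_diff integrable_mult_right i)
    show "?h differentiable at x" for x using D unfolding differentiable_def by blast
  qed (rule i)
  then have "(LINT x|lborel. ek \<xi> x * dir_deriv v f x) = \<i> * of_real (\<xi> \<bullet> v) * (LINT x|lborel. ek \<xi> x * f x)"
    using i unfolding eq by (simp add: Bochner_Integration.integral_diff)
  then show ?thesis by (simp add: fourier_ek)
qed

lemma fourier_schwartz:
  fixes f :: "'a::euclidean_space \<Rightarrow> complex"
  assumes "f \<in> schwartz"
  shows "fourier f \<in> schwartz"
proof (rule schwartz_coinduct[where F = "{fourier f |f. f \<in> schwartz}"])
  fix h :: "'a \<Rightarrow> complex" assume "h \<in> {fourier f |f. f \<in> schwartz}"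
  then obtain f where h: "h = fourier f" and f: "f \<in> schwartz" by auto
  have D: "(h has_derivative (\<lambda>v. fourier (\<lambda>x. - \<i> * (of_real (x \<bullet> v) * f x)) \<xi>)) (at \<xi>)" for \<xi>
    unfolding h by (rule has_derivative_fourier[OF schwartz_integrable[OF f] integrable_norm_mult_schwartz[OF f]])
  show "h differentiable (at x)" for x using D differentiable_def by blast
  have "dir_deriv v h = fourier (\<lambda>x. - \<i> * (of_real (x \<bullet> v) * f x))" for v
    using dir_deriv_eqI[OF D] by (intro ext)
  moreover have "(\<lambda>x. - \<i> * (of_real (x \<bullet> v) * f x)) \<in> schwartz" for v
    by (intro schwartz_cmult schwartz_mult_inner f)
  ultimately show "dir_deriv v h \<in> {fourier f |f. f \<in> schwartz}" for v by blast
  show "bounded (range (\<lambda>x. of_real (norm x ^ N) * h x))" for N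
  proof -
    have "\<exists>g\<in>schwartz. \<forall>\<xi>. norm (fourier g \<xi>) = \<bar>\<xi> \<bullet> b\<bar> ^ N * norm (fourier f \<xi>)" for b
    proof (induction N)
      case (Suc N)
      then obtain g where g: "g \<in> schwartz" "\<And>\<xi>. norm (fourier g \<xi>) = \<bar>\<xi> \<bullet> b\<bar> ^ N * norm (fourier f \<xi>)" by blast
      then show ?case using schwartz_dir_deriv[OF g(1), of b]
        by (intro bexI[of _ "dir_deriv b g"]) (auto simp: fourier_dir_deriv norm_mult)
    qed (use f in auto)
    then obtain g where g: "\<And>b. g b \<in> schwartz" "\<And>b \<xi>. norm (fourier (g b) \<xi>) = \<bar>\<xi> \<bullet> b\<bar> ^ N * norm (fourier f \<xi>)"
      by metis
    have "norm (of_real (norm \<xi> ^ N) * h \<xi>) \<le> real DIM('a) ^ N * (\<Sum>b\<in>Basis. fconst TYPE('a) * (LINT x|lborel. norm (g b x)))" for \<xi>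
    proof -
      \<comment> \<open>The coordinate of largest modulus controls the norm, |\<xi>| <= DIM * |\<xi>
        . b|, and powers of that single coordinate are produced by repeated derivatives in direction
        b.\<close>
      obtain b where b: "b \<in> Basis" "\<And>c. c \<in> Basis \<Longrightarrow> \<bar>\<xi> \<bullet> c\<bar> \<le> \<bar>\<xi> \<bullet> b\<bar>"
      proof -
        have "Max ((\<lambda>b. \<bar>\<xi> \<bullet> b\<bar>) ` Basis) \<in> (\<lambda>b. \<bar>\<xi> \<bullet> b\<bar>) ` Basis" by (rule Max_in) auto
        then obtain b where b: "Max ((\<lambda>b. \<bar>\<xi> \<bullet> b\<bar>) ` Basis) = \<bar>\<xi> \<bullet> b\<bar>" "b \<in> Basis" by (rule imageE)
        then show thesis using Max_ge[of "(\<lambda>b. \<bar>\<xi> \<bullet> b\<bar>) ` Basis"] by (intro that[of b]) auto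
      qed
      have "norm \<xi> \<le> (\<Sum>c\<in>Basis. \<bar>\<xi> \<bullet> c\<bar>)" by (rule norm_le_l1)
      also have "\<dots> \<le> (\<Sum>c\<in>(Basis::'a set). \<bar>\<xi> \<bullet> b\<bar>)" by (rule sum_mono) (use b in auto)
      finally have "norm \<xi> \<le> (\<Sum>c\<in>(Basis::'a set). \<bar>\<xi> \<bullet> b\<bar>)" .
      then have "norm \<xi> ^ N \<le> (real DIM('a) * \<bar>\<xi> \<bullet> b\<bar>) ^ N" by (intro power_mono) auto
      then have "norm (of_real (norm \<xi> ^ N) * h \<xi>) \<le> (real DIM('a) * \<bar>\<xi> \<bullet> b\<bar>) ^ N * norm (h \<xi>)"
        by (simp add: norm_mult norm_power mult_right_mono)
      also have "\<dots> = real DIM('a) ^ N * norm (fourier (g b) \<xi>)" by (simp add: g h power_mult_distrib)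
      also have "norm (fourier (g b) \<xi>) \<le> fconst TYPE('a) * (LINT x|lborel. norm (g b x))"
        by (rule norm_fourier_le[OF schwartz_integrable[OF g(1)]])
      also have "\<dots> \<le> (\<Sum>b\<in>Basis. fconst TYPE('a) * (LINT x|lborel. norm (g b x)))"
        by (rule member_le_sum[OF b(1)]) auto
      finally show ?thesis by (simp add: mult_left_mono)
    qed
    then show ?thesis by (auto simp: bounded_iff)
  qed
qed (use assms in auto)

section \<open>Gaussians, Fourier inversion and Plancherel's identity\<close>

lemma integral_gauss_ek_real: "(LINT x|lborel. exp (\<i> * of_real (t * x)) * of_real (exp (- x\<^sup>2 / 2))) = of_real (sqrt (2 * pi) * exp (- t\<^sup>2 / 2))"
    "integrable lborel (\<lambda>x::real. exp (- x\<^sup>2 / 2))"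
proof -
  have "of_real (exp (- t\<^sup>2 / 2)) = char std_normal_distribution t" by (simp add: char_std_normal_distribution)
  also have "\<dots> = (LINT x|lborel. normal_density 0 1 x *\<^sub>R exp (\<i> * of_real (t * x)))"
    unfolding char_def by (subst integral_density) (auto simp: mult_ac)
  also have "\<dots> = (LINT x|lborel. of_real (1 / sqrt (2 * pi)) * (exp (\<i> * of_real (t * x)) * of_real (exp (- x\<^sup>2 / 2))))"
    by (simp add: std_normal_density_def scaleR_conv_of_real mult_ac)
  finally have "of_real (exp (- t\<^sup>2 / 2)) = of_real (1 / sqrt (2 * pi)) * (LINT x|lborel. (exp (\<i> * of_real (t * x)) * of_real (exp (- x\<^sup>2 / 2))))"
    by simp
  then have "of_real (sqrt (2 * pi)) * of_real (exp (- t\<^sup>2 / 2)) = of_real (sqrt (2 * pi)) * (of_real (1 / sqrt (2 * pi)) * (LINT x|lborel. (exp (\<i> * of_real (t * x)) * complex_of_real (exp (- x\<^sup>2 / 2)))))"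
    by simp
  also have "\<dots> = (LINT x|lborel. exp (\<i> * of_real (t * x)) * of_real (exp (- x\<^sup>2 / 2)))"
    by (simp add: mult.assoc[symmetric] of_real_mult[symmetric] del: of_real_mult)
  finally show "(LINT x|lborel. exp (\<i> * of_real (t * x)) * of_real (exp (- x\<^sup>2 / 2))) = of_real (sqrt (2 * pi) * exp (- t\<^sup>2 / 2))"
    by simp
  have "integrable lborel (normal_density 0 1)" by (rule integrable_normal_density) simp
  then have "integrable lborel (\<lambda>x. sqrt (2 * pi) * normal_density 0 1 x)" by simp
  then show "integrable lborel (\<lambda>x::real. exp (- x\<^sup>2 / 2))"
    by (simp add: std_normal_density_def[abs_def])
qed

definition gauss :: "'a::euclidean_space \<Rightarrow> real" where
  "gauss x = exp (- (norm x)\<^sup>2 / 2)"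

lemma gauss_prod: "gauss x = (\<Prod>b\<in>Basis. exp (- (x \<bullet> b)\<^sup>2 / 2))"
proof -
  have "(norm x)\<^sup>2 = (\<Sum>b\<in>Basis. (x \<bullet> b)\<^sup>2)" unfolding power2_norm_eq_inner by (subst euclidean_inner) (simp add: power2_eq_square)
  then show ?thesis by (simp add: gauss_def exp_sum[symmetric] sum_negf sum_divide_distrib)
qed

lemma gauss_pos: "0 < gauss x" and gauss_le_1: "gauss x \<le> 1"
  by (simp_all add: gauss_def)

lemma gauss_measurable [measurable]: "gauss \<in> borel_measurable borel"
  unfolding gauss_def[abs_def] by measurable

lemma integrable_gauss: "integrable lborel (gauss :: 'a::euclidean_space \<Rightarrow> real)"
  unfolding gauss_prod[abs_def] by (rule integrable_prod_Basis(1)) (rule integral_gauss_ek_real(2))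

lemma integral_ek_gauss:
  "(LINT x|lborel. ek \<xi> x * of_real (gauss (x :: 'a::euclidean_space))) = of_real (1 / fconst TYPE('a) * gauss \<xi>)"
proof -
  have i: "integrable lborel (\<lambda>x. exp (\<i> * of_real (- (\<xi> \<bullet> b) * x)) * complex_of_real (exp (- x\<^sup>2 / 2)))" for b
    using integrable_ek[OF integrable_of_real[OF integral_gauss_ek_real(2)], of "\<xi> \<bullet> b"] by (simp add: ek_def)
  have "ek \<xi> x * of_real (gauss x) = (\<Prod>b\<in>Basis. exp (\<i> * of_real (- (\<xi> \<bullet> b) * (x \<bullet> b))) * complex_of_real (exp (- (x \<bullet> b)\<^sup>2 / 2)))" for x
  proof -
    have "ek \<xi> x = (\<Prod>b\<in>Basis. exp (\<i> * of_real (- (\<xi> \<bullet> b) * (x \<bullet> b))))"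
      unfolding ek_def euclidean_inner[of \<xi> x] by (simp add: exp_sum[symmetric] sum_distrib_left sum_negf)
    then show ?thesis by (simp add: gauss_prod prod.distrib)
  qed
  then have "(LINT x|lborel. ek \<xi> x * of_real (gauss x)) = (\<Prod>b\<in>Basis. of_real (sqrt (2 * pi) * exp (- (- (\<xi> \<bullet> b))\<^sup>2 / 2)))"
    using integrable_prod_Basis(2)[OF i] by (simp only: integral_gauss_ek_real(1))
  also have "\<dots> = of_real (sqrt (2 * pi) ^ DIM('a) * gauss \<xi>)" by (simp add: gauss_prod prod.distrib)
  also have "sqrt (2 * pi) ^ DIM('a) = 1 / fconst TYPE('a)"
    by (simp add: powr_half_sqrt[symmetric] powr_realpow[symmetric] powr_powr powr_minus field_simps)
  finally show ?thesis .
qed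

lemma integral_ek_gauss_scaled:
  assumes "0 < \<epsilon>"
  shows "(LINT x|lborel. ek \<xi> x * of_real (gauss (\<epsilon> *\<^sub>R (x :: 'a::euclidean_space)))) =
    of_real (1 / fconst TYPE('a) * (1 / \<epsilon>) ^ DIM('a) * gauss ((1 / \<epsilon>) *\<^sub>R \<xi>))"
proof -
  have "(LINT x|lborel. ek \<xi> x * of_real (gauss (\<epsilon> *\<^sub>R x))) =
      \<bar>1 / \<epsilon>\<bar> ^ DIM('a) *\<^sub>R (LINT x|lborel. ek \<xi> (0 + (1 / \<epsilon>) *\<^sub>R x) * of_real (gauss (\<epsilon> *\<^sub>R (0 + (1 / \<epsilon>) *\<^sub>R x))))"
    by (rule lborel_integral_affine) (use assms in auto)
  also have "(\<lambda>x. ek \<xi> (0 + (1 / \<epsilon>) *\<^sub>R x) * of_real (gauss (\<epsilon> *\<^sub>R (0 + (1 / \<epsilon>) *\<^sub>R x)))) = (\<lambda>x. ek ((1 / \<epsilon>) *\<^sub>R \<xi>) x * of_real (gauss x))"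
    using assms by (simp add: ek_def)
  finally show ?thesis using assms by (simp only: integral_ek_gauss) (simp add: scaleR_conv_of_real mult_ac)
qed

lemma integral_gauss: "(LINT x|lborel. gauss (x :: 'a::euclidean_space)) = 1 / fconst TYPE('a)"
proof -
  have "complex_of_real (LINT x|lborel. gauss (x :: 'a)) = of_real (1 / fconst TYPE('a))"
    using integral_ek_gauss[of "0 :: 'a"] by (simp add: ek_def gauss_def)
  then show ?thesis by (simp only: of_real_eq_iff)
qed

text \<open>A Gaussian factor of width 1/\<epsilon> makes the double integral absolutely convergent.
  Fubini and the transform of the Gaussian turn the damped inverse transform into an average of f at
  scale \<epsilon> around x, which is \<open>key\<close>; both sides converge by dominated
  convergence as \<epsilon> tends to 0.\<close>

lemma fourier_inversion:
  fixes f :: "'a::euclidean_space \<Rightarrow> complex"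
  assumes f: "integrable lborel f" "continuous_on UNIV f" "\<And>x. norm (f x) \<le> C" and ff: "integrable lborel (fourier f)"
  shows "fourier (fourier f) (- x) = f x"
proof -
  let ?c = "fconst TYPE('a)"
  have fm[measurable]: "f \<in> borel_measurable borel" "fourier f \<in> borel_measurable borel"
    using f(1) ff borel_measurable_integrable by force+
  have key: "(LINT \<xi>|lborel. of_real (gauss (\<epsilon> *\<^sub>R \<xi>)) * (ek (- x) \<xi> * fourier f \<xi>)) = (LINT z|lborel. f (x + \<epsilon> *\<^sub>R z) * of_real (gauss z))"
    if \<epsilon>: "0 < \<epsilon>" for \<epsilon>
  proof -
    have ig: "integrable lborel (\<lambda>\<xi>::'a. complex_of_real (gauss (\<epsilon> *\<^sub>R \<xi>)))"
      using lborel_integrable_affine[of \<epsilon> "gauss :: 'a \<Rightarrow> real" 0] integrable_gauss \<epsilon> by (intro integrable_of_real) simp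
    have "(LINT \<xi>|lborel. of_real (gauss (\<epsilon> *\<^sub>R \<xi>)) * (ek (- x) \<xi> * fourier f \<xi>)) =
        of_real ?c * (LINT \<xi>|lborel. LINT y|lborel. ek (y - x) \<xi> * of_real (gauss (\<epsilon> *\<^sub>R \<xi>)) * f y)"
    proof -
      have "of_real (gauss (\<epsilon> *\<^sub>R \<xi>)) * (ek (- x) \<xi> * fourier f \<xi>) = of_real ?c * (LINT y|lborel. ek (y - x) \<xi> * of_real (gauss (\<epsilon> *\<^sub>R \<xi>)) * f y)" for \<xi>
      proof -
        have "ek (y - x) \<xi> * of_real (gauss (\<epsilon> *\<^sub>R \<xi>)) * f y = (of_real (gauss (\<epsilon> *\<^sub>R \<xi>)) * ek (- x) \<xi>) * (ek \<xi> y * f y)" for y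
          using ek_add[of \<xi> y "- x"] by (simp add: ek_commute[of "y - x"] ek_commute[of "- x"])
        then have "(LINT y|lborel. ek (y - x) \<xi> * of_real (gauss (\<epsilon> *\<^sub>R \<xi>)) * f y) =
            (LINT y|lborel. (of_real (gauss (\<epsilon> *\<^sub>R \<xi>)) * ek (- x) \<xi>) * (ek \<xi> y * f y))" by (simp only:)
        then show ?thesis by (simp add: fourier_ek)
      qed
      then show ?thesis by simp
    qed
    also have "(LINT \<xi>|lborel. LINT y|lborel. ek (y - x) \<xi> * of_real (gauss (\<epsilon> *\<^sub>R \<xi>)) * f y) =
        (LINT y|lborel. LINT \<xi>|lborel. ek (y - x) \<xi> * of_real (gauss (\<epsilon> *\<^sub>R \<xi>)) * f y)"
      by (rule Fubini_bounded_kernel(1)[where k = "\<lambda>\<xi> y. ek (y - x) \<xi>" and C = 1, OF lborel.sigma_finite_measure_axioms lborel.sigma_finite_measure_axioms ig f(1)]) auto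
    also have "\<dots> = (LINT y|lborel. of_real (1 / ?c * (1 / \<epsilon>) ^ DIM('a) * gauss ((1 / \<epsilon>) *\<^sub>R (y - x))) * f y)"
      by (simp add: integral_ek_gauss_scaled[OF \<epsilon>])
    also have "\<dots> = \<bar>\<epsilon>\<bar> ^ DIM('a) *\<^sub>R (LINT z|lborel. of_real (1 / ?c * (1 / \<epsilon>) ^ DIM('a) * gauss ((1 / \<epsilon>) *\<^sub>R ((x + \<epsilon> *\<^sub>R z) - x))) * f (x + \<epsilon> *\<^sub>R z))"
      by (rule lborel_integral_affine) (use \<epsilon> in auto)
    also have "\<dots> = (LINT z|lborel. of_real (1 / ?c) * (f (x + \<epsilon> *\<^sub>R z) * of_real (gauss z)))"
      unfolding integral_scaleR_right[symmetric]
      by (rule Bochner_Integration.integral_cong) (use \<epsilon> in \<open>auto simp: scaleR_conv_of_real power_divide\<close>)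
    finally show ?thesis by simp
  qed
  have "(\<lambda>n. LINT \<xi>|lborel. of_real (gauss ((1 / Suc n) *\<^sub>R \<xi>)) * (ek (- x) \<xi> * fourier f \<xi>)) \<longlonglongrightarrow> (LINT \<xi>|lborel. of_real (gauss (0 *\<^sub>R \<xi>)) * (ek (- x) \<xi> * fourier f \<xi>))"
  proof (rule integral_dominated_convergence[where w = "\<lambda>\<xi>. norm (fourier f \<xi>)"])
    show "AE \<xi> in lborel. (\<lambda>n. of_real (gauss ((1 / Suc n) *\<^sub>R \<xi>)) * (ek (- x) \<xi> * fourier f \<xi>)) \<longlonglongrightarrow> of_real (gauss (0 *\<^sub>R \<xi>)) * (ek (- x) \<xi> * fourier f \<xi>)"
      unfolding gauss_def by (intro AE_I2 tendsto_intros LIMSEQ_Suc[OF lim_1_over_n]) auto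
    show "AE \<xi> in lborel. norm (of_real (gauss ((1 / Suc n) *\<^sub>R \<xi>)) * (ek (- x) \<xi> * fourier f \<xi>)) \<le> norm (fourier f \<xi>)" for n
      by (intro AE_I2) (simp add: norm_mult abs_of_pos[OF gauss_pos] mult_left_le_one_le gauss_le_1 less_imp_le[OF gauss_pos])
  qed (use ff in auto)
  then have "(\<lambda>n. LINT z|lborel. f (x + (1 / Suc n) *\<^sub>R z) * of_real (gauss z)) \<longlonglongrightarrow> (LINT \<xi>|lborel. ek (- x) \<xi> * fourier f \<xi>)"
    by (simp add: key) (simp add: gauss_def)
  moreover have "(\<lambda>n. LINT z|lborel. f (x + (1 / Suc n) *\<^sub>R z) * of_real (gauss z)) \<longlonglongrightarrow> (LINT z|lborel. f (x + 0 *\<^sub>R z) * of_real (gauss z))"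
  proof (rule integral_dominated_convergence[where w = "\<lambda>z. C * gauss z"])
    show "AE z in lborel. (\<lambda>n. f (x + (1 / Suc n) *\<^sub>R z) * of_real (gauss z)) \<longlonglongrightarrow> f (x + 0 *\<^sub>R z) * of_real (gauss z)"
      by (intro AE_I2 tendsto_mult tendsto_const continuous_on_tendsto_compose[OF f(2)] tendsto_add tendsto_scaleR LIMSEQ_Suc[OF lim_1_over_n]) auto
    show "AE z in lborel. norm (f (x + (1 / Suc n) *\<^sub>R z) * of_real (gauss z)) \<le> C * gauss z" for n
      by (intro AE_I2) (simp add: norm_mult abs_of_pos[OF gauss_pos] mult_right_mono f(3) less_imp_le[OF gauss_pos])
  qed (use integrable_gauss in auto)
  ultimately have "(LINT \<xi>|lborel. ek (- x) \<xi> * fourier f \<xi>) = (LINT z|lborel. f (x + 0 *\<^sub>R z) * of_real (gauss z))"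
    by (rule LIMSEQ_unique)
  also have "\<dots> = f x * of_real (1 / ?c)" by (simp add: integral_gauss)
  finally show ?thesis by (simp add: fourier_ek)
qed

lemma fourier_fourier:
  assumes "f \<in> schwartz" shows "fourier (fourier f) x = f (- x)"
proof -
  obtain C where "\<And>x. norm (f x) \<le> C" using schwartz_norm_le[OF assms] by blast
  from fourier_inversion[where x = "- x", OF schwartz_integrable schwartz_continuous this schwartz_integrable[OF fourier_schwartz]] assms
  show ?thesis by simp
qed

lemma fourier_surj: "f \<in> schwartz \<Longrightarrow> \<exists>g\<in>schwartz. fourier g = f"
proof (intro bexI[of _ "\<lambda>x. fourier f (- x)"] ext)
  assume f: "f \<in> schwartz"
  fix \<xi>
  have [measurable]: "fourier f \<in> borel_measurable borel" by (intro schwartz_measurable fourier_schwartz f)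
  have "fourier (\<lambda>x. fourier f (- x)) \<xi> = fourier (fourier f) (- \<xi>)"
    unfolding fourier_ek[of "\<lambda>x. fourier f (- x)"] fourier_ek[of "fourier f"]
    by (subst lborel_integral_uminus[of "\<lambda>x. ek (- \<xi>) x * fourier f x", symmetric]) (auto simp: ek_uminus)
  then show "fourier (\<lambda>x. fourier f (- x)) \<xi> = f \<xi>" using fourier_fourier[OF f] by simp
qed (intro schwartz_reflect fourier_schwartz)

lemma fourier_multiplication:
  fixes f g :: "'a::euclidean_space \<Rightarrow> complex"
  assumes f: "integrable lborel f" and g: "integrable lborel g"
  shows "(LINT x|lborel. fourier f x * g x) = (LINT x|lborel. f x * fourier g x)"
proof -
  have [measurable]: "f \<in> borel_measurable borel" "g \<in> borel_measurable borel"
    using f g borel_measurable_integrable by force+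
  have "(LINT x|lborel. LINT y|lborel. ek x y * g x * f y) = (LINT y|lborel. LINT x|lborel. ek x y * g x * f y)"
    by (rule Fubini_bounded_kernel(1)[where C = 1, OF lborel.sigma_finite_measure_axioms lborel.sigma_finite_measure_axioms g f]) auto
  moreover have "(LINT y|lborel. ek x y * g x * f y) = (LINT y|lborel. ek x y * f y) * g x" for x
    unfolding integral_mult_left_zero[symmetric] by (rule Bochner_Integration.integral_cong) auto
  moreover have "(LINT x|lborel. ek x y * g x * f y) = f y * (LINT x|lborel. ek y x * g x)" for y
    unfolding integral_mult_right_zero[symmetric] by (rule Bochner_Integration.integral_cong) (auto simp: ek_commute)
  ultimately have "(LINT x|lborel. (LINT y|lborel. ek x y * f y) * g x) = (LINT y|lborel. f y * (LINT x|lborel. ek y x * g x))" by (simp only:)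
  moreover have "(LINT x|lborel. fourier f x * g x) = (LINT x|lborel. of_real (fconst TYPE('a)) * ((LINT y|lborel. ek x y * f y) * g x))"
    by (rule Bochner_Integration.integral_cong) (auto simp: fourier_ek)
  moreover have "(LINT x|lborel. f x * fourier g x) = (LINT x|lborel. of_real (fconst TYPE('a)) * (f x * (LINT y|lborel. ek x y * g y)))"
    by (rule Bochner_Integration.integral_cong) (auto simp: fourier_ek)
  ultimately show ?thesis by (simp only: integral_mult_right_zero)
qed

lemma cnj_fourier: "cnj (fourier f \<xi>) = fourier (\<lambda>x. cnj (f x)) (- \<xi>)"
proof -
  have "cnj (LINT x|lborel. ek \<xi> x * f x) = (LINT x|lborel. cnj (ek \<xi> x * f x))"
    by (rule Bochner_Integration.integral_cnj[symmetric])
  then show ?thesis by (simp add: fourier_ek cnj_ek)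
qed

text \<open>This is the multiplication formula for f and the conjugate of \<open>fourier g\<close>.
  That conjugate is the reflected transform of cnj g, so transforming it once more returns cnj
  g.\<close>

lemma plancherel:
  assumes f: "f \<in> schwartz" and g: "g \<in> schwartz"
  shows "(LINT \<xi>|lborel. fourier f \<xi> * cnj (fourier g \<xi>)) = (LINT x|lborel. f x * cnj (g x))"
proof -
  have [measurable]: "fourier (\<lambda>x. cnj (g x)) \<in> borel_measurable borel" by (intro schwartz_measurable fourier_schwartz schwartz_cnj g)
  have r: "fourier (\<lambda>\<xi>. fourier (\<lambda>x. cnj (g x)) (- \<xi>)) x = cnj (g x)" for x
  proof -
    have "fourier (\<lambda>\<xi>. fourier (\<lambda>x. cnj (g x)) (- \<xi>)) x = fourier (fourier (\<lambda>x. cnj (g x))) (- x)"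
      unfolding fourier_ek[of "\<lambda>\<xi>. fourier (\<lambda>x. cnj (g x)) (- \<xi>)"] fourier_ek[of "fourier (\<lambda>x. cnj (g x))"]
      by (subst lborel_integral_uminus[of "\<lambda>\<xi>. ek (- x) \<xi> * fourier (\<lambda>x. cnj (g x)) \<xi>", symmetric]) (auto simp: ek_uminus)
    then show ?thesis by (simp add: fourier_fourier schwartz_cnj g)
  qed
  have "integrable lborel (\<lambda>\<xi>. fourier (\<lambda>x. cnj (g x)) (- \<xi>))"
    by (intro schwartz_integrable schwartz_reflect fourier_schwartz schwartz_cnj g)
  from fourier_multiplication[OF schwartz_integrable[OF f] this] show ?thesis by (simp add: cnj_fourier r)
qed

section \<open>Square-integrable functions\<close>

lemma L2D: "f \<in> L2 M \<Longrightarrow> f \<in> borel_measurable M" "f \<in> L2 M \<Longrightarrow> integrable M (\<lambda>x. (norm (f x))\<^sup>2)"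
  by (auto simp: L2_def)

lemma L2I_bound:
  assumes "f \<in> borel_measurable M" "integrable M w" "\<And>x. x \<in> space M \<Longrightarrow> (norm (f x))\<^sup>2 \<le> w x"
  shows "f \<in> L2 M"
  unfolding L2_def
  using assms by (auto intro!: Bochner_Integration.integrable_bound[OF assms(2)] AE_I2 order_trans[OF assms(3) abs_ge_self])

lemma norm_add_sq_le: "(norm (a + b :: complex))\<^sup>2 \<le> 2 * (norm a)\<^sup>2 + 2 * (norm b)\<^sup>2"
proof -
  have "(norm (a + b))\<^sup>2 \<le> (norm a + norm b)\<^sup>2" by (intro power_mono norm_triangle_ineq) auto
  also have "\<dots> \<le> 2 * (norm a)\<^sup>2 + 2 * (norm b)\<^sup>2"
    using zero_le_power2[of "norm a - norm b"] unfolding power2_sum power2_diff by linarith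
  finally show ?thesis .
qed

lemma L2_add: "f \<in> L2 M \<Longrightarrow> g \<in> L2 M \<Longrightarrow> (\<lambda>x. f x + g x) \<in> L2 M"
  by (rule L2I_bound[where w = "\<lambda>x. 2 * (norm (f x))\<^sup>2 + 2 * (norm (g x))\<^sup>2"])
    (auto simp: L2_def intro!: norm_add_sq_le)

lemma L2_cmult: "f \<in> L2 M \<Longrightarrow> (\<lambda>x. c * f x) \<in> L2 M"
  by (auto simp: L2_def norm_mult power_mult_distrib)

lemma L2_diff: "f \<in> L2 M \<Longrightarrow> g \<in> L2 M \<Longrightarrow> (\<lambda>x. f x - g x) \<in> L2 M"
  using L2_add[of f M "\<lambda>x. - 1 * g x"] L2_cmult[of g M "-1"] by simp

lemma L2_cnj: "f \<in> L2 M \<Longrightarrow> (\<lambda>x. cnj (f x)) \<in> L2 M"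
  by (auto simp: L2_def intro: measurable_compose[OF _ borel_measurable_continuous_onI] continuous_intros)

lemma L2_mult_integrable:
  assumes f: "f \<in> L2 M" and g: "g \<in> L2 M" shows "integrable M (\<lambda>x. f x * g x)"
proof (rule Bochner_Integration.integrable_bound[where f = "\<lambda>x. (norm (f x))\<^sup>2 + (norm (g x))\<^sup>2"])
  have "norm a * norm b \<le> (norm a)\<^sup>2 + (norm b)\<^sup>2" for a b :: complex
  proof -
    have "0 \<le> norm a * norm b" by simp
    then show ?thesis using sum_squares_bound[of "norm a" "norm b"] unfolding mult.assoc by linarith
  qed
  then show "AE x in M. norm (f x * g x) \<le> norm ((norm (f x))\<^sup>2 + (norm (g x))\<^sup>2)"
    by (intro AE_I2) (simp add: norm_mult)
qed (use f g in \<open>auto simp: L2_def\<close>)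

lemma L2_norm_nonneg [simp]: "0 \<le> L2_norm M f"
  by (simp add: L2_norm_def)

lemma L2_norm_sq: "(L2_norm M f)\<^sup>2 = (LINT x|M. (norm (f x))\<^sup>2)"
  by (simp add: L2_norm_def)

lemma L2_norm_nn: "f \<in> L2 M \<Longrightarrow> ennreal ((L2_norm M f)\<^sup>2) = (\<integral>\<^sup>+x. ennreal ((norm (f x))\<^sup>2) \<partial>M)"
  unfolding L2_norm_sq by (rule nn_integral_eq_integral[symmetric]) (auto simp: L2_def)

lemma L2_norm_cong_AE:
  assumes "f \<in> borel_measurable M" "g \<in> borel_measurable M" "AE x in M. f x = g x"
  shows "L2_norm M f = L2_norm M g"
  unfolding L2_norm_def using assms by (intro arg_cong[of _ _ sqrt] integral_cong_AE) auto

lemma L2_norm_minus: "L2_norm M (\<lambda>x. f x - g x) = L2_norm M (\<lambda>x. g x - f x)"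
  by (simp add: L2_norm_def norm_minus_commute)

lemma L2_norm_eq_0:
  assumes "f \<in> L2 M" "L2_norm M f = 0" shows "AE x in M. f x = 0"
proof -
  have "(LINT x|M. (norm (f x))\<^sup>2) = 0" using assms(2) by (metis L2_norm_sq zero_power2)
  then show ?thesis using assms(1) by (subst (asm) integral_nonneg_eq_0_iff_AE) (auto simp: L2_def)
qed

lemma L2_cauchy_schwarz_norm:
  assumes f: "f \<in> L2 M" and g: "g \<in> L2 M"
  shows "(LINT x|M. norm (f x) * norm (g x)) \<le> L2_norm M f * L2_norm M g"
proof -
  have "ennreal (LINT x|M. norm (f x) * norm (g x)) = (\<integral>\<^sup>+x. ennreal (norm (f x)) * ennreal (norm (g x)) \<partial>M)"
    using nn_integral_eq_integral[OF integrable_norm[OF L2_mult_integrable[OF f g]]]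
    by (simp add: norm_mult ennreal_mult)
  moreover have "(\<integral>\<^sup>+x. ennreal (norm (f x)) * ennreal (norm (g x)) \<partial>M)\<^sup>2 \<le> ennreal ((L2_norm M f)\<^sup>2) * ennreal ((L2_norm M g)\<^sup>2)"
    unfolding L2_norm_nn[OF f] L2_norm_nn[OF g] ennreal_power[OF norm_ge_zero, symmetric]
    using f g by (intro Cauchy_Schwarz_nn_integral) (auto simp: L2_def)
  ultimately have "ennreal ((LINT x|M. norm (f x) * norm (g x))\<^sup>2) \<le> ennreal ((L2_norm M f * L2_norm M g)\<^sup>2)"
  proof -
    assume a: "ennreal (LINT x|M. norm (f x) * norm (g x)) = (\<integral>\<^sup>+x. ennreal (norm (f x)) * ennreal (norm (g x)) \<partial>M)"
      and b: "(\<integral>\<^sup>+x. ennreal (norm (f x)) * ennreal (norm (g x)) \<partial>M)\<^sup>2 \<le> ennreal ((L2_norm M f)\<^sup>2) * ennreal ((L2_norm M g)\<^sup>2)"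
    have "ennreal ((LINT x|M. norm (f x) * norm (g x))\<^sup>2) = (ennreal (LINT x|M. norm (f x) * norm (g x)))\<^sup>2"
      by (rule ennreal_power[symmetric]) auto
    also have "\<dots> \<le> ennreal ((L2_norm M f)\<^sup>2) * ennreal ((L2_norm M g)\<^sup>2)" unfolding a by (rule b)
    finally show ?thesis by (simp add: ennreal_mult[symmetric] power_mult_distrib)
  qed
  then have "(LINT x|M. norm (f x) * norm (g x))\<^sup>2 \<le> (L2_norm M f * L2_norm M g)\<^sup>2"
    by (simp only: ennreal_le_iff zero_le_power2)
  then show ?thesis by (rule power2_le_imp_le) simp
qed

lemma L2_cauchy_schwarz:
  assumes f: "f \<in> L2 M" and g: "g \<in> L2 M"
  shows "norm (LINT x|M. f x * g x) \<le> L2_norm M f * L2_norm M g"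
  using order_trans[OF integral_norm_bound L2_cauchy_schwarz_norm[OF f g, unfolded norm_mult[symmetric]]] .

lemma L2_triangle:
  assumes f: "f \<in> L2 M" and g: "g \<in> L2 M"
  shows "L2_norm M (\<lambda>x. f x + g x) \<le> L2_norm M f + L2_norm M g"
proof (rule power2_le_imp_le)
  have i: "integrable M (\<lambda>x. norm (f x) * norm (g x))" using integrable_norm[OF L2_mult_integrable[OF f g]] by (simp add: norm_mult)
  have "(L2_norm M (\<lambda>x. f x + g x))\<^sup>2 \<le> (LINT x|M. (norm (f x))\<^sup>2 + (norm (g x))\<^sup>2 + 2 * (norm (f x) * norm (g x)))"
    unfolding L2_norm_sq
  proof (rule integral_mono)
    show "(norm (f x + g x))\<^sup>2 \<le> (norm (f x))\<^sup>2 + (norm (g x))\<^sup>2 + 2 * (norm (f x) * norm (g x))" for x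
      using power_mono[OF norm_triangle_ineq[of "f x" "g x"], of 2] by (simp add: power2_sum)
  qed (use i L2D(2)[OF L2_add[OF f g]] L2D(2)[OF f] L2D(2)[OF g] in auto)
  also have "\<dots> = (L2_norm M f)\<^sup>2 + (L2_norm M g)\<^sup>2 + 2 * (LINT x|M. norm (f x) * norm (g x))"
    using i L2D(2)[OF f] L2D(2)[OF g] by (simp add: L2_norm_sq)
  also have "\<dots> \<le> (L2_norm M f + L2_norm M g)\<^sup>2"
    using L2_cauchy_schwarz_norm[OF f g] by (simp add: power2_sum)
  finally show "(L2_norm M (\<lambda>x. f x + g x))\<^sup>2 \<le> (L2_norm M f + L2_norm M g)\<^sup>2" .
qed simp

lemma L2_triangle3:
  assumes "f \<in> L2 M" "g \<in> L2 M" "h \<in> L2 M"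
  shows "L2_norm M (\<lambda>x. f x - h x) \<le> L2_norm M (\<lambda>x. f x - g x) + L2_norm M (\<lambda>x. g x - h x)"
  using L2_triangle[OF L2_diff[OF assms(1,2)] L2_diff[OF assms(2,3)]] by simp

text \<open>Riesz-Fischer for representatives. Along a subsequence the increments a k have norm at
  most 2^(-k), so the sum of 2^k |a k|^2 has finite integral. Where that sum is finite, |a k| decays
  geometrically and the subsequence converges pointwise; Fatou's lemma then gives convergence in
  norm of the whole sequence.\<close>

lemma L2_complete:
  assumes f: "\<And>n. f n \<in> L2 M"
    and C: "\<And>e. 0 < e \<Longrightarrow> \<exists>N. \<forall>m\<ge>N. \<forall>n\<ge>N. L2_norm M (\<lambda>x. f m x - f n x) < e"
  obtains g where "g \<in> L2 M" "(\<lambda>n. L2_norm M (\<lambda>x. f n x - g x)) \<longlonglongrightarrow> 0"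
proof -
  have [measurable]: "\<And>n. f n \<in> borel_measurable M" using f by (auto simp: L2_def)
  have "\<exists>N. \<forall>k. (\<forall>m\<ge>N k. \<forall>n\<ge>N k. L2_norm M (\<lambda>x. f m x - f n x) < (1/2)^k)"
    using C[of "(1/2)^k" for k] by (intro choice) simp
  then obtain N where N: "\<And>k m n. N k \<le> m \<Longrightarrow> N k \<le> n \<Longrightarrow> L2_norm M (\<lambda>x. f m x - f n x) < (1/2)^k" by blast
  \<comment> \<open>The partial sum puts r k beyond N k and makes r increasing; the summand k
    ensures that r k tends to infinity.\<close>
  define r where "r k = (\<Sum>i\<le>k. N i) + k" for k
  have rN: "N k \<le> r k" for k unfolding r_def using member_le_sum[of k "{..k}" N] by simp
  have rS: "r k \<le> r (Suc k)" for k by (simp add: r_def)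
  have rk: "k \<le> r k" for k by (simp add: r_def)
  define a where "a k x = f (r (Suc k)) x - f (r k) x" for k x
  have aL2: "a k \<in> L2 M" for k unfolding a_def[abs_def] by (intro L2_diff f)
  have aN: "L2_norm M (a k) \<le> (1/2)^k" for k
    unfolding a_def[abs_def] using N[of k "r (Suc k)" "r k"] rN[of k] rS[of k] by simp
  have am[measurable]: "\<And>k. a k \<in> borel_measurable M" using aL2 by (auto simp: L2_def)
  define G where "G x = (\<Sum>k. ennreal (2^k * (norm (a k x))\<^sup>2))" for x
  have "(\<integral>\<^sup>+x. G x \<partial>M) = (\<Sum>k. \<integral>\<^sup>+x. ennreal (2^k * (norm (a k x))\<^sup>2) \<partial>M)"
    unfolding G_def by (rule nn_integral_suminf) measurable
  also have "\<dots> \<le> (\<Sum>k. ennreal ((1/2)^k))"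
  proof (intro suminf_le summableI)
    fix k
    have "(\<integral>\<^sup>+x. ennreal (2^k * (norm (a k x))\<^sup>2) \<partial>M) = ennreal (2^k) * ennreal ((L2_norm M (a k))\<^sup>2)"
      unfolding L2_norm_nn[OF aL2] by (subst nn_integral_cmult[symmetric]) (auto simp: ennreal_mult)
    also have "\<dots> = ennreal (2^k * (L2_norm M (a k))\<^sup>2)" by (simp add: ennreal_mult)
    also have "\<dots> \<le> ennreal (2^k * ((1/2)^k)\<^sup>2)" using aN[of k] by (intro ennreal_leI mult_left_mono power_mono) auto
    also have "2^k * ((1/2)^k)\<^sup>2 = (1/2::real)^k" by (simp add: power_divide power2_eq_square)
    finally show "(\<integral>\<^sup>+x. ennreal (2^k * (norm (a k x))\<^sup>2) \<partial>M) \<le> ennreal ((1/2)^k)" .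
  qed
  also have "\<dots> = ennreal 2" by (subst suminf_ennreal2) (auto simp: suminf_geometric)
  finally have "(\<integral>\<^sup>+x. G x \<partial>M) \<noteq> \<infinity>" by (auto simp: top_unique)
  then have "AE x in M. G x \<noteq> \<infinity>" by (intro nn_integral_PInf_AE) (auto simp: G_def[abs_def])
  then have conv: "AE x in M. convergent (\<lambda>k. f (r k) x)"
  proof eventually_elim
    fix x assume "G x \<noteq> \<infinity>"
    then obtain c where c: "G x = ennreal c" "0 \<le> c" by (cases "G x") auto
    have nb: "norm (a k x) \<le> sqrt c * sqrt (1/2) ^ k" for k
    proof -
      have "ennreal (2^k * (norm (a k x))\<^sup>2) \<le> G x" 
      proof -
        define F where "F k = ennreal (2^k * (norm (a k x))\<^sup>2)" for k
        have "(\<Sum>i\<in>{k}. F i) \<le> suminf F" by (rule sum_le_suminf) (auto intro: summableI)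
        then show ?thesis by (simp add: G_def F_def[abs_def])
      qed
      then have "2^k * (norm (a k x))\<^sup>2 \<le> c" using c by (simp add: ennreal_le_iff)
      then have "(norm (a k x))\<^sup>2 \<le> c * (1/2)^k" by (simp add: power_divide field_simps)
      then have "sqrt ((norm (a k x))\<^sup>2) \<le> sqrt (c * (1/2)^k)" by (rule real_sqrt_le_mono)
      then show ?thesis by (simp add: real_sqrt_mult real_sqrt_power)
    qed
    have "summable (\<lambda>k. sqrt c * sqrt (1/2) ^ k)"
      by (intro summable_mult summable_geometric) (simp add: real_sqrt_divide)
    from summable_comparison_test'[OF this nb] have "summable (\<lambda>k. a k x)" .
    then have "convergent (\<lambda>n. (\<Sum>k<n. a k x) + f (r 0) x)"
      by (intro convergent_add convergent_const) (simp add: summable_iff_convergent)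
    also have "(\<lambda>n. (\<Sum>k<n. a k x) + f (r 0) x) = (\<lambda>n. f (r n) x)"
      unfolding a_def by (subst sum_lessThan_telescope) simp
    finally show "convergent (\<lambda>k. f (r k) x)" .
  qed
  define g where "g x = lim (\<lambda>k. f (r k) x)" for x
  have [measurable]: "g \<in> borel_measurable M" unfolding g_def[abs_def] by measurable
  have bound: "(\<integral>\<^sup>+x. ennreal ((norm (f n x - g x))\<^sup>2) \<partial>M) \<le> ennreal (e\<^sup>2)"
    if e: "0 < e" and n: "\<And>m. m \<ge> K \<Longrightarrow> L2_norm M (\<lambda>x. f n x - f m x) < e" for n e K
  proof -
    have "(\<integral>\<^sup>+x. ennreal ((norm (f n x - g x))\<^sup>2) \<partial>M) = (\<integral>\<^sup>+x. liminf (\<lambda>k. ennreal ((norm (f n x - f (r k) x))\<^sup>2)) \<partial>M)"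
    proof (rule nn_integral_cong_AE)
      show "AE x in M. ennreal ((norm (f n x - g x))\<^sup>2) = liminf (\<lambda>k. ennreal ((norm (f n x - f (r k) x))\<^sup>2))"
        using conv
      proof eventually_elim
        fix x assume "convergent (\<lambda>k. f (r k) x)"
        then have "(\<lambda>k. f (r k) x) \<longlonglongrightarrow> g x" by (simp add: g_def convergent_LIMSEQ_iff)
        then have "(\<lambda>k. ennreal ((norm (f n x - f (r k) x))\<^sup>2)) \<longlonglongrightarrow> ennreal ((norm (f n x - g x))\<^sup>2)"
          by (intro tendsto_ennrealI tendsto_intros)
        from lim_imp_Liminf[OF _ this] show "ennreal ((norm (f n x - g x))\<^sup>2) = liminf (\<lambda>k. ennreal ((norm (f n x - f (r k) x))\<^sup>2))"
          by simp
      qed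
    qed
    also have "\<dots> \<le> liminf (\<lambda>k. \<integral>\<^sup>+x. ennreal ((norm (f n x - f (r k) x))\<^sup>2) \<partial>M)"
      by (rule nn_integral_liminf) measurable
    also have "\<dots> \<le> liminf (\<lambda>k. ennreal (e\<^sup>2))"
    proof (rule Liminf_mono)
      show "\<forall>\<^sub>F k in sequentially. (\<integral>\<^sup>+x. ennreal ((norm (f n x - f (r k) x))\<^sup>2) \<partial>M) \<le> ennreal (e\<^sup>2)"
        using eventually_ge_at_top[of K]
      proof eventually_elim
        fix k assume "K \<le> k"
        then have "L2_norm M (\<lambda>x. f n x - f (r k) x) < e" using rk[of k] by (intro n) simp
        then show "(\<integral>\<^sup>+x. ennreal ((norm (f n x - f (r k) x))\<^sup>2) \<partial>M) \<le> ennreal (e\<^sup>2)"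
          unfolding L2_norm_nn[OF L2_diff[OF f f], symmetric] by (intro ennreal_leI power_mono) auto
      qed
    qed
    also have "\<dots> = ennreal (e\<^sup>2)" by (simp add: Liminf_const)
    finally show ?thesis .
  qed
  have diffL2: "(\<lambda>x. f n x - g x) \<in> L2 M" if "(\<integral>\<^sup>+x. ennreal ((norm (f n x - g x))\<^sup>2) \<partial>M) \<le> ennreal (e\<^sup>2)" for n e
    unfolding L2_def using that by (auto simp: integrable_iff_bounded intro: le_less_trans)
  show thesis
  proof (rule that[of g])
    have "(\<integral>\<^sup>+x. ennreal ((norm (f (N 0) x - g x))\<^sup>2) \<partial>M) \<le> ennreal (1\<^sup>2)"
      by (rule bound[of 1 "N 0"]) (use N[of 0] in auto)
    from L2_diff[OF f diffL2[OF this], of "N 0"] show "g \<in> L2 M" by simp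
    show "(\<lambda>n. L2_norm M (\<lambda>x. f n x - g x)) \<longlonglongrightarrow> 0"
    proof (rule LIMSEQ_I)
      fix e :: real assume e: "0 < e"
      then obtain K where K: "\<And>m n. m \<ge> K \<Longrightarrow> n \<ge> K \<Longrightarrow> L2_norm M (\<lambda>x. f m x - f n x) < e / 2" using C[of "e/2"] by auto
      have "norm (L2_norm M (\<lambda>x. f n x - g x) - 0) < e" if "n \<ge> K" for n
      proof -
        have b: "(\<integral>\<^sup>+x. ennreal ((norm (f n x - g x))\<^sup>2) \<partial>M) \<le> ennreal ((e / 2)\<^sup>2)"
          by (rule bound[where K = K]) (use e K that in auto)
        from b have "ennreal ((L2_norm M (\<lambda>x. f n x - g x))\<^sup>2) \<le> ennreal ((e / 2)\<^sup>2)"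
          unfolding L2_norm_nn[OF diffL2[OF b]] .
        then have "(L2_norm M (\<lambda>x. f n x - g x))\<^sup>2 \<le> (e / 2)\<^sup>2" by (simp only: ennreal_le_iff zero_le_power2)
        then have "L2_norm M (\<lambda>x. f n x - g x) \<le> e / 2" by (rule power2_le_imp_le) (use e in simp)
        then show ?thesis using e by simp
      qed
      then show "\<exists>no. \<forall>n\<ge>no. norm (L2_norm M (\<lambda>x. f n x - g x) - 0) < e" by blast
    qed
  qed
qed

section \<open>Orthogonal projection onto the closure of a subspace\<close>

lemma L2_norm_diff_sq:
  assumes f: "f \<in> L2 M" and g: "g \<in> L2 M"
  shows "(L2_norm M (\<lambda>x. f x - c * g x))\<^sup>2 =
    (L2_norm M f)\<^sup>2 - 2 * Re (cnj c * (LINT x|M. f x * cnj (g x))) + (norm c)\<^sup>2 * (L2_norm M g)\<^sup>2"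
proof -
  have i: "integrable M (\<lambda>x. f x * cnj (g x))" by (intro L2_mult_integrable L2_cnj f g)
  have "(norm (z - c * w))\<^sup>2 = (norm z)\<^sup>2 - 2 * Re (cnj c * (z * cnj w)) + (norm c)\<^sup>2 * (norm w)\<^sup>2" for z w
    unfolding cmod_power2 by (simp add: power2_eq_square algebra_simps)
  moreover have "integrable M (\<lambda>x. Re (cnj c * (f x * cnj (g x))))" using i by (intro integrable_Re integrable_mult_right)
  ultimately show ?thesis
    using L2D(2)[OF f] L2D(2)[OF g] i unfolding L2_norm_sq
    by (simp del: times_complex.simps)
qed

text \<open>The subspace \<open>V\<close> need not be closed, so p is only a limit of its elements.
  A minimising sequence is Cauchy by the parallelogram law, applied to midpoints, which again lie in
  \<open>V\<close>. Minimality of the limit under the perturbations t a w yields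
  orthogonality.\<close>

lemma L2_projection:
  assumes V: "V \<subseteq> L2 M" "V \<noteq> {}" "\<And>f g. f \<in> V \<Longrightarrow> g \<in> V \<Longrightarrow> (\<lambda>x. f x + g x) \<in> V" "\<And>c f. f \<in> V \<Longrightarrow> (\<lambda>x. c * f x) \<in> V"
    and u: "u \<in> L2 M"
  obtains p v where "p \<in> L2 M" "\<And>n::nat. v n \<in> V" "(\<lambda>n. L2_norm M (\<lambda>x. v n x - p x)) \<longlonglongrightarrow> 0"
    "\<And>w. w \<in> V \<Longrightarrow> (LINT x|M. (u x - p x) * cnj (w x)) = 0"
proof -
  define d where "d = Inf ((\<lambda>v. L2_norm M (\<lambda>x. u x - v x)) ` V)"
  have bdd: "bdd_below ((\<lambda>v. L2_norm M (\<lambda>x. u x - v x)) ` V)" by (rule bdd_belowI[of _ 0]) auto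
  have dle: "d \<le> L2_norm M (\<lambda>x. u x - w x)" if "w \<in> V" for w unfolding d_def by (rule cInf_lower[OF _ bdd]) (use that in auto)
  have d0: "0 \<le> d" unfolding d_def by (rule cInf_greatest) (use V in auto)
  have "\<exists>w\<in>V. L2_norm M (\<lambda>x. u x - w x) < d + 1 / Suc n" for n
    using cInf_less_iff[OF _ bdd, of "d + 1 / Suc n"] V(2) by (auto simp: d_def[symmetric])
  then obtain v where v: "\<And>n. v n \<in> V" "\<And>n. L2_norm M (\<lambda>x. u x - v n x) < d + 1 / Suc n" by metis
  have vL2: "v n \<in> L2 M" for n using v(1) V(1) by auto
  have para: "(L2_norm M (\<lambda>x. v m x - v n x))\<^sup>2 \<le> 2 * (d + 1 / Suc m)\<^sup>2 + 2 * (d + 1 / Suc n)\<^sup>2 - 4 * d\<^sup>2" for m n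
  proof -
    let ?w = "\<lambda>x. (1/2) * (v m x + v n x)"
    have w: "?w \<in> V" by (intro V v)
    have eq: "(norm (a - b))\<^sup>2 = 2 * (norm (z - a))\<^sup>2 + 2 * (norm (z - b))\<^sup>2 - 4 * (norm (z - (1/2) * (a + b)))\<^sup>2" for a b z :: complex
      unfolding cmod_power2 by (simp add: power2_eq_square field_simps)
    have "(L2_norm M (\<lambda>x. v m x - v n x))\<^sup>2 = 2 * (L2_norm M (\<lambda>x. u x - v m x))\<^sup>2 + 2 * (L2_norm M (\<lambda>x. u x - v n x))\<^sup>2 - 4 * (L2_norm M (\<lambda>x. u x - ?w x))\<^sup>2"
    proof -
      have "(L2_norm M (\<lambda>x. v m x - v n x))\<^sup>2 = (LINT x|M. 2 * (norm (u x - v m x))\<^sup>2 + 2 * (norm (u x - v n x))\<^sup>2 - 4 * (norm (u x - ?w x))\<^sup>2)"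
        unfolding L2_norm_sq by (rule Bochner_Integration.integral_cong[OF refl]) (rule eq)
      then show ?thesis
        using L2D(2)[OF L2_diff[OF u vL2]] L2D(2)[OF L2_diff[OF u L2_cmult[OF L2_add[OF vL2 vL2]]], of "1/2" m n]
        by (simp add: L2_norm_sq)
    qed
    moreover have "d\<^sup>2 \<le> (L2_norm M (\<lambda>x. u x - ?w x))\<^sup>2" using dle[OF w] d0 by (intro power_mono) auto
    moreover have s: "(L2_norm M (\<lambda>x. u x - v i x))\<^sup>2 \<le> (d + 1 / Suc i)\<^sup>2" for i using v(2)[of i] by (intro power_mono) auto
    ultimately show ?thesis using s[of m] s[of n] by linarith
  qed
  have lim: "(\<lambda>n. 2 * ((d + 1 / Suc n)\<^sup>2 - d\<^sup>2)) \<longlonglongrightarrow> 2 * ((d + 0)\<^sup>2 - d\<^sup>2)"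
    by (intro tendsto_intros LIMSEQ_Suc[OF lim_1_over_n])
  have "\<exists>N. \<forall>m\<ge>N. \<forall>n\<ge>N. L2_norm M (\<lambda>x. v m x - v n x) < e" if e: "0 < e" for e
  proof -
    have "\<forall>\<^sub>F n in sequentially. 2 * ((d + 1 / Suc n)\<^sup>2 - d\<^sup>2) < e\<^sup>2 / 2"
      using order_tendstoD(2)[OF lim, of "e\<^sup>2 / 2"] e by simp
    then obtain N where N: "\<And>n. n \<ge> N \<Longrightarrow> 2 * ((d + 1 / Suc n)\<^sup>2 - d\<^sup>2) < e\<^sup>2 / 2" by (auto simp: eventually_sequentially)
    have "L2_norm M (\<lambda>x. v m x - v n x) < e" if "m \<ge> N" "n \<ge> N" for m n
    proof -
      have "(L2_norm M (\<lambda>x. v m x - v n x))\<^sup>2 < e\<^sup>2" using para[of m n] N[OF that(1)] N[OF that(2)] by (simp add: right_diff_distrib)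
      then show ?thesis using e power2_less_imp_less by (metis less_imp_le)
    qed
    then show ?thesis by blast
  qed
  from L2_complete[OF vL2 this] obtain p where p: "p \<in> L2 M" "(\<lambda>n. L2_norm M (\<lambda>x. v n x - p x)) \<longlonglongrightarrow> 0" by blast
  have lb: "d \<le> L2_norm M (\<lambda>x. (u x - p x) - w x)" if w: "w \<in> V" for w
  proof (rule LIMSEQ_le_const)
    have wL2: "w \<in> L2 M" using w V(1) by auto
    show "(\<lambda>n. L2_norm M (\<lambda>x. v n x - p x) + L2_norm M (\<lambda>x. (u x - p x) - w x)) \<longlonglongrightarrow> L2_norm M (\<lambda>x. (u x - p x) - w x)"
      using tendsto_add[OF p(2) tendsto_const] by simp
    have "d \<le> L2_norm M (\<lambda>x. v n x - p x) + L2_norm M (\<lambda>x. (u x - p x) - w x)" for n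
    proof -
      have "d \<le> L2_norm M (\<lambda>x. u x - (v n x + w x))" by (intro dle V v w)
      also have "\<dots> = L2_norm M (\<lambda>x. (p x - v n x) + ((u x - p x) - w x))" by (simp add: algebra_simps)
      also have "\<dots> \<le> L2_norm M (\<lambda>x. p x - v n x) + L2_norm M (\<lambda>x. (u x - p x) - w x)"
        by (intro L2_triangle L2_diff p u wL2 vL2)
      finally show ?thesis by (simp add: L2_norm_minus[of M "v n"])
    qed
    then show "\<exists>N. \<forall>n\<ge>N. d \<le> L2_norm M (\<lambda>x. v n x - p x) + L2_norm M (\<lambda>x. (u x - p x) - w x)" by blast
  qed
  have ub: "L2_norm M (\<lambda>x. u x - p x) \<le> d"
  proof (rule LIMSEQ_le_const)
    show "(\<lambda>n. (d + 1 / Suc n) + L2_norm M (\<lambda>x. v n x - p x)) \<longlonglongrightarrow> d"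
      using tendsto_add[OF tendsto_add[OF tendsto_const LIMSEQ_Suc[OF lim_1_over_n]] p(2), of d] by simp
    have "L2_norm M (\<lambda>x. u x - p x) \<le> (d + 1 / Suc n) + L2_norm M (\<lambda>x. v n x - p x)" for n
      using L2_triangle3[OF u vL2 p(1), of n] v(2)[of n] by simp
    then show "\<exists>N. \<forall>n\<ge>N. L2_norm M (\<lambda>x. u x - p x) \<le> (d + 1 / Suc n) + L2_norm M (\<lambda>x. v n x - p x)" by blast
  qed
  show thesis
  proof (rule that[OF p(1) v(1) p(2)])
    fix w assume w: "w \<in> V"
    then have wL2: "w \<in> L2 M" using V(1) by auto
    define a where "a = (LINT x|M. (u x - p x) * cnj (w x))"
    define q where "q = (L2_norm M w)\<^sup>2"
    have q0: "0 \<le> q" by (simp add: q_def)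
    have ineq: "0 \<le> - 2 * (t * (norm a)\<^sup>2) + t\<^sup>2 * (norm a)\<^sup>2 * q" for t :: real
    proof -
      have "d\<^sup>2 \<le> (L2_norm M (\<lambda>x. (u x - p x) - (of_real t * a) * w x))\<^sup>2" using lb[OF V(4)[OF w]] d0 by (intro power_mono) auto
      also have "\<dots> = (L2_norm M (\<lambda>x. u x - p x))\<^sup>2 - 2 * Re (cnj (of_real t * a) * a) + (norm (of_real t * a))\<^sup>2 * q"
        unfolding a_def q_def by (rule L2_norm_diff_sq[OF L2_diff[OF u p(1)] wL2])
      also have "Re (cnj (of_real t * a) * a) = t * (norm a)\<^sup>2" unfolding cmod_power2 by (simp add: power2_eq_square algebra_simps)
      also have "(norm (of_real t * a))\<^sup>2 = t\<^sup>2 * (norm a)\<^sup>2" by (simp add: norm_mult power_mult_distrib)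
      finally have "d\<^sup>2 \<le> (L2_norm M (\<lambda>x. u x - p x))\<^sup>2 - 2 * (t * (norm a)\<^sup>2) + t\<^sup>2 * (norm a)\<^sup>2 * q" .
      moreover have "(L2_norm M (\<lambda>x. u x - p x))\<^sup>2 \<le> d\<^sup>2" using ub by (intro power_mono) auto
      ultimately show ?thesis by linarith
    qed
    \<comment> \<open>With this t the inequality reads 0 <= t |a|^2 (t q - 2), where t q < 1, and
      forces a = 0. The 1 in the denominator also covers q = 0.\<close>
    define t where "t = 1 / (1 + q)"
    have t: "t > 0" "t * q < 1" using q0 by (auto simp: t_def pos_divide_less_eq)
    have "- 2 * (t * (norm a)\<^sup>2) + t\<^sup>2 * (norm a)\<^sup>2 * q = t * (norm a)\<^sup>2 * (t * q - 2)" by (simp add: power2_eq_square algebra_simps)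
    then have "0 \<le> t * (norm a)\<^sup>2 * (t * q - 2)" using ineq[of t] by simp
    moreover have "t * (norm a)\<^sup>2 * (t * q - 2) < 0" if "norm a \<noteq> 0"
      using t that by (intro mult_pos_neg mult_pos_pos) auto
    ultimately have "norm a = 0" by linarith
    then show "(LINT x|M. (u x - p x) * cnj (w x)) = 0" by (simp add: a_def)
  qed
qed

section \<open>The fundamental lemma of the calculus of variations\<close>

text \<open>The approximants of the indicator of \<open>K\<close> are products of two cut-offs:
  \<open>\<rho> n\<close> lives in the 1/(n+1)-neighbourhood of \<open>K\<close> and forces the
  convergence, while the fixed \<open>\<rho>0\<close> keeps the support inside \<open>U\<close> and
  provides the integrable majorant |m \<rho>0|.\<close>

lemma test_functions_compact_integral:
  fixes m :: "'a::euclidean_space \<Rightarrow> complex"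
  assumes U: "open U" and K: "compact K" "K \<subseteq> U"
    and i: "\<And>f. f \<in> test_functions U \<Longrightarrow> integrable lborel (\<lambda>x. m x * f x)"
    and z: "\<And>f. f \<in> test_functions U \<Longrightarrow> (LINT x|lborel. m x * f x) = 0"
    and m[measurable]: "m \<in> borel_measurable borel" and ne: "K \<noteq> {}"
  shows "integrable lborel (\<lambda>x. indicator K x *\<^sub>R m x)" "(LINT x|lborel. indicator K x *\<^sub>R m x) = 0"
proof -
  obtain \<rho>0 V0 where \<rho>0: "(\<lambda>x. complex_of_real (\<rho>0 x)) \<in> test_functions U" "\<And>x. 0 \<le> \<rho>0 x" "\<And>x. \<rho>0 x \<le> 1"
    "open V0" "K \<subseteq> V0" "\<And>x. x \<in> V0 \<Longrightarrow> \<rho>0 x = 1" using smooth_cutoff[OF K(1) U K(2)] by metis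
  let ?W = "\<lambda>n. {x. infdist x K < 1 / real (Suc n)}"
  have "\<exists>\<rho> V. (\<lambda>x. complex_of_real (\<rho> x)) \<in> test_functions (?W n) \<and> (\<forall>x. 0 \<le> \<rho> x \<and> \<rho> x \<le> 1) \<and> K \<subseteq> V \<and> (\<forall>x\<in>V. \<rho> x = 1)" for n
  proof -
    have o: "open (?W n)" by (intro open_Collect_less continuous_intros)
    have "K \<subseteq> ?W n" by auto
    from smooth_cutoff[OF K(1) o this] obtain \<rho> :: "'a \<Rightarrow> real" and V where "(\<lambda>x. complex_of_real (\<rho> x)) \<in> test_functions (?W n)"
      "\<And>x. 0 \<le> \<rho> x" "\<And>x. \<rho> x \<le> 1" "open V" "K \<subseteq> V" "\<And>x. x \<in> V \<Longrightarrow> \<rho> x = 1" by metis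
    then show ?thesis by (intro exI[of _ \<rho>] exI[of _ V]) simp
  qed
  then obtain \<rho> V where \<rho>: "\<And>n. (\<lambda>x. complex_of_real (\<rho> n x)) \<in> test_functions (?W n)" "\<And>n x. 0 \<le> \<rho> n x \<and> \<rho> n x \<le> 1"
    "\<And>n. K \<subseteq> V n" "\<And>n x. x \<in> V n \<Longrightarrow> \<rho> n x = 1" by metis
  let ?f = "\<lambda>n x. complex_of_real (\<rho> n x) * complex_of_real (\<rho>0 x)"
  have ft: "?f n \<in> test_functions U" for n by (rule test_functions_mult_left[OF \<rho>0(1) test_functions_smooth[OF \<rho>(1)]])
  have lim: "(\<lambda>n. m x * ?f n x) \<longlonglongrightarrow> indicator K x *\<^sub>R m x" for x
  proof (cases "x \<in> K")
    case True
    then have "\<rho> n x = 1" "\<rho>0 x = 1" for n using \<rho> \<rho>0 by blast+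
    then show ?thesis using True by simp
  next
    case False
    have "\<forall>\<^sub>F n in sequentially. \<rho> n x = 0"
    proof -
      have "0 < infdist x K" using False K(1) in_closed_iff_infdist_zero[OF compact_imp_closed[OF K(1)] ne, of x] infdist_nonneg[of x K] by linarith
      then have "\<forall>\<^sub>F n in sequentially. 1 / real (Suc n) < infdist x K"
        using order_tendstoD(2)[OF LIMSEQ_Suc[OF lim_1_over_n]] by blast
      then show ?thesis
      proof eventually_elim
        fix n assume "1 / real (Suc n) < infdist x K"
        then have "x \<notin> fun_supp (\<lambda>x. complex_of_real (\<rho> n x))" using test_functions_supp(2)[OF \<rho>(1)[of n]] by auto
        from fun_supp_zero[OF this] show "\<rho> n x = 0" by simp
      qed
    qed
    then have "\<forall>\<^sub>F n in sequentially. 0 = m x * ?f n x" by eventually_elim simp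
    then show ?thesis using False by (intro Lim_transform_eventually[OF tendsto_const]) auto
  qed
  have bd: "norm (m x * ?f n x) \<le> norm (m x * complex_of_real (\<rho>0 x))" for n x
    using \<rho>(2)[of n x] \<rho>0(2)[of x] by (auto simp: norm_mult abs_mult intro!: mult_left_mono mult_left_le_one_le)
  have fm: "(\<lambda>x. m x * ?f n x) \<in> borel_measurable lborel" for n using borel_measurable_integrable[OF i[OF ft]] .
  have Km[measurable]: "K \<in> sets borel" using K(1) by (simp add: borel_compact)
  have "(\<lambda>n. LINT x|lborel. m x * ?f n x) \<longlonglongrightarrow> (LINT x|lborel. indicator K x *\<^sub>R m x)"
    by (rule integral_dominated_convergence[where w = "\<lambda>x. norm (m x * complex_of_real (\<rho>0 x))"])
      (use fm lim bd integrable_norm[OF i[OF \<rho>0(1)]] in auto)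
  then show "(LINT x|lborel. indicator K x *\<^sub>R m x) = 0" using z[OF ft] by (simp add: LIMSEQ_const_iff)
  show "integrable lborel (\<lambda>x. indicator K x *\<^sub>R m x)"
    by (rule integrable_dominated_convergence[where w = "\<lambda>x. norm (m x * complex_of_real (\<rho>0 x))" and s = "\<lambda>n x. m x * ?f n x"])
      (use fm lim bd integrable_norm[OF i[OF \<rho>0(1)]] in auto)
qed

text \<open>If Re (c m) is positive on a compact subset of \<open>U\<close>, the vanishing of its
  integral over that subset makes the subset null. Inner regularity carries this over to the whole
  set where Re (c m) is positive.\<close>

lemma fundamental_lemma_variations:
  fixes m :: "'a::euclidean_space \<Rightarrow> complex"
  assumes U: "open U"
    and i: "\<And>f. f \<in> test_functions U \<Longrightarrow> integrable lborel (\<lambda>x. m x * f x)"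
    and z: "\<And>f. f \<in> test_functions U \<Longrightarrow> (LINT x|lborel. m x * f x) = 0"
    and m[measurable]: "m \<in> borel_measurable borel"
  shows "AE x in lborel. x \<in> U \<longrightarrow> m x = 0"
proof -
  have Um[measurable]: "U \<in> sets borel" using U by simp
  have A0: "AE x in lborel. x \<in> U \<longrightarrow> Re (c * m x) \<le> 0" for c
  proof -
    let ?A = "{x \<in> U. Re (c * m x) > 0}"
    have Am[measurable]: "?A \<in> sets borel" by measurable
    have K0: "emeasure lborel K = 0" if K: "compact K" "K \<subseteq> ?A" for K
    proof (cases "K = {}")
      case False
      have Km[measurable]: "K \<in> sets borel" using K(1) by (simp add: borel_compact)
      note I = test_functions_compact_integral[OF U K(1) _ i z m False]
      have KU: "K \<subseteq> U" using K(2) by auto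
      have ii: "integrable lborel (\<lambda>x. Re (c * (indicator K x *\<^sub>R m x)))"
        by (intro integrable_Re integrable_mult_right I(1) KU)
      have "(LINT x|lborel. Re (c * (indicator K x *\<^sub>R m x))) = Re (LINT x|lborel. c * (indicator K x *\<^sub>R m x))"
        by (rule integral_Re[OF integrable_mult_right[OF I(1)[OF KU]]])
      also have "\<dots> = Re (c * (LINT x|lborel. indicator K x *\<^sub>R m x))" by (simp only: integral_mult_right_zero)
      finally have "(LINT x|lborel. Re (c * (indicator K x *\<^sub>R m x))) = Re (c * (LINT x|lborel. indicator K x *\<^sub>R m x))" .
      then have "(LINT x|lborel. Re (c * (indicator K x *\<^sub>R m x))) = 0" by (simp only: I(2)[OF KU]) simp
      moreover have "AE x in lborel. 0 \<le> Re (c * (indicator K x *\<^sub>R m x))"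
        using K(2) by (intro AE_I2) (auto simp: indicator_def intro: less_imp_le simp del: times_complex.simps)
      ultimately have "AE x in lborel. Re (c * (indicator K x *\<^sub>R m x)) = 0"
        using integral_nonneg_eq_0_iff_AE[OF ii] by simp
      then have "AE x in lborel. x \<notin> K"
        by eventually_elim (use K(2) in \<open>auto simp: indicator_def\<close>)
      then show ?thesis by (simp add: AE_iff_null_sets[OF Km[folded sets_lborel]] null_setsD1)
    qed simp
    have "emeasure lborel (?A \<inter> cball 0 (real n)) = 0" for n
    proof -
      \<comment> \<open>Cutting down to balls provides the finite measure for which inner regularity
        is available.\<close>
      let ?M = "density lborel (indicator (cball (0::'a) (real n)))"
      have e: "emeasure ?M B = emeasure lborel (B \<inter> cball 0 (real n))" if "B \<in> sets borel" for B :: "'a set"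
        using that by (simp add: emeasure_restricted Int_commute)
      have fin: "emeasure ?M (space ?M) \<noteq> \<infinity>" using emeasure_lborel_cball_finite[of "0::'a" "real n"] by (simp add: e)
      have "emeasure ?M ?A = (SUP K \<in> {K. K \<subseteq> ?A \<and> compact K}. emeasure ?M K)"
        by (rule inner_regular[OF _ fin]) simp_all
      also have "\<dots> = (SUP K \<in> {K. K \<subseteq> ?A \<and> compact K}. 0)"
      proof (rule SUP_cong[OF refl])
        fix K assume K: "K \<in> {K. K \<subseteq> ?A \<and> compact K}"
        then have "emeasure lborel (K \<inter> cball 0 (real n)) \<le> emeasure lborel K"
          by (intro emeasure_mono) (auto simp: borel_compact)
        then show "emeasure ?M K = 0" using K K0[of K] by (simp add: e borel_compact)
      qed
      also have "\<dots> = 0" by (simp add: SUP_eq_const[of _ _ 0] bot_ennreal[symmetric])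
      finally show ?thesis by (simp add: e)
    qed
    then have "?A \<inter> cball 0 (real n) \<in> null_sets lborel" for n by (intro null_setsI) auto
    then have "(\<Union>n. ?A \<inter> cball 0 (real n)) \<in> null_sets lborel" by (intro null_sets_UN) auto
    also have "(\<Union>n. ?A \<inter> cball 0 (real n)) = ?A" by (auto intro: real_arch_simple)
    finally have "AE x in lborel. x \<notin> ?A" by (rule AE_not_in)
    then show ?thesis by eventually_elim auto
  qed
  \<comment> \<open>The four rotations bound the real and the imaginary part of m from above and
    below.\<close>
  from A0[of 1] A0[of "-1"] A0[of \<i>] A0[of "-\<i>"] show ?thesis
    by eventually_elim (auto simp: complex_eq_iff)
qed

section \<open>Sobolev spaces on the Fourier side\<close>

text \<open>Norm and inner product of order s are those of square-integrable functions for this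
  measure, so completeness and projection are inherited from the lemmas on
  \<open>L2\<close>.\<close>

definition wgt :: "real \<Rightarrow> 'a::euclidean_space measure" where
  "wgt s = density lborel (\<lambda>\<xi>. ennreal ((1 + (norm \<xi>)\<^sup>2) powr s))"

lemma one_plus_norm_sq [simp]: "0 < 1 + (norm x)\<^sup>2" "1 + (norm x)\<^sup>2 \<noteq> 0"
  using zero_le_power2[of "norm x"] by linarith+

lemma weight_pos [simp]: "0 < (1 + (norm (\<xi>::'a::euclidean_space))\<^sup>2) powr s"
  by simp

lemma sets_wgt [simp, measurable_cong]: "sets (wgt s) = sets borel"
  by (simp add: wgt_def)

lemma space_wgt [simp]: "space (wgt s) = UNIV"
  by (simp add: wgt_def)

lemma measurable_wgt [simp]: "f \<in> borel_measurable (wgt s) \<longleftrightarrow> f \<in> borel_measurable borel"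
  by (intro arg_cong[where f = "\<lambda>A. f \<in> A"] measurable_cong_sets) auto

lemma AE_wgt [simp]: "(AE \<xi> in wgt s. P \<xi>) \<longleftrightarrow> (AE \<xi> in lborel. P \<xi>)"
  unfolding wgt_def by (subst AE_density) simp_all

lemma integrable_wgt:
  fixes f :: "'a::euclidean_space \<Rightarrow> 'b::{banach, second_countable_topology}"
  shows "f \<in> borel_measurable borel \<Longrightarrow> integrable (wgt s) f \<longleftrightarrow> integrable lborel (\<lambda>\<xi>. (1 + (norm \<xi>)\<^sup>2) powr s *\<^sub>R f \<xi>)"
  unfolding wgt_def by (subst integrable_density) auto

lemma integral_wgt:
  fixes f :: "'a::euclidean_space \<Rightarrow> 'b::{banach, second_countable_topology}"
  shows "f \<in> borel_measurable borel \<Longrightarrow> integral\<^sup>L (wgt s) f = (LINT \<xi>|lborel. (1 + (norm \<xi>)\<^sup>2) powr s *\<^sub>R f \<xi>)"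
  unfolding wgt_def by (subst integral_density) auto

lemma L2_wgt_iff: "h \<in> L2 (wgt s) \<longleftrightarrow>
    h \<in> borel_measurable borel \<and> integrable lborel (\<lambda>\<xi>. (1 + (norm \<xi>)\<^sup>2) powr s * (norm (h \<xi>))\<^sup>2)"
  by (auto simp: L2_def integrable_wgt)

lemma L2_wgt_mono:
  assumes "h \<in> L2 (wgt s)" "t \<le> s" shows "h \<in> L2 (wgt t)"
  unfolding L2_wgt_iff
proof
  show "integrable lborel (\<lambda>\<xi>. (1 + (norm \<xi>)\<^sup>2) powr t * (norm (h \<xi>))\<^sup>2)"
    by (rule Bochner_Integration.integrable_bound[where f = "\<lambda>\<xi>. (1 + (norm \<xi>)\<^sup>2) powr s * (norm (h \<xi>))\<^sup>2"])
      (use assms in \<open>auto simp: L2_wgt_iff intro!: AE_I2 mult_right_mono powr_mono\<close>)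
qed (use assms in \<open>auto simp: L2_wgt_iff\<close>)

lemma wgt_0: "wgt 0 = lborel"
  by (simp add: wgt_def density_1)

lemma has_fourier_measurable: "has_fourier u h \<Longrightarrow> h \<in> borel_measurable borel"
  by (simp add: has_fourier_def)

lemma has_fourier_unique:
  assumes "has_fourier u h" "has_fourier u h'"
  shows "AE \<xi> in lborel. h \<xi> = h' \<xi>"
proof -
  have "AE \<xi> in lborel. \<xi> \<in> UNIV \<longrightarrow> h \<xi> - h' \<xi> = 0"
  proof (rule fundamental_lemma_variations)
    fix f :: "'a \<Rightarrow> complex" assume "f \<in> test_functions UNIV"
    then have f: "f \<in> schwartz" by (rule test_functions_schwartz)
    then have i: "integrable lborel (\<lambda>\<xi>. h \<xi> * f \<xi>)" "integrable lborel (\<lambda>\<xi>. h' \<xi> * f \<xi>)"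
      "(LINT \<xi>|lborel. h \<xi> * f \<xi>) = (LINT \<xi>|lborel. h' \<xi> * f \<xi>)"
      using assms by (auto simp: has_fourier_def)
    then show "integrable lborel (\<lambda>\<xi>. (h \<xi> - h' \<xi>) * f \<xi>)" "(LINT \<xi>|lborel. (h \<xi> - h' \<xi>) * f \<xi>) = 0"
      by (simp_all add: left_diff_distrib)
  qed (use assms in \<open>auto simp: has_fourier_def\<close>)
  then show ?thesis by simp
qed

text \<open>Every Schwartz function is a transform, so the density fixes all values on Schwartz
  functions. Elsewhere tempered distributions vanish by convention, which makes the equality one of
  HOL functions.\<close>

lemma has_fourier_eq:
  assumes "has_fourier u h" "has_fourier v h'" "AE \<xi> in lborel. h \<xi> = h' \<xi>"
  shows "u = v"
proof
  fix f :: "'a \<Rightarrow> complex"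
  show "u f = v f"
  proof (cases "f \<in> schwartz")
    case True
    then obtain g where g: "g \<in> schwartz" "f = fourier g" using fourier_surj by metis
    have "(LINT \<xi>|lborel. h \<xi> * g \<xi>) = (LINT \<xi>|lborel. h' \<xi> * g \<xi>)"
      by (rule integral_cong_AE)
        (use assms g schwartz_measurable[OF g(1)] in \<open>auto simp: has_fourier_def elim!: eventually_mono\<close>)
    then show ?thesis using assms g by (simp add: has_fourier_def)
  qed (use assms in \<open>simp add: has_fourier_def tempered_def\<close>)
qed

lemma fourier_distr_has_fourier: "has_fourier u h \<Longrightarrow> has_fourier u (fourier_distr u)"
  unfolding fourier_distr_def by (rule someI[of "has_fourier u"])

lemma fourier_distr_AE: "has_fourier u h \<Longrightarrow> AE \<xi> in lborel. fourier_distr u \<xi> = h \<xi>"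
  by (rule has_fourier_unique[OF fourier_distr_has_fourier])

lemma sobolev_has_fourier: "u \<in> sobolev s \<Longrightarrow> has_fourier u (fourier_distr u)"
  unfolding sobolev_def using fourier_distr_has_fourier by blast

lemma L2_cong_AE:
  assumes "f \<in> L2 M" "g \<in> borel_measurable M" "AE x in M. f x = g x" shows "g \<in> L2 M"
proof -
  have "integrable M (\<lambda>x. (norm (f x))\<^sup>2) \<longleftrightarrow> integrable M (\<lambda>x. (norm (g x))\<^sup>2)"
    by (rule integrable_cong_AE) (use assms in \<open>auto simp: L2_def elim!: eventually_mono\<close>)
  then show ?thesis using assms by (auto simp: L2_def)
qed

text \<open>Densities of the same distribution agree almost everywhere, so any one of them decides
  membership.\<close>

lemma sobolev_iff: "has_fourier u h \<Longrightarrow> u \<in> sobolev s \<longleftrightarrow> h \<in> L2 (wgt s)"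
proof
  assume h: "has_fourier u h" and "u \<in> sobolev s"
  then obtain h' where h': "has_fourier u h'" "h' \<in> L2 (wgt s)" by (auto simp: sobolev_def L2_wgt_iff has_fourier_def)
  then show "h \<in> L2 (wgt s)" using has_fourier_unique[OF h'(1) h] has_fourier_measurable[OF h]
    by (intro L2_cong_AE[OF h'(2)]) auto
next
  assume "has_fourier u h" "h \<in> L2 (wgt s)"
  then show "u \<in> sobolev s" by (auto simp: sobolev_def L2_wgt_iff has_fourier_def)
qed

lemma sobolev_L2: "u \<in> sobolev s \<Longrightarrow> fourier_distr u \<in> L2 (wgt s)"
  using sobolev_iff sobolev_has_fourier by blast

lemma sobolev_norm_eq:
  assumes "has_fourier u h" shows "sobolev_norm s u = L2_norm (wgt s) h"
proof -
  have "sobolev_norm s u = L2_norm (wgt s) (fourier_distr u)"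
    using has_fourier_measurable[OF fourier_distr_has_fourier[OF assms]]
    by (simp add: sobolev_norm_def L2_norm_def integral_wgt)
  also have "\<dots> = L2_norm (wgt s) h"
    using fourier_distr_AE[OF assms] has_fourier_measurable[OF fourier_distr_has_fourier[OF assms]] has_fourier_measurable[OF assms]
    by (intro L2_norm_cong_AE) auto
  finally show ?thesis .
qed

lemma sobolev_inner_eq:
  assumes "has_fourier u h" "has_fourier v k"
  shows "sobolev_inner s u v = (LINT \<xi>|wgt s. h \<xi> * cnj (k \<xi>))"
proof -
  note m[measurable] = has_fourier_measurable[OF assms(1)] has_fourier_measurable[OF assms(2)]
    has_fourier_measurable[OF fourier_distr_has_fourier[OF assms(1)]] has_fourier_measurable[OF fourier_distr_has_fourier[OF assms(2)]]
  have [measurable]: "cnj \<in> borel_measurable borel" by (intro borel_measurable_continuous_onI continuous_intros)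
  have "sobolev_inner s u v = (LINT \<xi>|lborel. (1 + (norm \<xi>)\<^sup>2) powr s *\<^sub>R (h \<xi> * cnj (k \<xi>)))"
    unfolding sobolev_inner_def
  proof (rule integral_cong_AE)
    show "AE \<xi> in lborel. of_real ((1 + (norm \<xi>)\<^sup>2) powr s) * fourier_distr u \<xi> * cnj (fourier_distr v \<xi>) = (1 + (norm \<xi>)\<^sup>2) powr s *\<^sub>R (h \<xi> * cnj (k \<xi>))"
      using fourier_distr_AE[OF assms(1)] fourier_distr_AE[OF assms(2)]
      by eventually_elim (simp add: scaleR_conv_of_real)
  qed measurable
  also have "\<dots> = (LINT \<xi>|wgt s. h \<xi> * cnj (k \<xi>))" by (rule integral_wgt[symmetric]) measurable
  finally show ?thesis .
qed

lemma sobolev_pairing_eq: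
  assumes "has_fourier u h" "has_fourier v k"
  shows "sobolev_pairing u v = (LINT \<xi>|lborel. h \<xi> * cnj (k \<xi>))"
proof -
  have "sobolev_pairing u v = sobolev_inner 0 u v" by (simp add: sobolev_pairing_def sobolev_inner_def)
  then show ?thesis using sobolev_inner_eq[OF assms, of 0] by (simp add: wgt_0)
qed

lemma schwartz_seminorm_mono:
  assumes f: "f \<in> schwartz" and NM: "N \<le> M" shows "schwartz_seminorm N f \<le> schwartz_seminorm M f"
  unfolding schwartz_seminorm_def[of N]
proof (rule cSup_least)
  show "{(1 + norm x) ^ N * norm (iter_deriv vs f x) | x vs. set vs \<subseteq> Basis \<and> length vs \<le> N} \<noteq> {}"
    by (auto intro!: exI[of _ "[]"])
  fix r assume "r \<in> {(1 + norm x) ^ N * norm (iter_deriv vs f x) | x vs. set vs \<subseteq> Basis \<and> length vs \<le> N}"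
  then obtain x vs where r: "r = (1 + norm x) ^ N * norm (iter_deriv vs f x)" "set vs \<subseteq> Basis" "length vs \<le> N" by auto
  have "r \<le> (1 + norm x) ^ M * norm (iter_deriv vs f x)"
    unfolding r(1) by (intro mult_right_mono power_increasing NM) auto
  also have "\<dots> \<le> schwartz_seminorm M f"
    unfolding schwartz_seminorm_def by (rule cSup_upper[OF _ schwartz_seminorm_bdd[OF f]])
      (use r NM in \<open>auto intro!: exI[of _ x] exI[of _ vs]\<close>)
  finally show "r \<le> schwartz_seminorm M f" .
qed

lemma tempered_diff:
  assumes u: "u \<in> tempered" and v: "v \<in> tempered" shows "distr_diff u v \<in> tempered"
proof -
  obtain C N where C: "\<And>f. f \<in> schwartz \<Longrightarrow> norm (u f) \<le> C * schwartz_seminorm N f" using u unfolding tempered_def by blast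
  obtain C' N' where C': "\<And>f. f \<in> schwartz \<Longrightarrow> norm (v f) \<le> C' * schwartz_seminorm N' f" using v unfolding tempered_def by blast
  have "norm (u f - v f) \<le> (\<bar>C\<bar> + \<bar>C'\<bar>) * schwartz_seminorm (max N N') f" if f: "f \<in> schwartz" for f
  proof -
    have "norm (u f) \<le> \<bar>C\<bar> * schwartz_seminorm (max N N') f"
      using C[OF f] mult_mono[OF abs_ge_self[of C] schwartz_seminorm_mono[OF f, of N "max N N'"]] schwartz_seminorm_nonneg[OF f, of N] by simp
    moreover have "norm (v f) \<le> \<bar>C'\<bar> * schwartz_seminorm (max N N') f"
      using C'[OF f] mult_mono[OF abs_ge_self[of C'] schwartz_seminorm_mono[OF f, of N' "max N N'"]] schwartz_seminorm_nonneg[OF f, of N'] by simp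
    ultimately show ?thesis using norm_triangle_ineq4[of "u f" "v f"] by (simp add: distrib_right)
  qed
  then show ?thesis using u v
    unfolding tempered_def distr_diff_def mem_Collect_eq by (simp add: right_diff_distrib) blast
qed

lemma has_fourier_diff:
  assumes "has_fourier u h" "has_fourier v k"
  shows "has_fourier (distr_diff u v) (\<lambda>\<xi>. h \<xi> - k \<xi>)"
  using assms tempered_diff[of u v] unfolding has_fourier_def
  by (auto simp: left_diff_distrib distr_diff_def)

lemma sobolev_diff: "u \<in> sobolev s \<Longrightarrow> v \<in> sobolev s \<Longrightarrow> distr_diff u v \<in> sobolev s"
  using sobolev_iff[OF has_fourier_diff[OF sobolev_has_fourier sobolev_has_fourier], of u s v s s]
  by (simp add: L2_diff sobolev_L2)

lemma L2_lborel_schwartz: "f \<in> schwartz \<Longrightarrow> f \<in> L2 lborel"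
  using integrable_norm[OF schwartz_mult_integrable[of f f]] schwartz_measurable[of f]
  by (simp add: L2_def norm_mult power2_eq_square)

lemma schwartz_L2_wgt:
  fixes f :: "'a::euclidean_space \<Rightarrow> complex"
  assumes f: "f \<in> schwartz" shows "f \<in> L2 (wgt s)"
  unfolding L2_wgt_iff
proof
  obtain n where n: "2 * s \<le> real n" using real_arch_simple by blast
  show "integrable lborel (\<lambda>\<xi>. (1 + (norm \<xi>)\<^sup>2) powr s * (norm (f \<xi>))\<^sup>2)"
  proof (rule Bochner_Integration.integrable_bound[OF integrable_mult_right[OF integrable_norm[OF schwartz_integrable[OF f]], of "schwartz_seminorm n f"]])
    have "(1 + (norm x)\<^sup>2) powr s * (norm (f x))\<^sup>2 \<le> schwartz_seminorm n f * norm (f x)" for x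
    proof -
      have "(1 + (norm x)\<^sup>2) powr s \<le> (1 + (norm x)\<^sup>2) powr (real n / 2)" using n by (intro powr_mono) auto
      also have "\<dots> \<le> ((1 + norm x)\<^sup>2) powr (real n / 2)" by (intro powr_mono2) (auto simp: power2_sum)
      also have "\<dots> = (1 + norm x) ^ n"
      proof -
        have p: "0 < 1 + norm x" using norm_ge_zero[of x] by linarith
        then show ?thesis unfolding powr_realpow[OF p, symmetric] powr_powr by simp
      qed
      finally have "(1 + (norm x)\<^sup>2) powr s * (norm (f x))\<^sup>2 \<le> ((1 + norm x) ^ n * norm (f x)) * norm (f x)"
        unfolding power2_eq_square mult.assoc by (intro mult_right_mono) auto
      also have "\<dots> \<le> schwartz_seminorm n f * norm (f x)" by (intro mult_right_mono schwartz_seminorm_ge f) auto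
      finally show ?thesis .
    qed
    then show "AE x in lborel. norm ((1 + (norm x)\<^sup>2) powr s * (norm (f x))\<^sup>2) \<le> norm (schwartz_seminorm n f * norm (f x))"
      using schwartz_seminorm_nonneg[OF f, of n] by (intro AE_I2) (simp add: abs_mult)
  qed (use schwartz_measurable[OF f] in measurable)
qed (rule schwartz_measurable[OF f])

lemma L2_norm_schwartz:
  "f \<in> schwartz \<Longrightarrow> L2_norm lborel (fourier f) = L2_norm lborel f"
proof -
  assume f: "f \<in> schwartz"
  have "complex_of_real (LINT \<xi>|lborel. (norm (fourier f \<xi>))\<^sup>2) = complex_of_real (LINT x|lborel. (norm (f x))\<^sup>2)"
    using plancherel[OF f f] unfolding complex_norm_square integral_complex_of_real[symmetric] by simp
  then show ?thesis by (simp only: of_real_eq_iff L2_norm_def)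
qed

lemma L2_norm_le_seminorm:
  fixes f :: "'a::euclidean_space \<Rightarrow> complex"
  assumes f: "f \<in> schwartz"
  shows "L2_norm lborel f \<le> sqrt (LINT x|lborel. wt (x::'a)) * schwartz_seminorm (2 * DIM('a)) f"
proof -
  let ?S = "schwartz_seminorm (2 * DIM('a)) f"
  have "(LINT x|lborel. (norm (f x))\<^sup>2) \<le> (LINT x|lborel. ?S\<^sup>2 * wt (x::'a))"
  proof (rule integral_mono)
    show "(norm (f x))\<^sup>2 \<le> ?S\<^sup>2 * wt x" for x
    proof -
      have "(norm (f x))\<^sup>2 \<le> (?S * wt x)\<^sup>2" by (intro power_mono schwartz_le_wt f) auto
      also have "\<dots> \<le> ?S\<^sup>2 * wt x" unfolding power_mult_distrib
        using wt_pos[of x] wt_le_1[of x] by (intro mult_left_mono) (auto simp: power2_eq_square mult_left_le_one_le)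
      finally show ?thesis .
    qed
  qed (use L2D(2)[OF L2_lborel_schwartz[OF f]] integrable_wt in auto)
  then have "sqrt (LINT x|lborel. (norm (f x))\<^sup>2) \<le> sqrt (?S\<^sup>2 * (LINT x|lborel. wt (x::'a)))" by (intro real_sqrt_le_mono) simp
  then show ?thesis using schwartz_seminorm_nonneg[OF f] by (simp add: L2_norm_def real_sqrt_mult mult.commute)
qed

text \<open>The distribution pairs \<open>h\<close> with the inverse Fourier transform of the test function;
  Plancherel's identity makes it continuous.\<close>

lemma sobolev_exists:
  fixes h :: "'a::euclidean_space \<Rightarrow> complex"
  assumes h: "h \<in> L2 (wgt s)" and s: "0 \<le> s"
  obtains u where "u \<in> sobolev s" "has_fourier u h"
proof -
  define u where "u f = (if f \<in> schwartz then LINT \<xi>|lborel. h \<xi> * fourier f (- \<xi>) else 0)" for f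
  have h0: "h \<in> L2 lborel" using L2_wgt_mono[OF h s] by (simp add: wgt_0)
  have FL: "(\<lambda>\<xi>. fourier f (- \<xi>)) \<in> L2 lborel" if "f \<in> schwartz" for f :: "'a \<Rightarrow> complex"
    by (intro L2_lborel_schwartz schwartz_reflect fourier_schwartz that)
  have i: "integrable lborel (\<lambda>\<xi>. h \<xi> * fourier f (- \<xi>))" if "f \<in> schwartz" for f
    by (rule L2_mult_integrable[OF h0 FL[OF that]])
  have T: "u \<in> tempered"
    unfolding tempered_def mem_Collect_eq
  proof (intro conjI ballI allI impI)
    show "u f = 0" if "f \<notin> schwartz" for f using that by (simp add: u_def)
    show "u (\<lambda>x. f x + g x) = u f + u g" if "f \<in> schwartz" "g \<in> schwartz" for f g
      using that i by (simp add: u_def schwartz_add fourier_add schwartz_integrable distrib_left)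
    show "u (\<lambda>x. c * f x) = c * u f" if "f \<in> schwartz" for c f
      using that by (simp add: u_def schwartz_cmult fourier_cmult mult.left_commute[of _ c])
    have "norm (u f) \<le> (L2_norm lborel h * sqrt (LINT x|lborel. wt (x::'a))) * schwartz_seminorm (2 * DIM('a)) f" if f: "f \<in> schwartz" for f
    proof -
      have "norm (u f) \<le> L2_norm lborel h * L2_norm lborel (\<lambda>\<xi>. fourier f (- \<xi>))"
        using L2_cauchy_schwarz[OF h0 FL[OF f]] f by (simp add: u_def)
      also have "L2_norm lborel (\<lambda>\<xi>. fourier f (- \<xi>)) = L2_norm lborel (fourier f)"
        unfolding L2_norm_def using lborel_integral_uminus[of "\<lambda>\<xi>. (norm (fourier f \<xi>))\<^sup>2"] schwartz_measurable[OF fourier_schwartz[OF f]] by simp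
      also have "\<dots> = L2_norm lborel f" by (rule L2_norm_schwartz[OF f])
      also have "\<dots> \<le> sqrt (LINT x|lborel. wt (x::'a)) * schwartz_seminorm (2 * DIM('a)) f" by (rule L2_norm_le_seminorm[OF f])
      finally show ?thesis by (simp add: mult_left_mono mult.assoc)
    qed
    then show "\<exists>C N. \<forall>f\<in>schwartz. norm (u f) \<le> C * schwartz_seminorm N f" by blast
  qed
  have "has_fourier u h"
    unfolding has_fourier_def
  proof (intro conjI ballI T)
    fix f :: "'a \<Rightarrow> complex" assume f: "f \<in> schwartz"
    show "integrable lborel (\<lambda>\<xi>. h \<xi> * f \<xi>)" by (rule L2_mult_integrable[OF h0 L2_lborel_schwartz[OF f]])
    show "u (fourier f) = (LINT \<xi>|lborel. h \<xi> * f \<xi>)" by (simp add: u_def fourier_schwartz f fourier_fourier)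
  qed (use h in \<open>simp add: L2_wgt_iff\<close>)
  then show thesis using that sobolev_iff h by blast
qed

lemma has_fourier_distr_of:
  fixes f :: "'a::euclidean_space \<Rightarrow> complex"
  assumes f: "f \<in> schwartz" shows "has_fourier (distr_of f) (fourier f)"
  unfolding has_fourier_def
proof (intro conjI ballI)
  show "distr_of f \<in> tempered"
    unfolding tempered_def mem_Collect_eq
  proof (intro conjI ballI allI impI)
    have i: "integrable lborel (\<lambda>x. f x * g x)" if "g \<in> schwartz" for g by (rule schwartz_mult_integrable[OF that f])
    show "distr_of f g = 0" if "g \<notin> schwartz" for g using that by (simp add: distr_of_def)
    show "distr_of f (\<lambda>x. g x + h x) = distr_of f g + distr_of f h" if "g \<in> schwartz" "h \<in> schwartz" for g h
      using that i by (simp add: distr_of_def schwartz_add distrib_left)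
    show "distr_of f (\<lambda>x. c * g x) = c * distr_of f g" if "g \<in> schwartz" for c g
      using that by (simp add: distr_of_def schwartz_cmult mult.left_commute[of _ c])
    have "norm (distr_of f g) \<le> (LINT x|lborel. norm (f x)) * schwartz_seminorm 0 g" if g: "g \<in> schwartz" for g
    proof -
      have "norm (LINT x|lborel. f x * g x) \<le> (LINT x|lborel. norm (f x) * schwartz_seminorm 0 g)"
        using schwartz_seminorm_ge[OF g, of _ 0]
        by (intro norm_integral_le i g) (auto simp: norm_mult intro!: mult_left_mono integrable_norm schwartz_integrable f)
      then show ?thesis using g by (simp add: distr_of_def)
    qed
    then show "\<exists>C N. \<forall>g\<in>schwartz. norm (distr_of f g) \<le> C * schwartz_seminorm N g" by blast
  qed
  fix g :: "'a \<Rightarrow> complex" assume g: "g \<in> schwartz"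
  show "integrable lborel (\<lambda>\<xi>. fourier f \<xi> * g \<xi>)" by (rule schwartz_mult_integrable[OF g fourier_schwartz[OF f]])
  show "distr_of f (fourier g) = (LINT \<xi>|lborel. fourier f \<xi> * g \<xi>)"
    by (simp add: distr_of_def fourier_schwartz g fourier_multiplication schwartz_integrable f)
qed (rule schwartz_measurable[OF fourier_schwartz[OF f]])

lemma distr_of_sobolev: "f \<in> schwartz \<Longrightarrow> distr_of f \<in> sobolev s"
  by (simp add: sobolev_iff[OF has_fourier_distr_of] schwartz_L2_wgt fourier_schwartz)

section \<open>Metric and Hilbert space structure of Sobolev spaces\<close>

lemma sobolev_triangle:
  assumes "u \<in> sobolev s" "v \<in> sobolev s" "w \<in> sobolev s"
  shows "sobolev_norm s (distr_diff u w) \<le> sobolev_norm s (distr_diff u v) + sobolev_norm s (distr_diff v w)"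
  using assms[THEN sobolev_has_fourier] assms[THEN sobolev_L2]
  by (simp add: sobolev_norm_eq[OF has_fourier_diff] L2_triangle3)

lemma sobolev_norm_commute:
  assumes "u \<in> sobolev s" "v \<in> sobolev s"
  shows "sobolev_norm s (distr_diff u v) = sobolev_norm s (distr_diff v u)"
  using assms[THEN sobolev_has_fourier] by (simp add: sobolev_norm_eq[OF has_fourier_diff]) (rule L2_norm_minus)

lemma sobolev_norm_nonneg [simp]: "0 \<le> sobolev_norm s u"
  unfolding sobolev_norm_def by (intro real_sqrt_ge_zero integral_nonneg_AE) auto

lemma sobolev_norm_eq_0:
  assumes "u \<in> sobolev s" "v \<in> sobolev s" "sobolev_norm s (distr_diff u v) = 0"
  shows "u = v"
proof (rule has_fourier_eq[OF assms(1,2)[THEN sobolev_has_fourier]])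
  have "AE \<xi> in wgt s. fourier_distr u \<xi> - fourier_distr v \<xi> = 0"
    using assms(3) unfolding sobolev_norm_eq[OF has_fourier_diff[OF assms(1,2)[THEN sobolev_has_fourier]]]
    by (intro L2_norm_eq_0 L2_diff sobolev_L2 assms(1,2))
  then show "AE \<xi> in lborel. fourier_distr u \<xi> = fourier_distr v \<xi>" by simp
qed

lemma sobolev_lim_unique:
  assumes "\<And>n. f n \<in> sobolev s" "u \<in> sobolev s" "v \<in> sobolev s"
    and u: "(\<lambda>n. sobolev_norm s (distr_diff (f n) u)) \<longlonglongrightarrow> 0" and v: "(\<lambda>n. sobolev_norm s (distr_diff (f n) v)) \<longlonglongrightarrow> 0"
  shows "u = v"
proof (rule sobolev_norm_eq_0[OF assms(2,3)])
  have "sobolev_norm s (distr_diff u v) \<le> sobolev_norm s (distr_diff (f n) u) + sobolev_norm s (distr_diff (f n) v)" for n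
    using sobolev_triangle[OF assms(2) assms(1) assms(3), of n] sobolev_norm_commute[OF assms(2) assms(1), of n] by simp
  then have "sobolev_norm s (distr_diff u v) \<le> 0"
    using tendsto_add[OF u v] by (intro LIMSEQ_le_const[of _ 0 "sobolev_norm s (distr_diff u v)"]) auto
  then show "sobolev_norm s (distr_diff u v) = 0" using sobolev_norm_nonneg[of s "distr_diff u v"] by linarith
qed

lemma sobolev_complete:
  assumes f: "\<And>n. f n \<in> sobolev s" and s: "0 \<le> s"
    and C: "\<And>e. 0 < e \<Longrightarrow> \<exists>N. \<forall>m\<ge>N. \<forall>n\<ge>N. sobolev_norm s (distr_diff (f m) (f n)) < e"
  obtains u where "u \<in> sobolev s" "(\<lambda>n. sobolev_norm s (distr_diff (f n) u)) \<longlonglongrightarrow> 0"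
proof -
  note hf = f[THEN sobolev_has_fourier]
  obtain h where h: "h \<in> L2 (wgt s)" "(\<lambda>n. L2_norm (wgt s) (\<lambda>x. fourier_distr (f n) x - h x)) \<longlonglongrightarrow> 0"
    using L2_complete[of "\<lambda>n. fourier_distr (f n)" "wgt s"] f[THEN sobolev_L2] C
    unfolding sobolev_norm_eq[OF has_fourier_diff[OF hf hf]] by blast
  obtain u where u: "u \<in> sobolev s" "has_fourier u h" by (rule sobolev_exists[OF h(1) s])
  show thesis by (rule that[OF u(1)]) (use h(2) in \<open>simp add: sobolev_norm_eq[OF has_fourier_diff[OF hf u(2)]]\<close>)
qed

lemma sobolev_inner_diff_left:
  assumes "u \<in> sobolev s" "v \<in> sobolev s" "z \<in> sobolev s"
  shows "sobolev_inner s (distr_diff u v) z = sobolev_inner s u z - sobolev_inner s v z"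
proof -
  note h = assms[THEN sobolev_has_fourier] and l = assms[THEN sobolev_L2]
  show ?thesis
    unfolding sobolev_inner_eq[OF has_fourier_diff[OF h(1,2)] h(3)] sobolev_inner_eq[OF h(1,3)] sobolev_inner_eq[OF h(2,3)]
    using L2_mult_integrable[OF l(1) L2_cnj[OF l(3)]] L2_mult_integrable[OF l(2) L2_cnj[OF l(3)]]
    by (simp add: left_diff_distrib)
qed

lemma sobolev_inner_cnj:
  assumes "u \<in> sobolev s" "v \<in> sobolev s"
  shows "sobolev_inner s v u = cnj (sobolev_inner s u v)"
  unfolding sobolev_inner_eq[OF assms(2,1)[THEN sobolev_has_fourier]] sobolev_inner_eq[OF assms[THEN sobolev_has_fourier]]
    Bochner_Integration.integral_cnj[symmetric]
  by (simp add: mult.commute)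

lemma sobolev_inner_le:
  assumes "u \<in> sobolev s" "v \<in> sobolev s"
  shows "norm (sobolev_inner s u v) \<le> sobolev_norm s u * sobolev_norm s v"
  using L2_cauchy_schwarz[OF sobolev_L2[OF assms(1)] L2_cnj[OF sobolev_L2[OF assms(2)]]]
  unfolding sobolev_inner_eq[OF assms[THEN sobolev_has_fourier]] sobolev_norm_eq[OF sobolev_has_fourier[OF assms(1)]]
    sobolev_norm_eq[OF sobolev_has_fourier[OF assms(2)]]
  by (simp add: L2_norm_def)

lemma sobolev_inner_self:
  assumes "u \<in> sobolev s"
  shows "sobolev_inner s u u = of_real ((sobolev_norm s u)\<^sup>2)"
  unfolding sobolev_inner_eq[OF assms[THEN sobolev_has_fourier] assms[THEN sobolev_has_fourier]]
    sobolev_norm_eq[OF sobolev_has_fourier[OF assms]] L2_norm_sq integral_complex_of_real[symmetric]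
  by (simp add: complex_norm_square del: of_real_power)

text \<open>The projection is computed among densities, in weighted L2, onto the closure of the
  transforms of test functions. The condition 0 <= s enters when the resulting density is turned
  back into a distribution by \<open>sobolev_exists\<close>.\<close>

lemma sobolev_projection:
  fixes u :: "'a::euclidean_space distr"
  assumes u: "u \<in> sobolev s" and s: "0 \<le> s"
  obtains p f where "p \<in> sobolev s" "\<And>n::nat. f n \<in> test_functions \<Omega>"
    "(\<lambda>n. sobolev_norm s (distr_diff (distr_of (f n)) p)) \<longlonglongrightarrow> 0"
    "\<And>\<phi>. \<phi> \<in> test_functions \<Omega> \<Longrightarrow> sobolev_inner s (distr_diff u p) (distr_of \<phi>) = 0"
proof -
  let ?V = "fourier ` (test_functions \<Omega> :: ('a \<Rightarrow> complex) set)"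
  have V: "?V \<subseteq> L2 (wgt s)" by (auto intro: schwartz_L2_wgt fourier_schwartz test_functions_schwartz)
  have "(\<lambda>x. 0) \<in> test_functions \<Omega>"
    by (rule test_functionsI[of _ "{}"]) (auto simp: smooth_iff_smooth_in intro!: smooth_in_const)
  then have V0: "?V \<noteq> {}" by auto
  have Vadd: "(\<lambda>x. f x + g x) \<in> ?V" if "f \<in> ?V" "g \<in> ?V" for f g
  proof -
    obtain f' g' where fg: "f = fourier f'" "f' \<in> test_functions \<Omega>" "g = fourier g'" "g' \<in> test_functions \<Omega>" using \<open>f \<in> ?V\<close> \<open>g \<in> ?V\<close> by blast
    have "(\<lambda>x. f x + g x) = fourier (\<lambda>x. f' x + g' x)"
      using fourier_add[OF schwartz_integrable[OF test_functions_schwartz[OF fg(2)]] schwartz_integrable[OF test_functions_schwartz[OF fg(4)]]]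
      by (intro ext) (simp add: fg)
    then show ?thesis using test_functions_add[OF fg(2,4)] by blast
  qed
  have Vmul: "(\<lambda>x. c * f x) \<in> ?V" if f: "f \<in> ?V" for c f
  proof -
    obtain f' where f': "f = fourier f'" "f' \<in> test_functions \<Omega>" using f by blast
    have "(\<lambda>x. c * f x) = fourier (\<lambda>x. c * f' x)" by (intro ext) (simp add: f' fourier_cmult)
    then show ?thesis using test_functions_cmult[OF f'(2)] by blast
  qed
  note hu = sobolev_has_fourier[OF u]
  from L2_projection[OF V V0 Vadd Vmul sobolev_L2[OF u]] obtain p v where p: "p \<in> L2 (wgt s)" "\<And>n::nat. v n \<in> ?V"
    "(\<lambda>n. L2_norm (wgt s) (\<lambda>x. v n x - p x)) \<longlonglongrightarrow> 0" "\<And>w. w \<in> ?V \<Longrightarrow> (LINT x|wgt s. (fourier_distr u x - p x) * cnj (w x)) = 0"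
    by blast
  obtain P where P: "P \<in> sobolev s" "has_fourier P p" by (rule sobolev_exists[OF p(1) s])
  have "\<forall>n. \<exists>f. f \<in> test_functions \<Omega> \<and> v n = fourier f" using p(2) by blast
  then obtain f where f: "\<And>n. f n \<in> test_functions \<Omega>" "\<And>n. v n = fourier (f n)" by metis
  show thesis
  proof (rule that[OF P(1) f(1)])
    show "(\<lambda>n. sobolev_norm s (distr_diff (distr_of (f n)) P)) \<longlonglongrightarrow> 0"
      using p(3) by (simp add: sobolev_norm_eq[OF has_fourier_diff[OF has_fourier_distr_of[OF test_functions_schwartz[OF f(1)]] P(2)]] f(2))
    show "sobolev_inner s (distr_diff u P) (distr_of \<phi>) = 0" if "\<phi> \<in> test_functions \<Omega>" for \<phi>
      using p(4)[of "fourier \<phi>"] that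
      by (simp add: sobolev_inner_eq[OF has_fourier_diff[OF hu P(2)] has_fourier_distr_of[OF test_functions_schwartz[OF that]]])
  qed
qed

text \<open>Uniqueness for the definite description: the difference of two candidates lies in the
  complement and is orthogonal to itself.\<close>

lemma orth_proj_eqI:
  assumes u: "u \<in> sobolev s" and q: "q \<in> orth_compl s T" and o: "\<And>z. z \<in> orth_compl s T \<Longrightarrow> sobolev_inner s (distr_diff u q) z = 0"
    and T: "T \<subseteq> sobolev s"
  shows "orth_proj s (orth_compl s T) u = q"
proof -
  let ?W = "orth_compl s T"
  have W: "w \<in> sobolev s" if "w \<in> ?W" for w using that by (simp add: orth_compl_def)
  have "w = q" if w: "w \<in> ?W" "\<forall>z\<in>?W. sobolev_inner s (distr_diff u w) z = 0" for w
  proof -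
    have z: "distr_diff w q \<in> ?W" using w(1) q T by (auto simp: orth_compl_def sobolev_diff sobolev_inner_diff_left subset_iff)
    have "sobolev_inner s (distr_diff w q) (distr_diff w q) = sobolev_inner s (distr_diff u q) (distr_diff w q) - sobolev_inner s (distr_diff u w) (distr_diff w q)"
      using W[OF w(1)] W[OF q] u by (simp add: sobolev_inner_diff_left sobolev_diff)
    also have "\<dots> = 0" using w(2) o z by simp
    finally have "sobolev_norm s (distr_diff w q) = 0"
      using sobolev_inner_self[OF sobolev_diff[OF W[OF w(1)] W[OF q]]] by simp
    then show ?thesis by (rule sobolev_norm_eq_0[OF W[OF w(1)] W[OF q]])
  qed
  then have "(THE w. w \<in> ?W \<and> (\<forall>z\<in>?W. sobolev_inner s (distr_diff u w) z = 0)) = q"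
    using q o by (intro the_equality conjI ballI) blast+
  then show ?thesis using u by (simp add: orth_proj_def)
qed

text \<open>Two facts are extracted for later: the part removed by the projection is a limit of test
  functions on \<Omega>, and every u' that differs from u by an element of
  \<open>sobolev_tilde s \<Omega>\<close> has the same projection. The second fact makes the
  single-layer operator independent of the cut-off.\<close>

lemma orth_proj_tilde:
  fixes u :: "'a::euclidean_space distr"
  assumes u: "u \<in> sobolev s" and s: "0 \<le> s"
  obtains q f where "q \<in> sobolev s" "\<And>n::nat. f n \<in> test_functions \<Omega>"
    "(\<lambda>n. sobolev_norm s (distr_diff (distr_of (f n)) (distr_diff u q))) \<longlonglongrightarrow> 0"
    "\<And>u'. u' \<in> sobolev s \<Longrightarrow> distr_diff u' u \<in> sobolev_tilde s \<Omega> \<Longrightarrow>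
       orth_proj s (orth_compl s (sobolev_tilde s \<Omega>)) u' = q"
proof -
  let ?T = "sobolev_tilde s \<Omega>"
  let ?W = "orth_compl s ?T"
  obtain p f where p: "p \<in> sobolev s" "\<And>n::nat. f n \<in> test_functions \<Omega>"
    "(\<lambda>n. sobolev_norm s (distr_diff (distr_of (f n)) p)) \<longlonglongrightarrow> 0"
    "\<And>\<phi>. \<phi> \<in> test_functions \<Omega> \<Longrightarrow> sobolev_inner s (distr_diff u p) (distr_of \<phi>) = 0"
    using sobolev_projection[OF u s, of \<Omega>] by blast
  let ?q = "distr_diff u p"
  have eq: "distr_diff u ?q = p" by (simp add: distr_diff_def)
  have qS: "?q \<in> sobolev s" by (rule sobolev_diff[OF u p(1)])
  have TS: "?T \<subseteq> sobolev s" by (auto simp: sobolev_tilde_def)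
  have fS: "distr_of \<phi> \<in> sobolev s" if "\<phi> \<in> test_functions \<Omega>" for \<phi> :: "'a \<Rightarrow> complex"
    by (rule distr_of_sobolev[OF test_functions_schwartz[OF that]])
  have qW: "?q \<in> ?W"
  proof -
    have "sobolev_inner s ?q v = 0" if v: "v \<in> ?T" for v
    proof -
      have vS: "v \<in> sobolev s" using v TS by auto
      have "norm (sobolev_inner s ?q v) \<le> e" if e: "0 < e" for e
      proof -
        have "0 < e / (1 + sobolev_norm s ?q)" using e sobolev_norm_nonneg[of s ?q] by (intro divide_pos_pos) linarith+
        then obtain \<phi> where \<phi>: "\<phi> \<in> test_functions \<Omega>" "sobolev_norm s (distr_diff v (distr_of \<phi>)) < e / (1 + sobolev_norm s ?q)"
          using v unfolding sobolev_tilde_def by blast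
        have "sobolev_inner s (distr_diff v (distr_of \<phi>)) ?q = sobolev_inner s v ?q - sobolev_inner s (distr_of \<phi>) ?q"
          by (rule sobolev_inner_diff_left[OF vS fS[OF \<phi>(1)] qS])
        also have "sobolev_inner s (distr_of \<phi>) ?q = 0" using p(4)[OF \<phi>(1)] sobolev_inner_cnj[OF qS fS[OF \<phi>(1)]] by simp
        finally have "norm (sobolev_inner s v ?q) \<le> sobolev_norm s (distr_diff v (distr_of \<phi>)) * sobolev_norm s ?q"
          using sobolev_inner_le[OF sobolev_diff[OF vS fS[OF \<phi>(1)]] qS] by simp
        also have "\<dots> \<le> e / (1 + sobolev_norm s ?q) * sobolev_norm s ?q" using \<phi>(2) by (intro mult_right_mono) auto
        also have "\<dots> \<le> e" using e sobolev_norm_nonneg[of s ?q] by (simp add: pos_divide_le_eq add_pos_nonneg algebra_simps)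
        finally show ?thesis using sobolev_inner_cnj[OF qS vS] by simp
      qed
      then have "norm (sobolev_inner s ?q v) \<le> 0" by (rule field_le_epsilon[of _ 0, simplified])
      then show ?thesis by simp
    qed
    then show ?thesis using qS by (simp add: orth_compl_def)
  qed
  have pT: "p \<in> ?T"
    unfolding sobolev_tilde_def
  proof (intro CollectI conjI p(1) allI impI)
    fix e :: real assume "0 < e"
    then have "\<forall>\<^sub>F n in sequentially. sobolev_norm s (distr_diff (distr_of (f n)) p) < e" using order_tendstoD(2)[OF p(3)] by blast
    then obtain n where "sobolev_norm s (distr_diff (distr_of (f n)) p) < e" by (auto simp: eventually_sequentially)
    then show "\<exists>f\<in>test_functions \<Omega>. sobolev_norm s (distr_diff p (distr_of f)) < e"
      using p(2) sobolev_norm_commute[OF p(1) fS[OF p(2)]] by metis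
  qed
  show thesis
  proof (rule that[OF qS p(2)])
    show "(\<lambda>n. sobolev_norm s (distr_diff (distr_of (f n)) (distr_diff u ?q))) \<longlonglongrightarrow> 0" unfolding eq by (rule p(3))
    fix u' assume u': "u' \<in> sobolev s" "distr_diff u' u \<in> ?T"
    show "orth_proj s ?W u' = ?q"
    proof (rule orth_proj_eqI[OF u'(1) qW _ TS])
      fix z assume z: "z \<in> ?W"
      then have zS: "z \<in> sobolev s" by (simp add: orth_compl_def)
      have o: "sobolev_inner s v z = 0" if "v \<in> ?T" for v
        using z that sobolev_inner_cnj[OF zS, of v] TS by (auto simp: orth_compl_def)
      have "sobolev_inner s (distr_diff u' ?q) z = sobolev_inner s (distr_diff u' u) z + sobolev_inner s (distr_diff u ?q) z"
        using u u'(1) zS qS p(1) by (simp add: sobolev_inner_diff_left)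
      then show "sobolev_inner s (distr_diff u' ?q) z = 0" using o[OF u'(2)] o[OF pT] by (simp add: eq)
    qed
  qed
qed

section \<open>Density of test functions\<close>

lemma fourier_inj_L1:
  assumes h: "integrable lborel h" and z: "\<And>\<xi>. fourier h \<xi> = 0"
  shows "AE x in lborel. h x = 0"
proof -
  have "AE x in lborel. x \<in> UNIV \<longrightarrow> h x = 0"
  proof (rule fundamental_lemma_variations)
    fix f :: "'a \<Rightarrow> complex" assume f: "f \<in> test_functions UNIV"
    note fs = test_functions_schwartz[OF f]
    show "integrable lborel (\<lambda>x. h x * f x)" by (rule schwartz_times_bounded_integrable[OF fs h])
    obtain g where g: "g \<in> schwartz" "fourier g = f" using fourier_surj[OF fs] by blast
    show "(LINT x|lborel. h x * f x) = 0"
      using fourier_multiplication[OF h schwartz_integrable[OF g(1)]] z by (simp add: g)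
  qed (use borel_measurable_integrable[OF h] in auto)
  then show ?thesis by simp
qed

lemma smooth_in_ek: "smooth_in UNIV (ek \<xi>)"
proof -
  have "smooth_in UNIV (\<lambda>x. (\<lambda>z. exp (- \<i> * z)) (of_real (x \<bullet> \<xi>)))"
    by (rule smooth_in_holomorphic(1)[where S = UNIV]) (auto intro!: holomorphic_intros smooth_in_inner)
  then show ?thesis by (simp add: ek_def[abs_def] inner_commute)
qed

lemma test_functions_translate:
  assumes f: "f \<in> test_functions UNIV" shows "(\<lambda>x. f (x - a)) \<in> test_functions UNIV"
proof (rule test_functionsI[where K = "(\<lambda>x. x + a) ` fun_supp f"])
  show "smooth (\<lambda>x. f (x - a))"
    using smooth_in_affine_comp[OF open_UNIV bounded_linear_ident, of "- a" UNIV f] test_functions_smooth[OF f]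
    by (simp add: smooth_iff_smooth_in)
  show "compact ((\<lambda>x. x + a) ` fun_supp f)"
    by (intro compact_continuous_image continuous_intros test_functions_supp(1)[OF f])
  show "f (x - a) = 0" if "x \<notin> (\<lambda>x. x + a) ` fun_supp f" for x
    using that by (intro fun_supp_zero) (auto simp: image_iff)
qed auto

lemma fourier_translate_modulate:
  fixes f :: "'a::euclidean_space \<Rightarrow> complex"
  assumes [measurable]: "f \<in> borel_measurable borel"
  shows "fourier (\<lambda>x. ek (- \<eta>) x * f (x - a)) \<xi> = ek (\<xi> - \<eta>) a * fourier f (\<xi> - \<eta>)"
proof -
  have m: "ek \<xi> x * ek (- \<eta>) x = ek (\<xi> - \<eta>) x" for x
    using ek_add[of x \<xi> "- \<eta>"] by (simp add: ek_commute[of _ x])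
  have "(LINT x|lborel. ek \<xi> x * (ek (- \<eta>) x * f (x - a))) = (LINT x|lborel. (\<lambda>x. ek (\<xi> - \<eta>) x * f (x - a)) (x + a))"
    by (subst lborel_integral_translate) (auto simp: mult.assoc[symmetric] m)
  also have "\<dots> = (LINT x|lborel. ek (\<xi> - \<eta>) a * (ek (\<xi> - \<eta>) x * f x))" by (simp add: ek_add mult_ac)
  finally show ?thesis by (simp add: fourier_ek)
qed

text \<open>A cut-off has positive integral, hence a transform that is nonzero at 0 and, by
  continuity, near 0.\<close>

lemma exists_test_function_fourier_nonzero:
  obtains \<phi> :: "'a::euclidean_space \<Rightarrow> complex" and \<delta> where "\<phi> \<in> test_functions UNIV" "0 < \<delta>" "\<And>\<xi>. norm \<xi> < \<delta> \<Longrightarrow> fourier \<phi> \<xi> \<noteq> 0"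
proof -
  obtain \<rho> :: "'a \<Rightarrow> real" and V where \<rho>: "(\<lambda>x. complex_of_real (\<rho> x)) \<in> test_functions UNIV"
    "\<And>x. 0 \<le> \<rho> x" "\<And>x. \<rho> x \<le> 1" "open V" "{0} \<subseteq> V" "\<And>x. x \<in> V \<Longrightarrow> \<rho> x = 1"
    using smooth_cutoff[of "{0::'a}" UNIV] by (metis compact_sing open_UNIV top_greatest)
  let ?\<phi> = "\<lambda>x. complex_of_real (\<rho> x)"
  note s = test_functions_schwartz[OF \<rho>(1)]
  have i: "integrable lborel \<rho>" using integrable_Re[OF schwartz_integrable[OF s]] by simp
  have "(LINT x|lborel. \<rho> x) \<noteq> 0"
  proof
    assume "(LINT x|lborel. \<rho> x) = 0"
    then have "AE x in lborel. \<rho> x = 0" using integral_nonneg_eq_0_iff_AE[OF i] \<rho>(2) by simp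
    then have "AE x in lborel. x \<notin> V" by eventually_elim (use \<rho>(6) in force)
    then have "emeasure lborel V = 0" using \<rho>(4) by (subst (asm) AE_iff_measurable[of V]) auto
    obtain r where r: "0 < r" "ball 0 r \<subseteq> V" using \<rho>(4,5) openE[of V 0] by auto
    have "emeasure lborel (ball (0::'a) r) \<le> emeasure lborel V" using r(2) \<rho>(4) by (intro emeasure_mono) auto
    moreover have "0 < emeasure lborel (ball (0::'a) r)" using r(1) by (simp add: emeasure_ball unit_ball_vol_pos)
    ultimately show False using \<open>emeasure lborel V = 0\<close> by simp
  qed
  then have "fourier ?\<phi> 0 \<noteq> 0" by (simp add: fourier_ek ek_def integral_complex_of_real)
  moreover have "isCont (fourier ?\<phi>) 0"
    using schwartz_continuous[OF fourier_schwartz[OF s]] by (simp add: continuous_on_eq_continuous_at)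
  ultimately obtain \<delta> where "0 < \<delta>" "\<And>\<xi>. dist 0 \<xi> < \<delta> \<Longrightarrow> fourier ?\<phi> \<xi> \<noteq> 0"
    using continuous_at_avoid[of 0 "fourier ?\<phi>" 0] by metis
  then show thesis using that[OF \<rho>(1)] by (simp add: dist_norm)
qed

text \<open>Testing with translates and modulations of a single test function \<open>\<phi>\<close> shows that, for every \<open>\<eta>\<close>,
  the integrable function \<open>\<xi> \<mapsto> (1 + |\<xi>|\<^sup>2)\<^sup>s h(\<xi>) cnj (fourier \<phi> (\<xi> - \<eta>))\<close> has vanishing Fourier transform.\<close>

lemma test_functions_total:
  fixes h :: "'a::euclidean_space \<Rightarrow> complex"
  assumes h: "h \<in> L2 (wgt s)" and o: "\<And>\<phi>. \<phi> \<in> test_functions UNIV \<Longrightarrow> (LINT \<xi>|wgt s. h \<xi> * cnj (fourier \<phi> \<xi>)) = 0"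
  shows "AE \<xi> in lborel. h \<xi> = 0"
proof -
  obtain \<phi> :: "'a \<Rightarrow> complex" and \<delta> where \<phi>: "\<phi> \<in> test_functions UNIV" "0 < \<delta>" "\<And>\<xi>. norm \<xi> < \<delta> \<Longrightarrow> fourier \<phi> \<xi> \<noteq> 0"
    using exists_test_function_fourier_nonzero by blast
  have hm[measurable]: "h \<in> borel_measurable borel" using h by (simp add: L2_wgt_iff)
  have [measurable]: "\<phi> \<in> borel_measurable borel" by (rule schwartz_measurable[OF test_functions_schwartz[OF \<phi>(1)]])
  have tm: "(\<lambda>x. ek (- \<eta>) x * \<phi> (x - a)) \<in> test_functions UNIV" for \<eta> a
    by (intro test_functions_mult_left test_functions_translate \<phi>(1) smooth_in_ek)
  have [measurable]: "fourier \<phi> \<in> borel_measurable borel" by (rule schwartz_measurable[OF fourier_schwartz[OF test_functions_schwartz[OF \<phi>(1)]]])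
  have [measurable]: "cnj \<in> borel_measurable borel" by (intro borel_measurable_continuous_onI continuous_intros)
  have z: "AE \<xi> in lborel. h \<xi> * cnj (fourier \<phi> (\<xi> - \<eta>)) = 0" for \<eta>
  proof -
    let ?g = "\<lambda>\<xi>. (1 + (norm \<xi>)\<^sup>2) powr s *\<^sub>R (h \<xi> * cnj (fourier \<phi> (\<xi> - \<eta>)))"
    have fL: "fourier (\<lambda>x. ek (- \<eta>) x * \<phi> (x - a)) \<in> L2 (wgt s)" for a
      by (intro schwartz_L2_wgt fourier_schwartz test_functions_schwartz[OF tm])
    have fe: "fourier (\<lambda>x. ek (- \<eta>) x * \<phi> (x - a)) = (\<lambda>\<xi>. ek (\<xi> - \<eta>) a * fourier \<phi> (\<xi> - \<eta>))" for a
      by (intro ext fourier_translate_modulate) measurable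
    have ig: "integrable lborel ?g"
      using L2_mult_integrable[OF h L2_cnj[OF fL[of 0]]] unfolding fe
      by (subst (asm) integrable_wgt) (auto simp: ek_def[of _ 0])
    have "fourier ?g a = 0" for a
    proof -
      have e: "cnj (ek (\<xi> - \<eta>) (- a)) = ek a \<xi> * ek a (- \<eta>)" for \<xi>
        unfolding cnj_ek ek_uminus minus_minus using ek_add[of a \<xi> "- \<eta>"] by (simp add: ek_commute[of a])
      have "0 = (LINT \<xi>|wgt s. h \<xi> * cnj (fourier (\<lambda>x. ek (- \<eta>) x * \<phi> (x - (- a))) \<xi>))" using o[OF tm, of \<eta> "- a"] by simp
      also have "\<dots> = (LINT \<xi>|lborel. ek a (- \<eta>) * (ek a \<xi> * ?g \<xi>))"
        unfolding fe by (subst integral_wgt) (auto simp: e scaleR_conv_of_real mult_ac intro!: Bochner_Integration.integral_cong)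
      also have "\<dots> = ek a (- \<eta>) * (LINT \<xi>|lborel. ek a \<xi> * ?g \<xi>)" by (rule integral_mult_right_zero)
      finally have "ek a (- \<eta>) * (LINT \<xi>|lborel. ek a \<xi> * ?g \<xi>) = 0" by (rule sym)
      moreover have "ek a (- \<eta>) \<noteq> 0" by (simp add: ek_def)
      ultimately have "(LINT \<xi>|lborel. ek a \<xi> * ?g \<xi>) = 0" by (simp only: mult_eq_0_iff simp_thms)
      then show ?thesis by (simp add: fourier_ek)
    qed
    from fourier_inj_L1[OF ig this] show ?thesis
      by (rule AE_mp) (auto intro!: AE_I2 simp: less_imp_neq[OF weight_pos, symmetric])
  qed
  obtain D :: "'a set" where D: "countable D" "\<And>X. open X \<Longrightarrow> X \<noteq> {} \<Longrightarrow> \<exists>d\<in>D. d \<in> X" using countable_dense_setE by metis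
  have "AE \<xi> in lborel. \<forall>\<eta>\<in>D. h \<xi> * cnj (fourier \<phi> (\<xi> - \<eta>)) = 0"
    using z by (subst AE_ball_countable[OF D(1)]) auto
  then show ?thesis
  proof eventually_elim
    fix \<xi> assume a: "\<forall>\<eta>\<in>D. h \<xi> * cnj (fourier \<phi> (\<xi> - \<eta>)) = 0"
    obtain \<eta> where "\<eta> \<in> D" "\<eta> \<in> ball \<xi> \<delta>" using D(2)[of "ball \<xi> \<delta>"] \<phi>(2) by auto
    then show "h \<xi> = 0" using a \<phi>(3)[of "\<xi> - \<eta>"] by (auto simp: dist_norm)
  qed
qed

text \<open>The residual of the projection onto the closure of all test functions is orthogonal to
  every test function, hence zero by \<open>test_functions_total\<close>.\<close>

lemma test_functions_dense:
  fixes u :: "'a::euclidean_space distr"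
  assumes u: "u \<in> sobolev s" and s: "0 \<le> s"
  obtains f where "\<And>n::nat. f n \<in> test_functions UNIV" "(\<lambda>n. sobolev_norm s (distr_diff (distr_of (f n)) u)) \<longlonglongrightarrow> 0"
proof -
  obtain p f where p: "p \<in> sobolev s" "\<And>n::nat. f n \<in> test_functions UNIV"
    "(\<lambda>n. sobolev_norm s (distr_diff (distr_of (f n)) p)) \<longlonglongrightarrow> 0"
    "\<And>\<phi>. \<phi> \<in> test_functions UNIV \<Longrightarrow> sobolev_inner s (distr_diff u p) (distr_of \<phi>) = 0"
    using sobolev_projection[OF u s, of UNIV] by blast
  note hf = sobolev_has_fourier[OF u] sobolev_has_fourier[OF p(1)]
  have "AE \<xi> in lborel. fourier_distr u \<xi> - fourier_distr p \<xi> = 0"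
    by (rule test_functions_total[where s = s])
      (use p(4) in \<open>auto simp: sobolev_inner_eq[OF has_fourier_diff[OF hf] has_fourier_distr_of[OF test_functions_schwartz]] intro!: L2_diff sobolev_L2 u p(1)\<close>)
  then have "u = p" by (intro has_fourier_eq[OF hf]) simp
  then show thesis using that p(2,3) by blast
qed

section \<open>Measures of controlled growth\<close>

lemma geometric_scale:
  fixes r :: real assumes "0 < r" "r \<le> 1"
  obtains i where "(1/2) ^ Suc i < r" "r \<le> (1/2) ^ i"
proof -
  obtain n where n: "(1/2) ^ n < r" using real_arch_pow_inv[OF assms(1), of "1/2"] by auto
  define m where "m = (LEAST n. (1/2) ^ n < r)"
  have m: "(1/2) ^ m < r" unfolding m_def using n by (rule LeastI)
  have "m \<noteq> 0" using m assms(2) by (intro notI) simp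
  then obtain i where i: "m = Suc i" using not0_implies_Suc by blast
  have "\<not> (1/2) ^ i < r" using not_less_Least[of i "\<lambda>n. (1/2) ^ n < r"] i by (simp add: m_def)
  then show thesis using that[of i] m i by simp
qed

lemma ennreal_le_suminf: "(f i :: ennreal) \<le> suminf f"
  using sum_le_suminf[of f "{i}"] by (simp add: summableI)

text \<open>On the shell 2^(-i-1) < \<rho> <= 2^(-i) the integrand is at most 2^((i+1) \<beta>), and
  the shell has measure at most c 2^(-i d), so a geometric series of ratio 2^(\<beta> - d) results;
  where \<rho> > 1 the total mass suffices. The function \<open>\<rho>\<close> is abstract because
  the bound serves both the distance on the screen and the norm in the ambient space.\<close>

lemma riesz_potential_bound:
  fixes \<rho> :: "'b \<Rightarrow> real"
  assumes fin: "finite_measure M" and \<rho>[measurable]: "\<rho> \<in> borel_measurable M" and pos: "\<And>y. 0 \<le> \<rho> y"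
    and growth: "\<And>r. 0 < r \<Longrightarrow> r \<le> 1 \<Longrightarrow> measure M {y \<in> space M. \<rho> y \<le> r} \<le> c * r powr d"
    and \<beta>: "0 < \<beta>" "\<beta> < d"
  shows "(\<integral>\<^sup>+y. ennreal (\<rho> y powr (- \<beta>)) \<partial>M) \<le> ennreal (measure M (space M) + c * 2 powr \<beta> / (1 - 2 powr (\<beta> - d)))"
proof -
  interpret finite_measure M by fact
  have c0: "0 \<le> c" using order_trans[OF measure_nonneg growth[of 1]] by simp
  let ?t = "\<lambda>i y. ennreal (2 powr ((real i + 1) * \<beta>)) * indicator {y \<in> space M. \<rho> y \<le> (1/2) ^ i} y"
  have half: "(1/2) ^ i = 2 powr (- real i)" for i :: nat by (simp add: powr_minus powr_realpow power_one_over inverse_eq_divide)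
  have "ennreal (\<rho> y powr (- \<beta>)) \<le> 1 + (\<Sum>i. ?t i y)" if y: "y \<in> space M" for y
  proof (cases "0 < \<rho> y \<and> \<rho> y \<le> 1")
    case True
    then obtain i where i: "(1/2) ^ Suc i < \<rho> y" "\<rho> y \<le> (1/2) ^ i" using geometric_scale by metis
    have "\<rho> y powr (- \<beta>) \<le> ((1/2) ^ Suc i) powr (- \<beta>)" using i True \<beta> by (intro powr_mono2') auto
    also have "\<dots> = 2 powr ((real i + 1) * \<beta>)" unfolding half by (simp add: powr_powr algebra_simps)
    finally have "ennreal (\<rho> y powr (- \<beta>)) \<le> ?t i y" using i y by (simp add: ennreal_leI)
    also have "\<dots> \<le> (\<Sum>i. ?t i y)" by (rule ennreal_le_suminf)
    also have "\<dots> \<le> 1 + (\<Sum>i. ?t i y)" by simp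
    finally show ?thesis .
  next
    case False
    \<comment> \<open>For \<open>\<rho> y = 0\<close> this relies on the convention
      \<open>0 powr a = 0\<close>.\<close>
    have "\<rho> y powr (- \<beta>) \<le> 1"
    proof (cases "\<rho> y = 0")
      case nz: False
      with False pos[of y] have "1 < \<rho> y" by auto
      then show ?thesis using \<beta> powr_mono2'[of "- \<beta>" 1 "\<rho> y"] by simp
    qed simp
    then have "ennreal (\<rho> y powr (- \<beta>)) \<le> 1" by (simp add: ennreal_le_1)
    then show ?thesis by (rule order_trans) simp
  qed
  then have "(\<integral>\<^sup>+y. ennreal (\<rho> y powr (- \<beta>)) \<partial>M) \<le> (\<integral>\<^sup>+y. 1 + (\<Sum>i. ?t i y) \<partial>M)" by (rule nn_integral_mono)
  also have "\<dots> = emeasure M (space M) + (\<Sum>i. \<integral>\<^sup>+y. ?t i y \<partial>M)"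
    by (subst nn_integral_add) (auto simp: nn_integral_suminf)
  also have "\<dots> \<le> ennreal (measure M (space M)) + (\<Sum>i. ennreal (c * 2 powr \<beta> * (2 powr (\<beta> - d)) ^ i))"
  proof (intro add_mono suminf_le summableI)
    fix i
    have "(\<integral>\<^sup>+y. ?t i y \<partial>M) = ennreal (2 powr ((real i + 1) * \<beta>)) * emeasure M {y \<in> space M. \<rho> y \<le> (1/2) ^ i}"
      by (rule nn_integral_cmult_indicator) measurable
    also have "\<dots> = ennreal (2 powr ((real i + 1) * \<beta>) * measure M {y \<in> space M. \<rho> y \<le> (1/2) ^ i})"
      by (simp add: emeasure_eq_measure ennreal_mult)
    also have "\<dots> \<le> ennreal (2 powr ((real i + 1) * \<beta>) * (c * ((1/2) ^ i) powr d))"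
      by (intro ennreal_leI mult_left_mono growth) (auto simp: power_le_one)
    also have "2 powr ((real i + 1) * \<beta>) * (c * ((1/2) ^ i) powr d) = c * 2 powr \<beta> * (2 powr (\<beta> - d)) ^ i"
      unfolding half powr_powr powr_realpow[symmetric, OF powr_gt_zero[THEN iffD2], of 2, simplified]
      by (simp add: powr_add[symmetric] algebra_simps)
    finally show "(\<integral>\<^sup>+y. ?t i y \<partial>M) \<le> ennreal (c * 2 powr \<beta> * (2 powr (\<beta> - d)) ^ i)" .
  qed (simp add: emeasure_eq_measure)
  also have "(\<Sum>i. ennreal (c * 2 powr \<beta> * (2 powr (\<beta> - d)) ^ i)) = ennreal (c * 2 powr \<beta> / (1 - 2 powr (\<beta> - d)))"
  proof -
    have q: "2 powr (\<beta> - d) < 1" using \<beta> powr_less_mono[of "\<beta> - d" 0 2] by simp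
    have "(\<lambda>i. c * 2 powr \<beta> * (2 powr (\<beta> - d)) ^ i) sums (c * 2 powr \<beta> * (1 / (1 - 2 powr (\<beta> - d))))"
      using q by (intro sums_mult geometric_sums) simp
    then show ?thesis using c0 by (intro sums_unique[symmetric] sums_ennreal[THEN iffD2]) (use q in \<open>auto\<close>)
  qed
  finally show ?thesis using c0 \<beta> powr_less_mono[of "\<beta> - d" 0 2] by (simp add: ennreal_plus divide_nonneg_pos)
qed

text \<open>With r = |z| one has r^\<beta> <= 1 + r^2 <= 2 exp (r^2 / 2); the first inequality is
  where \<beta> <= 2 enters.\<close>

lemma gauss_le_powr:
  assumes "z \<noteq> 0" "0 < \<beta>" "\<beta> \<le> 2" shows "gauss z \<le> 2 * norm z powr (- \<beta>)"
proof -
  let ?r = "norm z"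
  have r: "0 < ?r" using assms by simp
  have "?r powr \<beta> \<le> 1 + ?r\<^sup>2"
  proof (cases "?r \<le> 1")
    case True
    then have "?r powr \<beta> \<le> 1" using assms by (intro powr_le1) auto
    then show ?thesis by (simp add: add_increasing2)
  next
    case False
    then have "?r powr \<beta> \<le> ?r powr 2" using assms by (intro powr_mono) auto
    then show ?thesis using r by (simp add: powr_numeral)
  qed
  also have "\<dots> \<le> 2 * exp (?r\<^sup>2 / 2)" using exp_ge_add_one_self[of "?r\<^sup>2 / 2"] by linarith
  finally have "?r powr \<beta> * exp (- (?r\<^sup>2 / 2)) \<le> 2 * exp (?r\<^sup>2 / 2) * exp (- (?r\<^sup>2 / 2))" by (intro mult_right_mono) auto
  then have "?r powr \<beta> * gauss z \<le> 2" by (simp add: gauss_def mult.assoc exp_add[symmetric])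
  then show ?thesis using r by (simp add: powr_minus field_simps)
qed

text \<open>A single summand suffices. If j is the dyadic scale of the left side, so that 2^(-j)
  bounds it from above and 2^(-j-1) from below, then |2^(-j) \<xi>|^2 <= 4 and the Gaussian is at
  least exp (-2); hence the factor \<open>exp 2\<close>.\<close>

lemma weight_le_gauss_sum:
  "ennreal ((1 + (norm \<xi>)\<^sup>2) powr (- 1/2)) \<le> (\<Sum>j. ennreal (exp 2 * (1/2) ^ j * gauss ((1/2) ^ j *\<^sub>R \<xi>)))"
proof -
  let ?r = "(1 + (norm \<xi>)\<^sup>2) powr (- 1/2)"
  have r: "0 < ?r" "?r \<le> 1" using powr_mono2'[of "-1/2" 1 "1 + (norm \<xi>)\<^sup>2"] by simp_all
  obtain j where j: "(1/2) ^ Suc j < ?r" "?r \<le> (1/2) ^ j" by (rule geometric_scale[OF r])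
  have "?r\<^sup>2 = (1 + (norm \<xi>)\<^sup>2) powr (- 1)" by (subst powr_power) auto
  then have "?r\<^sup>2 = 1 / (1 + (norm \<xi>)\<^sup>2)" by (simp add: powr_minus_divide)
  then have "(1 + (norm \<xi>)\<^sup>2) * ?r\<^sup>2 = 1" by simp
  moreover have "((1/2) ^ Suc j)\<^sup>2 \<le> ?r\<^sup>2" using j by (intro power_mono) auto
  then have "(1 + (norm \<xi>)\<^sup>2) * ((1/2) ^ Suc j)\<^sup>2 \<le> (1 + (norm \<xi>)\<^sup>2) * ?r\<^sup>2" by (intro mult_left_mono) auto
  ultimately have "(1 + (norm \<xi>)\<^sup>2) * ((1/2) ^ Suc j)\<^sup>2 \<le> 1" by simp
  then have "(norm \<xi>)\<^sup>2 * ((1/2) ^ Suc j)\<^sup>2 \<le> 1" using zero_le_power2[of "(1/2::real) ^ Suc j"] by (simp only: distrib_right mult_1)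
  then have n: "(norm ((1/2) ^ j *\<^sub>R \<xi>))\<^sup>2 \<le> 4" by (simp add: power_mult_distrib power_divide mult.commute power_mult[symmetric] pos_divide_le_eq)
  have "1 \<le> exp 2 * gauss ((1/2) ^ j *\<^sub>R \<xi>)" using n unfolding gauss_def exp_add[symmetric] by simp
  then have "(1/2) ^ j * 1 \<le> (1/2) ^ j * (exp 2 * gauss ((1/2) ^ j *\<^sub>R \<xi>))" by (rule mult_left_mono) simp
  then have "?r \<le> (1/2) ^ j * (exp 2 * gauss ((1/2) ^ j *\<^sub>R \<xi>))" using j(2) by linarith
  then have "ennreal ?r \<le> ennreal (exp 2 * (1/2) ^ j * gauss ((1/2) ^ j *\<^sub>R \<xi>))" by (simp add: ennreal_leI mult_ac)
  also have "\<dots> \<le> (\<Sum>j. ennreal (exp 2 * (1/2) ^ j * gauss ((1/2) ^ j *\<^sub>R \<xi>)))" by (rule ennreal_le_suminf)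
  finally show ?thesis .
qed

section \<open>Distributions given by densities on a measure, and their energy\<close>

definition mdistr :: "'a::euclidean_space measure \<Rightarrow> ('a \<Rightarrow> complex) \<Rightarrow> 'a distr" where
  "mdistr M \<Psi> = (\<lambda>f. if f \<in> schwartz then LINT x|M. f x * \<Psi> x else 0)"

definition mfourier :: "'a::euclidean_space measure \<Rightarrow> ('a \<Rightarrow> complex) \<Rightarrow> 'a \<Rightarrow> complex" where
  "mfourier M \<Psi> \<xi> = of_real (fconst TYPE('a)) * (LINT x|M. ek \<xi> x * \<Psi> x)"

text \<open>Cauchy-Schwarz after multiplying the two transforms by the weights of exponents s/2 and
  -s/2, whose product is 1.\<close>

lemma sobolev_pairing_le:
  assumes u: "u \<in> sobolev s" and v: "v \<in> sobolev (- s)"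
  shows "norm (sobolev_pairing u v) \<le> sobolev_norm s u * sobolev_norm (- s) v"
    and "integrable lborel (\<lambda>\<xi>. fourier_distr u \<xi> * cnj (fourier_distr v \<xi>))"
proof -
  note hu = sobolev_has_fourier[OF u] and hv = sobolev_has_fourier[OF v]
  let ?f = "\<lambda>\<xi>. of_real ((1 + (norm \<xi>)\<^sup>2) powr (s / 2)) * fourier_distr u \<xi>"
  let ?g = "\<lambda>\<xi>. of_real ((1 + (norm \<xi>)\<^sup>2) powr (- s / 2)) * cnj (fourier_distr v \<xi>)"
  have L: "(\<lambda>\<xi>. of_real ((1 + (norm \<xi>)\<^sup>2) powr (t / 2)) * h \<xi>) \<in> L2 lborel"
    "L2_norm lborel (\<lambda>\<xi>. of_real ((1 + (norm \<xi>)\<^sup>2) powr (t / 2)) * h \<xi>) = L2_norm (wgt t) h" if h: "h \<in> L2 (wgt t)" for t and h :: "'a \<Rightarrow> complex"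
  proof -
    have [measurable]: "h \<in> borel_measurable borel" using h by (simp add: L2_wgt_iff)
    have e: "(norm (of_real ((1 + (norm \<xi>)\<^sup>2) powr (t / 2)) * h \<xi>))\<^sup>2 = (1 + (norm \<xi>)\<^sup>2) powr t * (norm (h \<xi>))\<^sup>2" for \<xi>
      by (simp add: norm_mult power_mult_distrib powr_power)
    show "(\<lambda>\<xi>. of_real ((1 + (norm \<xi>)\<^sup>2) powr (t / 2)) * h \<xi>) \<in> L2 lborel"
      unfolding L2_def mem_Collect_eq e using h by (simp add: L2_wgt_iff)
    show "L2_norm lborel (\<lambda>\<xi>. of_real ((1 + (norm \<xi>)\<^sup>2) powr (t / 2)) * h \<xi>) = L2_norm (wgt t) h"
      unfolding L2_norm_def e by (simp add: integral_wgt)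
  qed
  have fg: "?f \<xi> * ?g \<xi> = fourier_distr u \<xi> * cnj (fourier_distr v \<xi>)" for \<xi>
  proof -
    have "(1 + (norm \<xi>)\<^sup>2) powr (s / 2) * (1 + (norm \<xi>)\<^sup>2) powr (- s / 2) = 1" by (simp add: powr_add[symmetric])
    then have "complex_of_real ((1 + (norm \<xi>)\<^sup>2) powr (s / 2)) * of_real ((1 + (norm \<xi>)\<^sup>2) powr (- s / 2)) = 1"
      by (simp only: of_real_mult[symmetric] of_real_1)
    moreover have "?f \<xi> * ?g \<xi> = (complex_of_real ((1 + (norm \<xi>)\<^sup>2) powr (s / 2)) * of_real ((1 + (norm \<xi>)\<^sup>2) powr (- s / 2))) *
        (fourier_distr u \<xi> * cnj (fourier_distr v \<xi>))" by (simp only: mult_ac)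
    ultimately show ?thesis by (simp only: mult_1)
  qed
  have cl: "(\<lambda>\<xi>. cnj (fourier_distr v \<xi>)) \<in> L2 (wgt (- s))" by (intro L2_cnj sobolev_L2 v)
  note F = L[OF sobolev_L2[OF u]] and G = L[OF cl]
  show "integrable lborel (\<lambda>\<xi>. fourier_distr u \<xi> * cnj (fourier_distr v \<xi>))"
    using L2_mult_integrable[OF F(1) G(1)] unfolding fg .
  have "norm (LINT \<xi>|lborel. ?f \<xi> * ?g \<xi>) \<le> L2_norm lborel ?f * L2_norm lborel ?g" by (rule L2_cauchy_schwarz[OF F(1) G(1)])
  moreover have "L2_norm (wgt (- s)) (\<lambda>\<xi>. cnj (fourier_distr v \<xi>)) = sobolev_norm (- s) v"
    unfolding sobolev_norm_eq[OF hv] by (simp add: L2_norm_def)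
  ultimately show "norm (sobolev_pairing u v) \<le> sobolev_norm s u * sobolev_norm (- s) v"
    unfolding fg F(2) G(2) sobolev_pairing_eq[OF hu hv] sobolev_norm_eq[OF hu] by simp
qed

text \<open>The centres of the balls range over the whole space, not only over the support, because
  potentials are also evaluated at points off it.\<close>

locale growth_measure = finite_measure M for M :: "'a::euclidean_space measure" +
  fixes c d :: real
  assumes id_measurable [measurable]: "(\<lambda>x. x) \<in> borel_measurable M"
    and growth: "\<And>x r. 0 < r \<Longrightarrow> r \<le> 1 \<Longrightarrow> measure M {y \<in> space M. dist x y \<le> r} \<le> c * r powr d"
    and dim: "DIM('a) \<le> 2" "real DIM('a) - 1 < d" "d \<le> real DIM('a)"
begin

text \<open>The midpoint of the interval from n - 1 to d. Bounded Riesz potentials need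
  \<open>\<beta> < d\<close>; the dyadic sum in \<open>energy\<close> and the ambient integral in
  \<open>ambient_riesz\<close> converge because n - 1 < \<open>\<beta>\<close>.\<close>

definition \<beta> :: real where "\<beta> = (d + real DIM('a) - 1) / 2"

lemma beta: "0 < \<beta>" "real DIM('a) - 1 < \<beta>" "\<beta> < d" "\<beta> \<le> 2" "0 < d"
proof -
  define n where "n = real DIM('a)"
  have "1 \<le> n" using DIM_positive[where 'a='a] unfolding n_def by linarith
  moreover have "n \<le> 2" "n - 1 < d" "d \<le> n" using dim by (simp_all add: n_def)
  ultimately have "0 < (d + n - 1) / 2" "n - 1 < (d + n - 1) / 2" "(d + n - 1) / 2 < d" "(d + n - 1) / 2 \<le> 2" "0 < d" by auto
  then show "0 < \<beta>" "real DIM('a) - 1 < \<beta>" "\<beta> < d" "\<beta> \<le> 2" "0 < d" unfolding \<beta>_def n_def .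
qed

definition rconst :: "real \<Rightarrow> real" where
  "rconst b = measure M (space M) + c * 2 powr b / (1 - 2 powr (b - d))"

lemma riesz_le: "0 < b \<Longrightarrow> b < d \<Longrightarrow> (\<integral>\<^sup>+y. ennreal (dist x y powr (- b)) \<partial>M) \<le> ennreal (rconst b)"
  unfolding rconst_def by (rule riesz_potential_bound) (use growth in \<open>auto intro: finite_measure_axioms\<close>)

lemma c_nonneg: "0 \<le> c"
  using order_trans[OF measure_nonneg growth[of 1]] by simp

lemma rconst_nonneg: "b < d \<Longrightarrow> 0 \<le> rconst b"
  unfolding rconst_def using c_nonneg powr_less_mono[of "b - d" 0 2] by simp

text \<open>Let r tend to 0 in the growth condition. Consequently the diagonal, where singular
  kernels only have a default value, is negligible.\<close>

lemma AE_neq: "AE y in M. y \<noteq> x"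
proof -
  let ?A = "{y \<in> space M. y = x}"
  have "measure M ?A \<le> c * (1 / Suc n) powr d" for n
    by (rule order_trans[OF finite_measure_mono growth[of "1 / Suc n" x]]) auto
  moreover have "(\<lambda>n. c * (1 / Suc n) powr d) \<longlonglongrightarrow> c * 0 powr d"
    using beta(5) by (intro tendsto_intros LIMSEQ_Suc[OF lim_1_over_n]) auto
  ultimately have "measure M ?A \<le> 0" using beta(5) by (intro LIMSEQ_le_const[of _ _ "measure M ?A"]) auto
  then have "measure M ?A = 0" by (simp only: measure_le_0_iff)
  then have "emeasure M ?A = 0" by (simp only: emeasure_eq_measure ennreal_0)
  moreover have "?A = (\<lambda>x. x) -` {x} \<inter> space M" by auto
  then have "?A \<in> sets M" using measurable_sets[OF id_measurable, of "{x}"] by simp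
  ultimately show ?thesis by (intro AE_I[where N = ?A]) auto
qed

lemma integrable_L2: "\<Psi> \<in> L2 M \<Longrightarrow> integrable M \<Psi>"
  using L2_mult_integrable[of \<Psi> M "\<lambda>_. 1"] by (simp add: L2_def)

lemma bounded_L2: "\<Psi> \<in> borel_measurable M \<Longrightarrow> (\<And>x. x \<in> space M \<Longrightarrow> norm (\<Psi> x) \<le> C) \<Longrightarrow> \<Psi> \<in> L2 M"
  by (rule L2I_bound[where w = "\<lambda>x. C\<^sup>2"]) (auto intro!: power_mono)

lemma mfourier_measurable [measurable]:
  assumes "\<Psi> \<in> L2 M" shows "mfourier M \<Psi> \<in> borel_measurable borel"
proof -
  note [measurable] = L2D(1)[OF assms]
  show ?thesis unfolding mfourier_def[abs_def] by measurable
qed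

lemma mfourier_le: "\<Psi> \<in> L2 M \<Longrightarrow> norm (mfourier M \<Psi> \<xi>) \<le> fconst TYPE('a) * (LINT x|M. norm (\<Psi> x))"
  unfolding mfourier_def norm_mult
  using norm_integral_le[of M "\<lambda>x. ek \<xi> x * \<Psi> x" "\<lambda>x. norm (\<Psi> x)"] integrable_ek[OF integrable_L2 id_measurable, of \<Psi> \<xi>] integrable_L2
  by (simp add: norm_mult)

lemma has_fourier_mdistr:
  assumes \<Psi>: "\<Psi> \<in> L2 M" shows "has_fourier (mdistr M \<Psi>) (mfourier M \<Psi>)"
  unfolding has_fourier_def
proof (intro conjI ballI mfourier_measurable \<Psi>)
  note i = integrable_L2[OF \<Psi>]
  have fm: "f \<in> borel_measurable M" if "f \<in> schwartz" for f :: "'a \<Rightarrow> complex"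
    using measurable_compose[OF id_measurable schwartz_measurable[OF that]] .
  have fi: "integrable M (\<lambda>x. f x * \<Psi> x)" "norm (LINT x|M. f x * \<Psi> x) \<le> (LINT x|M. norm (\<Psi> x)) * schwartz_seminorm 0 f"
    if f: "f \<in> schwartz" for f
  proof -
    have b: "norm (f x) \<le> schwartz_seminorm 0 f" for x using schwartz_seminorm_ge[OF f, of x 0] by simp
    show fi: "integrable M (\<lambda>x. f x * \<Psi> x)"
      by (rule Bochner_Integration.integrable_bound[OF integrable_mult_right[OF integrable_norm[OF i], of "schwartz_seminorm 0 f"]])
        (use b schwartz_seminorm_nonneg[OF f, of 0] fm[OF f] i in \<open>auto simp: norm_mult abs_mult intro!: AE_I2 mult_right_mono\<close>)
    have "norm (LINT x|M. f x * \<Psi> x) \<le> (LINT x|M. schwartz_seminorm 0 f * norm (\<Psi> x))"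
      by (rule norm_integral_le[OF fi]) (use b i in \<open>auto simp: norm_mult intro!: mult_right_mono\<close>)
    then show "norm (LINT x|M. f x * \<Psi> x) \<le> (LINT x|M. norm (\<Psi> x)) * schwartz_seminorm 0 f" by (simp add: mult.commute)
  qed
  show "mdistr M \<Psi> \<in> tempered"
    unfolding tempered_def mem_Collect_eq
  proof (intro conjI ballI allI impI)
    show "mdistr M \<Psi> g = 0" if "g \<notin> schwartz" for g using that by (simp add: mdistr_def)
    show "mdistr M \<Psi> (\<lambda>x. g x + h x) = mdistr M \<Psi> g + mdistr M \<Psi> h" if "g \<in> schwartz" "h \<in> schwartz" for g h
      using that fi(1) by (simp add: mdistr_def schwartz_add distrib_right)
    show "mdistr M \<Psi> (\<lambda>x. c * g x) = c * mdistr M \<Psi> g" if "g \<in> schwartz" for c g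
      using that by (simp add: mdistr_def schwartz_cmult mult.assoc)
    show "\<exists>C N. \<forall>f\<in>schwartz. norm (mdistr M \<Psi> f) \<le> C * schwartz_seminorm N f"
      using fi(2) by (auto simp: mdistr_def)
  qed
  fix f :: "'a \<Rightarrow> complex" assume f: "f \<in> schwartz"
  have eq: "(LINT \<xi>|lborel. LINT x|M. ek \<xi> x * f \<xi> * \<Psi> x) = (LINT x|M. LINT \<xi>|lborel. ek \<xi> x * f \<xi> * \<Psi> x)"
    by (rule Fubini_bounded_kernel(1)[where C = 1, OF lborel.sigma_finite_measure_axioms sigma_finite_measure_axioms schwartz_integrable[OF f] i]) auto
  have "f \<xi> * mfourier M \<Psi> \<xi> = of_real (fconst TYPE('a)) * (LINT x|M. ek \<xi> x * f \<xi> * \<Psi> x)" for \<xi>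
  proof -
    have "(LINT x|M. ek \<xi> x * f \<xi> * \<Psi> x) = (LINT x|M. f \<xi> * (ek \<xi> x * \<Psi> x))" by (simp add: mult_ac)
    then show ?thesis by (simp add: mfourier_def)
  qed
  then have l: "mfourier M \<Psi> \<xi> * f \<xi> = of_real (fconst TYPE('a)) * (LINT x|M. ek \<xi> x * f \<xi> * \<Psi> x)" for \<xi>
    by (simp add: mult.commute)
  show "integrable lborel (\<lambda>\<xi>. mfourier M \<Psi> \<xi> * f \<xi>)"
    unfolding l
    by (intro integrable_mult_right Fubini_bounded_kernel(2)[where C = 1, OF lborel.sigma_finite_measure_axioms sigma_finite_measure_axioms schwartz_integrable[OF f] i]) auto
  have "fourier f x * \<Psi> x = of_real (fconst TYPE('a)) * (LINT \<xi>|lborel. ek \<xi> x * f \<xi> * \<Psi> x)" for x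
  proof -
    have "(LINT \<xi>|lborel. ek \<xi> x * f \<xi> * \<Psi> x) = (LINT \<xi>|lborel. ek \<xi> x * f \<xi>) * \<Psi> x"
      by (rule integral_mult_left_zero)
    moreover have "(LINT \<xi>|lborel. ek x \<xi> * f \<xi>) = (LINT \<xi>|lborel. ek \<xi> x * f \<xi>)" by (simp add: ek_commute[of x])
    ultimately show ?thesis unfolding fourier_ek by (simp only: mult.assoc)
  qed
  then have "(LINT x|M. fourier f x * \<Psi> x) = of_real (fconst TYPE('a)) * (LINT x|M. LINT \<xi>|lborel. ek \<xi> x * f \<xi> * \<Psi> x)"
    by (simp only: integral_mult_right_zero)
  then show "mdistr M \<Psi> (fourier f) = (LINT \<xi>|lborel. mfourier M \<Psi> \<xi> * f \<xi>)"
    unfolding l integral_mult_right_zero eq using f by (simp only: mdistr_def fourier_schwartz if_True)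
qed

text \<open>Inserting the definition of the transform twice and integrating out \<xi> gives a double
  integral over M of a Gaussian at length scale \<epsilon>; the factor (1/\<epsilon>)^n belongs to
  the transform of the scaled Gaussian. Off the diagonal that Gaussian is at most 2 (|x - y| /
  \<epsilon>)^(-\<beta>), which contributes the power of \<epsilon> and a bounded Riesz
  potential.\<close>

lemma gauss_energy:
  assumes \<Psi>: "\<Psi> \<in> L2 M" and \<epsilon>: "0 < \<epsilon>"
  shows "(\<integral>\<^sup>+\<xi>. ennreal (gauss (\<epsilon> *\<^sub>R \<xi>) * (norm (mfourier M \<Psi> \<xi>))\<^sup>2) \<partial>lborel) \<le>
    ennreal (2 * fconst TYPE('a) * rconst \<beta> * (1 / \<epsilon>) ^ DIM('a) * \<epsilon> powr \<beta> * (L2_norm M \<Psi>)\<^sup>2)"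
proof -
  let ?c = "fconst TYPE('a)" and ?N = "DIM('a)"
  note i = integrable_L2[OF \<Psi>]
  note [measurable] = L2D(1)[OF \<Psi>] mfourier_measurable[OF \<Psi>]
  have [measurable]: "cnj \<in> borel_measurable borel" by (intro borel_measurable_continuous_onI continuous_intros)
  have ig: "integrable lborel (\<lambda>\<xi>::'a. gauss (\<epsilon> *\<^sub>R \<xi>))"
    using lborel_integrable_affine[of \<epsilon> "gauss :: 'a \<Rightarrow> real" 0] integrable_gauss \<epsilon> by simp
  then have igc: "integrable lborel (\<lambda>\<xi>::'a. complex_of_real (gauss (\<epsilon> *\<^sub>R \<xi>)))" by (rule integrable_of_real)
  obtain B where B: "\<And>\<xi>. norm (mfourier M \<Psi> \<xi>) \<le> B" using mfourier_le[OF \<Psi>] by blast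
  have igv: "integrable lborel (\<lambda>\<xi>. complex_of_real (gauss (\<epsilon> *\<^sub>R \<xi>)) * cnj (mfourier M \<Psi> \<xi>))"
    by (rule Bochner_Integration.integrable_bound[OF integrable_mult_left[OF ig, of B]])
      (use B in \<open>auto simp: norm_mult abs_of_pos[OF gauss_pos] abs_mult intro!: AE_I2 mult_left_mono order_trans[OF B abs_ge_self] less_imp_le[OF gauss_pos]\<close>)
  let ?G = "\<lambda>x y. gauss ((1 / \<epsilon>) *\<^sub>R (x - y))"
  have inner: "(LINT \<xi>|lborel. ek \<xi> x * (of_real (gauss (\<epsilon> *\<^sub>R \<xi>)) * cnj (mfourier M \<Psi> \<xi>))) =
      of_real ((1 / \<epsilon>) ^ ?N) * (LINT y|M. of_real (?G x y) * cnj (\<Psi> y))" for x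
  proof -
    have "(LINT \<xi>|lborel. ek \<xi> x * (of_real (gauss (\<epsilon> *\<^sub>R \<xi>)) * cnj (mfourier M \<Psi> \<xi>))) =
        of_real ?c * (LINT \<xi>|lborel. LINT y|M. ek \<xi> (x - y) * of_real (gauss (\<epsilon> *\<^sub>R \<xi>)) * cnj (\<Psi> y))"
    proof -
      have "ek \<xi> x * (of_real (gauss (\<epsilon> *\<^sub>R \<xi>)) * cnj (mfourier M \<Psi> \<xi>)) = of_real ?c * (LINT y|M. ek \<xi> (x - y) * of_real (gauss (\<epsilon> *\<^sub>R \<xi>)) * cnj (\<Psi> y))" for \<xi>
      proof -
        have "ek \<xi> (x - y) = ek \<xi> x * cnj (ek \<xi> y)" for y using ek_add[of \<xi> x "- y"] by (simp add: cnj_ek ek_uminus)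
        then have "(LINT y|M. ek \<xi> (x - y) * of_real (gauss (\<epsilon> *\<^sub>R \<xi>)) * cnj (\<Psi> y)) = (LINT y|M. (ek \<xi> x * of_real (gauss (\<epsilon> *\<^sub>R \<xi>))) * cnj (ek \<xi> y * \<Psi> y))"
          by (simp add: mult_ac)
        also have "\<dots> = ek \<xi> x * of_real (gauss (\<epsilon> *\<^sub>R \<xi>)) * cnj (LINT y|M. ek \<xi> y * \<Psi> y)"
          unfolding Bochner_Integration.integral_cnj[symmetric] by (rule integral_mult_right_zero)
        finally show ?thesis by (simp add: mfourier_def)
      qed
      then show ?thesis by simp
    qed
    also have "(LINT \<xi>|lborel. LINT y|M. ek \<xi> (x - y) * of_real (gauss (\<epsilon> *\<^sub>R \<xi>)) * cnj (\<Psi> y)) =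
        (LINT y|M. LINT \<xi>|lborel. ek \<xi> (x - y) * of_real (gauss (\<epsilon> *\<^sub>R \<xi>)) * cnj (\<Psi> y))"
      by (rule Fubini_bounded_kernel(1)[where C = 1, OF lborel.sigma_finite_measure_axioms sigma_finite_measure_axioms igc])
        (use i in auto)
    also have "\<dots> = (LINT y|M. of_real (1 / ?c * (1 / \<epsilon>) ^ ?N) * (of_real (?G x y) * cnj (\<Psi> y)))"
    proof (rule Bochner_Integration.integral_cong[OF refl])
      fix y
      have e: "(LINT \<xi>|lborel. ek \<xi> (x - y) * of_real (gauss (\<epsilon> *\<^sub>R \<xi>))) = of_real (1 / ?c * (1 / \<epsilon>) ^ ?N * ?G x y)"
        using integral_ek_gauss_scaled[OF \<epsilon>, of "x - y"] by (simp add: ek_commute[of "x - y"])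
      then show "(LINT \<xi>|lborel. ek \<xi> (x - y) * of_real (gauss (\<epsilon> *\<^sub>R \<xi>)) * cnj (\<Psi> y)) = of_real (1 / ?c * (1 / \<epsilon>) ^ ?N) * (of_real (?G x y) * cnj (\<Psi> y))"
        unfolding integral_mult_left_zero e by (simp add: mult.assoc)
    qed
    finally show ?thesis unfolding integral_mult_right_zero by simp
  qed
  have "complex_of_real (LINT \<xi>|lborel. gauss (\<epsilon> *\<^sub>R \<xi>) * (norm (mfourier M \<Psi> \<xi>))\<^sup>2) =
      (LINT \<xi>|lborel. of_real (gauss (\<epsilon> *\<^sub>R \<xi>)) * (mfourier M \<Psi> \<xi> * cnj (mfourier M \<Psi> \<xi>)))"
    unfolding integral_complex_of_real[symmetric] by (simp add: complex_norm_square del: of_real_power)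
  also have "\<dots> = of_real ?c * (LINT \<xi>|lborel. LINT x|M. ek \<xi> x * (of_real (gauss (\<epsilon> *\<^sub>R \<xi>)) * cnj (mfourier M \<Psi> \<xi>)) * \<Psi> x)"
  proof -
    have "of_real (gauss (\<epsilon> *\<^sub>R \<xi>)) * (mfourier M \<Psi> \<xi> * cnj (mfourier M \<Psi> \<xi>)) = of_real ?c * (LINT x|M. ek \<xi> x * (of_real (gauss (\<epsilon> *\<^sub>R \<xi>)) * cnj (mfourier M \<Psi> \<xi>)) * \<Psi> x)" for \<xi>
    proof -
      have "(LINT x|M. ek \<xi> x * (of_real (gauss (\<epsilon> *\<^sub>R \<xi>)) * cnj (mfourier M \<Psi> \<xi>)) * \<Psi> x) = (LINT x|M. (of_real (gauss (\<epsilon> *\<^sub>R \<xi>)) * cnj (mfourier M \<Psi> \<xi>)) * (ek \<xi> x * \<Psi> x))"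
        by (simp add: mult_ac)
      also have "\<dots> = (of_real (gauss (\<epsilon> *\<^sub>R \<xi>)) * cnj (mfourier M \<Psi> \<xi>)) * (LINT x|M. ek \<xi> x * \<Psi> x)" by (rule integral_mult_right_zero)
      finally show ?thesis by (simp add: mfourier_def[of M \<Psi> \<xi>] mult_ac)
    qed
    then show ?thesis by simp
  qed
  also have "(LINT \<xi>|lborel. LINT x|M. ek \<xi> x * (of_real (gauss (\<epsilon> *\<^sub>R \<xi>)) * cnj (mfourier M \<Psi> \<xi>)) * \<Psi> x) =
      (LINT x|M. LINT \<xi>|lborel. ek \<xi> x * (of_real (gauss (\<epsilon> *\<^sub>R \<xi>)) * cnj (mfourier M \<Psi> \<xi>)) * \<Psi> x)"
    by (rule Fubini_bounded_kernel(1)[where C = 1, OF lborel.sigma_finite_measure_axioms sigma_finite_measure_axioms igv i]) auto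
  also have "\<dots> = (LINT x|M. of_real ((1 / \<epsilon>) ^ ?N) * (LINT y|M. of_real (?G x y) * cnj (\<Psi> y)) * \<Psi> x)"
    by (simp add: inner)
  finally have e1: "complex_of_real (LINT \<xi>|lborel. gauss (\<epsilon> *\<^sub>R \<xi>) * (norm (mfourier M \<Psi> \<xi>))\<^sup>2) =
    of_real ?c * (LINT x|M. of_real ((1 / \<epsilon>) ^ ?N) * (LINT y|M. of_real (?G x y) * cnj (\<Psi> y)) * \<Psi> x)" .
  have i2: "integrable lborel (\<lambda>\<xi>. gauss (\<epsilon> *\<^sub>R \<xi>) * (norm (mfourier M \<Psi> \<xi>))\<^sup>2)"
    by (rule Bochner_Integration.integrable_bound[OF integrable_mult_left[OF ig, of "B\<^sup>2"]])
      (use B in \<open>auto simp: abs_mult abs_of_pos[OF gauss_pos] intro!: AE_I2 mult_left_mono power_mono less_imp_le[OF gauss_pos]\<close>)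
  let ?K = "?c * (1 / \<epsilon>) ^ ?N"
  have K0: "0 \<le> ?K" using \<epsilon> by simp
  have Gle: "(\<integral>\<^sup>+y. ennreal (?G x y) \<partial>M) \<le> ennreal (2 * \<epsilon> powr \<beta> * rconst \<beta>)" for x
  proof -
    have "(\<integral>\<^sup>+y. ennreal (?G x y) \<partial>M) \<le> (\<integral>\<^sup>+y. ennreal (2 * \<epsilon> powr \<beta>) * ennreal (dist x y powr (- \<beta>)) \<partial>M)"
    proof (rule nn_integral_mono_AE)
      show "AE y in M. ennreal (?G x y) \<le> ennreal (2 * \<epsilon> powr \<beta>) * ennreal (dist x y powr (- \<beta>))"
        using AE_neq[of x]
      proof eventually_elim
        fix y assume "y \<noteq> x"
        then have "?G x y \<le> 2 * norm ((1 / \<epsilon>) *\<^sub>R (x - y)) powr (- \<beta>)" using \<epsilon> beta by (intro gauss_le_powr) auto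
        also have "norm ((1 / \<epsilon>) *\<^sub>R (x - y)) powr (- \<beta>) = (1 / \<epsilon>) powr (- \<beta>) * dist x y powr (- \<beta>)"
          using \<epsilon> by (simp add: powr_mult[symmetric] dist_norm)
        also have "(1 / \<epsilon>) powr (- \<beta>) = \<epsilon> powr \<beta>" using \<epsilon> by (simp add: powr_divide powr_minus)
        finally show "ennreal (?G x y) \<le> ennreal (2 * \<epsilon> powr \<beta>) * ennreal (dist x y powr (- \<beta>))"
          by (simp add: ennreal_mult[symmetric] ennreal_leI mult.assoc)
      qed
    qed
    also have "\<dots> = ennreal (2 * \<epsilon> powr \<beta>) * (\<integral>\<^sup>+y. ennreal (dist x y powr (- \<beta>)) \<partial>M)" by (rule nn_integral_cmult) measurable
    also have "\<dots> \<le> ennreal (2 * \<epsilon> powr \<beta>) * ennreal (rconst \<beta>)" using beta by (intro mult_left_mono riesz_le) auto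
    finally show ?thesis using rconst_nonneg[OF beta(3)] by (simp add: ennreal_mult[symmetric])
  qed
  have Gsym: "?G x y = ?G y x" for x y by (simp add: gauss_def norm_minus_commute)
  interpret MM: pair_sigma_finite M M ..
  \<comment> \<open>Schur test based on a b <= a^2/2 + b^2/2: by symmetry of the kernel both halves
    reduce to its row integrals, which \<open>Gle\<close> bounds by \<open>?S\<close>.\<close>
  let ?S = "ennreal (2 * \<epsilon> powr \<beta> * rconst \<beta>)"
  have "(\<integral>\<^sup>+x. (\<integral>\<^sup>+y. ennreal (norm (\<Psi> x) * norm (\<Psi> y) * ?G x y) \<partial>M) \<partial>M) \<le>
      (\<integral>\<^sup>+x. (\<integral>\<^sup>+y. ennreal ((norm (\<Psi> x))\<^sup>2 / 2) * ennreal (?G x y) + ennreal ((norm (\<Psi> y))\<^sup>2 / 2) * ennreal (?G x y) \<partial>M) \<partial>M)"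
  proof (intro nn_integral_mono)
    fix x y
    have "norm (\<Psi> x) * norm (\<Psi> y) \<le> (norm (\<Psi> x))\<^sup>2 / 2 + (norm (\<Psi> y))\<^sup>2 / 2"
      using sum_squares_bound[of "norm (\<Psi> x)" "norm (\<Psi> y)"] by simp
    then have "norm (\<Psi> x) * norm (\<Psi> y) * ?G x y \<le> ((norm (\<Psi> x))\<^sup>2 / 2 + (norm (\<Psi> y))\<^sup>2 / 2) * ?G x y"
      by (intro mult_right_mono less_imp_le[OF gauss_pos])
    then show "ennreal (norm (\<Psi> x) * norm (\<Psi> y) * ?G x y) \<le> ennreal ((norm (\<Psi> x))\<^sup>2 / 2) * ennreal (?G x y) + ennreal ((norm (\<Psi> y))\<^sup>2 / 2) * ennreal (?G x y)"
      by (simp add: ennreal_mult[symmetric] ennreal_plus[symmetric] less_imp_le[OF gauss_pos] distrib_right ennreal_leI del: ennreal_plus)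
  qed
  also have "\<dots> = (\<integral>\<^sup>+x. ennreal ((norm (\<Psi> x))\<^sup>2 / 2) * (\<integral>\<^sup>+y. ennreal (?G x y) \<partial>M) \<partial>M) +
      (\<integral>\<^sup>+x. (\<integral>\<^sup>+y. ennreal ((norm (\<Psi> y))\<^sup>2 / 2) * ennreal (?G x y) \<partial>M) \<partial>M)"
    by (subst nn_integral_add[symmetric]) (auto simp: nn_integral_add nn_integral_cmult)
  also have "(\<integral>\<^sup>+x. (\<integral>\<^sup>+y. ennreal ((norm (\<Psi> y))\<^sup>2 / 2) * ennreal (?G x y) \<partial>M) \<partial>M) =
      (\<integral>\<^sup>+y. (\<integral>\<^sup>+x. ennreal ((norm (\<Psi> y))\<^sup>2 / 2) * ennreal (?G x y) \<partial>M) \<partial>M)"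
    by (rule MM.Fubini'[symmetric]) measurable
  also have "\<dots> = (\<integral>\<^sup>+y. ennreal ((norm (\<Psi> y))\<^sup>2 / 2) * (\<integral>\<^sup>+x. ennreal (?G y x) \<partial>M) \<partial>M)"
    by (simp add: nn_integral_cmult Gsym)
  also have "(\<integral>\<^sup>+x. ennreal ((norm (\<Psi> x))\<^sup>2 / 2) * (\<integral>\<^sup>+y. ennreal (?G x y) \<partial>M) \<partial>M) + \<dots> \<le>
      (\<integral>\<^sup>+x. ennreal ((norm (\<Psi> x))\<^sup>2 / 2) * ?S \<partial>M) + (\<integral>\<^sup>+x. ennreal ((norm (\<Psi> x))\<^sup>2 / 2) * ?S \<partial>M)"
    by (intro add_mono nn_integral_mono mult_left_mono Gle) auto
  also have "\<dots> = (\<integral>\<^sup>+x. ennreal ((norm (\<Psi> x))\<^sup>2) * ?S \<partial>M)"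
    by (subst nn_integral_add[symmetric]) (auto simp: distrib_right[symmetric] ennreal_plus[symmetric] simp del: ennreal_plus)
  also have "\<dots> = ennreal ((L2_norm M \<Psi>)\<^sup>2) * ?S" by (simp add: nn_integral_multc L2_norm_nn[OF \<Psi>])
  finally have dbl: "(\<integral>\<^sup>+x. (\<integral>\<^sup>+y. ennreal (norm (\<Psi> x) * norm (\<Psi> y) * ?G x y) \<partial>M) \<partial>M) \<le> ennreal ((L2_norm M \<Psi>)\<^sup>2) * ?S" .
  have "ennreal (LINT \<xi>|lborel. gauss (\<epsilon> *\<^sub>R \<xi>) * (norm (mfourier M \<Psi> \<xi>))\<^sup>2) \<le>
      ennreal (norm (of_real ?c * (LINT x|M. of_real ((1 / \<epsilon>) ^ ?N) * (LINT y|M. of_real (?G x y) * cnj (\<Psi> y)) * \<Psi> x)))"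
    unfolding e1[symmetric] by (intro ennreal_leI) simp
  also have "\<dots> = ennreal ?K * ennreal (norm (LINT x|M. (LINT y|M. of_real (?G x y) * cnj (\<Psi> y)) * \<Psi> x))"
    using \<epsilon> by (simp add: mult.assoc norm_mult norm_power norm_divide ennreal_mult[symmetric])
  also have "\<dots> \<le> ennreal ?K * (\<integral>\<^sup>+x. (\<integral>\<^sup>+y. ennreal (norm (\<Psi> x) * norm (\<Psi> y) * ?G x y) \<partial>M) \<partial>M)"
  proof (intro mult_left_mono)
    have "ennreal (norm (LINT x|M. (LINT y|M. of_real (?G x y) * cnj (\<Psi> y)) * \<Psi> x)) \<le> (\<integral>\<^sup>+x. ennreal (norm ((LINT y|M. of_real (?G x y) * cnj (\<Psi> y)) * \<Psi> x)) \<partial>M)"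
    \<comment> \<open>A function that is not integrable has integral 0 by convention, so the bound
      is trivial for it.\<close>
    proof (cases "integrable M (\<lambda>x. (LINT y|M. of_real (?G x y) * cnj (\<Psi> y)) * \<Psi> x)")
      case False then show ?thesis by (simp add: not_integrable_integral_eq)
    qed (rule integral_norm_bound_ennreal)
    also have "\<dots> \<le> (\<integral>\<^sup>+x. (\<integral>\<^sup>+y. ennreal (norm (\<Psi> x) * norm (\<Psi> y) * ?G x y) \<partial>M) \<partial>M)"
    proof (rule nn_integral_mono)
      fix x
      have ii: "integrable M (\<lambda>y. of_real (?G x y) * cnj (\<Psi> y))"
        by (rule Bochner_Integration.integrable_bound[OF i])
          (auto simp: norm_mult abs_of_pos[OF gauss_pos] intro!: AE_I2 mult_left_le_one_le less_imp_le[OF gauss_pos] gauss_le_1)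
      have "ennreal (norm (LINT y|M. of_real (?G x y) * cnj (\<Psi> y))) * ennreal (norm (\<Psi> x)) \<le> (\<integral>\<^sup>+y. ennreal (norm (complex_of_real (?G x y) * cnj (\<Psi> y))) \<partial>M) * ennreal (norm (\<Psi> x))"
        by (intro mult_right_mono integral_norm_bound_ennreal ii) auto
      also have "\<dots> = (\<integral>\<^sup>+y. ennreal (norm (complex_of_real (?G x y) * cnj (\<Psi> y))) * ennreal (norm (\<Psi> x)) \<partial>M)"
        by (rule nn_integral_multc[symmetric]) measurable
      also have "\<dots> = (\<integral>\<^sup>+y. ennreal (norm (\<Psi> x) * norm (\<Psi> y) * ?G x y) \<partial>M)"
        by (intro nn_integral_cong) (simp add: norm_mult abs_of_pos[OF gauss_pos] ennreal_mult[symmetric] less_imp_le[OF gauss_pos] mult_ac)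
      finally show "ennreal (norm ((LINT y|M. of_real (?G x y) * cnj (\<Psi> y)) * \<Psi> x)) \<le> (\<integral>\<^sup>+y. ennreal (norm (\<Psi> x) * norm (\<Psi> y) * ?G x y) \<partial>M)"
        by (simp add: norm_mult ennreal_mult)
    qed
    finally show "ennreal (norm (LINT x|M. (LINT y|M. of_real (?G x y) * cnj (\<Psi> y)) * \<Psi> x)) \<le> (\<integral>\<^sup>+x. (\<integral>\<^sup>+y. ennreal (norm (\<Psi> x) * norm (\<Psi> y) * ?G x y) \<partial>M) \<partial>M)" .
  qed simp
  also have "\<dots> \<le> ennreal ?K * (ennreal ((L2_norm M \<Psi>)\<^sup>2) * ?S)" by (intro mult_left_mono dbl) simp
  also have "\<dots> = ennreal (2 * ?c * rconst \<beta> * (1 / \<epsilon>) ^ ?N * \<epsilon> powr \<beta> * (L2_norm M \<Psi>)\<^sup>2)"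
    using K0 rconst_nonneg[OF beta(3)] by (simp add: ennreal_mult[symmetric] mult_ac)
  finally show ?thesis
    by (subst nn_integral_eq_integral[OF i2]) (auto simp: less_imp_le[OF gauss_pos])
qed

end

section \<open>Traces\<close>

context growth_measure
begin

text \<open>For \<epsilon> = 2^(-j), the factor 2^(-j) of the dyadic weight and the factor
  \<epsilon>^(\<beta> - n) of \<open>gauss_energy\<close> multiply to the j-th power of 2^(n - 1 -
  \<beta>) < 1. The constant is the square root of the resulting geometric series, with
  \<open>exp 2\<close> from \<open>weight_le_gauss_sum\<close>.\<close>

definition econst :: real where
  "econst = sqrt (exp 2 * 2 * fconst TYPE('a) * rconst \<beta> / (1 - 2 powr (real DIM('a) - 1 - \<beta>)))"

lemma econst_nonneg: "0 \<le> econst"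
  unfolding econst_def using rconst_nonneg[OF beta(3)] beta(2) powr_less_mono[of "real DIM('a) - 1 - \<beta>" 0 2] by simp

lemma energy:
  assumes \<Psi>: "\<Psi> \<in> L2 M"
  shows "mfourier M \<Psi> \<in> L2 (wgt (- 1/2))" "L2_norm (wgt (- 1/2)) (mfourier M \<Psi>) \<le> econst * L2_norm M \<Psi>"
proof -
  let ?v = "mfourier M \<Psi>" and ?N = "DIM('a)" and ?w = "\<lambda>\<xi>::'a. (1 + (norm \<xi>)\<^sup>2) powr (- 1/2)"
  note [measurable] = mfourier_measurable[OF \<Psi>]
  let ?K = "exp 2 * 2 * fconst TYPE('a) * rconst \<beta> * (L2_norm M \<Psi>)\<^sup>2" and ?q = "2 powr (real ?N - 1 - \<beta>)"
  have q: "?q < 1" using beta(2) powr_less_mono[of "real ?N - 1 - \<beta>" 0 2] by simp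
  have K0: "0 \<le> ?K" using rconst_nonneg[OF beta(3)] by simp
  have "(\<integral>\<^sup>+\<xi>. ennreal (?w \<xi> * (norm (?v \<xi>))\<^sup>2) \<partial>lborel) \<le>
      (\<integral>\<^sup>+\<xi>. (\<Sum>j. ennreal (exp 2 * (1/2) ^ j) * ennreal (gauss ((1/2) ^ j *\<^sub>R \<xi>) * (norm (?v \<xi>))\<^sup>2)) \<partial>lborel)"
  proof (rule nn_integral_mono)
    fix \<xi> :: 'a
    have "ennreal (?w \<xi> * (norm (?v \<xi>))\<^sup>2) \<le> (\<Sum>j. ennreal (exp 2 * (1/2) ^ j * gauss ((1/2) ^ j *\<^sub>R \<xi>))) * ennreal ((norm (?v \<xi>))\<^sup>2)"
      unfolding ennreal_mult[OF less_imp_le[OF weight_pos] zero_le_power2] by (intro mult_right_mono weight_le_gauss_sum) simp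
    also have "\<dots> = (\<Sum>j. ennreal (exp 2 * (1/2) ^ j * gauss ((1/2) ^ j *\<^sub>R \<xi>)) * ennreal ((norm (?v \<xi>))\<^sup>2))" by simp
    also have "\<dots> = (\<Sum>j. ennreal (exp 2 * (1/2) ^ j) * ennreal (gauss ((1/2) ^ j *\<^sub>R \<xi>) * (norm (?v \<xi>))\<^sup>2))"
      by (intro suminf_cong) (simp add: ennreal_mult[symmetric] less_imp_le[OF gauss_pos] mult.assoc)
    finally show "ennreal (?w \<xi> * (norm (?v \<xi>))\<^sup>2) \<le> \<dots>" .
  qed
  also have "\<dots> = (\<Sum>j. ennreal (exp 2 * (1/2) ^ j) * (\<integral>\<^sup>+\<xi>. ennreal (gauss ((1/2) ^ j *\<^sub>R \<xi>) * (norm (?v \<xi>))\<^sup>2) \<partial>lborel))"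
    by (subst nn_integral_suminf) (auto simp: nn_integral_cmult)
  also have "\<dots> \<le> (\<Sum>j. ennreal (?K * ?q ^ j))"
  proof (intro suminf_le summableI)
    fix j
    have half: "(1/2) ^ j = 2 powr (- real j)" by (simp add: powr_minus powr_realpow power_one_over inverse_eq_divide)
    have e: "(1/2) ^ j * ((1 / (1/2) ^ j) ^ ?N * ((1/2) ^ j) powr \<beta>) = ?q ^ j"
    proof -
      have "(1 / (1/2) ^ j) ^ ?N = 2 powr (real j * real ?N)"
        by (simp add: power_one_over powr_realpow[symmetric] powr_powr power_mult[symmetric])
      then have "(1/2) ^ j * ((1 / (1/2) ^ j) ^ ?N * ((1/2) ^ j) powr \<beta>) = 2 powr (- real j + (real j * real ?N + - real j * \<beta>))"
        unfolding half by (simp only: powr_powr powr_add)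
      also have "- real j + (real j * real ?N + - real j * \<beta>) = (real ?N - 1 - \<beta>) * real j" by (simp add: algebra_simps)
      also have "2 powr \<dots> = ?q ^ j" by (simp only: powr_powr[symmetric] powr_realpow powr_gt_zero)
      finally show ?thesis .
    qed
    have "ennreal (exp 2 * (1/2) ^ j) * (\<integral>\<^sup>+\<xi>. ennreal (gauss ((1/2) ^ j *\<^sub>R \<xi>) * (norm (?v \<xi>))\<^sup>2) \<partial>lborel) \<le>
        ennreal (exp 2 * (1/2) ^ j) * ennreal (2 * fconst TYPE('a) * rconst \<beta> * (1 / (1/2) ^ j) ^ ?N * ((1/2) ^ j) powr \<beta> * (L2_norm M \<Psi>)\<^sup>2)"
      by (intro mult_left_mono gauss_energy \<Psi>) auto
    also have "\<dots> = ennreal (?K * ((1/2) ^ j * ((1 / (1/2) ^ j) ^ ?N * ((1/2) ^ j) powr \<beta>)))"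
      by (subst ennreal_mult'[symmetric]) (auto simp: mult_ac)
    also have "\<dots> = ennreal (?K * ?q ^ j)" unfolding e ..
    finally show "ennreal (exp 2 * (1/2) ^ j) * (\<integral>\<^sup>+\<xi>. ennreal (gauss ((1/2) ^ j *\<^sub>R \<xi>) * (norm (?v \<xi>))\<^sup>2) \<partial>lborel) \<le> ennreal (?K * ?q ^ j)" .
  qed
  also have "\<dots> = ennreal (?K * (1 / (1 - ?q)))"
  proof (intro sums_unique[symmetric] sums_ennreal[THEN iffD2])
    show "(\<lambda>j. ?K * ?q ^ j) sums (?K * (1 / (1 - ?q)))" using q by (intro sums_mult geometric_sums) simp
  qed (use K0 q in auto)
  also have "?K * (1 / (1 - ?q)) = (econst * L2_norm M \<Psi>)\<^sup>2"
    unfolding econst_def using rconst_nonneg[OF beta(3)] q by (simp add: power_mult_distrib)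
  finally have le: "(\<integral>\<^sup>+\<xi>. ennreal (?w \<xi> * (norm (?v \<xi>))\<^sup>2) \<partial>lborel) \<le> ennreal ((econst * L2_norm M \<Psi>)\<^sup>2)" .
  have i: "integrable lborel (\<lambda>\<xi>. ?w \<xi> * (norm (?v \<xi>))\<^sup>2)"
    by (rule integrableI_bounded) (use le in \<open>auto simp: abs_mult intro: le_less_trans\<close>)
  then show L: "?v \<in> L2 (wgt (- 1/2))" unfolding L2_wgt_iff by simp
  have "ennreal ((L2_norm (wgt (- 1/2)) ?v)\<^sup>2) \<le> ennreal ((econst * L2_norm M \<Psi>)\<^sup>2)"
    using le nn_integral_eq_integral[OF i] by (simp add: L2_norm_sq integral_wgt)
  then have "(L2_norm (wgt (- 1/2)) ?v)\<^sup>2 \<le> (econst * L2_norm M \<Psi>)\<^sup>2" by (simp only: ennreal_le_iff zero_le_power2)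
  then show "L2_norm (wgt (- 1/2)) ?v \<le> econst * L2_norm M \<Psi>" by (rule power2_le_imp_le) (simp add: econst_nonneg)
qed

lemma mdistr_sobolev: "\<Psi> \<in> L2 M \<Longrightarrow> mdistr M \<Psi> \<in> sobolev (- (1/2))"
  using energy(1) sobolev_iff[OF has_fourier_mdistr] by fastforce

lemma sobolev_norm_mdistr: "\<Psi> \<in> L2 M \<Longrightarrow> sobolev_norm (- (1/2)) (mdistr M \<Psi>) \<le> econst * L2_norm M \<Psi>"
  using energy(2) by (simp add: sobolev_norm_eq[OF has_fourier_mdistr])

lemma schwartz_L2: "f \<in> schwartz \<Longrightarrow> f \<in> L2 M"
  using schwartz_norm_le[of f] measurable_compose[OF id_measurable schwartz_measurable[of f]]
  by (metis bounded_L2)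

text \<open>The distribution is tested with the transform of \<open>cnj (fourier f)\<close>, which
  is cnj f by inversion. The conjugation at the end accounts for the antilinear second slot of the
  pairing.\<close>

lemma pairing_mdistr:
  assumes f: "f \<in> schwartz" and \<Psi>: "\<Psi> \<in> L2 M"
  shows "sobolev_pairing (distr_of f) (mdistr M \<Psi>) = (LINT x|M. f x * cnj (\<Psi> x))"
proof -
  let ?g = "\<lambda>\<xi>. cnj (fourier f \<xi>)"
  have g: "?g \<in> schwartz" by (intro schwartz_cnj fourier_schwartz f)
  have "fourier ?g x = cnj (f x)" for x
    using cnj_fourier[of "fourier f" "- x"] by (simp add: fourier_fourier f)
  then have "(LINT x|M. cnj (f x) * \<Psi> x) = mdistr M \<Psi> (fourier ?g)" by (simp add: mdistr_def fourier_schwartz g)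
  also have "\<dots> = (LINT \<xi>|lborel. mfourier M \<Psi> \<xi> * ?g \<xi>)"
    using has_fourier_mdistr[OF \<Psi>] g by (simp add: has_fourier_def)
  finally have e: "(LINT x|M. cnj (f x) * \<Psi> x) = (LINT \<xi>|lborel. mfourier M \<Psi> \<xi> * ?g \<xi>)" .
  have "sobolev_pairing (distr_of f) (mdistr M \<Psi>) = (LINT \<xi>|lborel. cnj (mfourier M \<Psi> \<xi> * ?g \<xi>))"
    unfolding sobolev_pairing_eq[OF has_fourier_distr_of[OF f] has_fourier_mdistr[OF \<Psi>]] by (simp add: mult.commute)
  also have "\<dots> = (LINT x|M. cnj (cnj (f x) * \<Psi> x))" unfolding Bochner_Integration.integral_cnj e ..
  finally show ?thesis by simp
qed

text \<open>Duality: \<open>\<phi>\<close> itself is used as density in the pairing.\<close>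

lemma trace_inequality:
  assumes \<phi>: "\<phi> \<in> schwartz"
  shows "L2_norm M \<phi> \<le> econst * sobolev_norm (1/2) (distr_of \<phi>)"
proof -
  note L = schwartz_L2[OF \<phi>]
  have "(LINT x|M. \<phi> x * cnj (\<phi> x)) = complex_of_real ((L2_norm M \<phi>)\<^sup>2)"
    unfolding L2_norm_sq integral_complex_of_real[symmetric] by (simp add: complex_norm_square del: of_real_power)
  then have "(L2_norm M \<phi>)\<^sup>2 = norm (sobolev_pairing (distr_of \<phi>) (mdistr M \<phi>))"
    unfolding pairing_mdistr[OF \<phi> L] by (simp del: of_real_power)
  also have "\<dots> \<le> sobolev_norm (1/2) (distr_of \<phi>) * sobolev_norm (- (1/2)) (mdistr M \<phi>)"
    by (rule sobolev_pairing_le(1)[OF distr_of_sobolev[OF \<phi>] mdistr_sobolev[OF L]])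
  also have "\<dots> \<le> sobolev_norm (1/2) (distr_of \<phi>) * (econst * L2_norm M \<phi>)"
    by (intro mult_left_mono sobolev_norm_mdistr L) simp
  finally have "L2_norm M \<phi> * L2_norm M \<phi> \<le> (econst * sobolev_norm (1/2) (distr_of \<phi>)) * L2_norm M \<phi>"
    by (simp add: power2_eq_square mult_ac)
  then show ?thesis
    by (cases "L2_norm M \<phi> = 0") (use L2_norm_nonneg[of M \<phi>] econst_nonneg in \<open>simp_all add: mult_le_cancel_right\<close>)
qed

lemma trace_inequality_diff:
  assumes "\<phi> \<in> schwartz" "\<psi> \<in> schwartz"
  shows "L2_norm M (\<lambda>x. \<phi> x - \<psi> x) \<le> econst * sobolev_norm (1/2) (distr_diff (distr_of \<phi>) (distr_of \<psi>))"
proof -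
  have "distr_diff (distr_of \<phi>) (distr_of \<psi>) = distr_of (\<lambda>x. \<phi> x - \<psi> x)"
    using assms by (auto simp: distr_diff_def distr_of_def left_diff_distrib schwartz_mult_integrable)
  then show ?thesis using trace_inequality[OF schwartz_diff[OF assms]] by simp
qed

text \<open>The predicate under the \<open>SOME\<close> of \<open>trace_on\<close> at order 1/2. A
  trace is determined only up to null sets, so results are stated for any function with this
  property.\<close>

definition is_trace :: "'a distr \<Rightarrow> ('a \<Rightarrow> complex) \<Rightarrow> bool" where
  "is_trace u g \<longleftrightarrow> g \<in> L2 M \<and> (\<forall>f :: nat \<Rightarrow> 'a \<Rightarrow> complex.
        (\<forall>j. f j \<in> test_functions UNIV) \<and> (\<lambda>j. sobolev_norm (1/2) (distr_diff (distr_of (f j)) u)) \<longlonglongrightarrow> 0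
        \<longrightarrow> (\<lambda>j. L2_norm M (\<lambda>x. f j x - g x)) \<longlonglongrightarrow> 0)"

text \<open>By the trace inequality the restrictions of one approximating sequence are Cauchy in
  \<open>L2 M\<close> and converge; every other approximating sequence is compared with it through
  the same inequality.\<close>

lemma is_trace_exists:
  assumes u: "u \<in> sobolev (1/2)" shows "\<exists>g. is_trace u g"
proof -
  obtain f :: "nat \<Rightarrow> 'a \<Rightarrow> complex" where f: "\<And>n. f n \<in> test_functions UNIV" "(\<lambda>n. sobolev_norm (1/2) (distr_diff (distr_of (f n)) u)) \<longlonglongrightarrow> 0"
    using test_functions_dense[OF u] by (metis half_gt_zero_iff less_eq_real_def zero_less_one)
  have fs: "f n \<in> schwartz" for n by (rule test_functions_schwartz[OF f(1)])
  have fS: "distr_of (f n) \<in> sobolev (1/2)" for n by (rule distr_of_sobolev[OF fs])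
  have key: "L2_norm M (\<lambda>x. \<phi> x - \<psi> x) \<le> econst * (sobolev_norm (1/2) (distr_diff (distr_of \<phi>) u) + sobolev_norm (1/2) (distr_diff (distr_of \<psi>) u))"
    if "\<phi> \<in> schwartz" "\<psi> \<in> schwartz" for \<phi> \<psi>
    using order_trans[OF trace_inequality_diff[OF that] mult_left_mono[OF sobolev_triangle[OF distr_of_sobolev[OF that(1)] u distr_of_sobolev[OF that(2)]] econst_nonneg]]
      sobolev_norm_commute[OF u distr_of_sobolev[OF that(2)]] by simp
  have "\<exists>N. \<forall>m\<ge>N. \<forall>n\<ge>N. L2_norm M (\<lambda>x. f m x - f n x) < e" if e: "0 < e" for e
  proof -
    \<comment> \<open>Only \<open>0 \<le> econst\<close> is known; the added 1 keeps the denominator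
      positive.\<close>
    define \<delta> where "\<delta> = e / (2 * (econst + 1))"
    have d: "0 < \<delta>" using e econst_nonneg by (simp add: \<delta>_def)
    then obtain N where N: "\<And>n. n \<ge> N \<Longrightarrow> sobolev_norm (1/2) (distr_diff (distr_of (f n)) u) < \<delta>"
      using order_tendstoD(2)[OF f(2)] by (auto simp: eventually_sequentially)
    have "L2_norm M (\<lambda>x. f m x - f n x) < e" if "m \<ge> N" "n \<ge> N" for m n
    proof -
      have "L2_norm M (\<lambda>x. f m x - f n x) \<le> econst * (\<delta> + \<delta>)"
        using N[OF that(1)] N[OF that(2)] by (intro order_trans[OF key[OF fs fs] mult_left_mono[OF _ econst_nonneg]]) simp
      also have "\<dots> < (econst + 1) * (\<delta> + \<delta>)" using d by (intro mult_strict_right_mono) auto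
      also have "\<dots> = \<delta> * (2 * (econst + 1))" by (simp add: algebra_simps)
      also have "\<dots> = e" using econst_nonneg by (simp add: \<delta>_def)
      finally show ?thesis .
    qed
    then show ?thesis by blast
  qed
  from L2_complete[OF schwartz_L2[OF fs] this] obtain g where g: "g \<in> L2 M" "(\<lambda>n. L2_norm M (\<lambda>x. f n x - g x)) \<longlonglongrightarrow> 0" by blast
  have "(\<lambda>j. L2_norm M (\<lambda>x. h j x - g x)) \<longlonglongrightarrow> 0"
    if h: "\<And>j. h j \<in> test_functions UNIV" "(\<lambda>j. sobolev_norm (1/2) (distr_diff (distr_of (h j)) u)) \<longlonglongrightarrow> 0" for h :: "nat \<Rightarrow> 'a \<Rightarrow> complex"
  proof (rule tendsto_sandwich[OF _ _ tendsto_const])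
    have hs: "h n \<in> schwartz" for n by (rule test_functions_schwartz[OF h(1)])
    show "\<forall>\<^sub>F j in sequentially. L2_norm M (\<lambda>x. h j x - g x) \<le> econst * (sobolev_norm (1/2) (distr_diff (distr_of (h j)) u) + sobolev_norm (1/2) (distr_diff (distr_of (f j)) u)) + L2_norm M (\<lambda>x. f j x - g x)"
      using order_trans[OF L2_triangle3[OF schwartz_L2[OF hs] schwartz_L2[OF fs] g(1)] add_right_mono[OF key[OF hs fs]]] by (intro always_eventually allI)
    show "(\<lambda>j. econst * (sobolev_norm (1/2) (distr_diff (distr_of (h j)) u) + sobolev_norm (1/2) (distr_diff (distr_of (f j)) u)) + L2_norm M (\<lambda>x. f j x - g x)) \<longlonglongrightarrow> 0"
      using tendsto_add[OF tendsto_mult[OF tendsto_const tendsto_add[OF h(2) f(2)]] g(2), of econst] by simp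
  qed auto
  then show ?thesis using g(1) unfolding is_trace_def by blast
qed

text \<open>Both facts hold for test functions, by \<open>trace_inequality\<close> and
  \<open>pairing_mdistr\<close>, and pass to the limit along an approximating sequence.\<close>

lemma is_trace_props:
  assumes u: "u \<in> sobolev (1/2)" and g: "is_trace u g"
  shows "L2_norm M g \<le> econst * sobolev_norm (1/2) u"
    and "\<Psi> \<in> L2 M \<Longrightarrow> sobolev_pairing u (mdistr M \<Psi>) = (LINT x|M. g x * cnj (\<Psi> x))"
proof -
  obtain f :: "nat \<Rightarrow> 'a \<Rightarrow> complex" where f: "\<And>n. f n \<in> test_functions UNIV" "(\<lambda>n. sobolev_norm (1/2) (distr_diff (distr_of (f n)) u)) \<longlonglongrightarrow> 0"
    using test_functions_dense[OF u] by (metis half_gt_zero_iff less_eq_real_def zero_less_one)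
  have fs: "f n \<in> schwartz" for n by (rule test_functions_schwartz[OF f(1)])
  note fL = schwartz_L2[OF fs] and fS = distr_of_sobolev[OF fs, of _ "1/2"]
  have gL: "g \<in> L2 M" and lim: "(\<lambda>j. L2_norm M (\<lambda>x. f j x - g x)) \<longlonglongrightarrow> 0"
    using g f unfolding is_trace_def by blast+
  note hu = sobolev_has_fourier[OF u]
  have nf: "sobolev_norm (1/2) (distr_of (f n)) \<le> sobolev_norm (1/2) (distr_diff (distr_of (f n)) u) + sobolev_norm (1/2) u" for n
    using L2_triangle[OF L2_diff[OF schwartz_L2_wgt[OF fourier_schwartz[OF fs]] sobolev_L2[OF u]] sobolev_L2[OF u], of n]
    by (simp add: sobolev_norm_eq[OF has_fourier_diff[OF has_fourier_distr_of[OF fs] hu]] sobolev_norm_eq[OF has_fourier_distr_of[OF fs]] sobolev_norm_eq[OF hu])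
  have "L2_norm M g \<le> L2_norm M (\<lambda>x. f n x - g x) + econst * (sobolev_norm (1/2) (distr_diff (distr_of (f n)) u) + sobolev_norm (1/2) u)" for n
  proof -
    have "L2_norm M g \<le> L2_norm M (\<lambda>x. g x - f n x) + L2_norm M (f n)"
      using L2_triangle[OF L2_diff[OF gL fL] fL, of n n] by simp
    also have "L2_norm M (f n) \<le> econst * (sobolev_norm (1/2) (distr_diff (distr_of (f n)) u) + sobolev_norm (1/2) u)"
      by (rule order_trans[OF trace_inequality[OF fs] mult_left_mono[OF nf econst_nonneg]])
    finally show ?thesis by (simp add: L2_norm_minus[of M g])
  qed
  moreover have "(\<lambda>n. L2_norm M (\<lambda>x. f n x - g x) + econst * (sobolev_norm (1/2) (distr_diff (distr_of (f n)) u) + sobolev_norm (1/2) u)) \<longlonglongrightarrow> 0 + econst * (0 + sobolev_norm (1/2) u)"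
    by (intro tendsto_intros lim f(2))
  ultimately show "L2_norm M g \<le> econst * sobolev_norm (1/2) u"
    by (intro LIMSEQ_le_const[of _ _ "L2_norm M g"]) auto
  assume \<Psi>: "\<Psi> \<in> L2 M"
  note mS = mdistr_sobolev[OF \<Psi>] and hm = has_fourier_mdistr[OF \<Psi>]
  have "(\<lambda>n. LINT x|M. f n x * cnj (\<Psi> x)) \<longlonglongrightarrow> (LINT x|M. g x * cnj (\<Psi> x))"
  proof (rule LIM_zero_cancel, rule Lim_null_comparison)
    have "norm ((LINT x|M. f n x * cnj (\<Psi> x)) - (LINT x|M. g x * cnj (\<Psi> x))) \<le> L2_norm M (\<lambda>x. f n x - g x) * L2_norm M (\<lambda>x. cnj (\<Psi> x))" for n
      using L2_cauchy_schwarz[OF L2_diff[OF fL gL] L2_cnj[OF \<Psi>], of n] L2_mult_integrable[OF fL L2_cnj[OF \<Psi>], of n] L2_mult_integrable[OF gL L2_cnj[OF \<Psi>]]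
      by (simp add: left_diff_distrib)
    then show "\<forall>\<^sub>F n in sequentially. norm ((LINT x|M. f n x * cnj (\<Psi> x)) - (LINT x|M. g x * cnj (\<Psi> x))) \<le> L2_norm M (\<lambda>x. f n x - g x) * L2_norm M (\<lambda>x. cnj (\<Psi> x))"
      by (intro always_eventually allI)
    show "(\<lambda>n. L2_norm M (\<lambda>x. f n x - g x) * L2_norm M (\<lambda>x. cnj (\<Psi> x))) \<longlonglongrightarrow> 0"
      using tendsto_mult[OF lim tendsto_const] by simp
  qed
  moreover have "(\<lambda>n. sobolev_pairing (distr_of (f n)) (mdistr M \<Psi>)) \<longlonglongrightarrow> sobolev_pairing u (mdistr M \<Psi>)"
  proof (rule LIM_zero_cancel, rule Lim_null_comparison)
    have "norm (sobolev_pairing (distr_of (f n)) (mdistr M \<Psi>) - sobolev_pairing u (mdistr M \<Psi>)) \<le> sobolev_norm (1/2) (distr_diff (distr_of (f n)) u) * sobolev_norm (- (1/2)) (mdistr M \<Psi>)" for n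
    proof -
      have p: "sobolev_pairing v (mdistr M \<Psi>) = (LINT \<xi>|lborel. fourier_distr v \<xi> * cnj (fourier_distr (mdistr M \<Psi>) \<xi>))" for v
        by (simp add: sobolev_pairing_def)
      have "sobolev_pairing (distr_diff (distr_of (f n)) u) (mdistr M \<Psi>) = sobolev_pairing (distr_of (f n)) (mdistr M \<Psi>) - sobolev_pairing u (mdistr M \<Psi>)"
        by (subst sobolev_pairing_eq[OF has_fourier_diff[OF sobolev_has_fourier[OF fS] hu] sobolev_has_fourier[OF mS]], unfold p)
          (use sobolev_pairing_le(2)[OF fS mS] sobolev_pairing_le(2)[OF u mS] in \<open>simp add: left_diff_distrib\<close>)
      then show ?thesis using sobolev_pairing_le(1)[OF sobolev_diff[OF fS u] mS, of n] by simp
    qed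
    then show "\<forall>\<^sub>F n in sequentially. norm (sobolev_pairing (distr_of (f n)) (mdistr M \<Psi>) - sobolev_pairing u (mdistr M \<Psi>)) \<le> sobolev_norm (1/2) (distr_diff (distr_of (f n)) u) * sobolev_norm (- (1/2)) (mdistr M \<Psi>)"
      by (intro always_eventually allI)
    show "(\<lambda>n. sobolev_norm (1/2) (distr_diff (distr_of (f n)) u) * sobolev_norm (- (1/2)) (mdistr M \<Psi>)) \<longlonglongrightarrow> 0"
      using tendsto_mult[OF f(2) tendsto_const] by simp
  qed
  ultimately show "sobolev_pairing u (mdistr M \<Psi>) = (LINT x|M. g x * cnj (\<Psi> x))"
    unfolding pairing_mdistr[OF fs \<Psi>] using LIMSEQ_unique by blast
qed

lemma trace_on_is_trace:
  assumes "M = surface d \<Gamma>" "u \<in> sobolev (1/2)"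
  shows "is_trace u (trace_on d (1/2) \<Gamma> u)"
proof -
  have "trace_on d (1/2) \<Gamma> u = (SOME g. is_trace u g)"
    unfolding trace_on_def is_trace_def assms(1)[symmetric] using assms(2) by simp
  then show ?thesis using someI_ex[OF is_trace_exists[OF assms(2)]] by simp
qed

text \<open>If D is the difference of the two transforms, pairing with the u whose transform is (1 +
  |\<xi>|^2)^(-s) D gives the squared norm of D of order -s, which must therefore vanish.\<close>

lemma sobolev_pairing_injective:
  assumes v: "v \<in> sobolev (- s)" "w \<in> sobolev (- s)" and s: "0 \<le> s"
    and eq: "\<And>u. u \<in> sobolev s \<Longrightarrow> sobolev_pairing u v = sobolev_pairing u (w :: 'b::euclidean_space distr)"
  shows "v = w"
proof -
  note hv = v[THEN sobolev_has_fourier] and Lv = v[THEN sobolev_L2]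
  define D where "D \<xi> = fourier_distr v \<xi> - fourier_distr w \<xi>" for \<xi>
  have DL: "D \<in> L2 (wgt (- s))" unfolding D_def[abs_def] by (intro L2_diff Lv)
  then have Dm[measurable]: "D \<in> borel_measurable borel" by (simp add: L2_wgt_iff)
  define h where "h \<xi> = of_real ((1 + (norm \<xi>)\<^sup>2) powr (- s)) * D \<xi>" for \<xi>
  have hn: "(1 + (norm \<xi>)\<^sup>2) powr s * (norm (h \<xi>))\<^sup>2 = (1 + (norm \<xi>)\<^sup>2) powr (- s) * (norm (D \<xi>))\<^sup>2" for \<xi>
  proof -
    have "(1 + (norm \<xi>)\<^sup>2) powr s * ((1 + (norm \<xi>)\<^sup>2) powr (- s))\<^sup>2 = (1 + (norm \<xi>)\<^sup>2) powr (- s)"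
      by (simp only: powr_power one_plus_norm_sq powr_add[symmetric] simp_thms) simp
    then show ?thesis by (simp add: h_def norm_mult power_mult_distrib mult.assoc[symmetric])
  qed
  have "h \<in> L2 (wgt s)" using DL unfolding L2_wgt_iff hn by (simp add: h_def[abs_def])
  then obtain u where u: "u \<in> sobolev s" "has_fourier u h" using sobolev_exists s by blast
  have ae: "AE \<xi> in lborel. fourier_distr u \<xi> = h \<xi>" by (rule fourier_distr_AE[OF u(2)])
  have i: "integrable lborel (\<lambda>\<xi>. fourier_distr u \<xi> * cnj (D \<xi>))"
    unfolding D_def using sobolev_pairing_le(2)[OF u(1) v(1)] sobolev_pairing_le(2)[OF u(1) v(2)] by (simp add: right_diff_distrib)
  have z: "(LINT \<xi>|lborel. fourier_distr u \<xi> * cnj (D \<xi>)) = 0"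
    using eq[OF u(1)] sobolev_pairing_le(2)[OF u(1) v(1)] sobolev_pairing_le(2)[OF u(1) v(2)]
    unfolding sobolev_pairing_def D_def by (simp add: right_diff_distrib)
  have "AE \<xi> in lborel. fourier_distr u \<xi> * cnj (D \<xi>) = of_real ((1 + (norm \<xi>)\<^sup>2) powr (- s) * (norm (D \<xi>))\<^sup>2)"
    using ae by eventually_elim (simp add: h_def complex_norm_square[symmetric] mult.assoc del: of_real_power)
  then have "(LINT \<xi>|lborel. fourier_distr u \<xi> * cnj (D \<xi>)) = (LINT \<xi>|lborel. complex_of_real ((1 + (norm \<xi>)\<^sup>2) powr (- s) * (norm (D \<xi>))\<^sup>2))"
    using borel_measurable_integrable[OF i] by (intro integral_cong_AE) auto
  then have "complex_of_real ((L2_norm (wgt (- s)) D)\<^sup>2) = 0"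
    using z by (simp add: L2_norm_sq integral_wgt integral_complex_of_real del: of_real_mult of_real_power)
  then have "AE \<xi> in wgt (- s). D \<xi> = 0" by (intro L2_norm_eq_0[OF DL]) simp
  then show ?thesis by (intro has_fourier_eq[OF hv]) (simp add: D_def)
qed

text \<open>As \<open>trace_adj\<close> is specified on \<open>trace_dual\<close> only, membership
  of the functional comes first: Cauchy-Schwarz bounds it by the L2 norm of its argument, and
  \<open>is_trace_props\<close> bounds that by each competitor in the quotient norm. The value is
  then forced by \<open>sobolev_pairing_injective\<close>.\<close>

lemma trace_adj_L2_embed:
  assumes M: "M = surface d \<Gamma>" and \<Psi>: "\<Psi> \<in> L2 M"
  shows "trace_adj d (1/2 - (real DIM('a) - d) / 2) \<Gamma> (L2_embed d \<Gamma> \<Psi>) = mdistr M \<Psi>"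
proof -
  let ?t = "1/2 - (real DIM('a) - d) / 2" and ?F = "L2_embed d \<Gamma> \<Psi>"
  have lift: "lift_exponent TYPE('a) d ?t = 1/2" by (simp add: lift_exponent_def)
  note tr = trace_on_is_trace[OF M]
  have TS: "g \<in> L2 M" if "g \<in> trace_space d ?t \<Gamma>" for g using that by (simp add: trace_space_def M)
  have int: "integrable M (\<lambda>x. \<Psi> x * cnj (g x))" if "g \<in> L2 M" for g by (rule L2_mult_integrable[OF \<Psi> L2_cnj[OF that]])
  have F: "?F g = (LINT x|M. \<Psi> x * cnj (g x))" for g by (simp add: L2_embed_def M)
  have dual: "?F \<in> trace_dual d ?t \<Gamma>"
    unfolding trace_dual_def mem_Collect_eq
  proof (intro conjI ballI allI impI)
    fix g h assume gh: "g \<in> trace_space d ?t \<Gamma>" "h \<in> trace_space d ?t \<Gamma>"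
    show "?F g = ?F h" if "AE x in surface d \<Gamma>. g x = h x"
      unfolding F
    proof (rule integral_cong_AE)
      show "AE x in M. \<Psi> x * cnj (g x) = \<Psi> x * cnj (h x)" using that unfolding M by eventually_elim simp
    qed (use borel_measurable_integrable[OF int[OF TS]] gh in auto)
    show "?F (\<lambda>x. g x + h x) = ?F g + ?F h"
      unfolding F using int[OF TS[OF gh(1)]] int[OF TS[OF gh(2)]] by (simp add: distrib_left)
  next
    fix c g show "?F (\<lambda>x. c * g x) = cnj c * ?F g" unfolding F by (simp add: mult.left_commute[of _ "cnj c"])
  next
    \<comment> \<open>The added 1 makes the constant positive, so that it can be divided out before
      the infimum is taken.\<close>
    let ?C = "L2_norm M \<Psi> * econst + 1"
    have C: "0 < ?C" using econst_nonneg by (intro add_nonneg_pos mult_nonneg_nonneg) auto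
    have "norm (?F g) \<le> ?C * trace_space_norm d ?t \<Gamma> g" if g: "g \<in> trace_space d ?t \<Gamma>" for g
    proof -
      let ?U = "{u. u \<in> sobolev (1/2) \<and> (AE x in surface d \<Gamma>. g x = trace_on d (1/2) \<Gamma> u x)}"
      have "norm (?F g) / ?C \<le> Inf (sobolev_norm (1/2) ` ?U)"
      proof (rule cInf_greatest)
        show "sobolev_norm (1/2) ` ?U \<noteq> {}" using g by (auto simp: trace_space_def lift)
        fix r assume "r \<in> sobolev_norm (1/2) ` ?U"
        then obtain u where u: "r = sobolev_norm (1/2) u" "u \<in> sobolev (1/2)" "AE x in M. g x = trace_on d (1/2) \<Gamma> u x"
          unfolding M by blast
        have "L2_norm M g = L2_norm M (trace_on d (1/2) \<Gamma> u)"
          using u(3) TS[OF g] tr[OF u(2)] by (intro L2_norm_cong_AE) (auto simp: is_trace_def L2_def)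
        then have n: "L2_norm M g \<le> econst * r" using is_trace_props(1)[OF u(2) tr[OF u(2)]] u(1) by simp
        have "norm (?F g) \<le> L2_norm M \<Psi> * L2_norm M (\<lambda>x. cnj (g x))" unfolding F by (rule L2_cauchy_schwarz[OF \<Psi> L2_cnj[OF TS[OF g]]])
        also have "L2_norm M (\<lambda>x. cnj (g x)) = L2_norm M g" by (simp add: L2_norm_def)
        also have "L2_norm M \<Psi> * L2_norm M g \<le> L2_norm M \<Psi> * (econst * r)" by (intro mult_left_mono n) simp
        also have "\<dots> \<le> ?C * r" using u(1) by (simp add: distrib_right)
        finally show "norm (?F g) / ?C \<le> r" using C by (simp add: pos_divide_le_eq mult.commute)
      qed
      also have "\<dots> = trace_space_norm d ?t \<Gamma> g" unfolding trace_space_norm_def lift by (rule arg_cong[where f = Inf]) auto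
      finally show ?thesis using C by (simp add: pos_divide_le_eq mult.commute)
    qed
    then show "\<exists>C. \<forall>g\<in>trace_space d ?t \<Gamma>. norm (?F g) \<le> C * trace_space_norm d ?t \<Gamma> g" by blast
  qed
  have eq: "sobolev_pairing u (mdistr M \<Psi>) = cnj (?F (trace_on d (1/2) \<Gamma> u))" if "u \<in> sobolev (1/2)" for u
    unfolding is_trace_props(2)[OF that tr[OF that] \<Psi>] F Bochner_Integration.integral_cnj[symmetric] by (simp add: mult.commute)
  have "(THE v. v \<in> sobolev (- (1/2)) \<and> (\<forall>u\<in>sobolev (1/2). sobolev_pairing u v = cnj (?F (trace_on d (1/2) \<Gamma> u)))) = mdistr M \<Psi>"
  proof (rule the_equality)
    fix v assume v: "v \<in> sobolev (- (1/2)) \<and> (\<forall>u\<in>sobolev (1/2). sobolev_pairing u v = cnj (?F (trace_on d (1/2) \<Gamma> u)))"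
    show "v = mdistr M \<Psi>"
      by (rule sobolev_pairing_injective[where s = "1/2"]) (use v eq mdistr_sobolev[OF \<Psi>] in auto)
  qed (use eq mdistr_sobolev[OF \<Psi>] in auto)
  then show ?thesis using dual by (simp add: trace_adj_def lift)
qed

end

section \<open>Weak derivatives and Dirichlet traces\<close>

lemma L2_on_set:
  fixes U :: "'a::euclidean_space set"
  assumes U: "open U" and f: "f \<in> L2 lborel"
  shows "f \<in> L2 (on_set U)"
proof -
  have "U \<in> sets borel" using U by simp
  then show ?thesis using f integrable_mult_indicator[of U lborel "\<lambda>x. (norm (f x))\<^sup>2"]
    unfolding L2_def on_set_def by (auto simp: integrable_restrict_space intro!: measurable_restrict_space1)
qed

lemma L2_on_set_iff:
  fixes U :: "'a::euclidean_space set"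
  assumes U: "open U"
  shows "f \<in> L2 (on_set U) \<longleftrightarrow> (\<lambda>x. indicator U x *\<^sub>R f x) \<in> L2 lborel"
proof -
  have "U \<in> sets borel" using U by simp
  moreover have "(norm (indicator U x *\<^sub>R f x))\<^sup>2 = indicator U x *\<^sub>R (norm (f x))\<^sup>2" for x by (simp add: indicator_def)
  ultimately show ?thesis unfolding L2_def on_set_def by (simp add: integrable_restrict_space borel_measurable_restrict_space_iff)
qed

lemma integral_on_set:
  fixes f :: "'a::euclidean_space \<Rightarrow> 'b::{banach, second_countable_topology}"
  shows "open U \<Longrightarrow> (LINT x|on_set U. f x) = (LINT x|lborel. indicator U x *\<^sub>R f x)"
  unfolding on_set_def by (rule integral_restrict_space) simp

lemma test_functions_L2_on_set: "open U \<Longrightarrow> f \<in> test_functions V \<Longrightarrow> f \<in> L2 (on_set U)"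
  by (rule L2_on_set[OF _ L2_lborel_schwartz[OF test_functions_schwartz]])

text \<open>\<open>W1_norm\<close> selects a weak derivative by \<open>SOME\<close>. By the
  fundamental lemma two choices agree almost everywhere, so any known weak derivative can be used to
  compute the norm.\<close>

lemma weak_deriv_unique:
  fixes U :: "'a::euclidean_space set"
  assumes U: "open U" and g: "has_weak_deriv U b f g" and h: "has_weak_deriv U b f h"
  shows "L2_norm (on_set U) g = L2_norm (on_set U) h"
proof -
  have gh: "g \<in> L2 (on_set U)" "h \<in> L2 (on_set U)" using g h by (auto simp: has_weak_deriv_def)
  have Um: "U \<in> sets borel" using U by simp
  let ?m = "\<lambda>x. indicator U x *\<^sub>R (g x - h x)"
  have mL: "?m \<in> L2 lborel" by (rule L2_on_set_iff[OF U, THEN iffD1, OF L2_diff[OF gh]])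
  have AE: "AE x in lborel. x \<in> U \<longrightarrow> ?m x = 0"
  proof (rule fundamental_lemma_variations[OF U])
    fix \<phi> :: "'a \<Rightarrow> complex" assume \<phi>: "\<phi> \<in> test_functions U"
    show "integrable lborel (\<lambda>x. ?m x * \<phi> x)"
      by (rule L2_mult_integrable[OF mL L2_lborel_schwartz[OF test_functions_schwartz[OF \<phi>]]])
    have pL: "\<phi> \<in> L2 (on_set U)" by (rule test_functions_L2_on_set[OF U \<phi>])
    have "(LINT x|on_set U. g x * \<phi> x) = (LINT x|on_set U. h x * \<phi> x)"
      using g h \<phi> unfolding has_weak_deriv_def by (metis add.inverse_inverse)
    then have "(LINT x|on_set U. (g x - h x) * \<phi> x) = 0"
      using L2_mult_integrable[OF gh(1) pL] L2_mult_integrable[OF gh(2) pL] by (simp add: left_diff_distrib)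
    then show "(LINT x|lborel. ?m x * \<phi> x) = 0" by (simp add: integral_on_set[OF U])
  qed (use mL in \<open>auto simp: L2_def\<close>)
  have "AE x in on_set U. g x = h x"
    unfolding on_set_def using AE by (subst AE_restrict_space_iff) (auto simp: Um elim!: eventually_mono)
  then show ?thesis using gh by (intro L2_norm_cong_AE) (auto simp: L2_def)
qed

lemma W1_norm_eq:
  fixes U :: "'a::euclidean_space set"
  assumes U: "open U" and g: "\<And>b. b \<in> Basis \<Longrightarrow> has_weak_deriv U b f (g b)"
  shows "W1_norm U f = sqrt ((L2_norm (on_set U) f)\<^sup>2 + (\<Sum>b\<in>Basis. (L2_norm (on_set U) (g b))\<^sup>2))"
proof -
  have "L2_norm (on_set U) (SOME g. has_weak_deriv U b f g) = L2_norm (on_set U) (g b)" if "b \<in> Basis" for b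
    by (rule weak_deriv_unique[OF U _ g[OF that]]) (rule someI[of "has_weak_deriv U b f", OF g[OF that]])
  then show ?thesis unfolding W1_norm_def by simp
qed

lemma has_weak_deriv_test:
  fixes U :: "'a::euclidean_space set"
  assumes U: "open U" and f: "f \<in> test_functions UNIV"
  shows "has_weak_deriv U b f (dir_deriv b f)"
  unfolding has_weak_deriv_def
proof (intro conjI ballI)
  show "dir_deriv b f \<in> L2 (on_set U)" by (rule test_functions_L2_on_set[OF U test_functions_dir_deriv[OF f]])
  fix \<phi> :: "'a \<Rightarrow> complex" assume \<phi>: "\<phi> \<in> test_functions U"
  have ind: "indicator U x *\<^sub>R (a * h x) = a * h x" if "h \<in> test_functions U" for h :: "'a \<Rightarrow> complex" and a x
    using test_functions_supp(2)[OF that] fun_supp_zero[of x h] by (auto simp: indicator_def)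
  have fs: "f \<in> schwartz" "dir_deriv b f \<in> schwartz" "\<phi> \<in> schwartz" "dir_deriv b \<phi> \<in> schwartz"
    using f \<phi> test_functions_dir_deriv test_functions_schwartz by blast+
  have p: "(\<lambda>x. f x * \<phi> x) \<in> schwartz"
    by (rule test_functions_schwartz[OF test_functions_mult_left[OF \<phi> test_functions_smooth[OF f]]])
  have d: "dir_deriv b (\<lambda>x. f x * \<phi> x) x = f x * dir_deriv b \<phi> x + dir_deriv b f x * \<phi> x" for x
    by (rule dir_deriv_mult) (auto intro: schwartz_differentiable fs)
  have "(LINT x|lborel. dir_deriv b (\<lambda>x. f x * \<phi> x) x) = 0"
    by (intro integral_dir_deriv_zero schwartz_differentiable schwartz_continuous schwartz_integrable schwartz_dir_deriv p)
  then have "(LINT x|lborel. f x * dir_deriv b \<phi> x) + (LINT x|lborel. dir_deriv b f x * \<phi> x) = 0"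
    unfolding d using schwartz_mult_integrable[OF fs(4,1)] schwartz_mult_integrable[OF fs(3,2)] by simp
  then show "(LINT x|on_set U. f x * dir_deriv b \<phi> x) = - (LINT x|on_set U. dir_deriv b f x * \<phi> x)"
    by (simp add: integral_on_set[OF U] ind[OF test_functions_dir_deriv[OF \<phi>]] ind[OF \<phi>] eq_neg_iff_add_eq_0)
qed

lemma has_weak_deriv_diff:
  assumes U: "open U" and "f \<in> L2 (on_set U)" "k \<in> L2 (on_set U)" and g: "has_weak_deriv U b f g" and h: "has_weak_deriv U b k h"
  shows "has_weak_deriv U b (\<lambda>x. f x - k x) (\<lambda>x. g x - h x)"
proof -
  have gh: "g \<in> L2 (on_set U)" "h \<in> L2 (on_set U)" using g h by (auto simp: has_weak_deriv_def)
  show ?thesis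
    unfolding has_weak_deriv_def
  proof (intro conjI ballI L2_diff gh)
    fix \<phi> :: "'a \<Rightarrow> complex" assume \<phi>: "\<phi> \<in> test_functions U"
    note L = test_functions_L2_on_set[OF U \<phi>] test_functions_L2_on_set[OF U test_functions_dir_deriv[OF \<phi>]]
    show "(LINT x|on_set U. (f x - k x) * dir_deriv b \<phi> x) = - (LINT x|on_set U. (g x - h x) * \<phi> x)"
      using g h \<phi> L2_mult_integrable[OF assms(2) L(2), of b] L2_mult_integrable[OF assms(3) L(2), of b]
        L2_mult_integrable[OF gh(1) L(1)] L2_mult_integrable[OF gh(2) L(1)]
      by (simp add: left_diff_distrib has_weak_deriv_def)
  qed
qed

text \<open>The weak formulation involves only integrals against fixed square-integrable functions,
  and these pass to L2 limits.\<close>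

lemma has_weak_deriv_limit:
  assumes U: "open U" and f: "\<And>n::nat. f n \<in> L2 (on_set U)" "u \<in> L2 (on_set U)"
    and g: "\<And>n. has_weak_deriv U b (f n) (g n)" "G \<in> L2 (on_set U)"
    and l: "(\<lambda>n. L2_norm (on_set U) (\<lambda>x. f n x - u x)) \<longlonglongrightarrow> 0" "(\<lambda>n. L2_norm (on_set U) (\<lambda>x. g n x - G x)) \<longlonglongrightarrow> 0"
  shows "has_weak_deriv U b u G"
  unfolding has_weak_deriv_def
proof (intro conjI ballI g(2))
  fix \<phi> :: "'a \<Rightarrow> complex" assume \<phi>: "\<phi> \<in> test_functions U"
  note L = test_functions_L2_on_set[OF U \<phi>] test_functions_L2_on_set[OF U test_functions_dir_deriv[OF \<phi>]]
  have gL: "g n \<in> L2 (on_set U)" for n using g(1) by (auto simp: has_weak_deriv_def)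
  have lim: "(\<lambda>n. LINT x|on_set U. p n x * \<psi> x) \<longlonglongrightarrow> (LINT x|on_set U. q x * \<psi> x)"
    if p: "\<And>n::nat. p n \<in> L2 (on_set U)" "q \<in> L2 (on_set U)" "\<psi> \<in> L2 (on_set U)" "(\<lambda>n. L2_norm (on_set U) (\<lambda>x. p n x - q x)) \<longlonglongrightarrow> 0" for p q \<psi>
  proof (rule LIM_zero_cancel, rule Lim_null_comparison)
    have "norm ((LINT x|on_set U. p n x * \<psi> x) - (LINT x|on_set U. q x * \<psi> x)) \<le> L2_norm (on_set U) (\<lambda>x. p n x - q x) * L2_norm (on_set U) \<psi>" for n
      using L2_cauchy_schwarz[OF L2_diff[OF p(1,2)] p(3), of n] L2_mult_integrable[OF p(1,3), of n] L2_mult_integrable[OF p(2,3)]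
      by (simp add: left_diff_distrib)
    then show "\<forall>\<^sub>F n in sequentially. norm ((LINT x|on_set U. p n x * \<psi> x) - (LINT x|on_set U. q x * \<psi> x)) \<le> L2_norm (on_set U) (\<lambda>x. p n x - q x) * L2_norm (on_set U) \<psi>"
      by (intro always_eventually allI)
    show "(\<lambda>n. L2_norm (on_set U) (\<lambda>x. p n x - q x) * L2_norm (on_set U) \<psi>) \<longlonglongrightarrow> 0" using tendsto_mult[OF p(4) tendsto_const] by simp
  qed
  have "(\<lambda>n. LINT x|on_set U. f n x * dir_deriv b \<phi> x) \<longlonglongrightarrow> (LINT x|on_set U. u x * dir_deriv b \<phi> x)"
    by (rule lim[OF f L(2) l(1)])
  then have "(\<lambda>n. - (LINT x|on_set U. g n x * \<phi> x)) \<longlonglongrightarrow> (LINT x|on_set U. u x * dir_deriv b \<phi> x)"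
    using g(1) \<phi> by (simp add: has_weak_deriv_def)
  moreover have "(\<lambda>n. - (LINT x|on_set U. g n x * \<phi> x)) \<longlonglongrightarrow> - (LINT x|on_set U. G x * \<phi> x)"
    by (rule tendsto_minus[OF lim[OF gL g(2) L(1) l(2)]])
  ultimately show "(LINT x|on_set U. u x * dir_deriv b \<phi> x) = - (LINT x|on_set U. G x * \<phi> x)"
    by (rule LIMSEQ_unique)
qed

section \<open>The trace inequality on half-spaces\<close>

lemma sum_Basis_pair_real:
  fixes F :: "'a::euclidean_space \<times> real \<Rightarrow> 'c::comm_monoid_add"
  shows "sum F Basis = (\<Sum>b\<in>Basis. F (b, 0)) + F (0, 1)"
  unfolding Basis_prod_def by (subst sum.union_disjoint) (auto simp: sum.reindex inj_on_def)

lemma open_half_space: "open (half_space e)"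
  unfolding half_space_def by (intro open_Collect_less continuous_intros)

text \<open>The derivative of |k|^2 is at most 2 |k| |k'|, and it is integrated between 0 and a
  point where k vanishes. The auxiliary fact \<open>main\<close> concerns a general interval, so
  that both signs are instances of it.\<close>

lemma ftc_half_line:
  fixes k :: "real \<Rightarrow> complex"
  assumes k: "\<And>t. (k has_vector_derivative k' t) (at t)" "continuous_on UNIV k'" and T: "\<And>t. \<bar>t\<bar> \<ge> T \<Longrightarrow> k t = 0"
    and e: "e \<in> {-1, 1::real}"
  shows "ennreal ((norm (k 0))\<^sup>2) \<le> (\<integral>\<^sup>+t. indicator {t. 0 < e * t} t * ennreal (2 * (norm (k t) * norm (k' t))) \<partial>lborel)"
proof -
  have kc: "continuous_on UNIV k" using k(1) by (intro continuous_at_imp_continuous_on ballI has_vector_derivative_continuous)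
  define S where "S = max T 1"
  have S: "0 < S" "k S = 0" "k (- S) = 0" using T by (auto simp: S_def)
  let ?D = "\<lambda>t. 2 * Re (cnj (k t) * k' t)"
  have n2: "(norm (k t))\<^sup>2 = Re (cnj (k t) * k t)" for t unfolding cmod_power2 by (simp add: power2_eq_square)
  have D: "((\<lambda>t. (norm (k t))\<^sup>2) has_vector_derivative ?D t) (at t within A)" for t A
  proof -
    have "((\<lambda>t. cnj (k t)) has_vector_derivative cnj (k' t)) (at t)"
      using bounded_linear.has_vector_derivative[OF bounded_linear_cnj k(1)] .
    from has_vector_derivative_mult[OF this k(1)]
    have "((\<lambda>t. Re (cnj (k t) * k t)) has_vector_derivative Re (cnj (k t) * k' t + cnj (k' t) * k t)) (at t)"
      by (rule bounded_linear.has_vector_derivative[OF bounded_linear_Re])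
    also have "Re (cnj (k t) * k' t + cnj (k' t) * k t) = ?D t" by simp
    finally show ?thesis unfolding n2[symmetric] by (rule has_vector_derivative_at_within)
  qed
  have Dc: "continuous_on A ?D" for A
    by (intro continuous_intros continuous_on_subset[OF kc] continuous_on_subset[OF k(2)]) auto
  have Db: "\<bar>?D t\<bar> \<le> 2 * (norm (k t) * norm (k' t))" for t
    using abs_Re_le_cmod[of "cnj (k t) * k' t"] by (simp add: norm_mult)
  have [measurable]: "?D \<in> borel_measurable borel" by (rule borel_measurable_continuous_onI[OF Dc])
  have main: "ennreal ((norm (k 0))\<^sup>2) \<le> (\<integral>\<^sup>+t. indicator {t. 0 < e * t} t * ennreal (2 * (norm (k t) * norm (k' t))) \<partial>lborel)"
    if ab: "a \<le> b" "(norm (k 0))\<^sup>2 = \<bar>(norm (k b))\<^sup>2 - (norm (k a))\<^sup>2\<bar>" "\<And>t. t \<noteq> 0 \<Longrightarrow> a \<le> t \<Longrightarrow> t \<le> b \<Longrightarrow> 0 < e * t" for a b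
  proof -
    have "(norm (k 0))\<^sup>2 = norm (LINT t|lborel. indicator {a..b} t *\<^sub>R ?D t)"
      using integral_FTC_Icc[OF ab(1) D Dc] ab(2) by simp
    moreover have "integrable lborel (\<lambda>t. indicator {a..b} t *\<^sub>R ?D t)" by (rule borel_integrable_compact[OF compact_Icc Dc])
    ultimately have "ennreal ((norm (k 0))\<^sup>2) \<le> (\<integral>\<^sup>+t. ennreal (norm (indicator {a..b} t *\<^sub>R ?D t)) \<partial>lborel)"
      by (simp only: integral_norm_bound_ennreal)
    also have "\<dots> \<le> (\<integral>\<^sup>+t. indicator {t. 0 < e * t} t * ennreal (2 * (norm (k t) * norm (k' t))) \<partial>lborel)"
    proof (rule nn_integral_mono_AE)
      have "AE t in lborel. t \<noteq> (0::real)" by (rule AE_lborel_singleton)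
      then show "AE t in lborel. ennreal (norm (indicator {a..b} t *\<^sub>R ?D t)) \<le> indicator {t. 0 < e * t} t * ennreal (2 * (norm (k t) * norm (k' t)))"
        by eventually_elim (use ab(3) Db in \<open>auto simp: indicator_def ennreal_leI simp del: times_complex.simps\<close>)
    qed
    finally show ?thesis .
  qed
  from e show ?thesis
  proof
    assume "e = -1" then show ?thesis using S by (intro main[of "- S" 0]) auto
  next
    assume "e \<in> {1}" then show ?thesis using S by (intro main[of 0 S]) auto
  qed
qed

context
  fixes f :: "'a::euclidean_space \<times> real \<Rightarrow> complex"
  assumes f: "f \<in> test_functions UNIV"
begin

lemma slice_linear: "bounded_linear (\<lambda>x::'a. (x, 0::real))"
  by (intro bounded_linear_Pair bounded_linear_ident bounded_linear_zero)

lemma slice_test: "(\<lambda>x. f (x, t)) \<in> test_functions UNIV"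
proof (rule test_functionsI[where K = "fst ` fun_supp f"])
  show "smooth (\<lambda>x. f (x, t))"
    using smooth_in_affine_comp[OF open_UNIV slice_linear, of "(0, t)" UNIV f] test_functions_smooth[OF f]
    by (simp add: smooth_iff_smooth_in)
  show "compact (fst ` fun_supp f)"
    by (intro compact_continuous_image continuous_intros test_functions_supp(1)[OF f])
  show "f (x, t) = 0" if "x \<notin> fst ` fun_supp f" for x
    using that by (intro fun_supp_zero) (force simp: image_iff)
qed auto

lemma slice_dir_deriv: "dir_deriv b (\<lambda>x. f (x, t)) x = dir_deriv (b, 0) f (x, t)"
proof (rule dir_deriv_eqI)
  have "f differentiable (at ((0, t) + (x, 0)))"
    using smooth_in_differentiable[OF test_functions_smooth[OF f]] by simp
  from has_derivative_affine_comp[OF slice_linear this]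
  show "((\<lambda>x. f (x, t)) has_derivative (\<lambda>v. dir_deriv (v, 0) f (x, t))) (at x)" by simp
qed

lemma slice_fourier_measurable: "(\<lambda>(\<xi>, t). fourier (\<lambda>x. f (x, t)) \<xi>) \<in> borel_measurable (borel \<Otimes>\<^sub>M borel)"
proof -
  have [measurable]: "f \<in> borel_measurable (borel \<Otimes>\<^sub>M borel)"
    unfolding borel_prod by (rule borel_measurable_continuous_onI[OF test_functions_continuous[OF f]])
  show ?thesis unfolding fourier_ek by measurable
qed

lemma slice_fourier_deriv:
  "((\<lambda>t. fourier (\<lambda>x. f (x, t)) \<xi>) has_vector_derivative fourier (\<lambda>x. dir_deriv (0, 1) f (x, t)) \<xi>) (at t)"
proof -
  let ?D = "dir_deriv (0, 1) f"
  have Dt: "?D \<in> test_functions UNIV" by (rule test_functions_dir_deriv[OF f])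
  obtain C where C: "\<And>z. norm (?D z) \<le> C" "0 \<le> C" using test_functions_bounded[OF Dt] by blast
  let ?K = "fst ` fun_supp ?D"
  have K: "compact ?K" by (intro compact_continuous_image continuous_intros test_functions_supp(1)[OF Dt])
  have B: "norm (?D (x, s)) \<le> C * indicator ?K x" for x s
  proof (cases "x \<in> ?K")
    case False
    then have "(x, s) \<notin> fun_supp ?D" by force
    then show ?thesis using fun_supp_zero[of "(x, s)" ?D] C(2) by simp
  qed (use C in simp)
  have L: "bounded_linear (\<lambda>t::real. (0::'a, t))" by (intro bounded_linear_Pair bounded_linear_ident bounded_linear_zero)
  have d: "((\<lambda>t. f (x, t)) has_derivative (\<lambda>v. v *\<^sub>R ?D (x, t))) (at t)" for x t
  proof -
    have df: "f differentiable (at z)" for z using smooth_in_differentiable[OF test_functions_smooth[OF f]] by simp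
    have "((\<lambda>t. f ((x, 0) + (0, t))) has_derivative (\<lambda>v. dir_deriv (0, v) f ((x, 0) + (0, t)))) (at t)"
      by (rule has_derivative_affine_comp[OF L df])
    moreover have "(\<lambda>v. dir_deriv (0, v) f ((x, 0) + (0, t))) = (\<lambda>v. v *\<^sub>R ?D ((x, 0) + (0, t)))"
    proof
      fix v :: real
      have "(0, v) = v *\<^sub>R (0::'a, 1::real)" by simp
      then show "dir_deriv (0, v) f ((x, 0) + (0, t)) = v *\<^sub>R ?D ((x, 0) + (0, t))"
        by (metis linear_scale[OF has_derivative_linear[OF has_derivative_dir_deriv[OF df]]])
    qed
    ultimately show ?thesis by (simp only: add_Pair add_0 add_0_right)
  qed
  have i: "integrable lborel (\<lambda>x. ek \<xi> x * f (x, t))" for t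
    by (intro integrable_ek schwartz_integrable test_functions_schwartz[OF slice_test]) simp
  have [measurable]: "?D \<in> borel_measurable (borel \<Otimes>\<^sub>M borel)"
    unfolding borel_prod by (rule borel_measurable_continuous_onI[OF test_functions_continuous[OF Dt]])
  have "((\<lambda>t. LINT x|lborel. ek \<xi> x * f (x, t)) has_derivative (\<lambda>v. LINT x|lborel. ek \<xi> x * (v *\<^sub>R ?D (x, t)))) (at t)"
  proof (rule has_derivative_integral_param(1)[where r = 1 and w = "\<lambda>x. C * indicator ?K x" and g' = "\<lambda>t x v. ek \<xi> x * (v *\<^sub>R ?D (x, t))"])
    show "((\<lambda>t. ek \<xi> x * f (x, t)) has_derivative (\<lambda>v. ek \<xi> x * (v *\<^sub>R ?D (x, t)))) (at t)" for x t
      by (intro has_derivative_mult_right d)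
    show "norm (ek \<xi> x * (v *\<^sub>R ?D (x, s))) \<le> C * indicator ?K x * norm v" for x s v
      using mult_right_mono[OF B[of x s], of "\<bar>v\<bar>"] by (simp add: norm_mult mult.commute)
    show "integrable lborel (\<lambda>x. C * indicator ?K x)"
      using K by (intro integrable_mult_right integrable_real_indicator) (auto simp: borel_compact dest!: compact_imp_bounded emeasure_bounded_finite)
  qed (use i in auto)
  from has_derivative_mult_right[OF this, of "of_real (fconst TYPE('a))"]
  show ?thesis unfolding has_vector_derivative_def fourier_ek by (simp only: mult_scaleR_right integral_scaleR_right)
qed

text \<open>The inequality holds frequency by frequency. For fixed \<xi>,
  \<open>ftc_half_line\<close> is applied to the transform of the slice at height t as a function of
  t; Plancherel's identity on every slice then assembles the W1 norm, with constant 1.\<close>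

lemma half_space_trace_inequality:
  assumes e: "e \<in> {-1, 1}"
  shows "sobolev_norm (1/2) (distr_of (\<lambda>x. f (x, 0))) \<le> W1_norm (half_space e) f"
proof -
  let ?H = "\<lambda>\<xi> t. fourier (\<lambda>x. f (x, t)) \<xi>" and ?D = "dir_deriv (0, 1) f"
  let ?G = "\<lambda>\<xi> t. fourier (\<lambda>x. ?D (x, t)) \<xi>"
  let ?w = "\<lambda>\<xi>::'a. 1 + (norm \<xi>)\<^sup>2" and ?T = "{t. 0 < e * t}"
  have Dt: "?D \<in> test_functions UNIV" by (rule test_functions_dir_deriv[OF f])
  have Hm: "(\<lambda>(\<xi>, t). ?H \<xi> t) \<in> borel_measurable (borel \<Otimes>\<^sub>M borel)" by (rule slice_fourier_measurable)
  \<comment> \<open>The qualified name denotes the lemma exported from this context, hence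
    generalised over \<open>f\<close>; it is applied to the vertical derivative.\<close>
  have Gm: "(\<lambda>(\<xi>, t). ?G \<xi> t) \<in> borel_measurable (borel \<Otimes>\<^sub>M borel)"
    by (rule Submission.slice_fourier_measurable[OF Dt])
  note [measurable] = Hm Gm
  obtain T where T: "\<And>z. z \<in> fun_supp f \<Longrightarrow> norm z \<le> T" using test_functions_supp(1)[OF f] compact_imp_bounded bounded_iff by metis
  have H0: "?H \<xi> t = 0" if "\<bar>t\<bar> \<ge> T + 1" for \<xi> t
  proof -
    have "f (x, t) = 0" for x
    proof (rule fun_supp_zero[of "(x, t)" f], rule notI)
      assume "(x, t) \<in> fun_supp f"
      from T[OF this] norm_snd_le[of t x] that show False by simp
    qed
    then show ?thesis by (simp add: fourier_ek)
  qed
  have Gc: "continuous_on UNIV (?G \<xi>)" for \<xi>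
    using Submission.slice_fourier_deriv[OF Dt] by (intro continuous_at_imp_continuous_on ballI has_vector_derivative_continuous)
  have pt: "ennreal (?w \<xi> powr (1/2) * (norm (?H \<xi> 0))\<^sup>2) \<le>
      (\<integral>\<^sup>+t. indicator ?T t * ennreal (?w \<xi> * (norm (?H \<xi> t))\<^sup>2 + (norm (?G \<xi> t))\<^sup>2) \<partial>lborel)" for \<xi>
  proof -
    let ?r = "?w \<xi> powr (1/2)"
    have r2: "?r\<^sup>2 = ?w \<xi>" by (simp add: powr_power)
    have "ennreal (?r * (norm (?H \<xi> 0))\<^sup>2) = ennreal ?r * ennreal ((norm (?H \<xi> 0))\<^sup>2)" by (simp add: ennreal_mult)
    also have "\<dots> \<le> ennreal ?r * (\<integral>\<^sup>+t. indicator ?T t * ennreal (2 * (norm (?H \<xi> t) * norm (?G \<xi> t))) \<partial>lborel)"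
      by (intro mult_left_mono ftc_half_line[OF slice_fourier_deriv Gc H0 e]) auto
    also have "\<dots> = (\<integral>\<^sup>+t. ennreal ?r * (indicator ?T t * ennreal (2 * (norm (?H \<xi> t) * norm (?G \<xi> t)))) \<partial>lborel)"
      by (rule nn_integral_cmult[symmetric]) measurable
    also have "\<dots> \<le> (\<integral>\<^sup>+t. indicator ?T t * ennreal (?w \<xi> * (norm (?H \<xi> t))\<^sup>2 + (norm (?G \<xi> t))\<^sup>2) \<partial>lborel)"
    proof (rule nn_integral_mono)
      fix t
      \<comment> \<open>The half power of the weight is attached to \<open>?H\<close>, so that
        squaring restores the full weight.\<close>
      have "?r * (2 * (norm (?H \<xi> t) * norm (?G \<xi> t))) \<le> ?w \<xi> * (norm (?H \<xi> t))\<^sup>2 + (norm (?G \<xi> t))\<^sup>2"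
        using sum_squares_bound[of "?r * norm (?H \<xi> t)" "norm (?G \<xi> t)"] by (simp only: power_mult_distrib r2)
      then have "ennreal ?r * ennreal (2 * (norm (?H \<xi> t) * norm (?G \<xi> t))) \<le> ennreal (?w \<xi> * (norm (?H \<xi> t))\<^sup>2 + (norm (?G \<xi> t))\<^sup>2)"
        by (simp only: ennreal_mult'[symmetric, OF less_imp_le[OF weight_pos]] ennreal_leI)
      then show "ennreal ?r * (indicator ?T t * ennreal (2 * (norm (?H \<xi> t) * norm (?G \<xi> t)))) \<le> indicator ?T t * ennreal (?w \<xi> * (norm (?H \<xi> t))\<^sup>2 + (norm (?G \<xi> t))\<^sup>2)"
        by (simp add: indicator_def)
    qed
    finally show ?thesis .
  qed
  have pl: "(\<integral>\<^sup>+\<xi>. ennreal ((norm (fourier h \<xi>))\<^sup>2) \<partial>lborel) = (\<integral>\<^sup>+x. ennreal ((norm (h x))\<^sup>2) \<partial>lborel)" if "h \<in> schwartz" for h :: "'a \<Rightarrow> complex"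
    unfolding L2_norm_nn[OF L2_lborel_schwartz[OF that], symmetric] L2_norm_nn[OF L2_lborel_schwartz[OF fourier_schwartz[OF that]], symmetric]
    by (simp add: L2_norm_schwartz that)
  let ?N = "\<lambda>x t. ennreal ((norm (f (x, t)))\<^sup>2) + (\<Sum>b\<in>Basis. ennreal ((norm (dir_deriv b f (x, t)))\<^sup>2))"
  have mt: "h \<in> borel_measurable (borel \<Otimes>\<^sub>M borel)" if "h \<in> test_functions UNIV" for h :: "'a \<times> real \<Rightarrow> complex"
    unfolding borel_prod by (rule borel_measurable_continuous_onI[OF test_functions_continuous[OF that]])
  note [measurable] = mt[OF f] mt[OF test_functions_dir_deriv[OF f]]
  \<comment> \<open>Plancherel in the hyperplane variables at fixed height: the horizontal
    derivatives account for the factor |\<xi>|^2, the vertical one for the second term.\<close>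
  have slice: "(\<integral>\<^sup>+\<xi>. ennreal (?w \<xi> * (norm (?H \<xi> t))\<^sup>2 + (norm (?G \<xi> t))\<^sup>2) \<partial>lborel) = (\<integral>\<^sup>+x. ?N x t \<partial>lborel)" for t
  proof -
    note s = test_functions_schwartz[OF slice_test, of t] and sD = test_functions_schwartz[OF Submission.slice_test[OF Dt], of t]
    have [measurable]: "fourier (\<lambda>x. f (x, t)) \<in> borel_measurable borel" "fourier (\<lambda>x. ?D (x, t)) \<in> borel_measurable borel"
      by (intro schwartz_measurable fourier_schwartz s sD)+
    have nx: "(norm \<xi>)\<^sup>2 = (\<Sum>b\<in>Basis. (\<xi> \<bullet> b)\<^sup>2)" for \<xi> :: 'a
      unfolding power2_norm_eq_inner by (subst euclidean_inner) (simp add: power2_eq_square)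
    have "ennreal (?w \<xi> * (norm (?H \<xi> t))\<^sup>2 + (norm (?G \<xi> t))\<^sup>2) = ennreal ((norm (?H \<xi> t))\<^sup>2) +
        (\<Sum>b\<in>Basis. ennreal ((norm (fourier (\<lambda>x. dir_deriv (b, 0) f (x, t)) \<xi>))\<^sup>2)) + ennreal ((norm (?G \<xi> t))\<^sup>2)" for \<xi>
    proof -
      have "fourier (\<lambda>x. dir_deriv (b, 0) f (x, t)) \<xi> = \<i> * of_real (\<xi> \<bullet> b) * ?H \<xi> t" for b
        using fourier_dir_deriv[OF s, of b \<xi>] by (simp add: slice_dir_deriv[abs_def])
      then have "(\<Sum>b\<in>Basis. (norm (fourier (\<lambda>x. dir_deriv (b, 0) f (x, t)) \<xi>))\<^sup>2) = (norm \<xi>)\<^sup>2 * (norm (?H \<xi> t))\<^sup>2"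
        by (simp add: norm_mult power_mult_distrib nx sum_distrib_right)
      then show ?thesis by (simp add: sum_ennreal ennreal_plus[symmetric] distrib_right add.assoc del: ennreal_plus)
    qed
    then have "(\<integral>\<^sup>+\<xi>. ennreal (?w \<xi> * (norm (?H \<xi> t))\<^sup>2 + (norm (?G \<xi> t))\<^sup>2) \<partial>lborel) =
        (\<integral>\<^sup>+\<xi>. ennreal ((norm (?H \<xi> t))\<^sup>2) + (\<Sum>b\<in>Basis. ennreal ((norm (fourier (\<lambda>x. dir_deriv (b, 0) f (x, t)) \<xi>))\<^sup>2)) + ennreal ((norm (?G \<xi> t))\<^sup>2) \<partial>lborel)"
      by simp
    also have "\<dots> = (\<integral>\<^sup>+\<xi>. ennreal ((norm (?H \<xi> t))\<^sup>2) \<partial>lborel) + (\<Sum>b\<in>Basis. \<integral>\<^sup>+\<xi>. ennreal ((norm (fourier (\<lambda>x. dir_deriv (b, 0) f (x, t)) \<xi>))\<^sup>2) \<partial>lborel) + (\<integral>\<^sup>+\<xi>. ennreal ((norm (?G \<xi> t))\<^sup>2) \<partial>lborel)"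
    proof -
      have [measurable]: "fourier (\<lambda>x. dir_deriv (b, 0) f (x, t)) \<in> borel_measurable borel" for b
        by (intro schwartz_measurable fourier_schwartz test_functions_schwartz[OF Submission.slice_test[OF test_functions_dir_deriv[OF f]]])
      show ?thesis by (simp add: nn_integral_add nn_integral_sum del: sum_ennreal)
    qed
    also have "\<dots> = (\<integral>\<^sup>+x. ennreal ((norm (f (x, t)))\<^sup>2) \<partial>lborel) + (\<Sum>b\<in>Basis. \<integral>\<^sup>+x. ennreal ((norm (dir_deriv (b, 0) f (x, t)))\<^sup>2) \<partial>lborel) + (\<integral>\<^sup>+x. ennreal ((norm (?D (x, t)))\<^sup>2) \<partial>lborel)"
      using pl[OF s] pl[OF sD] pl[OF test_functions_schwartz[OF Submission.slice_test[OF test_functions_dir_deriv[OF f]]], of _ t] by simp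
    also have "\<dots> = (\<integral>\<^sup>+x. ennreal ((norm (f (x, t)))\<^sup>2) + ((\<Sum>b\<in>Basis. ennreal ((norm (dir_deriv (b, 0) f (x, t)))\<^sup>2)) + ennreal ((norm (?D (x, t)))\<^sup>2)) \<partial>lborel)"
      by (simp add: nn_integral_add nn_integral_sum add.assoc del: sum_ennreal)
    also have "\<dots> = (\<integral>\<^sup>+x. ?N x t \<partial>lborel)" by (simp add: sum_Basis_pair_real del: sum_ennreal)
    finally show ?thesis .
  qed
  let ?U = "half_space e :: ('a \<times> real) set"
  have Um: "?U \<in> sets borel" using open_half_space by (rule borel_open)
  have "ennreal ((sobolev_norm (1/2) (distr_of (\<lambda>x. f (x, 0))))\<^sup>2) = (\<integral>\<^sup>+\<xi>. ennreal (?w \<xi> powr (1/2) * (norm (?H \<xi> 0))\<^sup>2) \<partial>lborel)"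
  proof -
    note s = test_functions_schwartz[OF slice_test, of 0]
    have [measurable]: "fourier (\<lambda>x. f (x, 0)) \<in> borel_measurable borel" by (intro schwartz_measurable fourier_schwartz s)
    show ?thesis unfolding sobolev_norm_eq[OF has_fourier_distr_of[OF s]] L2_norm_nn[OF schwartz_L2_wgt[OF fourier_schwartz[OF s]]]
      unfolding wgt_def by (subst nn_integral_density) (auto simp: ennreal_mult)
  qed
  also have "\<dots> \<le> (\<integral>\<^sup>+\<xi>. (\<integral>\<^sup>+t. indicator ?T t * ennreal (?w \<xi> * (norm (?H \<xi> t))\<^sup>2 + (norm (?G \<xi> t))\<^sup>2) \<partial>lborel) \<partial>lborel)"
    by (intro nn_integral_mono pt)
  also have "\<dots> = (\<integral>\<^sup>+t. (\<integral>\<^sup>+\<xi>. indicator ?T t * ennreal (?w \<xi> * (norm (?H \<xi> t))\<^sup>2 + (norm (?G \<xi> t))\<^sup>2) \<partial>lborel) \<partial>lborel)"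
    by (rule lborel_pair.Fubini'[symmetric]) measurable
  also have "\<dots> = (\<integral>\<^sup>+t. indicator ?T t * (\<integral>\<^sup>+x. ?N x t \<partial>lborel) \<partial>lborel)"
  proof (rule nn_integral_cong)
    fix t
    have "(\<lambda>\<xi>. ennreal (?w \<xi> * (norm (?H \<xi> t))\<^sup>2 + (norm (?G \<xi> t))\<^sup>2)) \<in> borel_measurable lborel" by measurable
    then show "(\<integral>\<^sup>+\<xi>. indicator ?T t * ennreal (?w \<xi> * (norm (?H \<xi> t))\<^sup>2 + (norm (?G \<xi> t))\<^sup>2) \<partial>lborel) = indicator ?T t * (\<integral>\<^sup>+x. ?N x t \<partial>lborel)"
      unfolding slice[symmetric] by (rule nn_integral_cmult)
  qed
  also have "\<dots> = (\<integral>\<^sup>+t. (\<integral>\<^sup>+x. indicator ?T t * ?N x t \<partial>lborel) \<partial>lborel)"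
    by (intro nn_integral_cong nn_integral_cmult[symmetric]) measurable
  also have "\<dots> = (\<integral>\<^sup>+z. indicator ?U z * ?N (fst z) (snd z) \<partial>(lborel \<Otimes>\<^sub>M lborel))"
  proof -
    have "(\<lambda>z. indicator ?T (snd z) * ?N (fst z) (snd z)) \<in> borel_measurable (lborel \<Otimes>\<^sub>M lborel)" by measurable
    from lborel_pair.nn_integral_snd[OF this] show ?thesis by (simp add: half_space_def indicator_def)
  qed
  also have "\<dots> = (\<integral>\<^sup>+z. indicator ?U z * (ennreal ((norm (f z))\<^sup>2) + (\<Sum>b\<in>Basis. ennreal ((norm (dir_deriv b f z))\<^sup>2))) \<partial>lborel)"
    by (simp add: lborel_prod)
  also have "\<dots> = (\<integral>\<^sup>+z. ennreal ((norm (f z))\<^sup>2) + (\<Sum>b\<in>Basis. ennreal ((norm (dir_deriv b f z))\<^sup>2)) \<partial>on_set ?U)"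
    unfolding on_set_def by (subst nn_integral_restrict_space) (auto simp: Um mult.commute)
  also have "\<dots> = ennreal ((L2_norm (on_set ?U) f)\<^sup>2) + (\<Sum>b\<in>Basis. ennreal ((L2_norm (on_set ?U) (dir_deriv b f))\<^sup>2))"
  proof -
    have L: "h \<in> L2 (on_set ?U)" if "h \<in> test_functions UNIV" for h by (rule test_functions_L2_on_set[OF open_half_space that])
    note Lf = L[OF f] and LD = L[OF test_functions_dir_deriv[OF f]]
    show ?thesis unfolding L2_norm_nn[OF Lf] L2_norm_nn[OF LD]
      using L2D(1)[OF Lf] L2D(1)[OF LD] by (simp add: nn_integral_add nn_integral_sum del: sum_ennreal)
  qed
  also have "\<dots> = ennreal ((W1_norm ?U f)\<^sup>2)"
    by (simp add: W1_norm_eq[OF open_half_space has_weak_deriv_test[OF open_half_space f]] sum_nonneg sum_ennreal)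
  finally have "(sobolev_norm (1/2) (distr_of (\<lambda>x. f (x, 0))))\<^sup>2 \<le> (W1_norm ?U f)\<^sup>2" by (simp only: ennreal_le_iff zero_le_power2)
  then show ?thesis
    by (rule power2_le_imp_le) (simp add: W1_norm_eq[OF open_half_space has_weak_deriv_test[OF open_half_space f]] sum_nonneg)
qed

end

text \<open>The data from which a Dirichlet trace is read off: \<open>dirichlet_trace\<close>
  quantifies over all such sequences f, and \<open>dirichlet_trace_eqI\<close> shows that one of
  them decides.\<close>

definition w1_approx :: "real \<Rightarrow> ('a::euclidean_space \<times> real \<Rightarrow> complex) \<Rightarrow> (nat \<Rightarrow> 'a \<times> real \<Rightarrow> complex) \<Rightarrow> bool" where
  "w1_approx e u f \<longleftrightarrow> u \<in> W1 (half_space e) \<and> (\<forall>n. f n \<in> test_functions UNIV) \<and>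
     (\<lambda>n. W1_norm (half_space e) (\<lambda>x. f n x - u x)) \<longlonglongrightarrow> 0"

lemma W1_norm_nonneg:
  assumes U: "open U" and u: "u \<in> W1 U" and f: "f \<in> test_functions UNIV"
  obtains G where "\<And>b. b \<in> Basis \<Longrightarrow> has_weak_deriv U b u (G b)"
    "\<And>f. f \<in> test_functions UNIV \<Longrightarrow> (W1_norm U (\<lambda>x. f x - u x))\<^sup>2 = (L2_norm (on_set U) (\<lambda>x. f x - u x))\<^sup>2 +
      (\<Sum>b\<in>Basis. (L2_norm (on_set U) (\<lambda>x. dir_deriv b f x - G b x))\<^sup>2)"
    "\<And>f. f \<in> test_functions UNIV \<Longrightarrow> 0 \<le> W1_norm U (\<lambda>x. f x - u x)"
proof -
  from u have uL: "u \<in> L2 (on_set U)" and "\<forall>b\<in>Basis. \<exists>g. has_weak_deriv U b u g" by (auto simp: W1_def)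
  then obtain G where G: "\<And>b. b \<in> Basis \<Longrightarrow> has_weak_deriv U b u (G b)" by metis
  have e: "W1_norm U (\<lambda>x. f x - u x) = sqrt ((L2_norm (on_set U) (\<lambda>x. f x - u x))\<^sup>2 +
      (\<Sum>b\<in>Basis. (L2_norm (on_set U) (\<lambda>x. dir_deriv b f x - G b x))\<^sup>2))" if "f \<in> test_functions UNIV" for f
    by (rule W1_norm_eq[OF U]) (rule has_weak_deriv_diff[OF U test_functions_L2_on_set[OF U that] uL has_weak_deriv_test[OF U that] G])
  show thesis by (rule that[OF G]) (simp_all add: e sum_nonneg)
qed

lemma L2_norm_diff_sq_le:
  assumes "f \<in> L2 M" "g \<in> L2 M" "h \<in> L2 M"
  shows "(L2_norm M (\<lambda>x. f x - g x))\<^sup>2 \<le> 2 * (L2_norm M (\<lambda>x. f x - h x))\<^sup>2 + 2 * (L2_norm M (\<lambda>x. g x - h x))\<^sup>2"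
proof -
  let ?a = "L2_norm M (\<lambda>x. f x - h x)" and ?b = "L2_norm M (\<lambda>x. g x - h x)"
  have "L2_norm M (\<lambda>x. f x - g x) \<le> ?a + ?b" using L2_triangle3[OF assms(1,3,2)] L2_norm_minus[of M h g] by simp
  then have "(L2_norm M (\<lambda>x. f x - g x))\<^sup>2 \<le> (?a + ?b)\<^sup>2" by (intro power_mono) auto
  also have "\<dots> \<le> 2 * ?a\<^sup>2 + 2 * ?b\<^sup>2" using zero_le_power2[of "?a - ?b"] unfolding power2_sum power2_diff by linarith
  finally show ?thesis .
qed

lemma sum_squares_le_double_sum:
  fixes a b :: real assumes "0 \<le> a" "0 \<le> b" shows "2 * a\<^sup>2 + 2 * b\<^sup>2 \<le> (2 * (a + b))\<^sup>2"
proof -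
  have "(2 * (a + b))\<^sup>2 = (2 * a\<^sup>2 + 2 * b\<^sup>2) + (2 * a\<^sup>2 + 2 * b\<^sup>2 + 8 * (a * b))" by (simp add: power2_eq_square algebra_simps)
  moreover have "0 \<le> 2 * a\<^sup>2 + 2 * b\<^sup>2 + 8 * (a * b)" using assms by simp
  ultimately show ?thesis by linarith
qed

text \<open>The trace inequality is applied to f - h, a test function even though u is not. The
  factor 2 arises because the triangle inequality through u is used on squared norms, term by
  term.\<close>

lemma half_space_trace_diff:
  assumes e: "e \<in> {-1, 1}" and u: "u \<in> W1 (half_space e)" and f: "f \<in> test_functions UNIV" and h: "h \<in> test_functions UNIV"
  shows "sobolev_norm (1/2) (distr_diff (distr_of (\<lambda>y. f (y, 0))) (distr_of (\<lambda>y. h (y, 0))))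
    \<le> 2 * (W1_norm (half_space e) (\<lambda>x. f x - u x) + W1_norm (half_space e) (\<lambda>x. h x - u x))"
proof -
  let ?U = "half_space e :: ('a \<times> real) set"
  note U = open_half_space[of e, where 'a='a]
  obtain G where G: "\<And>b. b \<in> Basis \<Longrightarrow> has_weak_deriv ?U b u (G b)"
    "\<And>f. f \<in> test_functions UNIV \<Longrightarrow> (W1_norm ?U (\<lambda>x. f x - u x))\<^sup>2 = (L2_norm (on_set ?U) (\<lambda>x. f x - u x))\<^sup>2 +
      (\<Sum>b\<in>Basis. (L2_norm (on_set ?U) (\<lambda>x. dir_deriv b f x - G b x))\<^sup>2)"
    "\<And>f. f \<in> test_functions UNIV \<Longrightarrow> 0 \<le> W1_norm ?U (\<lambda>x. f x - u x)"
    using W1_norm_nonneg[OF U u f] by blast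
  have fh: "(\<lambda>x. f x - h x) \<in> test_functions UNIV" by (rule test_functions_diff[OF f h])
  have uL: "u \<in> L2 (on_set ?U)" using u by (simp add: W1_def)
  have GL: "G b \<in> L2 (on_set ?U)" if "b \<in> Basis" for b using G(1)[OF that] by (simp add: has_weak_deriv_def)
  note L = test_functions_L2_on_set[OF U]
  note D = test_functions_dir_deriv
  have df: "\<phi> differentiable at x" if "\<phi> \<in> test_functions UNIV" for \<phi> :: "'a \<times> real \<Rightarrow> complex" and x
    using smooth_in_differentiable[OF test_functions_smooth[OF that]] by simp
  have dd: "dir_deriv b (\<lambda>x. f x - h x) x = dir_deriv b f x - dir_deriv b h x" for b x
    by (rule dir_deriv_eqI) (intro has_derivative_diff has_derivative_dir_deriv df f h)
  let ?a = "W1_norm ?U (\<lambda>x. f x - u x)" and ?b = "W1_norm ?U (\<lambda>x. h x - u x)"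
  have W: "(W1_norm ?U (\<lambda>x. f x - h x))\<^sup>2 = (L2_norm (on_set ?U) (\<lambda>x. f x - h x))\<^sup>2 + (\<Sum>b\<in>Basis. (L2_norm (on_set ?U) (\<lambda>x. dir_deriv b f x - dir_deriv b h x))\<^sup>2)"
    unfolding W1_norm_eq[OF U has_weak_deriv_test[OF U fh]] dd by (simp add: sum_nonneg)
  also have "\<dots> \<le> (2 * (L2_norm (on_set ?U) (\<lambda>x. f x - u x))\<^sup>2 + 2 * (L2_norm (on_set ?U) (\<lambda>x. h x - u x))\<^sup>2) +
      (\<Sum>b\<in>Basis. 2 * (L2_norm (on_set ?U) (\<lambda>x. dir_deriv b f x - G b x))\<^sup>2 + 2 * (L2_norm (on_set ?U) (\<lambda>x. dir_deriv b h x - G b x))\<^sup>2)"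
    by (intro add_mono sum_mono L2_norm_diff_sq_le L[OF f] L[OF h] uL GL L[OF D[OF f]] L[OF D[OF h]])
  also have "\<dots> = 2 * ?a\<^sup>2 + 2 * ?b\<^sup>2" unfolding G(2)[OF f] G(2)[OF h] sum.distrib sum_distrib_left[symmetric] by (simp only: distrib_left add_ac)
  also have "\<dots> \<le> (2 * (?a + ?b))\<^sup>2" by (rule sum_squares_le_double_sum[OF G(3)[OF f] G(3)[OF h]])
  finally have "(W1_norm ?U (\<lambda>x. f x - h x))\<^sup>2 \<le> (2 * (?a + ?b))\<^sup>2" .
  moreover have "0 \<le> 2 * (?a + ?b)" using add_nonneg_nonneg[OF G(3)[OF f] G(3)[OF h]] by (simp only: zero_le_mult_iff zero_le_numeral simp_thms)
  ultimately have "W1_norm ?U (\<lambda>x. f x - h x) \<le> 2 * (?a + ?b)" by (rule power2_le_imp_le)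
  moreover have "distr_diff (distr_of (\<lambda>y. f (y, 0))) (distr_of (\<lambda>y. h (y, 0))) = distr_of (\<lambda>y. f (y, 0) - h (y, 0))"
    using test_functions_schwartz[OF slice_test[OF f, of 0]] test_functions_schwartz[OF slice_test[OF h, of 0]]
    by (auto simp: distr_diff_def distr_of_def left_diff_distrib schwartz_mult_integrable)
  ultimately show ?thesis using half_space_trace_inequality[OF fh e] by simp
qed

text \<open>By \<open>half_space_trace_diff\<close> the restrictions of any two approximating
  sequences have the same limit, which gives existence for the definite description; uniqueness is
  that of limits in the Sobolev norm.\<close>

lemma dirichlet_trace_eqI:
  assumes e: "e \<in> {-1, 1}" and a: "w1_approx e u f" and g: "g \<in> sobolev (1/2)"
    "(\<lambda>n. sobolev_norm (1/2) (distr_diff (distr_of (\<lambda>y. f n (y, 0))) g)) \<longlonglongrightarrow> 0"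
  shows "dirichlet_trace e u = g"
proof -
  have u: "u \<in> W1 (half_space e)" and f: "\<And>n. f n \<in> test_functions UNIV" and fu: "(\<lambda>n. W1_norm (half_space e) (\<lambda>x. f n x - u x)) \<longlonglongrightarrow> 0"
    using a by (auto simp: w1_approx_def)
  have S: "distr_of (\<lambda>y. h (y, 0)) \<in> sobolev (1/2)" if "h \<in> test_functions UNIV" for h :: "'a \<times> real \<Rightarrow> complex"
    by (rule distr_of_sobolev[OF test_functions_schwartz[OF slice_test[OF that]]])
  let ?P = "\<lambda>g. g \<in> sobolev (1/2) \<and>
     (\<forall>f :: nat \<Rightarrow> 'a \<times> real \<Rightarrow> complex.
        (\<forall>j. f j \<in> test_functions UNIV) \<and>
        (\<lambda>j. W1_norm (half_space e) (\<lambda>x. f j x - u x)) \<longlonglongrightarrow> 0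
        \<longrightarrow> (\<lambda>j. sobolev_norm (1/2) (distr_diff (distr_of (\<lambda>y. f j (y, 0))) g)) \<longlonglongrightarrow> 0)"
  have "?P g"
  proof (intro conjI allI impI g(1))
    fix h :: "nat \<Rightarrow> 'a \<times> real \<Rightarrow> complex"
    assume "(\<forall>j. h j \<in> test_functions UNIV) \<and> (\<lambda>j. W1_norm (half_space e) (\<lambda>x. h j x - u x)) \<longlonglongrightarrow> 0"
    then have h: "\<And>j. h j \<in> test_functions UNIV" "(\<lambda>j. W1_norm (half_space e) (\<lambda>x. h j x - u x)) \<longlonglongrightarrow> 0" by auto
    show "(\<lambda>j. sobolev_norm (1/2) (distr_diff (distr_of (\<lambda>y. h j (y, 0))) g)) \<longlonglongrightarrow> 0"
    proof (rule tendsto_sandwich[OF _ _ tendsto_const])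
      show "\<forall>\<^sub>F j in sequentially. sobolev_norm (1/2) (distr_diff (distr_of (\<lambda>y. h j (y, 0))) g) \<le>
          2 * (W1_norm (half_space e) (\<lambda>x. h j x - u x) + W1_norm (half_space e) (\<lambda>x. f j x - u x)) + sobolev_norm (1/2) (distr_diff (distr_of (\<lambda>y. f j (y, 0))) g)"
        using order_trans[OF sobolev_triangle[OF S[OF h(1)] S[OF f] g(1)] add_right_mono[OF half_space_trace_diff[OF e u h(1) f]]]
        by (intro always_eventually allI)
      show "(\<lambda>j. 2 * (W1_norm (half_space e) (\<lambda>x. h j x - u x) + W1_norm (half_space e) (\<lambda>x. f j x - u x)) + sobolev_norm (1/2) (distr_diff (distr_of (\<lambda>y. f j (y, 0))) g)) \<longlonglongrightarrow> 0"
        using tendsto_add[OF tendsto_mult[OF tendsto_const tendsto_add[OF h(2) fu]] g(2), of 2] by simp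
    qed auto
  qed
  moreover have "g' = g" if "?P g'" for g'
  proof -
    have "(\<lambda>n. sobolev_norm (1/2) (distr_diff (distr_of (\<lambda>y. f n (y, 0))) g')) \<longlonglongrightarrow> 0" "g' \<in> sobolev (1/2)"
      using that f fu by blast+
    then show ?thesis using sobolev_lim_unique[OF S[OF f] _ g(1) _ g(2)] by blast
  qed
  ultimately have "(THE g. ?P g) = g" by (rule the_equality)
  then show ?thesis using u by (simp add: dirichlet_trace_def)
qed

text \<open>The restrictions are Cauchy by \<open>half_space_trace_diff\<close>, and the Sobolev
  space of order 1/2 is complete.\<close>

lemma w1_approx_trace:
  assumes e: "e \<in> {-1, 1}" and a: "w1_approx e u f"
  obtains g where "g \<in> sobolev (1/2)" "(\<lambda>n. sobolev_norm (1/2) (distr_diff (distr_of (\<lambda>y. f n (y, 0))) g)) \<longlonglongrightarrow> 0"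
proof -
  have u: "u \<in> W1 (half_space e)" and f: "\<And>n. f n \<in> test_functions UNIV" and fu: "(\<lambda>n. W1_norm (half_space e) (\<lambda>x. f n x - u x)) \<longlonglongrightarrow> 0"
    using a by (auto simp: w1_approx_def)
  have S: "distr_of (\<lambda>y. f n (y, 0)) \<in> sobolev (1/2)" for n
    by (rule distr_of_sobolev[OF test_functions_schwartz[OF slice_test[OF f]]])
  have "\<exists>N. \<forall>m\<ge>N. \<forall>n\<ge>N. sobolev_norm (1/2) (distr_diff (distr_of (\<lambda>y. f m (y, 0))) (distr_of (\<lambda>y. f n (y, 0)))) < r" if r: "0 < r" for r
  proof -
    have "\<forall>\<^sub>F n in sequentially. W1_norm (half_space e) (\<lambda>x. f n x - u x) < r / 4" by (rule order_tendstoD(2)[OF fu]) (use r in simp)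
    then obtain N where N: "\<And>n. n \<ge> N \<Longrightarrow> W1_norm (half_space e) (\<lambda>x. f n x - u x) < r / 4" by (auto simp: eventually_sequentially)
    have "sobolev_norm (1/2) (distr_diff (distr_of (\<lambda>y. f m (y, 0))) (distr_of (\<lambda>y. f n (y, 0)))) < r" if "m \<ge> N" "n \<ge> N" for m n
    proof -
      have "2 * (W1_norm (half_space e) (\<lambda>x. f m x - u x) + W1_norm (half_space e) (\<lambda>x. f n x - u x)) < 2 * (r / 4 + r / 4)"
        by (intro mult_strict_left_mono add_strict_mono N that) simp
      also have "\<dots> = r" by simp
      finally show ?thesis using half_space_trace_diff[OF e u f f, of m n] by (rule le_less_trans[rotated])
    qed
    then show ?thesis by blast
  qed
  from sobolev_complete[OF S _ this] show thesis using that by auto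
qed

lemma dirichlet_trace_test:
  assumes e: "e \<in> {-1, 1}" and f: "f \<in> test_functions UNIV"
  shows "dirichlet_trace e f = distr_of (\<lambda>y. f (y, 0))"
proof (rule dirichlet_trace_eqI[OF e, of _ "\<lambda>n. f"])
  note U = open_half_space[of e, where 'a='a]
  have z: "(\<lambda>x. 0) \<in> test_functions UNIV"
    by (rule test_functionsI[of _ "{}"]) (auto simp: smooth_iff_smooth_in intro!: smooth_in_const)
  have "W1_norm (half_space e) (\<lambda>x. f x - f x) = 0"
    using W1_norm_eq[OF U has_weak_deriv_test[OF U z]]
    by (simp add: L2_norm_def dir_deriv_eqI[OF has_derivative_const])
  then show "w1_approx e f (\<lambda>n. f)"
    using f test_functions_L2_on_set[OF U f] has_weak_deriv_test[OF U f] by (auto simp: w1_approx_def W1_def)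
  note s = test_functions_schwartz[OF slice_test[OF f, of 0]]
  show "distr_of (\<lambda>y. f (y, 0)) \<in> sobolev (1/2)" by (rule distr_of_sobolev[OF s])
  have "sobolev_norm (1/2) (distr_diff (distr_of (\<lambda>y. f (y, 0))) (distr_of (\<lambda>y. f (y, 0)))) = 0"
    unfolding sobolev_norm_eq[OF has_fourier_diff[OF has_fourier_distr_of[OF s] has_fourier_distr_of[OF s]]] by (simp add: L2_norm_def)
  then show "(\<lambda>n. sobolev_norm (1/2) (distr_diff (distr_of (\<lambda>y. f (y, 0))) (distr_of (\<lambda>y. f (y, 0))))) \<longlonglongrightarrow> 0" by simp
qed

section \<open>Approximation in W1 by domination\<close>

lemma L2_dominated_convergence:
  assumes m: "\<And>n. p n \<in> borel_measurable M" "q \<in> borel_measurable M" and w: "integrable M (\<lambda>x. (w x)\<^sup>2)"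
    and b: "\<And>n x. x \<in> space M \<Longrightarrow> norm (p n x) \<le> w x" and l: "\<And>x. x \<in> space M \<Longrightarrow> (\<lambda>n. p n x) \<longlonglongrightarrow> q x"
  shows "p n \<in> L2 M" "q \<in> L2 M" "(\<lambda>n. L2_norm M (\<lambda>x. p n x - q x)) \<longlonglongrightarrow> 0"
proof -
  have qb: "norm (q x) \<le> w x" if x: "x \<in> space M" for x
    using LIMSEQ_le_const2[OF tendsto_norm[OF l[OF x]]] b[OF x] by blast
  show "p n \<in> L2 M" for n by (rule L2I_bound[OF m(1) w]) (intro power_mono b, auto)
  show "q \<in> L2 M" by (rule L2I_bound[OF m(2) w]) (intro power_mono qb, auto)
  have "(\<lambda>n. LINT x|M. (norm (p n x - q x))\<^sup>2) \<longlonglongrightarrow> (LINT x|M. 0)"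
  proof (rule integral_dominated_convergence[where w = "\<lambda>x. 4 * (w x)\<^sup>2"])
    show "AE x in M. (\<lambda>n. (norm (p n x - q x))\<^sup>2) \<longlonglongrightarrow> 0"
    proof (rule AE_I2)
      fix x assume x: "x \<in> space M"
      have "(\<lambda>n. (norm (p n x - q x))\<^sup>2) \<longlonglongrightarrow> (norm (q x - q x))\<^sup>2" by (intro tendsto_intros l x)
      then show "(\<lambda>n. (norm (p n x - q x))\<^sup>2) \<longlonglongrightarrow> 0" by simp
    qed
    show "AE x in M. norm ((norm (p n x - q x))\<^sup>2) \<le> 4 * (w x)\<^sup>2" for n
    proof (rule AE_I2)
      fix x assume x: "x \<in> space M"
      have "norm (p n x - q x) \<le> 2 * w x" using norm_triangle_ineq4[of "p n x" "q x"] b[OF x, of n] qb[OF x] by linarith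
      then have "(norm (p n x - q x))\<^sup>2 \<le> (2 * w x)\<^sup>2" by (intro power_mono) auto
      then show "norm ((norm (p n x - q x))\<^sup>2) \<le> 4 * (w x)\<^sup>2" by (simp add: power_mult_distrib)
    qed
  qed (use m w in auto)
  then have "(\<lambda>n. sqrt (LINT x|M. (norm (p n x - q x))\<^sup>2)) \<longlonglongrightarrow> sqrt 0" by (intro tendsto_real_sqrt) simp
  then show "(\<lambda>n. L2_norm M (\<lambda>x. p n x - q x)) \<longlonglongrightarrow> 0" by (simp add: L2_norm_def)
qed

text \<open>One square-integrable majorant for the functions and their derivatives turns pointwise
  convergence into L2 convergence; closedness of weak derivatives then identifies \<open>G b\<close>
  as those of u.\<close>

lemma w1_approxI:
  assumes e: "e \<in> {-1, 1}" and f: "\<And>n. f n \<in> test_functions UNIV" and w: "integrable (on_set (half_space e)) (\<lambda>x. (w x)\<^sup>2)"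
    and b: "\<And>n x. x \<in> half_space e \<Longrightarrow> norm (f n x) \<le> w x" "\<And>b n x. b \<in> Basis \<Longrightarrow> x \<in> half_space e \<Longrightarrow> norm (dir_deriv b (f n) x) \<le> w x"
    and l: "\<And>x. x \<in> half_space e \<Longrightarrow> (\<lambda>n. f n x) \<longlonglongrightarrow> u x"
      "\<And>b x. b \<in> Basis \<Longrightarrow> x \<in> half_space e \<Longrightarrow> (\<lambda>n. dir_deriv b (f n) x) \<longlonglongrightarrow> G b x"
  shows "w1_approx e u f"
proof -
  let ?U = "half_space e :: ('a \<times> real) set"
  note U = open_half_space[of e, where 'a='a]
  have sp: "space (on_set ?U) = ?U" by (simp add: on_set_def space_restrict_space)
  have mt: "h \<in> borel_measurable (on_set ?U)" if "h \<in> test_functions UNIV" for h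
    using test_functions_L2_on_set[OF U that] by (simp add: L2_def)
  have um: "u \<in> borel_measurable (on_set ?U)"
    by (rule borel_measurable_LIMSEQ_metric[OF mt[OF f]]) (use l(1) sp in auto)
  have Gm: "G b \<in> borel_measurable (on_set ?U)" if "b \<in> Basis" for b
    by (rule borel_measurable_LIMSEQ_metric[OF mt[OF test_functions_dir_deriv[OF f, of b]]]) (use l(2)[OF that] sp in auto)
  note Lu = L2_dominated_convergence[where p = f and q = u and w = w and M = "on_set ?U", OF mt[OF f] um w]
  note LG = L2_dominated_convergence[where p = "\<lambda>n. dir_deriv b (f n)" and q = "G b" and w = w and M = "on_set ?U" for b, OF mt[OF test_functions_dir_deriv[OF f]] Gm w]
  have u2: "u \<in> L2 (on_set ?U)" "(\<lambda>n. L2_norm (on_set ?U) (\<lambda>x. f n x - u x)) \<longlonglongrightarrow> 0"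
    using Lu(2,3) b(1) l(1) sp by auto
  have G2: "G b \<in> L2 (on_set ?U)" "(\<lambda>n. L2_norm (on_set ?U) (\<lambda>x. dir_deriv b (f n) x - G b x)) \<longlonglongrightarrow> 0" if "b \<in> Basis" for b
    using LG(2,3)[OF that] b(2)[OF that] l(2)[OF that] sp by auto
  have wd: "has_weak_deriv ?U b u (G b)" if "b \<in> Basis" for b
    by (rule has_weak_deriv_limit[OF U test_functions_L2_on_set[OF U f] u2(1) has_weak_deriv_test[OF U f] G2(1)[OF that] u2(2) G2(2)[OF that]])
  have W: "W1_norm ?U (\<lambda>x. f n x - u x) = sqrt ((L2_norm (on_set ?U) (\<lambda>x. f n x - u x))\<^sup>2 + (\<Sum>b\<in>Basis. (L2_norm (on_set ?U) (\<lambda>x. dir_deriv b (f n) x - G b x))\<^sup>2))" for n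
    by (rule W1_norm_eq[OF U]) (rule has_weak_deriv_diff[OF U test_functions_L2_on_set[OF U f] u2(1) has_weak_deriv_test[OF U f] wd])
  have "(\<lambda>n. W1_norm ?U (\<lambda>x. f n x - u x)) \<longlonglongrightarrow> sqrt (0\<^sup>2 + (\<Sum>b\<in>(Basis :: ('a \<times> real) set). 0\<^sup>2))"
    unfolding W by (intro tendsto_intros u2(2) G2(2))
  then show ?thesis unfolding w1_approx_def W1_def using f u2(1) wd by auto
qed

section \<open>Layer potentials with weakly singular kernels\<close>

text \<open>The kernel is given as a function \<kappa> of the squared distance s. The bound
  s^(-\<beta>/2) means order |z|^(-\<beta>) for the kernel; the bound s^(-(n+1)/2) on the
  derivative, with the inner derivative 2 z, means order |z|^(-n) for the gradient.\<close>

locale layer_potential = growth_measure M c d for M :: "'a::euclidean_space measure" and c d :: real +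
  fixes \<kappa> :: "complex \<Rightarrow> complex" and \<Psi> :: "'a \<Rightarrow> complex" and B :: real
  assumes kap_hol: "\<kappa> holomorphic_on {z. 0 < Re z}"
    and kap_bound: "\<And>R. 0 < R \<Longrightarrow> \<exists>C\<ge>0. \<forall>s. 0 < s \<and> s \<le> R \<longrightarrow> norm (\<kappa> (of_real s)) \<le> C * s powr (- (\<beta> / 2)) \<and>
        norm (deriv \<kappa> (of_real s)) \<le> C * s powr (- ((real DIM('a) + 1) / 2))"
    and bdd: "bounded (space M)"
    and Psi_meas [measurable]: "\<Psi> \<in> borel_measurable M"
    and Psi_le: "\<And>y. y \<in> space M \<Longrightarrow> norm (\<Psi> y) \<le> B"
begin

definition K :: "real \<Rightarrow> 'a \<times> real \<Rightarrow> complex" where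
  "K \<epsilon> z = \<kappa> (of_real ((norm z)\<^sup>2 + \<epsilon>\<^sup>2))"

definition dK :: "real \<Rightarrow> 'a \<times> real \<Rightarrow> 'a \<times> real \<Rightarrow> complex" where
  "dK \<epsilon> b z = of_real (2 * (z \<bullet> b)) * deriv \<kappa> (of_real ((norm z)\<^sup>2 + \<epsilon>\<^sup>2))"

definition pot :: "real \<Rightarrow> 'a \<times> real \<Rightarrow> complex" where
  "pot \<epsilon> x = (LINT y|M. K \<epsilon> (x - (y, 0)) * \<Psi> y)"

definition dpot :: "real \<Rightarrow> 'a \<times> real \<Rightarrow> 'a \<times> real \<Rightarrow> complex" where
  "dpot \<epsilon> b x = (LINT y|M. dK \<epsilon> b (x - (y, 0)) * \<Psi> y)"

text \<open>Up to a constant, a majorant of the gradients of all regularised potentials on a bounded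
  set off the hyperplane.\<close>

definition gradw :: "'a \<times> real \<Rightarrow> real" where
  "gradw x = (LINT y|M. norm (x - (y, 0)) powr (- real DIM('a)))"

lemma open_rhp: "open {z. 0 < Re z}"
  by (rule open_halfspace_Re_gt)

lemma cont_kap: "0 < s \<Longrightarrow> isCont \<kappa> (of_real s)" "0 < s \<Longrightarrow> isCont (deriv \<kappa>) (of_real s)"
  using holomorphic_on_imp_continuous_on[OF kap_hol] holomorphic_on_imp_continuous_on[OF holomorphic_deriv[OF kap_hol open_rhp]]
  by (simp_all add: continuous_on_eq_continuous_at[OF open_rhp])

lemma arg_pos: "z \<noteq> 0 \<or> \<epsilon> \<noteq> 0 \<Longrightarrow> 0 < (norm z)\<^sup>2 + \<epsilon>\<^sup>2" for z :: "'a \<times> real"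
  by (auto simp: add_pos_nonneg add_nonneg_pos)

lemma smooth_K:
  assumes "0 < \<epsilon>" shows "smooth_in UNIV (K \<epsilon>)" "dir_deriv b (K \<epsilon>) z = dK \<epsilon> b z"
proof -
  let ?q = "\<lambda>z::'a \<times> real. (norm z)\<^sup>2 + \<epsilon>\<^sup>2"
  have s: "smooth_in UNIV (\<lambda>z. complex_of_real (?q z))"
    unfolding of_real_add using smooth_in_norm_sq[OF open_UNIV, of "0 :: 'a \<times> real"] by (intro smooth_in_add smooth_in_const) auto
  have p: "complex_of_real (?q z) \<in> {z. 0 < Re z}" for z using arg_pos[of z \<epsilon>] assms by simp
  note H = smooth_in_holomorphic[where q = ?q, OF kap_hol open_rhp open_UNIV s p]
  show "smooth_in UNIV (K \<epsilon>)" using H(1) by (simp add: K_def[abs_def])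
  have "((\<lambda>z. complex_of_real (?q z)) has_derivative (\<lambda>v. of_real (2 * (z \<bullet> v)))) (at z)"
    unfolding power2_norm_eq_inner by (auto intro!: derivative_eq_intros simp: inner_commute)
  from dir_deriv_eqI[OF this] have "dir_deriv b (\<lambda>z. complex_of_real (?q z)) z = of_real (2 * (z \<bullet> b))" .
  then show "dir_deriv b (K \<epsilon>) z = dK \<epsilon> b z" using H(2)[of z b] by (simp add: K_def[abs_def] dK_def)
qed

lemma Psi_L2: "\<Psi> \<in> L2 M"
  by (rule bounded_L2[OF Psi_meas Psi_le])

lemma emb_measurable [measurable]: "(\<lambda>y. (y, 0::real)) \<in> M \<rightarrow>\<^sub>M borel"
  unfolding borel_prod[symmetric] by measurable

lemma emb_bounded: "bounded ((\<lambda>y. (y, 0::real)) ` space M)"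
  using bdd by (auto simp: bounded_iff)

lemma smooth_pot:
  assumes "0 < \<epsilon>" shows "smooth_in UNIV (pot \<epsilon>)" "dir_deriv b (pot \<epsilon>) x = dpot \<epsilon> b x"
  using smooth_in_convolution[OF emb_measurable emb_bounded integrable_L2[OF Psi_L2] smooth_K(1)[OF assms]]
  unfolding smooth_K(2)[OF assms] by (simp_all add: pot_def[abs_def] dpot_def)

lemma K_measurable [measurable]: "K \<epsilon> \<in> borel_measurable borel" and dK_measurable [measurable]: "dK \<epsilon> b \<in> borel_measurable borel"
proof -
  \<comment> \<open>The conditional has equal branches: it is f itself, presented as continuous on
    each of the pieces {0} and its complement.\<close>
  have P: "(\<lambda>z. if z \<in> {0} then f z else f z) \<in> borel_measurable borel"
    if "continuous_on (- {0}) f" for f :: "'a \<times> real \<Rightarrow> complex"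
    by (rule borel_measurable_continuous_on_if[OF _ _ that]) auto
  have c: "continuous_on (- {0}) (\<lambda>z::'a \<times> real. h (complex_of_real ((norm z)\<^sup>2 + \<epsilon>\<^sup>2)))" if "\<And>s. 0 < s \<Longrightarrow> isCont h (of_real s)" for h :: "complex \<Rightarrow> complex"
  proof (intro continuous_at_imp_continuous_on ballI)
    fix z :: "'a \<times> real" assume "z \<in> - {0}"
    then have "isCont h (complex_of_real ((norm z)\<^sup>2 + \<epsilon>\<^sup>2))" using arg_pos[of z \<epsilon>] by (intro that) auto
    then show "isCont (\<lambda>z. h (complex_of_real ((norm z)\<^sup>2 + \<epsilon>\<^sup>2))) z"
      by (rule isCont_o2[where g = h, rotated]) (intro continuous_intros)
  qed
  show "K \<epsilon> \<in> borel_measurable borel" using P[OF c[OF cont_kap(1)]] by (simp add: K_def[abs_def])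
  have "continuous_on (- {0}) (\<lambda>z. of_real (2 * (z \<bullet> b)) * deriv \<kappa> (complex_of_real ((norm z)\<^sup>2 + \<epsilon>\<^sup>2)))"
    by (intro continuous_on_mult c cont_kap(2) continuous_intros)
  from P[OF this] show "dK \<epsilon> b \<in> borel_measurable borel" by (simp add: dK_def[abs_def])
qed

text \<open>The exponents are negative, so adding \<epsilon>^2 to |z|^2 only lowers the bounds and
  the constant is uniform in \<epsilon>. In the gradient the factor 2 (z . b) reduces the order n +
  1 to n and doubles the constant.\<close>

lemma kernel_bounds:
  assumes "0 < R"
  obtains C where "0 \<le> C"
    "\<And>x y \<epsilon>. norm x \<le> R \<Longrightarrow> y \<in> space M \<Longrightarrow> 0 \<le> \<epsilon> \<Longrightarrow> \<epsilon> \<le> 1 \<Longrightarrow> x \<noteq> (y, 0) \<Longrightarrow> norm (K \<epsilon> (x - (y, 0))) \<le> C * norm (x - (y, 0)) powr (- \<beta>)"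
    "\<And>x y \<epsilon> b. norm x \<le> R \<Longrightarrow> y \<in> space M \<Longrightarrow> 0 \<le> \<epsilon> \<Longrightarrow> \<epsilon> \<le> 1 \<Longrightarrow> x \<noteq> (y, 0) \<Longrightarrow> b \<in> Basis \<Longrightarrow> norm (dK \<epsilon> b (x - (y, 0))) \<le> C * norm (x - (y, 0)) powr (- real DIM('a))"
proof -
  let ?N = "real DIM('a)"
  obtain R' where R': "\<And>y. y \<in> space M \<Longrightarrow> norm y \<le> R'" using bdd by (auto simp: bounded_iff)
  \<comment> \<open>An upper bound for |x - (y, 0)|^2 + \<epsilon>^2 when |x| <= R, y is in the
    space of M and \<epsilon> <= 1.\<close>
  define Q where "Q = (R + \<bar>R'\<bar>)\<^sup>2 + 1"
  have "0 < Q" by (simp add: Q_def add_nonneg_pos)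
  from kap_bound[OF this] obtain C where C: "0 \<le> C"
    "\<And>s. 0 < s \<Longrightarrow> s \<le> Q \<Longrightarrow> norm (\<kappa> (of_real s)) \<le> C * s powr (- (\<beta> / 2))"
    "\<And>s. 0 < s \<Longrightarrow> s \<le> Q \<Longrightarrow> norm (deriv \<kappa> (of_real s)) \<le> C * s powr (- ((?N + 1) / 2))" by blast
  have Qb: "0 < (norm (x - (y, 0)))\<^sup>2 + \<epsilon>\<^sup>2 \<and> (norm (x - (y, 0)))\<^sup>2 + \<epsilon>\<^sup>2 \<le> Q"
    if "norm x \<le> R" "y \<in> space M" "0 \<le> \<epsilon>" "\<epsilon> \<le> 1" "x \<noteq> (y, 0)" for x :: "'a \<times> real" and y \<epsilon>
  proof -
    have "norm (x - (y, 0)) \<le> norm x + norm (y, 0::real)" by (rule norm_triangle_ineq4)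
    also have "\<dots> \<le> R + \<bar>R'\<bar>" using that(1) R'[OF that(2)] by (simp add: norm_Pair)
    finally have "(norm (x - (y, 0)))\<^sup>2 \<le> (R + \<bar>R'\<bar>)\<^sup>2" by (intro power_mono) auto
    moreover have "\<epsilon>\<^sup>2 \<le> 1" using that by (simp add: power_le_one)
    ultimately show ?thesis using arg_pos[of "x - (y, 0)" \<epsilon>] that(5) by (simp add: Q_def)
  qed
  have pw: "((norm z)\<^sup>2 + \<epsilon>\<^sup>2) powr (- (a / 2)) \<le> norm z powr (- a)" if "z \<noteq> 0" "0 \<le> a" for z :: "'a \<times> real" and \<epsilon> a
  proof -
    have "((norm z)\<^sup>2 + \<epsilon>\<^sup>2) powr (- (a / 2)) \<le> ((norm z)\<^sup>2) powr (- (a / 2))" using that by (intro powr_mono2') auto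
    also have "\<dots> = (norm z powr 2) powr (- (a / 2))" using that by (simp add: powr_numeral)
    also have "\<dots> = norm z powr (- a)" by (simp only: powr_powr) simp
    finally show ?thesis .
  qed
  show thesis
  proof (rule that[of "2 * C"])
    show "0 \<le> 2 * C" using C(1) by simp
    fix x :: "'a \<times> real" and y and \<epsilon> :: real assume a: "norm x \<le> R" "y \<in> space M" "0 \<le> \<epsilon>" "\<epsilon> \<le> 1" "x \<noteq> (y, 0)"
    let ?z = "x - (y, 0)"
    have z: "?z \<noteq> 0" using a(5) by simp
    note q = Qb[OF a]
    have "norm (K \<epsilon> ?z) \<le> C * ((norm ?z)\<^sup>2 + \<epsilon>\<^sup>2) powr (- (\<beta> / 2))" unfolding K_def using q by (intro C(2)) auto
    also have "\<dots> \<le> C * norm ?z powr (- \<beta>)" using beta by (intro mult_left_mono pw z C(1)) auto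
    also have "\<dots> \<le> 2 * C * norm ?z powr (- \<beta>)" using C(1) by (intro mult_right_mono) auto
    finally show "norm (K \<epsilon> ?z) \<le> 2 * C * norm ?z powr (- \<beta>)" .
    fix b :: "'a \<times> real" assume b: "b \<in> Basis"
    have "norm (dK \<epsilon> b ?z) = 2 * \<bar>?z \<bullet> b\<bar> * norm (deriv \<kappa> (of_real ((norm ?z)\<^sup>2 + \<epsilon>\<^sup>2)))"
      unfolding dK_def norm_mult norm_of_real abs_mult by simp
    also have "\<dots> \<le> 2 * norm ?z * (C * ((norm ?z)\<^sup>2 + \<epsilon>\<^sup>2) powr (- ((?N + 1) / 2)))"
      using q b by (intro mult_mono C(3) Basis_le_norm) auto
    also have "\<dots> \<le> 2 * norm ?z * (C * norm ?z powr (- (?N + 1)))"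
      by (intro mult_left_mono pw z C(1)) auto
    also have "\<dots> = 2 * C * (norm ?z powr 1 * norm ?z powr (- (?N + 1)))" using z by simp
    also have "norm ?z powr 1 * norm ?z powr (- (?N + 1)) = norm ?z powr (- ?N)" unfolding powr_add[symmetric] by simp
    finally show "norm (dK \<epsilon> b ?z) \<le> 2 * C * norm ?z powr (- ?N)" .
  qed
qed

lemma integrable_riesz: "integrable M (\<lambda>y. dist x y powr (- \<beta>))" "(LINT y|M. dist x y powr (- \<beta>)) \<le> rconst \<beta>"
proof -
  have le: "(\<integral>\<^sup>+y. ennreal (dist x y powr (- \<beta>)) \<partial>M) \<le> ennreal (rconst \<beta>)" by (rule riesz_le[OF beta(1,3)])
  show i: "integrable M (\<lambda>y. dist x y powr (- \<beta>))"
    by (rule integrableI_bounded) (use le in \<open>auto intro: le_less_trans\<close>)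
  show "(LINT y|M. dist x y powr (- \<beta>)) \<le> rconst \<beta>"
    using le nn_integral_eq_integral[OF i] rconst_nonneg[OF beta(3)] by (simp add: ennreal_le_iff)
qed

text \<open>Projecting to the hyperplane decreases distances and so increases negative powers, which
  reduces the ambient kernel to a Riesz kernel on the hyperplane. The point y = fst x is excluded
  because there \<open>powr\<close> would give 0.\<close>

lemma riesz_fst_le:
  assumes "y \<noteq> fst x" shows "norm (x - (y, 0::real)) powr (- \<beta>) \<le> dist (fst x) y powr (- \<beta>)"
proof (rule powr_mono2')
  have "norm (fst (x - (y, 0::real))) \<le> norm (x - (y, 0::real))" by (metis norm_fst_le prod.collapse)
  then show "dist (fst x) y \<le> norm (x - (y, 0::real))" by (simp add: dist_norm)
qed (use beta(1) assms in auto)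

section \<open>Bounds and limits of the regularised potentials\<close>

lemma pot_dominated:
  assumes C: "0 \<le> C" "\<And>x y \<epsilon>. norm x \<le> R \<Longrightarrow> y \<in> space M \<Longrightarrow> 0 \<le> \<epsilon> \<Longrightarrow> \<epsilon> \<le> 1 \<Longrightarrow> x \<noteq> (y, 0) \<Longrightarrow> norm (K \<epsilon> (x - (y, 0))) \<le> C * norm (x - (y, 0)) powr (- \<beta>)"
    and x: "norm x \<le> R" and \<epsilon>: "0 \<le> \<epsilon>" "\<epsilon> \<le> 1"
  shows "AE y in M. norm (K \<epsilon> (x - (y, 0)) * \<Psi> y) \<le> C * \<bar>B\<bar> * dist (fst x) y powr (- \<beta>)"
  using AE_neq[of "fst x"] AE_space
proof eventually_elim
  fix y assume y: "y \<noteq> fst x" "y \<in> space M"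
  have "norm (K \<epsilon> (x - (y, 0))) \<le> C * norm (x - (y, 0)) powr (- \<beta>)" using y by (intro C(2) x \<epsilon>) auto
  also have "\<dots> \<le> C * dist (fst x) y powr (- \<beta>)" by (intro mult_left_mono riesz_fst_le C(1) y)
  finally have "norm (K \<epsilon> (x - (y, 0))) * norm (\<Psi> y) \<le> (C * dist (fst x) y powr (- \<beta>)) * \<bar>B\<bar>"
    using Psi_le[OF y(2)] C(1) by (intro mult_mono) auto
  then show "norm (K \<epsilon> (x - (y, 0)) * \<Psi> y) \<le> C * \<bar>B\<bar> * dist (fst x) y powr (- \<beta>)" by (simp add: norm_mult mult_ac)
qed

lemma pot_measurable_integrand: "(\<lambda>y. K \<epsilon> (x - (y, 0)) * \<Psi> y) \<in> borel_measurable M" "(\<lambda>y. dK \<epsilon> b (x - (y, 0)) * \<Psi> y) \<in> borel_measurable M"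
  by measurable

lemma pot_integrable:
  assumes "0 \<le> \<epsilon>" "\<epsilon> \<le> 1" shows "integrable M (\<lambda>y. K \<epsilon> (x - (y, 0)) * \<Psi> y)"
proof -
  have "0 < norm x + 1" by (simp add: add_nonneg_pos)
  then obtain C where C: "0 \<le> C" "\<And>x' y \<epsilon>. norm x' \<le> norm x + 1 \<Longrightarrow> y \<in> space M \<Longrightarrow> 0 \<le> \<epsilon> \<Longrightarrow> \<epsilon> \<le> 1 \<Longrightarrow> x' \<noteq> (y, 0) \<Longrightarrow> norm (K \<epsilon> (x' - (y, 0))) \<le> C * norm (x' - (y, 0)) powr (- \<beta>)"
    using kernel_bounds by metis
  have "AE y in M. norm (K \<epsilon> (x - (y, 0)) * \<Psi> y) \<le> C * \<bar>B\<bar> * dist (fst x) y powr (- \<beta>)"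
    by (rule pot_dominated[OF C _ assms]) auto
  then show ?thesis
    by (intro Bochner_Integration.integrable_bound[OF integrable_mult_right[OF integrable_riesz(1), of "C * \<bar>B\<bar>" "fst x"] pot_measurable_integrand(1)])
      (use C(1) in \<open>auto elim!: eventually_mono simp: abs_mult\<close>)
qed

lemma pot_le:
  assumes "0 < R"
  obtains C where "0 \<le> C" "\<And>x \<epsilon>. norm x \<le> R \<Longrightarrow> 0 \<le> \<epsilon> \<Longrightarrow> \<epsilon> \<le> 1 \<Longrightarrow> norm (pot \<epsilon> x) \<le> C"
proof -
  obtain C where C: "0 \<le> C" "\<And>x' y \<epsilon>. norm x' \<le> R \<Longrightarrow> y \<in> space M \<Longrightarrow> 0 \<le> \<epsilon> \<Longrightarrow> \<epsilon> \<le> 1 \<Longrightarrow> x' \<noteq> (y, 0) \<Longrightarrow> norm (K \<epsilon> (x' - (y, 0))) \<le> C * norm (x' - (y, 0)) powr (- \<beta>)"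
    using kernel_bounds[OF assms] by metis
  have "norm (pot \<epsilon> x) \<le> C * \<bar>B\<bar> * rconst \<beta>" if "norm x \<le> R" "0 \<le> \<epsilon>" "\<epsilon> \<le> 1" for x \<epsilon>
  proof -
    have "norm (pot \<epsilon> x) \<le> (LINT y|M. norm (K \<epsilon> (x - (y, 0)) * \<Psi> y))" unfolding pot_def by (rule integral_norm_bound)
    also have "\<dots> \<le> (LINT y|M. C * \<bar>B\<bar> * dist (fst x) y powr (- \<beta>))"
      by (rule integral_mono_AE[OF integrable_norm[OF pot_integrable[OF that(2,3)]] integrable_mult_right[OF integrable_riesz(1)] pot_dominated[OF C that]])
    also have "\<dots> \<le> C * \<bar>B\<bar> * rconst \<beta>" using integrable_riesz(2)[of "fst x"] C(1) by (simp add: mult_left_mono)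
    finally show ?thesis .
  qed
  then show thesis using that[of "C * \<bar>B\<bar> * rconst \<beta>"] C(1) rconst_nonneg[OF beta(3)] by simp
qed

abbreviation "eps n \<equiv> 1 / real (Suc n)"

lemma eps: "0 \<le> eps n" "eps n \<le> 1" "0 < eps n" "eps \<longlonglongrightarrow> 0"
  using LIMSEQ_Suc[OF lim_1_over_n] by auto

lemma kernel_lim:
  assumes "z \<noteq> 0" shows "(\<lambda>n. K (eps n) z) \<longlonglongrightarrow> K 0 z" "(\<lambda>n. dK (eps n) b z) \<longlonglongrightarrow> dK 0 b z"
proof -
  have "0 < (norm z)\<^sup>2 + 0\<^sup>2" using assms by simp
  note c = cont_kap[OF this]
  have l: "(\<lambda>n. complex_of_real ((norm z)\<^sup>2 + (eps n)\<^sup>2)) \<longlonglongrightarrow> complex_of_real ((norm z)\<^sup>2 + 0\<^sup>2)"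
    by (intro tendsto_intros eps(4))
  show "(\<lambda>n. K (eps n) z) \<longlonglongrightarrow> K 0 z" unfolding K_def by (rule isCont_tendsto_compose[OF c(1) l])
  show "(\<lambda>n. dK (eps n) b z) \<longlonglongrightarrow> dK 0 b z" unfolding dK_def by (intro tendsto_mult tendsto_const isCont_tendsto_compose[OF c(2) l])
qed

text \<open>Points of the screen are included: the integrands converge off a null diagonal and are
  dominated by an integrable Riesz kernel.\<close>

lemma pot_lim: "(\<lambda>n. pot (eps n) x) \<longlonglongrightarrow> pot 0 x"
proof -
  have "0 < norm x + 1" by (simp add: add_nonneg_pos)
  then obtain C where C: "0 \<le> C" "\<And>x' y \<epsilon>. norm x' \<le> norm x + 1 \<Longrightarrow> y \<in> space M \<Longrightarrow> 0 \<le> \<epsilon> \<Longrightarrow> \<epsilon> \<le> 1 \<Longrightarrow> x' \<noteq> (y, 0) \<Longrightarrow> norm (K \<epsilon> (x' - (y, 0))) \<le> C * norm (x' - (y, 0)) powr (- \<beta>)"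
    using kernel_bounds by metis
  show ?thesis
    unfolding pot_def
  proof (rule integral_dominated_convergence[where w = "\<lambda>y. C * \<bar>B\<bar> * dist (fst x) y powr (- \<beta>)"])
    show "AE y in M. (\<lambda>n. K (eps n) (x - (y, 0)) * \<Psi> y) \<longlonglongrightarrow> K 0 (x - (y, 0)) * \<Psi> y"
      using AE_neq[of "fst x"] by eventually_elim (intro tendsto_mult tendsto_const kernel_lim, auto)
    show "AE y in M. norm (K (eps n) (x - (y, 0)) * \<Psi> y) \<le> C * \<bar>B\<bar> * dist (fst x) y powr (- \<beta>)" for n
      by (rule pot_dominated[OF C _ eps(1,2)]) auto
  qed (use integrable_riesz in auto)
qed

section \<open>Gradients off the hyperplane\<close>

lemma norm_snd_le_diff: "\<bar>snd x\<bar> \<le> norm (x - (y, 0::real))" for x :: "'a \<times> real"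
proof -
  have "norm (snd (x - (y, 0::real))) \<le> norm (x - (y, 0::real))" by (metis norm_snd_le prod.collapse)
  then show ?thesis by simp
qed

lemma off_screen_powr:
  fixes x :: "'a \<times> real"
  assumes "snd x \<noteq> 0" shows "norm (x - (y, 0::real)) powr (- real DIM('a)) \<le> \<bar>snd x\<bar> powr (- real DIM('a))"
  by (rule powr_mono2') (use norm_snd_le_diff assms in auto)

lemma gradw_integrable:
  assumes "snd x \<noteq> 0" shows "integrable M (\<lambda>y. norm (x - (y, 0::real)) powr (- real DIM('a)))"
  by (rule integrable_const_bound[where B = "\<bar>snd x\<bar> powr (- real DIM('a))"])
    (use off_screen_powr[OF assms] in auto)

lemma gradw_nonneg: "0 \<le> gradw x"
  unfolding gradw_def by (intro integral_nonneg_AE) auto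

text \<open>At a fixed point off the hyperplane the gradient kernel stays away from its singularity,
  so the integrals exist and converge. The bound is uniform in n although it degenerates towards the
  screen.\<close>

lemma dpot_le_lim:
  assumes C: "0 \<le> C" "\<And>x y \<epsilon> b. norm x \<le> R \<Longrightarrow> y \<in> space M \<Longrightarrow> 0 \<le> \<epsilon> \<Longrightarrow> \<epsilon> \<le> 1 \<Longrightarrow> x \<noteq> (y, 0) \<Longrightarrow> b \<in> Basis \<Longrightarrow> norm (dK \<epsilon> b (x - (y, 0))) \<le> C * norm (x - (y, 0)) powr (- real DIM('a))"
    and x: "norm x \<le> R" "snd x \<noteq> 0" and b: "b \<in> Basis"
  shows "norm (dpot (eps n) b x) \<le> C * \<bar>B\<bar> * gradw x" "(\<lambda>n. dpot (eps n) b x) \<longlonglongrightarrow> dpot 0 b x"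
proof -
  let ?w = "\<lambda>y. C * \<bar>B\<bar> * norm (x - (y, 0)) powr (- real DIM('a))"
  have w: "integrable M ?w" by (intro integrable_mult_right gradw_integrable x)
  have le: "norm (dK (eps n) b (x - (y, 0)) * \<Psi> y) \<le> ?w y" if y: "y \<in> space M" for n y
  proof -
    have "norm (dK (eps n) b (x - (y, 0))) * norm (\<Psi> y) \<le> (C * norm (x - (y, 0)) powr (- real DIM('a))) * \<bar>B\<bar>"
      using Psi_le[OF y] C(1) x y b eps(1-3)[of n] by (intro mult_mono C(2)) auto
    then show ?thesis by (simp add: norm_mult mult_ac)
  qed
  have i: "integrable M (\<lambda>y. dK (eps n) b (x - (y, 0)) * \<Psi> y)" for n
    by (rule Bochner_Integration.integrable_bound[OF w pot_measurable_integrand(2)]) (use le in \<open>auto intro!: AE_I2 order_trans[OF _ abs_ge_self]\<close>)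
  show "norm (dpot (eps n) b x) \<le> C * \<bar>B\<bar> * gradw x"
    using norm_integral_le[OF i w le, of n] by (simp add: dpot_def gradw_def)
  show "(\<lambda>n. dpot (eps n) b x) \<longlonglongrightarrow> dpot 0 b x"
    unfolding dpot_def
  proof (rule integral_dominated_convergence[where w = ?w])
    show "AE y in M. (\<lambda>n. dK (eps n) b (x - (y, 0)) * \<Psi> y) \<longlonglongrightarrow> dK 0 b (x - (y, 0)) * \<Psi> y"
      using x(2) by (intro AE_I2 tendsto_mult tendsto_const kernel_lim) auto
  qed (use w le in auto)
qed

lemma emb_diff_measurable [measurable]: "(\<lambda>p. fst p - (snd p, 0::real)) \<in> borel_measurable (borel \<Otimes>\<^sub>M M)"
  using measurable_compose[OF measurable_snd emb_measurable] by (intro borel_measurable_diff measurable_fst) simp_all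

lemma kernel_measurable [measurable]: "(\<lambda>(x, y). norm (x - (y, 0::real)) powr a) \<in> borel_measurable (borel \<Otimes>\<^sub>M M)"
  unfolding case_prod_beta
  by (rule measurable_compose[OF emb_diff_measurable, where g = "\<lambda>z. norm z powr a"]) measurable

lemma gradw_measurable [measurable]: "gradw \<in> borel_measurable borel"
  unfolding gradw_def[abs_def] by measurable

text \<open>Lebesgue measure on a ball of the ambient space has growth exponent n + 1, and 2 n -
  \<beta> < n + 1 because \<beta> > n - 1. Hence \<open>riesz_potential_bound\<close> applies with
  the distance to p.\<close>

lemma ambient_riesz:
  assumes "0 < R"
  obtains C where "0 \<le> C" "\<And>p. (\<integral>\<^sup>+x. indicator (cball 0 R) x * ennreal (norm (x - (p :: 'a \<times> real)) powr (- (2 * real DIM('a) - \<beta>))) \<partial>lborel) \<le> ennreal C"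
proof -
  let ?M = "restrict_space lborel (cball (0 :: 'a \<times> real) R)" and ?v = "unit_ball_vol (real DIM('a) + 1)"
  have fin: "finite_measure ?M"
    by (intro finite_measureI) (simp add: emeasure_restrict_space space_restrict_space less_imp_neq[OF emeasure_lborel_cball_finite[unfolded infinity_ennreal_def]])
  have growth: "measure ?M {x \<in> space ?M. norm (x - p) \<le> r} \<le> ?v * r powr (real DIM('a) + 1)" if r: "0 < r" "r \<le> 1" for p r
  proof -
    have e: "{x \<in> space ?M. norm (x - p) \<le> r} = cball 0 R \<inter> cball p r"
      by (simp add: space_restrict_space set_eq_iff mem_cball dist_norm[of p] norm_minus_commute)
    have "measure ?M {x \<in> space ?M. norm (x - p) \<le> r} = measure lborel (cball 0 R \<inter> cball p r)"
      unfolding e by (subst measure_restrict_space) auto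
    also have "\<dots> \<le> measure lborel (cball p r)"
      by (rule measure_mono_fmeasurable) (use emeasure_lborel_cball_finite[of p r] in \<open>auto simp: fmeasurable_def\<close>)
    also have "\<dots> = ?v * r ^ (DIM('a) + 1)" using r content_cball[of r p] by (simp add: add.commute)
    also have "r ^ (DIM('a) + 1) = r powr (real DIM('a) + 1)" using r powr_realpow[of r "DIM('a) + 1"] by (simp add: add.commute)
    finally show ?thesis .
  qed
  have "2 * real DIM('a) - \<beta> < real DIM('a) + 1" "0 < 2 * real DIM('a) - \<beta>"
    using beta dim(3) by auto
  note rb = riesz_potential_bound[OF fin _ _ growth this(2,1)]
  let ?C = "measure ?M (space ?M) + ?v * 2 powr (2 * real DIM('a) - \<beta>) / (1 - 2 powr (2 * real DIM('a) - \<beta> - (real DIM('a) + 1)))"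
  have "(\<integral>\<^sup>+x. indicator (cball 0 R) x * ennreal (norm (x - p) powr (- (2 * real DIM('a) - \<beta>))) \<partial>lborel) \<le> ennreal ?C" for p :: "'a \<times> real"
  proof -
    have "(\<lambda>x. norm (x - p)) \<in> borel_measurable ?M" by (intro measurable_restrict_space1) measurable
    note rb[OF this]
    moreover have "(\<integral>\<^sup>+x. ennreal (norm (x - p) powr (- (2 * real DIM('a) - \<beta>))) \<partial>?M) = (\<integral>\<^sup>+x. indicator (cball 0 R) x * ennreal (norm (x - p) powr (- (2 * real DIM('a) - \<beta>))) \<partial>lborel)"
      by (subst nn_integral_restrict_space) (auto simp: mult.commute)
    ultimately show ?thesis by simp
  qed
  from this ennreal_leI[OF max.cobounded1[of ?C 0]] show thesis by (intro that[of "max ?C 0"]) (auto intro: order_trans)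
qed

text \<open>Schur test: the exponent \<open>2 * DIM('a)\<close> of the squared kernel is split as \<open>(2 * DIM('a) - \<beta>) + \<beta>\<close>.
  The first part is integrable over bounded sets of the ambient space, the second one with respect to \<open>M\<close>.\<close>

lemma gradw_integrable_sq:
  assumes R: "0 < R" shows "integrable lborel (\<lambda>x. indicator (cball 0 R) x * (gradw x)\<^sup>2)"
proof -
  have [measurable]: "cball (0 :: 'a \<times> real) R \<in> sets borel" by (rule borel_closed) simp
  let ?N = "real DIM('a)"
  obtain C where C: "0 \<le> C" "\<And>p. (\<integral>\<^sup>+x. indicator (cball 0 R) x * ennreal (norm (x - (p :: 'a \<times> real)) powr (- (2 * ?N - \<beta>))) \<partial>lborel) \<le> ennreal C"
    using ambient_riesz[OF R] by blast
  let ?F = "\<lambda>a x. \<integral>\<^sup>+y. ennreal (norm (x - (y, 0::real)) powr (- a)) \<partial>M"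
  have sq: "ennreal ((gradw x)\<^sup>2) \<le> ?F (2 * ?N - \<beta>) x * ennreal (rconst \<beta>)" for x :: "'a \<times> real"
  proof -
    have "ennreal (gradw x) \<le> ?F ?N x"
    proof (cases "integrable M (\<lambda>y. norm (x - (y, 0::real)) powr (- ?N))")
      case True then show ?thesis by (simp add: gradw_def nn_integral_eq_integral)
    next
      case False then show ?thesis by (simp add: gradw_def not_integrable_integral_eq)
    qed
    then have "(ennreal (gradw x))\<^sup>2 \<le> (?F ?N x)\<^sup>2" by (intro power_mono) auto
    also have "?F ?N x = (\<integral>\<^sup>+y. ennreal (norm (x - (y, 0::real)) powr (- ((2 * ?N - \<beta>) / 2))) * ennreal (norm (x - (y, 0::real)) powr (- (\<beta> / 2))) \<partial>M)"
      by (intro nn_integral_cong) (simp add: ennreal_mult[symmetric] powr_add[symmetric] field_simps)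
    also have "\<dots>\<^sup>2 \<le> (\<integral>\<^sup>+y. (ennreal (norm (x - (y, 0::real)) powr (- ((2 * ?N - \<beta>) / 2))))\<^sup>2 \<partial>M) * (\<integral>\<^sup>+y. (ennreal (norm (x - (y, 0::real)) powr (- (\<beta> / 2))))\<^sup>2 \<partial>M)"
      by (rule Cauchy_Schwarz_nn_integral) measurable
    also have "\<dots> = ?F (2 * ?N - \<beta>) x * ?F \<beta> x"
    proof -
      have "(norm z powr (- (a / 2)))\<^sup>2 = norm z powr (- a)" for z :: "'a \<times> real" and a
        unfolding power2_eq_square powr_add[symmetric] by simp
      then show ?thesis by (simp add: ennreal_power)
    qed
    also have "?F \<beta> x \<le> (\<integral>\<^sup>+y. ennreal (dist (fst x) y powr (- \<beta>)) \<partial>M)"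
    proof (rule nn_integral_mono_AE)
      show "AE y in M. ennreal (norm (x - (y, 0::real)) powr (- \<beta>)) \<le> ennreal (dist (fst x) y powr (- \<beta>))"
        using AE_neq[of "fst x"] by eventually_elim (intro ennreal_leI riesz_fst_le)
    qed
    also have "\<dots> \<le> ennreal (rconst \<beta>)" by (rule riesz_le[OF beta(1,3)])
    finally show ?thesis by (simp add: ennreal_power gradw_nonneg mult_left_mono)
  qed
  interpret P: pair_sigma_finite lborel M ..
  have "(\<integral>\<^sup>+x. ennreal (norm (indicator (cball 0 R) x * (gradw x)\<^sup>2)) \<partial>lborel) \<le>
      (\<integral>\<^sup>+x. (\<integral>\<^sup>+y. indicator (cball 0 R) x * ennreal (norm (x - (y, 0::real)) powr (- (2 * ?N - \<beta>))) \<partial>M) * ennreal (rconst \<beta>) \<partial>lborel)"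
  proof (rule nn_integral_mono)
    fix x :: "'a \<times> real"
    have "(\<lambda>y. ennreal (norm (x - (y, 0::real)) powr (- (2 * ?N - \<beta>)))) \<in> borel_measurable M" by measurable
    then have e: "(\<integral>\<^sup>+y. indicator (cball 0 R) x * ennreal (norm (x - (y, 0::real)) powr (- (2 * ?N - \<beta>))) \<partial>M) = indicator (cball 0 R) x * ?F (2 * ?N - \<beta>) x"
      by (rule nn_integral_cmult)
    show "ennreal (norm (indicator (cball 0 R) x * (gradw x)\<^sup>2)) \<le>
      (\<integral>\<^sup>+y. indicator (cball 0 R) x * ennreal (norm (x - (y, 0::real)) powr (- (2 * ?N - \<beta>))) \<partial>M) * ennreal (rconst \<beta>)"
      unfolding e using sq[of x] by (simp add: indicator_def)
  qed
  also have "\<dots> = (\<integral>\<^sup>+x. (\<integral>\<^sup>+y. indicator (cball 0 R) x * ennreal (norm (x - (y, 0::real)) powr (- (2 * ?N - \<beta>))) \<partial>M) \<partial>lborel) * ennreal (rconst \<beta>)"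
    by (rule nn_integral_multc) measurable
  also have "(\<integral>\<^sup>+x. (\<integral>\<^sup>+y. indicator (cball 0 R) x * ennreal (norm (x - (y, 0::real)) powr (- (2 * ?N - \<beta>))) \<partial>M) \<partial>lborel) =
      (\<integral>\<^sup>+y. (\<integral>\<^sup>+x. indicator (cball 0 R) x * ennreal (norm (x - (y, 0::real)) powr (- (2 * ?N - \<beta>))) \<partial>lborel) \<partial>M)"
    by (rule P.Fubini'[symmetric]) measurable
  also have "\<dots> \<le> (\<integral>\<^sup>+y. ennreal C \<partial>M)" by (intro nn_integral_mono C(2))
  also have "(\<integral>\<^sup>+y. ennreal C \<partial>M) * ennreal (rconst \<beta>) < \<infinity>"
    by (simp add: emeasure_eq_measure ennreal_mult_less_top)
  finally have fin: "(\<integral>\<^sup>+x. ennreal (norm (indicator (cball 0 R) x * (gradw x)\<^sup>2)) \<partial>lborel) < \<infinity>" by (simp add: mult_right_mono)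
  show ?thesis by (rule integrableI_bounded[OF _ fin]) simp
qed

text \<open>The majorant is a constant plus a multiple of \<open>gradw\<close> on a ball containing
  the support of \<sigma>, square integrable by \<open>gradw_integrable_sq\<close>. Agreement of u
  with the potential is asked for on the half-space only, since the single-layer potential is
  prescribed only off the screen.\<close>

lemma cutoff_pot_w1_approx:
  assumes \<sigma>: "\<sigma> \<in> test_functions UNIV" and e: "e \<in> {-1, 1}"
    and u: "\<And>x. x \<in> half_space e \<Longrightarrow> u x = \<sigma> x * pot 0 x"
  shows "w1_approx e u (\<lambda>n x. \<sigma> x * pot (eps n) x)"
proof -
  let ?f = "\<lambda>n x. \<sigma> x * pot (eps n) x"
  obtain R0 where R0: "\<And>x. x \<in> fun_supp \<sigma> \<Longrightarrow> norm x \<le> R0" using test_functions_supp(1)[OF \<sigma>] compact_imp_bounded bounded_iff by metis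
  define R where "R = max R0 1"
  have R: "0 < R" "\<And>x. x \<in> fun_supp \<sigma> \<Longrightarrow> norm x \<le> R" using R0 by (auto simp: R_def le_max_iff_disj)
  obtain C1 where C1: "0 \<le> C1" "\<And>x \<epsilon>. norm x \<le> R \<Longrightarrow> 0 \<le> \<epsilon> \<Longrightarrow> \<epsilon> \<le> 1 \<Longrightarrow> norm (pot \<epsilon> x) \<le> C1" using pot_le[OF R(1)] by blast
  obtain C2 where C2: "0 \<le> C2" "\<And>x y \<epsilon> b. norm x \<le> R \<Longrightarrow> y \<in> space M \<Longrightarrow> 0 \<le> \<epsilon> \<Longrightarrow> \<epsilon> \<le> 1 \<Longrightarrow> x \<noteq> (y, 0) \<Longrightarrow> b \<in> Basis \<Longrightarrow> norm (dK \<epsilon> b (x - (y, 0))) \<le> C2 * norm (x - (y, 0)) powr (- real DIM('a))"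
    using kernel_bounds[OF R(1)] by metis
  obtain S0 where S0: "\<And>x. norm (\<sigma> x) \<le> S0" "0 \<le> S0" using test_functions_bounded[OF \<sigma>] by blast
  have "\<exists>S. \<forall>x. norm (dir_deriv b \<sigma> x) \<le> S" for b
    using test_functions_bounded[OF test_functions_dir_deriv[OF \<sigma>, of b]] by blast
  then obtain Sb where Sb: "\<And>b x. norm (dir_deriv b \<sigma> x) \<le> Sb b" by metis
  have Sb0: "0 \<le> Sb b" for b using Sb[of b 0] norm_ge_zero order_trans by blast
  define S where "S = S0 + (\<Sum>b\<in>Basis. Sb b)"
  have S: "norm (\<sigma> x) \<le> S" "0 \<le> S" for x using S0(1)[of x] S0(2) Sb0 by (auto simp: S_def intro!: add_increasing2 sum_nonneg)
  have SD: "norm (dir_deriv b \<sigma> x) \<le> S" if "b \<in> Basis" for b x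
    using Sb[of b x] member_le_sum[OF that, of Sb] Sb0 S0(2) by (force simp: S_def)
  define w where "w x = indicator (cball 0 R) x * (S * C1 + S * (C2 * \<bar>B\<bar> * gradw x))" for x :: "'a \<times> real"
  have ft: "?f n \<in> test_functions UNIV" for n
    using test_functions_mult_left[OF \<sigma> smooth_pot(1)[OF eps(3)], of n] by (simp add: mult.commute)
  \<comment> \<open>The constants chosen above bound the potentials and gradients on the ball only;
    outside it every term of the product rule has to vanish.\<close>
  have out: "\<sigma> x = 0" "dir_deriv b \<sigma> x = 0" if "\<not> norm x \<le> R" for x b
  proof -
    have o: "open {x::'a \<times> real. R < norm x}" by (intro open_Collect_less continuous_intros)
    have z: "\<sigma> y = 0" if "R < norm y" for y using R(2)[of y] that by (intro fun_supp_zero) auto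
    show "\<sigma> x = 0" using that z by simp
    have "dir_deriv b \<sigma> x = dir_deriv b (\<lambda>x. 0) x" by (rule dir_deriv_cong_open[OF o]) (use that z in auto)
    then show "dir_deriv b \<sigma> x = 0" by (simp add: dir_deriv_eqI[OF has_derivative_const])
  qed
  have dd: "dir_deriv b (?f n) x = \<sigma> x * dpot (eps n) b x + dir_deriv b \<sigma> x * pot (eps n) x" for b n x
    using dir_deriv_mult[of \<sigma> x "pot (eps n)" b] smooth_in_differentiable[OF test_functions_smooth[OF \<sigma>]]
      smooth_in_differentiable[OF smooth_pot(1)[OF eps(3)]] smooth_pot(2)[OF eps(3)] by simp
  have snd0: "snd x \<noteq> 0" if "x \<in> half_space e" for x :: "'a \<times> real" using that by (auto simp: half_space_def)
  show ?thesis
  proof (rule w1_approxI[OF e ft, where w = w and G = "\<lambda>b x. \<sigma> x * dpot 0 b x + dir_deriv b \<sigma> x * pot 0 x"])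
    have i: "integrable lborel (\<lambda>x. indicator (cball 0 R) x * (2 * (S * C1)\<^sup>2) + 2 * (S * (C2 * \<bar>B\<bar>))\<^sup>2 * (indicator (cball 0 R) x * (gradw x)\<^sup>2) :: real)"
      using gradw_integrable_sq[OF R(1)] emeasure_lborel_cball_finite[of "0 :: 'a \<times> real" R]
      by (intro Bochner_Integration.integrable_add integrable_mult_right integrable_mult_left) auto
    have le: "(w x)\<^sup>2 \<le> indicator (cball 0 R) x * (2 * (S * C1)\<^sup>2) + 2 * (S * (C2 * \<bar>B\<bar>))\<^sup>2 * (indicator (cball 0 R) x * (gradw x)\<^sup>2)" for x
    proof (cases "x \<in> cball 0 R")
      case True
      have "(a + b)\<^sup>2 \<le> 2 * a\<^sup>2 + 2 * b\<^sup>2" for a b :: real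
        using zero_le_power2[of "a - b"] unfolding power2_sum power2_diff by linarith
      from this[of "S * C1" "S * (C2 * \<bar>B\<bar> * gradw x)"] True show ?thesis by (simp add: w_def power_mult_distrib mult_ac)
    qed (simp add: w_def)
    have [measurable]: "cball (0 :: 'a \<times> real) R \<in> sets borel" by (rule borel_closed) simp
    have wm: "w \<in> borel_measurable borel" unfolding w_def[abs_def] by measurable
    have iw: "integrable lborel (\<lambda>x. (w x)\<^sup>2)"
      by (rule Bochner_Integration.integrable_bound[OF i]) (use wm order_trans[OF le abs_ge_self] in simp_all)
    then show "integrable (on_set (half_space e)) (\<lambda>x. (w x)\<^sup>2)"
      using integrable_mult_indicator[OF _ iw, of "half_space e"] borel_open[OF open_half_space[of e, where 'a='a]]
      unfolding on_set_def by (subst integrable_restrict_space) auto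
    fix n and x :: "'a \<times> real" assume x: "x \<in> half_space e"
    show "norm (?f n x) \<le> w x"
    proof (cases "norm x \<le> R")
      case True
      have "norm (\<sigma> x) * norm (pot (eps n) x) \<le> S * C1" using S C1 eps True by (intro mult_mono) auto
      then show ?thesis using True S C2(1) gradw_nonneg[of x] by (simp add: w_def norm_mult add_increasing2)
    qed (simp add: out w_def)
    show "(\<lambda>n. ?f n x) \<longlonglongrightarrow> u x" unfolding u[OF x] by (intro tendsto_mult tendsto_const pot_lim)
    fix b :: "'a \<times> real" assume b: "b \<in> Basis"
    show "norm (dir_deriv b (?f n) x) \<le> w x"
    proof (cases "norm x \<le> R")
      case True
      have "norm (\<sigma> x) * norm (dpot (eps n) b x) \<le> S * (C2 * \<bar>B\<bar> * gradw x)"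
        using S dpot_le_lim(1)[OF C2 True snd0[OF x] b, of n] by (intro mult_mono) auto
      moreover have "norm (dir_deriv b \<sigma> x) * norm (pot (eps n) x) \<le> S * C1" using SD[OF b] S(2) C1 eps True by (intro mult_mono) auto
      ultimately have "norm (\<sigma> x * dpot (eps n) b x) + norm (dir_deriv b \<sigma> x * pot (eps n) x) \<le> S * (C2 * \<bar>B\<bar> * gradw x) + S * C1"
        unfolding norm_mult by (rule add_mono)
      then show ?thesis unfolding dd using True norm_triangle_ineq[of "\<sigma> x * dpot (eps n) b x" "dir_deriv b \<sigma> x * pot (eps n) x"]
        by (simp add: w_def add.commute)
    next
      case False
      then show ?thesis using out(1)[OF False] out(2)[OF False, of b] by (simp only: dd) (simp add: w_def)
    qed
    show "(\<lambda>n. dir_deriv b (?f n) x) \<longlonglongrightarrow> \<sigma> x * dpot 0 b x + dir_deriv b \<sigma> x * pot 0 x"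
    proof (cases "norm x \<le> R")
      case True
      show ?thesis unfolding dd by (intro tendsto_intros pot_lim dpot_le_lim(2)[OF C2 True snd0[OF x] b])
    next
      case False
      then show ?thesis using out(1)[OF False] out(2)[OF False, of b] by (simp only: dd) simp
    qed
  qed
qed

text \<open>The potentials are uniformly bounded on the screen, and on a finite measure a constant
  is a square-integrable majorant.\<close>

lemma pot_trace_L2:
  assumes \<sigma>: "\<And>x. x \<in> space M \<Longrightarrow> \<sigma> (x, 0) = 1"
  shows "(\<lambda>x. pot 0 (x, 0)) \<in> L2 M" "(\<lambda>n. L2_norm M (\<lambda>x. \<sigma> (x, 0) * pot (eps n) (x, 0) - pot 0 (x, 0))) \<longlonglongrightarrow> 0"
proof -
  obtain R0 where R0: "\<And>x. x \<in> space M \<Longrightarrow> norm x \<le> R0" using bdd by (auto simp: bounded_iff)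
  define R where "R = max R0 1"
  have R: "0 < R" "\<And>x. x \<in> space M \<Longrightarrow> norm (x, 0::real) \<le> R" using R0 by (auto simp: R_def le_max_iff_disj norm_Pair)
  obtain C where C: "0 \<le> C" "\<And>x \<epsilon>. norm x \<le> R \<Longrightarrow> 0 \<le> \<epsilon> \<Longrightarrow> \<epsilon> \<le> 1 \<Longrightarrow> norm (pot \<epsilon> x) \<le> C" using pot_le[OF R(1)] by blast
  have m: "(\<lambda>x. pot (eps n) (x, 0)) \<in> borel_measurable M" for n
    using measurable_compose[OF emb_measurable borel_measurable_continuous_onI[OF smooth_in_continuous_on[OF smooth_pot(1)[OF eps(3)]]]] .
  have m0: "(\<lambda>x. pot 0 (x, 0)) \<in> borel_measurable M" by (rule borel_measurable_LIMSEQ_metric[OF m pot_lim])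
  have b: "norm (pot (eps n) (x, 0)) \<le> C" if "x \<in> space M" for n x using C(2) R(2)[OF that] eps by blast
  note L = L2_dominated_convergence[where p = "\<lambda>n x. pot (eps n) (x, 0)" and w = "\<lambda>_. C", OF m m0 _ b pot_lim]
  show "(\<lambda>x. pot 0 (x, 0)) \<in> L2 M" by (rule L(2)) auto
  have "(\<lambda>n. L2_norm M (\<lambda>x. pot (eps n) (x, 0) - pot 0 (x, 0))) \<longlonglongrightarrow> 0" by (rule L(3)) auto
  moreover have "L2_norm M (\<lambda>x. \<sigma> (x, 0) * pot (eps n) (x, 0) - pot 0 (x, 0)) = L2_norm M (\<lambda>x. pot (eps n) (x, 0) - pot 0 (x, 0))" for n
    unfolding L2_norm_def by (intro arg_cong[where f = sqrt] Bochner_Integration.integral_cong refl) (simp add: \<sigma>)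
  ultimately show "(\<lambda>n. L2_norm M (\<lambda>x. \<sigma> (x, 0) * pot (eps n) (x, 0) - pot 0 (x, 0))) \<longlonglongrightarrow> 0" by simp
qed

end

section \<open>The fundamental solution as a function of the squared distance\<close>

lemma one_le_powr:
  fixes s R b :: real assumes "0 < s" "s \<le> R" "0 \<le> b" shows "1 \<le> R powr b * s powr (- b)"
proof -
  have "R powr (- b) \<le> s powr (- b)" using assms by (intro powr_mono2') auto
  then have "R powr b * R powr (- b) \<le> R powr b * s powr (- b)" by (intro mult_left_mono) auto
  then show ?thesis using assms by (simp add: powr_add[symmetric])
qed

text \<open>For u = c s, the bound ln u <= u covers large values and -ln u <= u^(-b) / b small ones.
  The term u is then converted into a negative power of s by \<open>one_le_powr\<close>, at the
  price of powers of R.\<close>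

lemma abs_ln_le_powr:
  fixes c R b :: real assumes "0 < c" "0 < b" "0 < R"
  obtains C where "0 \<le> C" "\<And>s. 0 < s \<Longrightarrow> s \<le> R \<Longrightarrow> \<bar>ln (c * s)\<bar> \<le> C * s powr (- b)"
proof (rule that[of "c * R * R powr b + c powr (- b) / b"])
  show "0 \<le> c * R * R powr b + c powr (- b) / b" using assms by simp
  fix s assume s: "0 < s" "s \<le> R"
  define u where "u = c * s"
  have u: "0 < u" using assms s by (simp add: u_def)
  have "ln (u powr (- b)) \<le> u powr (- b) - 1" using u by (intro ln_le_minus_one) simp
  then have "- ln u * b \<le> u powr (- b)" using u by (simp add: ln_powr mult.commute)
  then have 1: "- ln u \<le> u powr (- b) / b" using assms by (simp add: field_simps)
  have 2: "ln u \<le> u" using ln_le_minus_one[OF u] by simp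
  have "u \<le> (c * R) * 1" using assms s by (simp add: u_def)
  also have "\<dots> \<le> (c * R) * (R powr b * s powr (- b))" using one_le_powr[OF s] assms by (intro mult_left_mono) auto
  finally have 3: "u \<le> c * R * R powr b * s powr (- b)" by (simp add: mult_ac)
  have 4: "u powr (- b) = c powr (- b) * s powr (- b)" unfolding u_def by (rule powr_mult)
  have 5: "0 \<le> u powr (- b) / b" using assms by simp
  have "\<bar>ln u\<bar> \<le> u + u powr (- b) / b" using 1 2 u 5 by linarith
  also have "\<dots> \<le> c * R * R powr b * s powr (- b) + c powr (- b) / b * s powr (- b)" using 3 4 by simp
  also have "\<dots> = (c * R * R powr b + c powr (- b) / b) * s powr (- b)" by (simp only: distrib_right)
  finally show "\<bar>ln (c * s)\<bar> \<le> (c * R * R powr b + c powr (- b) / b) * s powr (- b)" unfolding u_def .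
qed

lemma entire_bounded_segment:
  assumes "f holomorphic_on UNIV" obtains C where "0 \<le> C" "\<And>s::real. 0 < s \<Longrightarrow> s \<le> R \<Longrightarrow> norm (f (of_real s) :: complex) \<le> C"
proof -
  have "compact ((\<lambda>s. f (of_real s)) ` {0..R})"
    by (intro compact_continuous_image continuous_on_compose2[OF holomorphic_on_imp_continuous_on[OF assms]] continuous_intros) auto
  from compact_imp_bounded[OF this] obtain C where C: "\<forall>s\<in>{0..R}. norm (f (of_real s)) \<le> C" by (auto simp: bounded_iff)
  show thesis by (rule that[of "\<bar>C\<bar>"]) (use C in \<open>auto intro: order_trans[OF _ abs_ge_self]\<close>)
qed

text \<open>Entire plus logarithm times entire is the shape of the two-dimensional fundamental
  solution as a function of squared distance; the derivative of the logarithm causes the order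
  s^(-1). The logarithm is set to 0 at 0 to match the convention \<open>ln 0 = 0\<close> at
  coincident points.\<close>

lemma log_kernel_bounds:
  assumes P: "P holomorphic_on UNIV" and Q: "Q holomorphic_on UNIV" and c: "0 < c"
  defines "\<kappa> \<equiv> \<lambda>z. P z + (if z = 0 then 0 else Ln (of_real c * z)) * Q z"
  shows "\<kappa> holomorphic_on {z. 0 < Re z}"
    "0 < R \<Longrightarrow> 0 < b \<Longrightarrow> \<exists>C\<ge>0. \<forall>s. 0 < s \<and> s \<le> R \<longrightarrow> norm (\<kappa> (of_real s)) \<le> C * s powr (- b) \<and> norm (deriv \<kappa> (of_real s)) \<le> C * s powr (- 1)"
proof -
  have D: "(\<kappa> has_field_derivative deriv P z + (inverse z * Q z + Ln (of_real c * z) * deriv Q z)) (at z)" if z: "0 < Re z" for z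
  proof (rule has_field_derivative_transform_within_open)
    have "of_real c * z \<notin> \<real>\<^sub>\<le>\<^sub>0" using z c by (auto simp: complex_nonpos_Reals_iff mult_le_0_iff)
    moreover have "z \<noteq> 0" using z by auto
    moreover have "(P has_field_derivative deriv P z) (at z)" "(Q has_field_derivative deriv Q z) (at z)"
      using holomorphic_derivI[OF P open_UNIV] holomorphic_derivI[OF Q open_UNIV] by auto
    ultimately show "((\<lambda>z. P z + Ln (of_real c * z) * Q z) has_field_derivative deriv P z + (inverse z * Q z + Ln (of_real c * z) * deriv Q z)) (at z)"
      using c by (auto intro!: derivative_eq_intros simp: field_simps)
    show "open {z. 0 < Re z}" by (rule open_halfspace_Re_gt)
  qed (use z in \<open>auto simp: \<kappa>_def\<close>)
  show "\<kappa> holomorphic_on {z. 0 < Re z}" unfolding holomorphic_on_def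
    using D by (auto simp: field_differentiable_def intro: has_field_derivative_at_within)
  assume R: "0 < R" "0 < b"
  obtain p where p: "0 \<le> p" "\<And>s. 0 < s \<Longrightarrow> s \<le> R \<Longrightarrow> norm (P (of_real s)) \<le> p" using entire_bounded_segment[OF P, where R = R] by blast
  obtain q where q: "0 \<le> q" "\<And>s. 0 < s \<Longrightarrow> s \<le> R \<Longrightarrow> norm (Q (of_real s)) \<le> q" using entire_bounded_segment[OF Q, where R = R] by blast
  obtain p' where p': "0 \<le> p'" "\<And>s. 0 < s \<Longrightarrow> s \<le> R \<Longrightarrow> norm (deriv P (of_real s)) \<le> p'" using entire_bounded_segment[OF holomorphic_deriv[OF P open_UNIV], where R = R] by blast
  obtain q' where q': "0 \<le> q'" "\<And>s. 0 < s \<Longrightarrow> s \<le> R \<Longrightarrow> norm (deriv Q (of_real s)) \<le> q'" using entire_bounded_segment[OF holomorphic_deriv[OF Q open_UNIV], where R = R] by blast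
  obtain l where l: "0 \<le> l" "\<And>s. 0 < s \<Longrightarrow> s \<le> R \<Longrightarrow> \<bar>ln (c * s)\<bar> \<le> l * s powr (- b)" using abs_ln_le_powr[OF c R(2,1)] by blast
  obtain m where m: "0 \<le> m" "\<And>s. 0 < s \<Longrightarrow> s \<le> R \<Longrightarrow> \<bar>ln (c * s)\<bar> \<le> m * s powr (- 1)" using abs_ln_le_powr[OF c zero_less_one R(1)] by blast
  have ln: "Ln (of_real c * of_real s) = of_real (ln (c * s))" if "0 < s" for s
    using c that Ln_of_real[of "c * s"] by simp
  let ?C1 = "p * R powr b + l * q" and ?C2 = "p' * R powr 1 + q + m * q'"
  show "\<exists>C\<ge>0. \<forall>s. 0 < s \<and> s \<le> R \<longrightarrow> norm (\<kappa> (of_real s)) \<le> C * s powr (- b) \<and> norm (deriv \<kappa> (of_real s)) \<le> C * s powr (- 1)"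
  proof (intro exI[of _ "?C1 + ?C2"] conjI allI impI)
    have C: "0 \<le> ?C1" "0 \<le> ?C2" using p q p' q' l m by simp_all
    then show "0 \<le> ?C1 + ?C2" by simp
    fix s assume "0 < s \<and> s \<le> R" then have s: "0 < s" "s \<le> R" by auto
    have "norm (\<kappa> (of_real s)) \<le> norm (P (of_real s)) + \<bar>ln (c * s)\<bar> * norm (Q (of_real s))"
      using norm_triangle_ineq[of "P (of_real s)" "of_real (ln (c * s)) * Q (of_real s)"] s by (simp add: \<kappa>_def ln norm_mult)
    also have "\<dots> \<le> p * (R powr b * s powr (- b)) + (l * s powr (- b)) * q"
      using p(1) p(2)[OF s] q(2)[OF s] q(1) l(1) l(2)[OF s] one_le_powr[OF s, of b] R mult_mono[of "norm (P (of_real s))" p 1 "R powr b * s powr (- b)"]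
      by (intro add_mono mult_mono) auto
    also have "\<dots> = ?C1 * s powr (- b)" by (simp add: algebra_simps)
    also have "\<dots> \<le> (?C1 + ?C2) * s powr (- b)" using C by (intro mult_right_mono) auto
    finally show "norm (\<kappa> (of_real s)) \<le> (?C1 + ?C2) * s powr (- b)" .
    have i: "norm (inverse (of_real s :: complex)) = s powr (- 1)" using s by (simp add: powr_minus norm_inverse)
    have dk: "deriv \<kappa> (of_real s) = deriv P (of_real s) + (inverse (of_real s) * Q (of_real s) + of_real (ln (c * s)) * deriv Q (of_real s))"
      using DERIV_imp_deriv[OF D[of "of_real s"]] s by (simp add: ln)
    have "norm (deriv \<kappa> (of_real s)) \<le> norm (deriv P (of_real s)) + (s powr (- 1) * norm (Q (of_real s)) + \<bar>ln (c * s)\<bar> * norm (deriv Q (of_real s)))"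
      using norm_triangle_ineq[of "deriv P (of_real s)" "inverse (of_real s) * Q (of_real s) + of_real (ln (c * s)) * deriv Q (of_real s)"]
        norm_triangle_ineq[of "inverse (of_real s) * Q (of_real s)" "of_real (ln (c * s)) * deriv Q (of_real s)"]
      unfolding dk norm_mult i norm_of_real by linarith
    also have "\<dots> \<le> p' * (R powr 1 * s powr (- 1)) + (s powr (- 1) * q + (m * s powr (- 1)) * q')"
      using p'(1) p'(2)[OF s] q(2)[OF s] q' (1) q'(2)[OF s] m(1) m(2)[OF s] one_le_powr[OF s, of 1] mult_mono[of "norm (deriv P (of_real s))" p' 1 "R powr 1 * s powr (- 1)"]
      by (intro add_mono mult_mono mult_left_mono) auto
    also have "\<dots> = ?C2 * s powr (- 1)" by (simp add: algebra_simps)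
    also have "\<dots> \<le> (?C1 + ?C2) * s powr (- 1)" using C by (intro mult_right_mono) auto
    finally show "norm (deriv \<kappa> (of_real s)) \<le> (?C1 + ?C2) * s powr (- 1)" .
  qed
qed

text \<open>The bound m + 1 admits both the signs in \<open>bessel_J0\<close> and the signed
  harmonic numbers in \<open>bessel_Y0\<close>. As m + 1 <= 2^m, one of the two factorials reduces
  the series to an exponential one.\<close>

lemma summable_bessel:
  assumes "\<And>m. norm (a m) \<le> real m + 1" shows "summable (\<lambda>m. a m / (fact m)\<^sup>2 * z ^ m :: complex)"
proof (rule summable_comparison_test')
  show "summable (\<lambda>m. inverse (fact m) * (2 * norm z) ^ m)" by (rule summable_exp)
  fix m :: nat
  have "real m + 1 \<le> 2 ^ m" using of_nat_mono[OF Suc_leI[OF less_exp[of m]], where 'a = real] by simp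
  then have "norm (a m) \<le> 2 ^ m * fact m" using assms[of m] fact_ge_1[of m, where 'a = real] mult_mono[of "real m + 1" "2 ^ m" 1 "fact m :: real"] by simp
  then have "norm (a m) / (fact m)\<^sup>2 \<le> 2 ^ m / fact m" by (simp add: field_simps power2_eq_square)
  then have "norm (a m) / (fact m)\<^sup>2 * norm z ^ m \<le> 2 ^ m / fact m * norm z ^ m" by (intro mult_right_mono) auto
  then show "norm (a m / (fact m)\<^sup>2 * z ^ m) \<le> inverse (fact m) * (2 * norm z) ^ m"
    by (simp add: norm_mult norm_divide norm_power power_mult_distrib field_simps)
qed

lemma entire_bessel:
  assumes "\<And>m. norm (a m) \<le> real m + 1" shows "(\<lambda>z. \<Sum>m. a m / (fact m)\<^sup>2 * z ^ m :: complex) holomorphic_on UNIV"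
  unfolding holomorphic_on_def field_differentiable_def
  using termdiffs_strong_converges_everywhere[of "\<lambda>m. a m / (fact m)\<^sup>2", OF summable_bessel[OF assms]] by auto

text \<open>Only even powers of k r / 2 occur, so the series are power series in (k^2 / 4) r^2,
  evaluated here at real arguments.\<close>

lemma suminf_bessel_of_real:
  fixes a :: "nat \<Rightarrow> real" assumes "\<And>m. \<bar>a m\<bar> \<le> real m + 1"
  shows "(\<Sum>m. of_real (a m) / (fact m)\<^sup>2 * (of_real (k\<^sup>2 / 4) * of_real (r\<^sup>2)) ^ m) = complex_of_real (\<Sum>m. a m * (k * r / 2) ^ (2 * m) / (fact m)\<^sup>2)"
proof -
  let ?t = "\<lambda>m. a m * (k * r / 2) ^ (2 * m) / (fact m)\<^sup>2"
  have e: "of_real (a m) / (fact m)\<^sup>2 * (of_real (k\<^sup>2 / 4) * of_real (r\<^sup>2)) ^ m = complex_of_real (?t m)" for m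
  proof -
    have "(k * r / 2) ^ (2 * m) = (k\<^sup>2 / 4 * r\<^sup>2) ^ m" by (simp add: power_mult power_divide power_mult_distrib)
    then show ?thesis by simp
  qed
  have "summable (\<lambda>m. complex_of_real (?t m))"
    using summable_bessel[of "\<lambda>m. of_real (a m)" "of_real (k\<^sup>2 / 4) * of_real (r\<^sup>2)"] assms unfolding e by simp
  then have "summable ?t" by (simp only: summable_of_real_iff)
  from bounded_linear.suminf[OF bounded_linear_of_real this] show ?thesis unfolding e by (rule sym)
qed

text \<open>With c = k^2 / 4, the Bessel series are entire functions A and H of c r^2. The
  logarithmic term of \<open>bessel_Y0\<close> supplies Q; everything else, including Euler's
  constant, goes into P.\<close>

lemma fund_sol_kernel_1:
  assumes k: "0 < k" and N: "DIM('a::euclidean_space) = 1"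
  obtains \<kappa> where "\<kappa> holomorphic_on {z. 0 < Re z}"
    "\<And>x y :: 'a \<times> real. fund_sol k x y = \<kappa> (of_real ((norm (x - y))\<^sup>2))"
    "\<And>R b. 0 < R \<Longrightarrow> 0 < b \<Longrightarrow> \<exists>C\<ge>0. \<forall>s. 0 < s \<and> s \<le> R \<longrightarrow> norm (\<kappa> (of_real s)) \<le> C * s powr (- b) \<and> norm (deriv \<kappa> (of_real s)) \<le> C * s powr (- 1)"
proof -
  define g where "g = (euler_mascheroni :: real)"
  define c where "c = k\<^sup>2 / 4"
  have c: "0 < c" using k by (simp add: c_def)
  define A H where "A w = (\<Sum>m. of_real ((- 1) ^ m) / (fact m)\<^sup>2 * w ^ m)"
    and "H w = (\<Sum>m. of_real ((- 1) ^ m * harm m) / (fact m)\<^sup>2 * w ^ m)" for w :: complex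
  have harm: "harm m \<le> real m + 1" for m :: nat
    by (induction m) (auto simp: harm_expand harm_Suc inverse_eq_divide intro: order_trans[OF add_mono])
  have a: "\<bar>(- 1) ^ m\<bar> \<le> real m + 1" "\<bar>(- 1) ^ m * harm m\<bar> \<le> real m + 1" for m
    using harm[of m] harm_nonneg[of m, where 'a = real] by (auto simp: abs_mult power_abs)
  have ent: "A holomorphic_on UNIV" "H holomorphic_on UNIV"
    unfolding A_def[abs_def] H_def[abs_def] by (rule entire_bessel, use a in \<open>simp only: norm_of_real\<close>)+
  define P where "P z = \<i> / 4 * (A (of_real c * z) + \<i> * of_real (2 / pi) * (of_real g * A (of_real c * z) - H (of_real c * z)))" for z
  \<comment> \<open>The factor 1/pi is half of the 2/pi in \<open>bessel_Y0\<close>, because ln (c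
    r^2) = 2 ln (k r / 2).\<close>
  define Q where "Q z = \<i> / 4 * (\<i> * of_real (1 / pi) * A (of_real c * z))" for z
  have comp: "(\<lambda>z. f (of_real c * z)) holomorphic_on UNIV" if "f holomorphic_on UNIV" for f :: "complex \<Rightarrow> complex"
    using holomorphic_on_compose_gen[OF _ that, of "\<lambda>z. of_real c * z" UNIV] by (auto simp: o_def intro: holomorphic_intros)
  have PQ: "P holomorphic_on UNIV" "Q holomorphic_on UNIV"
    unfolding P_def[abs_def] Q_def[abs_def] by (intro holomorphic_intros comp ent)+
  define \<kappa> where "\<kappa> z = P z + (if z = 0 then 0 else Ln (of_real c * z)) * Q z" for z
  show thesis
  proof (rule that[of \<kappa>])
    show "\<kappa> holomorphic_on {z. 0 < Re z}" unfolding \<kappa>_def[abs_def] by (rule log_kernel_bounds(1)[OF PQ c])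
    show "\<exists>C\<ge>0. \<forall>s. 0 < s \<and> s \<le> R \<longrightarrow> norm (\<kappa> (of_real s)) \<le> C * s powr (- b) \<and> norm (deriv \<kappa> (of_real s)) \<le> C * s powr (- 1)" if "0 < R" "0 < b" for R b
      unfolding \<kappa>_def[abs_def] by (rule log_kernel_bounds(2)[OF PQ c that])
    fix x y :: "'a \<times> real"
    define r where "r = dist x y"
    have r: "0 \<le> r" by (simp add: r_def)
    have J: "A (of_real c * of_real (r\<^sup>2)) = of_real (bessel_J0 (k * r))"
      using suminf_bessel_of_real[of "\<lambda>m. (- 1) ^ m" k r, OF a(1)] by (simp only: A_def c_def bessel_J0_def)
    have Y: "of_real (bessel_Y0 (k * r)) = complex_of_real (2 / pi) * (of_real (ln (k * r / 2) + g) * A (of_real c * of_real (r\<^sup>2)) - H (of_real c * of_real (r\<^sup>2)))"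
    proof -
      have h: "H (of_real c * of_real (r\<^sup>2)) = complex_of_real (\<Sum>m. (- 1) ^ m * harm m * (k * r / 2) ^ (2 * m) / (fact m)\<^sup>2)"
        using suminf_bessel_of_real[of "\<lambda>m. (- 1) ^ m * harm m" k r, OF a(2)] by (simp only: H_def c_def)
      show ?thesis unfolding J h by (simp add: bessel_Y0_def g_def algebra_simps)
    qed
    have ln: "(if of_real (r\<^sup>2) = (0 :: complex) then 0 else Ln (of_real c * of_real (r\<^sup>2))) = of_real (2 * ln (k * r / 2))"
    proof (cases "r = 0")
      case False
      then have "c * r\<^sup>2 = (k * r / 2) ^ 2" by (simp add: c_def power_mult_distrib power_divide)
      then have "ln (c * r\<^sup>2) = 2 * ln (k * r / 2)" using k r False by (simp add: ln_realpow)
      then show ?thesis using Ln_of_real[of "c * r\<^sup>2"] c False by simp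
    qed simp
    have "fund_sol k x y = \<i> / 4 * (of_real (bessel_J0 (k * r)) + \<i> * of_real (bessel_Y0 (k * r)))"
      by (simp add: fund_sol_def N hankel1_0_def Complex_eq r_def)
    also have "\<dots> = \<kappa> (of_real (r\<^sup>2))"
      unfolding \<kappa>_def ln P_def Q_def J[symmetric] Y by (simp add: algebra_simps)
    finally show "fund_sol k x y = \<kappa> (of_real ((norm (x - y))\<^sup>2))" by (simp add: r_def dist_norm)
  qed
qed

text \<open>The principal root is holomorphic on the right half-plane and maps r^2 to r; on positive
  reals the exponential has modulus 1. At coincident points both expressions are divisions by zero,
  hence equal.\<close>

lemma fund_sol_kernel_2:
  assumes k: "0 < k" and N: "DIM('a::euclidean_space) \<noteq> 1"
  obtains \<kappa> where "\<kappa> holomorphic_on {z. 0 < Re z}"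
    "\<And>x y :: 'a \<times> real. fund_sol k x y = \<kappa> (of_real ((norm (x - y))\<^sup>2))"
    "\<And>R. 0 < R \<Longrightarrow> \<exists>C\<ge>0. \<forall>s. 0 < s \<and> s \<le> R \<longrightarrow> norm (\<kappa> (of_real s)) \<le> C * s powr (- (1 / 2)) \<and> norm (deriv \<kappa> (of_real s)) \<le> C * s powr (- (3 / 2))"
proof -
  define \<kappa> where "\<kappa> z = exp (\<i> * of_real k * csqrt z) / (of_real (4 * pi) * csqrt z)" for z
  define E where "E z = exp (\<i> * of_real k * csqrt z)" for z
  have D: "(\<kappa> has_field_derivative (\<i> * of_real k / (8 * of_real pi * z) - inverse (8 * of_real pi * z * csqrt z)) * E z) (at z)" if z: "0 < Re z" for z
  proof -
    have n: "z \<notin> \<real>\<^sub>\<le>\<^sub>0" "csqrt z \<noteq> 0" using z by (auto simp: complex_nonpos_Reals_iff)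
    have s: "csqrt z * csqrt z = z" using power2_csqrt[of z] by (simp only: power2_eq_square)
    have zz: "z * z \<noteq> 0" "z \<noteq> 0" using z by auto
    have "(\<kappa> has_field_derivative (\<i> * of_real k * inverse (2 * csqrt z) * E z * (of_real (4 * pi) * csqrt z) - E z * (of_real (4 * pi) * inverse (2 * csqrt z))) / ((of_real (4 * pi) * csqrt z) * (of_real (4 * pi) * csqrt z))) (at z)"
      unfolding \<kappa>_def[abs_def] E_def using n by (auto intro!: derivative_eq_intros simp: inverse_eq_divide)
    also have "(\<i> * of_real k * inverse (2 * csqrt z) * E z * (of_real (4 * pi) * csqrt z) - E z * (of_real (4 * pi) * inverse (2 * csqrt z))) / ((of_real (4 * pi) * csqrt z) * (of_real (4 * pi) * csqrt z))
        = (\<i> * of_real k / (8 * of_real pi * (csqrt z * csqrt z)) - inverse (8 * of_real pi * (csqrt z * csqrt z) * csqrt z)) * E z"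
      using n(2) by (simp add: field_simps)
    finally show ?thesis unfolding s .
  qed
  show thesis
  proof (rule that[of \<kappa>])
    show "\<kappa> holomorphic_on {z. 0 < Re z}" unfolding holomorphic_on_def
      using D by (auto simp: field_differentiable_def intro: has_field_derivative_at_within)
    have cs: "csqrt (of_real s) = of_real (sqrt s)" if "0 \<le> s" for s using that by (rule of_real_sqrt[symmetric])
    show "fund_sol k x y = \<kappa> (of_real ((norm (x - y))\<^sup>2))" for x y :: "'a \<times> real"
    proof -
      have "csqrt (of_real ((norm (x - y))\<^sup>2)) = of_real (dist x y)" using cs[of "(norm (x - y))\<^sup>2"] by (simp add: dist_norm del: of_real_power)
      then show ?thesis using N by (simp add: fund_sol_def \<kappa>_def mult.assoc del: of_real_power)
    qed
    fix R :: real assume R: "0 < R"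
    show "\<exists>C\<ge>0. \<forall>s. 0 < s \<and> s \<le> R \<longrightarrow> norm (\<kappa> (of_real s)) \<le> C * s powr (- (1 / 2)) \<and> norm (deriv \<kappa> (of_real s)) \<le> C * s powr (- (3 / 2))"
    proof (intro exI[of _ "1 + k * R powr (1 / 2)"] conjI allI impI)
      show "0 \<le> 1 + k * R powr (1 / 2)" using k by simp
      fix s :: real assume "0 < s \<and> s \<le> R" then have s: "0 < s" "s \<le> R" by auto
      have ex: "norm (E (of_real s)) = 1" using s cs[of s] by (simp add: E_def norm_exp_eq_Re)
      have pi: "1 \<le> pi" using pi_gt3 by simp
      have h: "sqrt s = s powr (1 / 2)" using s by (simp add: powr_half_sqrt)
      have "norm (\<kappa> (of_real s)) = 1 / (4 * pi) * s powr (- (1 / 2))"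
        using ex s cs[of s] by (simp add: \<kappa>_def E_def norm_divide norm_mult h powr_minus field_simps)
      also have "\<dots> \<le> (1 + k * R powr (1 / 2)) * s powr (- (1 / 2))"
      proof (intro mult_right_mono)
        have "1 / (4 * pi) \<le> 1" using pi by simp
        also have "1 \<le> 1 + k * R powr (1 / 2)" using k by simp
        finally show "1 / (4 * pi) \<le> 1 + k * R powr (1 / 2)" .
      qed simp
      finally show "norm (\<kappa> (of_real s)) \<le> (1 + k * R powr (1 / 2)) * s powr (- (1 / 2))" .
      \<comment> \<open>The term of order s^(-1) in the derivative is weakened to s^(-3/2); this is
        where R enters the constant.\<close>
      have i1: "inverse s = s powr (1 / 2) * s powr (- (3 / 2))" using s powr_minus[of s 1] by (simp add: powr_add[symmetric] del: powr_minus)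
      have i2: "inverse (s * sqrt s) = s powr (- (3 / 2))"
      proof -
        have "s * sqrt s = s powr (1 + 1 / 2)" unfolding h powr_add using s by simp
        then show ?thesis by (simp add: powr_minus)
      qed
      have dk: "deriv \<kappa> (of_real s) = (\<i> * of_real k / (8 * of_real pi * of_real s) - inverse (8 * of_real pi * of_real s * of_real (sqrt s))) * E (of_real s)"
        using DERIV_imp_deriv[OF D[of "of_real s"]] s cs[of s] by simp
      have "norm (deriv \<kappa> (of_real s)) \<le> norm (\<i> * of_real k / (8 * of_real pi * of_real s) :: complex) + norm (inverse (8 * of_real pi * of_real s * of_real (sqrt s)) :: complex)"
        unfolding dk norm_mult[of _ "E (of_real s)"] ex mult_1_right by (rule norm_triangle_ineq4)
      also have "\<dots> = k / (8 * pi) * inverse s + 1 / (8 * pi) * inverse (s * sqrt s)"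
        using s k by (simp add: norm_mult norm_divide norm_inverse field_simps)
      also have "\<dots> \<le> k * inverse s + 1 * inverse (s * sqrt s)"
        using pi k s by (intro add_mono mult_right_mono) (auto simp: divide_le_eq mult_le_cancel_left1)
      also have "\<dots> \<le> k * (R powr (1 / 2) * s powr (- (3 / 2))) + 1 * s powr (- (3 / 2))"
        unfolding i1 i2 using s k by (intro add_mono mult_left_mono mult_right_mono powr_mono2) auto
      also have "\<dots> = (1 + k * R powr (1 / 2)) * s powr (- (3 / 2))" by (simp add: algebra_simps)
      finally show "norm (deriv \<kappa> (of_real s)) \<le> (1 + k * R powr (1 / 2)) * s powr (- (3 / 2))" .
    qed
  qed
qed

text \<open>The condition b > (n - 1)/2 covers both cases: any b > 0 for the logarithm when n = 1,
  and a weakening of the exact order 1/2 when n = 2. It will be used with b = \<beta>/2, which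
  satisfies it because \<beta> > n - 1.\<close>

lemma fund_sol_kernel:
  assumes k: "0 < k" and N: "DIM('a::euclidean_space) \<in> {1, 2}"
  obtains \<kappa> where "\<kappa> holomorphic_on {z. 0 < Re z}"
    "\<And>x y :: 'a \<times> real. fund_sol k x y = \<kappa> (of_real ((norm (x - y))\<^sup>2))"
    "\<And>R b. 0 < R \<Longrightarrow> (real DIM('a) - 1) / 2 < b \<Longrightarrow> \<exists>C\<ge>0. \<forall>s. 0 < s \<and> s \<le> R \<longrightarrow> norm (\<kappa> (of_real s)) \<le> C * s powr (- b) \<and>
        norm (deriv \<kappa> (of_real s)) \<le> C * s powr (- ((real DIM('a) + 1) / 2))"
proof (cases "DIM('a) = 1")
  case True
  show thesis
  proof (rule fund_sol_kernel_1[OF k True])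
    fix \<kappa> assume \<kappa>: "\<kappa> holomorphic_on {z. 0 < Re z}"
      "\<And>x y :: 'a \<times> real. fund_sol k x y = \<kappa> (of_real ((norm (x - y))\<^sup>2))"
      "\<And>R b. 0 < R \<Longrightarrow> 0 < b \<Longrightarrow> \<exists>C\<ge>0. \<forall>s. 0 < s \<and> s \<le> R \<longrightarrow> norm (\<kappa> (of_real s)) \<le> C * s powr (- b) \<and> norm (deriv \<kappa> (of_real s)) \<le> C * s powr (- 1)"
    show thesis by (rule that[OF \<kappa>(1,2)]) (use \<kappa>(3) True in simp_all)
  qed
next
  case False
  then have N2: "real DIM('a) = 2" using N by auto
  show thesis
  proof (rule fund_sol_kernel_2[OF k False], rule that)
    fix \<kappa> assume \<kappa>: "\<kappa> holomorphic_on {z. 0 < Re z}"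
      "\<And>x y :: 'a \<times> real. fund_sol k x y = \<kappa> (of_real ((norm (x - y))\<^sup>2))"
      "\<And>R. 0 < R \<Longrightarrow> \<exists>C\<ge>0. \<forall>s. 0 < s \<and> s \<le> R \<longrightarrow> norm (\<kappa> (of_real s)) \<le> C * s powr (- (1 / 2)) \<and> norm (deriv \<kappa> (of_real s)) \<le> C * s powr (- (3 / 2))"
    show "\<kappa> holomorphic_on {z. 0 < Re z}" "\<And>x y :: 'a \<times> real. fund_sol k x y = \<kappa> (of_real ((norm (x - y))\<^sup>2))" by (rule \<kappa>)+
    fix R b :: real assume R: "0 < R" and "(real DIM('a) - 1) / 2 < b"
    then have b: "1 / 2 < b" by (simp add: N2)
    from \<kappa>(3)[OF R] obtain C where C: "0 \<le> C"
      "\<And>s. 0 < s \<Longrightarrow> s \<le> R \<Longrightarrow> norm (\<kappa> (of_real s)) \<le> C * s powr (- (1 / 2))"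
      "\<And>s. 0 < s \<Longrightarrow> s \<le> R \<Longrightarrow> norm (deriv \<kappa> (of_real s)) \<le> C * s powr (- (3 / 2))" by auto
    let ?c = "R powr (b - 1 / 2)"
    have "norm (\<kappa> (of_real s)) \<le> C * (1 + ?c) * s powr (- b) \<and> norm (deriv \<kappa> (of_real s)) \<le> C * (1 + ?c) * s powr (- (3 / 2))" if s: "0 < s" "s \<le> R" for s
    proof
      have "s powr (- (1 / 2)) = 1 * s powr (- (1 / 2))" by simp
      also have "\<dots> \<le> (?c * s powr (- (b - 1 / 2))) * s powr (- (1 / 2))" using one_le_powr[OF s, of "b - 1 / 2"] b by (intro mult_right_mono) auto
      also have "\<dots> = ?c * s powr (- b)" unfolding mult.assoc powr_add[symmetric] by simp
      also have "\<dots> \<le> (1 + ?c) * s powr (- b)" by (intro mult_right_mono) auto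
      finally have "C * s powr (- (1 / 2)) \<le> C * ((1 + ?c) * s powr (- b))" using C(1) by (rule mult_left_mono)
      then show "norm (\<kappa> (of_real s)) \<le> C * (1 + ?c) * s powr (- b)" using C(2)[OF s] by (simp only: mult.assoc)
      have "1 * s powr (- (3 / 2)) \<le> (1 + ?c) * s powr (- (3 / 2))" by (intro mult_right_mono) auto
      then have "C * (1 * s powr (- (3 / 2))) \<le> C * ((1 + ?c) * s powr (- (3 / 2)))" using C(1) by (rule mult_left_mono)
      then show "norm (deriv \<kappa> (of_real s)) \<le> C * (1 + ?c) * s powr (- (3 / 2))" using C(3)[OF s] by (simp only: mult.assoc mult_1)
    qed
    moreover have "0 \<le> C * (1 + ?c)" using C(1) by simp
    ultimately show "\<exists>C\<ge>0. \<forall>s. 0 < s \<and> s \<le> R \<longrightarrow> norm (\<kappa> (of_real s)) \<le> C * s powr (- b) \<and> norm (deriv \<kappa> (of_real s)) \<le> C * s powr (- ((real DIM('a) + 1) / 2))"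
      unfolding N2 by auto
  qed
qed

section \<open>The single-layer operator\<close>

lemma finite_measure_cball_cover:
  fixes \<Gamma> :: "'a::euclidean_space set"
  assumes "compact \<Gamma>" and s: "sets N = sets borel" and f: "\<And>x. x \<in> \<Gamma> \<Longrightarrow> emeasure N (\<Gamma> \<inter> cball x 1) < \<infinity>"
  shows "emeasure N \<Gamma> < \<infinity>"
proof -
  have "\<Gamma> \<subseteq> (\<Union>x\<in>\<Gamma>. ball x 1)" by auto
  with assms(1) obtain D where D: "D \<subseteq> \<Gamma>" "finite D" "\<Gamma> \<subseteq> (\<Union>x\<in>D. ball x 1)"
    using compactE_image[of \<Gamma> \<Gamma> "\<lambda>x. ball x 1"] by (metis open_ball)
  have m: "\<Gamma> \<inter> cball x 1 \<in> sets N" for x unfolding s using assms(1) by (intro borel_closed closed_Int compact_imp_closed) auto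
  have "\<Gamma> \<subseteq> (\<Union>x\<in>D. \<Gamma> \<inter> cball x 1)" using D(3) using ball_subset_cball by blast
  then have "emeasure N \<Gamma> \<le> emeasure N (\<Union>x\<in>D. \<Gamma> \<inter> cball x 1)" using m D(2) by (intro emeasure_mono sets.finite_UN) auto
  also have "\<dots> \<le> (\<Sum>x\<in>D. emeasure N (\<Gamma> \<inter> cball x 1))" using m D(2) by (intro emeasure_subadditive_finite) auto
  also have "\<dots> < \<infinity>" unfolding infinity_ennreal_def ennreal_sum_less_top[OF D(2)] using D(1) f by auto
  finally show ?thesis .
qed

lemma sets_hausdorff_measure: "sets (hausdorff_measure d) = sets borel" and space_hausdorff_measure: "space (hausdorff_measure d) = UNIV"
  unfolding hausdorff_measure_def by (simp_all add: sets_measure_of_conv space_measure_of_conv sigma_algebra.sigma_sets_eq[OF sets.sigma_algebra_axioms[of borel, unfolded space_borel]])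

text \<open>The definition of a d-set controls balls centred on \<Gamma>. The part of \<Gamma> in a
  ball about an arbitrary point, if nonempty, lies in a ball of twice the radius about a point of
  \<Gamma>, whence 2^d; when 2 r > 1 the total mass T takes over, whence c2 + T.\<close>

lemma d_set_growth_measure:
  fixes \<Gamma> :: "'a::euclidean_space set"
  assumes \<Gamma>: "compact \<Gamma>" and dset: "d_set d \<Gamma>" and N: "DIM('a) \<le> 2" "real DIM('a) - 1 < d" "d \<le> real DIM('a)"
  obtains c where "growth_measure (surface d \<Gamma>) c d"
proof -
  let ?H = "hausdorff_measure d :: 'a measure" and ?M = "surface d \<Gamma>"
  obtain c2 where c2: "0 < c2" "\<And>x r. x \<in> \<Gamma> \<Longrightarrow> 0 < r \<Longrightarrow> r \<le> 1 \<Longrightarrow> emeasure ?H (\<Gamma> \<inter> cball x r) \<le> ennreal (c2 * r powr d)"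
    using dset unfolding d_set_def by blast
  have "0 \<le> real DIM('a) - 1" using DIM_positive[where 'a='a] by linarith
  then have d: "0 < d" using N by linarith
  have fin: "emeasure ?H \<Gamma> < \<infinity>"
    by (rule finite_measure_cball_cover[OF \<Gamma> sets_hausdorff_measure order.strict_trans1[OF c2(2)[OF _ zero_less_one order_refl]]]) auto
  have cl: "closed \<Gamma>" by (rule compact_imp_closed[OF \<Gamma>])
  have gm: "\<Gamma> \<inter> space ?H \<in> sets ?H" using cl by (simp add: sets_hausdorff_measure space_hausdorff_measure)
  have sp: "space ?M = \<Gamma>" by (simp add: surface_def space_restrict_space space_hausdorff_measure)
  have em: "emeasure ?M A = emeasure ?H A" if "A \<subseteq> \<Gamma>" for A
    unfolding surface_def by (rule emeasure_restrict_space[OF gm that])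
  interpret finite_measure ?M by (intro finite_measureI) (use fin in \<open>simp add: sp em\<close>)
  define T where "T = measure ?M \<Gamma>"
  have T: "0 \<le> T" "\<And>A. measure ?M A \<le> T" unfolding T_def using bounded_measure by (simp_all add: sp)
  have growth: "measure ?M {y \<in> space ?M. dist x y \<le> r} \<le> ((c2 + T) * 2 powr d) * r powr d" if r: "0 < r" "r \<le> 1" for x r
  proof -
    let ?A = "{y \<in> space ?M. dist x y \<le> r}"
    have p: "(2 * r) powr d = 2 powr d * r powr d" by (rule powr_mult)
    have "measure ?M ?A \<le> (c2 + T) * (2 * r) powr d"
    proof (cases "?A = {}")
      case True
      then show ?thesis using c2(1) T by (simp only: measure_empty) simp
    next
      case False
      then obtain z where z: "z \<in> \<Gamma>" "dist x z \<le> r" by (auto simp: sp)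
      show ?thesis
      proof (cases "2 * r \<le> 1")
        case True
        have s: "?A \<subseteq> \<Gamma> \<inter> cball z (2 * r)"
        proof
          fix y assume "y \<in> ?A"
          then show "y \<in> \<Gamma> \<inter> cball z (2 * r)" using z(2) dist_triangle3[of z y x] by (simp add: sp)
        qed
        have mb: "\<Gamma> \<inter> cball z (2 * r) \<in> sets ?M"
          unfolding surface_def using cl by (subst sets_restrict_space_iff[OF gm]) (auto simp: sets_hausdorff_measure intro!: borel_closed)
        have "measure ?M ?A \<le> measure ?M (\<Gamma> \<inter> cball z (2 * r))" using s mb by (rule finite_measure_mono)
        also have "\<dots> \<le> c2 * (2 * r) powr d"
        proof -
          have "ennreal (measure ?M (\<Gamma> \<inter> cball z (2 * r))) = emeasure ?H (\<Gamma> \<inter> cball z (2 * r))"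
            by (simp add: emeasure_eq_measure[symmetric] em)
          also have "\<dots> \<le> ennreal (c2 * (2 * r) powr d)" using c2(2)[OF z(1)] True r by simp
          finally show ?thesis using c2(1) by (subst (asm) ennreal_le_iff) auto
        qed
        also have "\<dots> \<le> (c2 + T) * (2 * r) powr d" using T(1) by (intro mult_right_mono) auto
        finally show ?thesis .
      next
        case False
        have "1 \<le> (2 * r) powr d" using False d by (intro ge_one_powr_ge_zero) auto
        then have "T * 1 \<le> (c2 + T) * (2 * r) powr d" using T(1) c2(1) by (intro mult_mono) auto
        then show ?thesis using T(2)[of ?A] by simp
      qed
    qed
    then show ?thesis unfolding p mult.assoc .
  qed
  have "(\<lambda>x. x) \<in> borel_measurable ?H" by (simp add: measurable_ident_sets[OF sets_hausdorff_measure])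
  then have "(\<lambda>x. x) \<in> borel_measurable ?M" unfolding surface_def by (rule measurable_restrict_space1)
  then have "growth_measure ?M ((c2 + T) * 2 powr d) d"
    by unfold_locales (use growth N in auto)
  then show thesis by (rule that)
qed

lemma sobolev_norm_diff_diff:
  assumes S: "a \<in> sobolev s" "b \<in> sobolev s" "a' \<in> sobolev s" "b' \<in> sobolev s"
  shows "sobolev_norm s (distr_diff (distr_diff a b) (distr_diff a' b')) \<le> sobolev_norm s (distr_diff a a') + sobolev_norm s (distr_diff b b')"
proof -
  let ?u = "distr_diff a a'" and ?v = "distr_diff b b'" and ?z = "distr_diff a a"
  have m: "?u \<in> sobolev s" "?v \<in> sobolev s" "?z \<in> sobolev s" by (intro sobolev_diff S)+
  have "distr_diff (distr_diff a b) (distr_diff a' b') = distr_diff ?u ?v" "distr_diff ?u ?z = ?u" "distr_diff ?v ?z = ?v"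
    by (auto simp: distr_diff_def)
  then show ?thesis using sobolev_triangle[OF m(1,3,2)] sobolev_norm_commute[OF m(3,2)] by simp
qed

text \<open>Without a cut-off whose support avoids x, the description in
  \<open>single_layer_pot\<close> would impose no condition and determine no value.\<close>

lemma cutoffs_exist:
  assumes "compact \<Gamma>" "x \<notin> screen \<Gamma>" obtains \<sigma> where "\<sigma> \<in> cutoffs \<Gamma>" "x \<notin> fun_supp \<sigma>"
proof -
  have "compact (screen \<Gamma>)" unfolding screen_def by (intro compact_Times assms) simp
  from smooth_cutoff[OF this, of "- {x}"] assms(2) obtain \<rho> V where
    \<rho>: "(\<lambda>x. complex_of_real (\<rho> x)) \<in> test_functions (- {x})" "open V" "screen \<Gamma> \<subseteq> V" "\<And>x. x \<in> V \<Longrightarrow> \<rho> x = 1"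
    by (metis open_Compl finite_imp_closed finite.emptyI finite.insertI subset_Compl_singleton)
  show thesis
  proof (rule that)
    show "(\<lambda>x. complex_of_real (\<rho> x)) \<in> cutoffs \<Gamma>"
      unfolding cutoffs_def using \<rho> test_functions_mono[OF subset_UNIV \<rho>(1)] by auto
    show "x \<notin> fun_supp (\<lambda>x. complex_of_real (\<rho> x))" using test_functions_supp(2)[OF \<rho>(1)] by auto
  qed
qed

lemma cutoffs_one: "\<sigma> \<in> cutoffs \<Gamma> \<Longrightarrow> y \<in> \<Gamma> \<Longrightarrow> \<sigma> (y, 0) = 1"
  by (auto simp: cutoffs_def screen_def)

section \<open>Evaluation of the operators on the screen\<close>

locale screen_layer = layer_potential "surface d \<Gamma>" c d \<kappa> \<Psi> B
  for \<Gamma> :: "'a::euclidean_space set" and c d :: real and \<kappa> \<Psi> and B :: real +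
  fixes k :: real
  assumes compact: "compact \<Gamma>"
    and fund_sol: "\<And>x y :: 'a \<times> real. fund_sol k x y = \<kappa> (of_real ((norm (x - y))\<^sup>2))"
begin

abbreviation "M \<equiv> surface d \<Gamma>"

lemma space_M: "space M = \<Gamma>"
  by (simp add: surface_def space_restrict_space space_hausdorff_measure)

lemma fund_sol_K: "fund_sol k x (y, 0) = K 0 (x - (y, 0))"
  by (simp add: fund_sol K_def)

lemma mdistr_supp: "mdistr M \<Psi> \<in> sobolev_supp (- 1 / 2) \<Gamma>"
proof -
  have "mdistr M \<Psi> f = 0" if f: "f \<in> test_functions (- \<Gamma>)" for f
  proof -
    have "f y = 0" if "y \<in> \<Gamma>" for y using test_functions_supp(2)[OF f] that by (intro fun_supp_zero) auto
    then have "(LINT y|M. f y * \<Psi> y) = (LINT y|M. 0)" by (intro Bochner_Integration.integral_cong) (auto simp: space_M)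
    then show ?thesis by (simp add: mdistr_def)
  qed
  moreover have "open (- \<Gamma>)" using compact_imp_closed[OF compact] by (rule open_Compl)
  ultimately have "distr_supp (mdistr M \<Psi>) \<subseteq> \<Gamma>" unfolding distr_supp_def by blast
  then show ?thesis using mdistr_sobolev[OF Psi_L2] by (simp add: sobolev_supp_def)
qed

lemma distr_cnj_mdistr: "distr_cnj (mdistr M \<Psi>) = mdistr M (\<lambda>y. cnj (\<Psi> y))"
proof
  fix f :: "'a \<Rightarrow> complex"
  have "(\<lambda>x. cnj (f x)) \<in> schwartz \<longleftrightarrow> f \<in> schwartz"
    using schwartz_cnj[of f] schwartz_cnj[of "\<lambda>x. cnj (f x)"] by auto
  then show "distr_cnj (mdistr M \<Psi>) f = mdistr M (\<lambda>y. cnj (\<Psi> y)) f"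
    by (simp add: distr_cnj_def mdistr_def flip: Bochner_Integration.integral_cnj)
qed

lemma smooth_fund_sol: "smooth_in (- {x}) (fund_sol k x)" for x :: "'a \<times> real"
proof -
  have "smooth_in (- {x}) (\<lambda>y. \<kappa> (of_real ((norm (y - x))\<^sup>2)))"
    by (rule smooth_in_holomorphic(1)[OF kap_hol open_rhp _ smooth_in_norm_sq]) auto
  moreover have "fund_sol k x = (\<lambda>y. \<kappa> (of_real ((norm (y - x))\<^sup>2)))" by (rule ext) (simp only: fund_sol norm_minus_commute[of x])
  ultimately show ?thesis by simp
qed

text \<open>Since x is off the support of \<sigma>, the cut-off fundamental solution is a test
  function and its Dirichlet trace is its restriction; on \<Gamma> the cut-off is 1. The conjugation
  of the density cancels against the antilinear second slot of the pairing.\<close>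

lemma single_layer_pot_eq:
  assumes x: "x \<notin> screen \<Gamma>" shows "single_layer_pot k \<Gamma> (mdistr M \<Psi>) x = pot 0 x"
proof -
  let ?P = "\<lambda>c. \<forall>\<sigma>\<in>cutoffs \<Gamma>. x \<notin> fun_supp \<sigma> \<longrightarrow> (\<forall>e\<in>{- 1, 1}.
       c = sobolev_pairing (dirichlet_trace e (\<lambda>y. \<sigma> y * fund_sol k x y)) (distr_cnj (mdistr M \<Psi>)))"
  have val: "sobolev_pairing (dirichlet_trace e (\<lambda>y. \<sigma> y * fund_sol k x y)) (distr_cnj (mdistr M \<Psi>)) = pot 0 x"
    if s: "\<sigma> \<in> cutoffs \<Gamma>" "x \<notin> fun_supp \<sigma>" and e: "e \<in> {- 1, 1}" for \<sigma> and e :: real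
  proof -
    let ?f = "\<lambda>y. \<sigma> y * fund_sol k x y"
    have \<sigma>: "\<sigma> \<in> test_functions UNIV" using s by (simp add: cutoffs_def)
    have t: "?f \<in> test_functions UNIV"
    proof (rule test_functionsI[where K = "fun_supp \<sigma>"])
      have "smooth_in UNIV ?f"
      proof (rule smooth_in_local)
        fix y
        show "\<exists>V. open V \<and> y \<in> V \<and> smooth_in V ?f"
        \<comment> \<open>Near x the product is identically 0; at every other point the fundamental
          solution is smooth.\<close>
        proof (cases "y = x")
          case True
          have o: "open (- fun_supp \<sigma>)" using closed_fun_supp by auto
          have "smooth_in (- fun_supp \<sigma>) ?f"
            by (rule smooth_in_cong[OF o _ smooth_in_const[OF o, of 0]]) (simp add: fun_supp_zero)
          then show ?thesis using o True s(2) by (intro exI[of _ "- fun_supp \<sigma>"]) auto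
        next
          case False
          have "smooth_in (- {x}) ?f"
            by (intro smooth_in_mult smooth_fund_sol smooth_in_subset[OF test_functions_smooth[OF \<sigma>]]) auto
          then show ?thesis using False by (intro exI[of _ "- {x}"]) auto
        qed
      qed
      then show "smooth ?f" by (simp add: smooth_iff_smooth_in)
    qed (use test_functions_supp(1)[OF \<sigma>] fun_supp_zero[of _ \<sigma>] in auto)
    have "sobolev_pairing (dirichlet_trace e ?f) (distr_cnj (mdistr M \<Psi>)) = (LINT y|M. ?f (y, 0) * cnj (cnj (\<Psi> y)))"
      unfolding dirichlet_trace_test[OF e t] distr_cnj_mdistr
      by (rule pairing_mdistr[OF test_functions_schwartz[OF slice_test[OF t]] L2_cnj[OF Psi_L2]])
    also have "\<dots> = (LINT y|M. K 0 (x - (y, 0)) * \<Psi> y)"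
      by (intro Bochner_Integration.integral_cong) (simp_all add: space_M cutoffs_one[OF s(1)] fund_sol_K)
    finally show ?thesis by (simp add: pot_def)
  qed
  obtain \<sigma> where \<sigma>: "\<sigma> \<in> cutoffs \<Gamma>" "x \<notin> fun_supp \<sigma>" by (rule cutoffs_exist[OF compact x])
  have "(THE c. ?P c) = pot 0 x"
  proof (rule the_equality)
    show "?P (pot 0 x)" using val by auto
    fix c assume "?P c"
    from bspec[OF this \<sigma>(1)] \<sigma>(2) have "c = sobolev_pairing (dirichlet_trace 1 (\<lambda>y. \<sigma> y * fund_sol k x y)) (distr_cnj (mdistr M \<Psi>))" by blast
    also have "\<dots> = pot 0 x" by (rule val[OF \<sigma>]) simp
    finally show "c = pot 0 x" .
  qed
  then show ?thesis using mdistr_supp x by (simp add: single_layer_pot_def)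
qed

lemma w1_approx_pot:
  assumes "\<sigma> \<in> cutoffs \<Gamma>" "e \<in> {- 1, 1}"
  shows "w1_approx e (\<lambda>x. \<sigma> x * single_layer_pot k \<Gamma> (mdistr M \<Psi>) x) (\<lambda>n x. \<sigma> x * pot (eps n) x)"
proof (rule cutoff_pot_w1_approx)
  show "\<sigma> \<in> test_functions UNIV" using assms(1) by (simp add: cutoffs_def)
  fix x :: "'a \<times> real" assume "x \<in> half_space e"
  then have "x \<notin> screen \<Gamma>" by (auto simp: half_space_def screen_def)
  then show "\<sigma> x * single_layer_pot k \<Gamma> (mdistr M \<Psi>) x = \<sigma> x * pot 0 x" by (simp add: single_layer_pot_eq)
qed (rule assms)

lemma cutoff_pot_test: "\<sigma> \<in> test_functions UNIV \<Longrightarrow> (\<lambda>x. \<sigma> x * pot (eps n) x) \<in> test_functions UNIV"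
  using test_functions_mult_left[OF _ smooth_pot(1)[OF eps(3)], of \<sigma> UNIV n] by (simp add: mult.commute)

text \<open>Both cut-offs are 1 near the screen, so the two restrictions coincide in a neighbourhood
  of \<Gamma>.\<close>

lemma cutoff_diff_test:
  assumes \<sigma>: "\<sigma> \<in> cutoffs \<Gamma>" and \<sigma>': "\<sigma>' \<in> cutoffs \<Gamma>"
  shows "(\<lambda>y. \<sigma> (y, 0) * pot (eps n) (y, 0) - \<sigma>' (y, 0) * pot (eps n) (y, 0)) \<in> test_functions (- \<Gamma>)"
proof -
  obtain V V' where V: "open V" "screen \<Gamma> \<subseteq> V" "\<And>x. x \<in> V \<Longrightarrow> \<sigma> x = 1" "open V'" "screen \<Gamma> \<subseteq> V'" "\<And>x. x \<in> V' \<Longrightarrow> \<sigma>' x = 1"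
    using \<sigma> \<sigma>' unfolding cutoffs_def by blast
  let ?g = "\<lambda>y. \<sigma> (y, 0) * pot (eps n) (y, 0) - \<sigma>' (y, 0) * pot (eps n) (y, 0)"
  have t: "?g \<in> test_functions UNIV"
    by (intro test_functions_diff slice_test[OF cutoff_pot_test]) (use \<sigma> \<sigma>' in \<open>simp_all add: cutoffs_def\<close>)
  let ?W = "(\<lambda>y. (y, 0)) -` (V \<inter> V')"
  have "open ?W" using V by (intro continuous_open_vimage open_Int) (auto intro: continuous_intros)
  moreover have "{y. ?g y \<noteq> 0} \<subseteq> - ?W" using V by auto
  ultimately have "fun_supp ?g \<subseteq> - ?W" unfolding fun_supp_def by (intro closure_minimal closed_Compl)
  moreover have "\<Gamma> \<subseteq> ?W" using V by (auto simp: screen_def)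
  ultimately show ?thesis using t by (auto simp: test_functions_def)
qed

text \<open>This brings the operator into the form that the definition of \<open>trace_on\<close>
  asks for: test functions that converge to its value and whose values on \<Gamma> are those of the
  regularised potentials.\<close>

lemma single_layer_op_eq:
  obtains q f \<sigma> where "q \<in> sobolev (1/2)" "\<And>n::nat. f n \<in> test_functions (- \<Gamma>)" "\<sigma> \<in> cutoffs \<Gamma>"
    "(\<lambda>n. sobolev_norm (1/2) (distr_diff (distr_of (\<lambda>y. \<sigma> (y, 0) * pot (eps n) (y, 0) - f n y)) q)) \<longlonglongrightarrow> 0"
    "single_layer_op k \<Gamma> (mdistr M \<Psi>) = q"
proof -
  let ?T = "sobolev_tilde (1/2) (- \<Gamma>)" and ?u = "\<lambda>\<sigma> x. \<sigma> x * single_layer_pot k \<Gamma> (mdistr M \<Psi>) x"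
  let ?h = "\<lambda>\<sigma> n y. \<sigma> (y, 0) * pot (eps n) (y, 0)"
  have hS: "distr_of (?h \<sigma> n) \<in> sobolev (1/2)" "?h \<sigma> n \<in> schwartz" if "\<sigma> \<in> cutoffs \<Gamma>" for \<sigma> n
    using that test_functions_schwartz[OF slice_test[OF cutoff_pot_test, of \<sigma> 0 n]] by (auto intro: distr_of_sobolev simp: cutoffs_def)
  have "\<exists>g. g \<in> sobolev (1/2) \<and> (\<lambda>n. sobolev_norm (1/2) (distr_diff (distr_of (?h \<sigma> n)) g)) \<longlonglongrightarrow> 0" if s: "\<sigma> \<in> cutoffs \<Gamma>" for \<sigma>
    by (rule w1_approx_trace[OF _ w1_approx_pot[OF s], of 1]) auto
  then have "\<forall>\<sigma>\<in>cutoffs \<Gamma>. \<exists>g. g \<in> sobolev (1/2) \<and> (\<lambda>n. sobolev_norm (1/2) (distr_diff (distr_of (?h \<sigma> n)) g)) \<longlonglongrightarrow> 0" by (rule ballI)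
  from bchoice[OF this] obtain g where
    g: "\<And>\<sigma>. \<sigma> \<in> cutoffs \<Gamma> \<Longrightarrow> g \<sigma> \<in> sobolev (1/2)"
      "\<And>\<sigma>. \<sigma> \<in> cutoffs \<Gamma> \<Longrightarrow> (\<lambda>n. sobolev_norm (1/2) (distr_diff (distr_of (?h \<sigma> n)) (g \<sigma>))) \<longlonglongrightarrow> 0" by blast
  \<comment> \<open>The restrictions to the hyperplane are the same sequence for both half-spaces,
    so one limit \<open>g \<sigma>\<close> serves e = 1 and e = -1.\<close>
  have tr: "dirichlet_trace e (?u \<sigma>) = g \<sigma>" if "\<sigma> \<in> cutoffs \<Gamma>" "e \<in> {- 1, 1}" for \<sigma> and e :: real
    by (rule dirichlet_trace_eqI[OF that(2) w1_approx_pot[OF that] g[OF that(1)]])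
  have "(0, 1) \<notin> screen \<Gamma>" by (simp add: screen_def)
  from cutoffs_exist[OF compact this] obtain \<sigma>0 where s0: "\<sigma>0 \<in> cutoffs \<Gamma>" by blast
  have dist: "distr_of (\<lambda>y. a y - b y) = distr_diff (distr_of a) (distr_of b)" if "a \<in> schwartz" "b \<in> schwartz" for a b :: "'a \<Rightarrow> complex"
  proof
    fix g :: "'a \<Rightarrow> complex"
    show "distr_of (\<lambda>y. a y - b y) g = distr_diff (distr_of a) (distr_of b) g"
      using schwartz_mult_integrable[of g a] schwartz_mult_integrable[of g b] that
      by (simp add: distr_of_def distr_diff_def left_diff_distrib)
  qed
  \<comment> \<open>The traces for two cut-offs differ by a limit of the functions of
    \<open>cutoff_diff_test\<close>, which are test functions off \<Gamma>; by the choice of q they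
    therefore have the same projection.\<close>
  have tilde: "distr_diff (g \<sigma>) (g \<sigma>0) \<in> ?T" if s: "\<sigma> \<in> cutoffs \<Gamma>" for \<sigma>
  proof -
    have D: "distr_diff (g \<sigma>) (g \<sigma>0) \<in> sobolev (1/2)" by (rule sobolev_diff[OF g(1)[OF s] g(1)[OF s0]])
    have "\<exists>f\<in>test_functions (- \<Gamma>). sobolev_norm (1/2) (distr_diff (distr_diff (g \<sigma>) (g \<sigma>0)) (distr_of f)) < \<epsilon>" if \<epsilon>: "0 < \<epsilon>" for \<epsilon>
    proof -
      have "(\<lambda>n. sobolev_norm (1/2) (distr_diff (distr_of (?h \<sigma> n)) (g \<sigma>)) + sobolev_norm (1/2) (distr_diff (distr_of (?h \<sigma>0 n)) (g \<sigma>0))) \<longlonglongrightarrow> 0 + 0"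
        by (intro tendsto_add g(2) s s0)
      then have "eventually (\<lambda>n. sobolev_norm (1/2) (distr_diff (distr_of (?h \<sigma> n)) (g \<sigma>)) + sobolev_norm (1/2) (distr_diff (distr_of (?h \<sigma>0 n)) (g \<sigma>0)) < \<epsilon>) sequentially"
        using \<epsilon> by (intro order_tendstoD(2)) auto
      then obtain n where n: "sobolev_norm (1/2) (distr_diff (distr_of (?h \<sigma> n)) (g \<sigma>)) + sobolev_norm (1/2) (distr_diff (distr_of (?h \<sigma>0 n)) (g \<sigma>0)) < \<epsilon>"
        by (auto simp: eventually_sequentially)
      let ?f = "\<lambda>y. ?h \<sigma> n y - ?h \<sigma>0 n y"
      have "sobolev_norm (1/2) (distr_diff (distr_diff (g \<sigma>) (g \<sigma>0)) (distr_of ?f)) < \<epsilon>"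
        using sobolev_norm_diff_diff[OF g(1)[OF s] g(1)[OF s0] hS(1)[OF s, of n] hS(1)[OF s0, of n]] n
        unfolding dist[OF hS(2)[OF s] hS(2)[OF s0]] sobolev_norm_commute[OF g(1)[OF s] hS(1)[OF s]] sobolev_norm_commute[OF g(1)[OF s0] hS(1)[OF s0]]
        by (rule order.strict_trans1)
      then show ?thesis using cutoff_diff_test[OF s s0, of n] by blast
    qed
    then show ?thesis using D by (simp add: sobolev_tilde_def)
  qed
  obtain q f where q: "q \<in> sobolev (1/2)" "\<And>n::nat. f n \<in> test_functions (- \<Gamma>)"
      "(\<lambda>n. sobolev_norm (1/2) (distr_diff (distr_of (f n)) (distr_diff (g \<sigma>0) q))) \<longlonglongrightarrow> 0"
      "\<And>u'. u' \<in> sobolev (1/2) \<Longrightarrow> distr_diff u' (g \<sigma>0) \<in> ?T \<Longrightarrow> orth_proj (1/2) (orth_compl (1/2) ?T) u' = q"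
    using orth_proj_tilde[OF g(1)[OF s0], of "- \<Gamma>"] by (metis half_gt_zero_iff less_eq_real_def zero_less_one)
  have proj: "orth_proj (1/2) (orth_compl (1/2) ?T) (dirichlet_trace e (?u \<sigma>)) = q" if "\<sigma> \<in> cutoffs \<Gamma>" "e \<in> {- 1, 1}" for \<sigma> and e :: real
    unfolding tr[OF that] by (rule q(4)[OF g(1)[OF that(1)] tilde[OF that(1)]])
  let ?P = "\<lambda>v. \<forall>\<sigma>\<in>cutoffs \<Gamma>. \<forall>e\<in>{- 1, 1::real}. v = orth_proj (1/2) (orth_compl (1/2) ?T) (dirichlet_trace e (?u \<sigma>))"
  have "(THE v. ?P v) = q"
  proof (rule the_equality)
    show "?P q" using proj by simp
    fix v assume "?P v"
    then have "v = orth_proj (1/2) (orth_compl (1/2) ?T) (dirichlet_trace 1 (?u \<sigma>0))" using s0 by blast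
    then show "v = q" using proj[OF s0, of 1] by simp
  qed
  then have op: "single_layer_op k \<Gamma> (mdistr M \<Psi>) = q" using mdistr_supp by (simp add: single_layer_op_def)
  have fS: "f n \<in> schwartz" "distr_of (f n) \<in> sobolev (1/2)" for n
    using test_functions_schwartz[OF q(2)[of n]] by (auto intro: distr_of_sobolev)
  have "(\<lambda>n. sobolev_norm (1/2) (distr_diff (distr_of (\<lambda>y. ?h \<sigma>0 n y - f n y)) q)) \<longlonglongrightarrow> 0"
  proof (rule Lim_null_comparison)
    show "(\<lambda>n. sobolev_norm (1/2) (distr_diff (distr_of (?h \<sigma>0 n)) (g \<sigma>0)) + sobolev_norm (1/2) (distr_diff (distr_of (f n)) (distr_diff (g \<sigma>0) q))) \<longlonglongrightarrow> 0"
      using tendsto_add[OF g(2)[OF s0] q(3)] by simp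
    have "sobolev_norm (1/2) (distr_diff (distr_diff (distr_of (?h \<sigma>0 n)) (distr_of (f n))) q) \<le> sobolev_norm (1/2) (distr_diff (distr_of (?h \<sigma>0 n)) (g \<sigma>0)) + sobolev_norm (1/2) (distr_diff (distr_of (f n)) (distr_diff (g \<sigma>0) q))" for n
    proof -
      have "distr_diff (distr_diff (g \<sigma>0) (distr_diff (g \<sigma>0) q)) q = (\<lambda>f. 0)" "distr_diff (g \<sigma>0) (distr_diff (g \<sigma>0) q) = q" by (auto simp: distr_diff_def)
      then show ?thesis
        using sobolev_norm_diff_diff[OF hS(1)[OF s0, of n] fS(2)[of n] g(1)[OF s0] sobolev_diff[OF g(1)[OF s0] q(1)]] by simp
    qed
    then show "\<forall>\<^sub>F n in sequentially. norm (sobolev_norm (1/2) (distr_diff (distr_of (\<lambda>y. ?h \<sigma>0 n y - f n y)) q)) \<le> sobolev_norm (1/2) (distr_diff (distr_of (?h \<sigma>0 n)) (g \<sigma>0)) + sobolev_norm (1/2) (distr_diff (distr_of (f n)) (distr_diff (g \<sigma>0) q))"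
      unfolding dist[OF hS(2)[OF s0] fS(1)] real_norm_def abs_of_nonneg[OF sobolev_norm_nonneg] by (intro always_eventually allI)
  qed
  then show thesis by (rule that[OF q(1,2) s0 _ op])
qed

text \<open>The sequence \<open>?h\<close> has two limits in \<open>L2 M\<close>: the trace, by
  definition of \<open>trace_on\<close>, and the potential itself, since on \<Gamma> the cut-off is
  1 and f n is 0.\<close>

lemma trace_single_layer: "AE x in M. trace_on d (1/2) \<Gamma> (single_layer_op k \<Gamma> (mdistr M \<Psi>)) x = pot 0 (x, 0)"
proof (rule single_layer_op_eq)
  fix q and f :: "nat \<Rightarrow> 'a \<Rightarrow> complex" and \<sigma> assume q: "q \<in> sobolev (1/2)" "\<And>n. f n \<in> test_functions (- \<Gamma>)" and s: "\<sigma> \<in> cutoffs \<Gamma>"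
    and lim: "(\<lambda>n. sobolev_norm (1/2) (distr_diff (distr_of (\<lambda>y. \<sigma> (y, 0) * pot (eps n) (y, 0) - f n y)) q)) \<longlonglongrightarrow> 0"
    and op: "single_layer_op k \<Gamma> (mdistr M \<Psi>) = q"
  let ?t = "trace_on d (1/2) \<Gamma> q" and ?p = "\<lambda>x. pot 0 (x, 0)"
  let ?h = "\<lambda>n y. \<sigma> (y, 0) * pot (eps n) (y, 0) - f n y"
  have t: "?t \<in> L2 M" and tl: "\<And>F. (\<And>j::nat. F j \<in> test_functions UNIV) \<Longrightarrow> (\<lambda>j. sobolev_norm (1/2) (distr_diff (distr_of (F j)) q)) \<longlonglongrightarrow> 0 \<Longrightarrow> (\<lambda>j. L2_norm M (\<lambda>x. F j x - ?t x)) \<longlonglongrightarrow> 0"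
    using trace_on_is_trace[OF refl q(1)] by (simp_all add: is_trace_def)
  have \<sigma>: "\<sigma> \<in> test_functions UNIV" using s by (simp add: cutoffs_def)
  have ht: "?h n \<in> test_functions UNIV" for n
    by (rule test_functions_diff[OF slice_test[OF cutoff_pot_test[OF \<sigma>]] test_functions_mono[OF subset_UNIV q(2)]])
  have h: "(\<lambda>n. L2_norm M (\<lambda>x. ?h n x - ?t x)) \<longlonglongrightarrow> 0" by (rule tl[OF ht lim])
  have fz: "f n y = 0" if "y \<in> \<Gamma>" for n y using test_functions_supp(2)[OF q(2)[of n]] that by (intro fun_supp_zero) auto
  note pt = pot_trace_L2[of \<sigma>, unfolded space_M, OF cutoffs_one[OF s]]
  have p: "(\<lambda>n. L2_norm M (\<lambda>x. ?h n x - ?p x)) \<longlonglongrightarrow> 0"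
  proof -
    have "L2_norm M (\<lambda>x. ?h n x - ?p x) = L2_norm M (\<lambda>x. \<sigma> (x, 0) * pot (eps n) (x, 0) - ?p x)" for n
      unfolding L2_norm_def by (intro arg_cong[where f = sqrt] Bochner_Integration.integral_cong refl) (simp add: space_M fz)
    then show ?thesis using pt(2) by simp
  qed
  have "L2_norm M (\<lambda>x. ?t x - ?p x) \<le> 0"
  proof (rule LIMSEQ_le_const)
    show "(\<lambda>n. L2_norm M (\<lambda>x. ?h n x - ?t x) + L2_norm M (\<lambda>x. ?h n x - ?p x)) \<longlonglongrightarrow> 0" using tendsto_add[OF h p] by simp
    show "\<exists>N. \<forall>n\<ge>N. L2_norm M (\<lambda>x. ?t x - ?p x) \<le> L2_norm M (\<lambda>x. ?h n x - ?t x) + L2_norm M (\<lambda>x. ?h n x - ?p x)"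
      using L2_triangle3[OF t schwartz_L2[OF test_functions_schwartz[OF ht]] pt(1)] L2_norm_minus[of M ?t] by (intro exI allI impI) simp
  qed
  then have "L2_norm M (\<lambda>x. ?t x - ?p x) = 0" using L2_norm_nonneg[of M "\<lambda>x. ?t x - ?p x"] by simp
  from L2_norm_eq_0[OF L2_diff[OF t pt(1)] this] show "AE x in M. trace_on d (1/2) \<Gamma> (single_layer_op k \<Gamma> (mdistr M \<Psi>)) x = pot 0 (x, 0)"
    unfolding op by (auto elim!: eventually_mono)
qed

end

text \<open>Integrability is proved along with the formula, so that the integral is a genuine value
  and not the default 0 of a non-integrable function.\<close>

lemma single_layer_dset_eq:
  fixes \<Gamma> :: "'a::euclidean_space set" and k d :: real and \<Psi> :: "'a \<Rightarrow> complex"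
  assumes N: "DIM('a) \<in> {1, 2}" and k: "0 < k" and \<Gamma>: "compact \<Gamma>" "d_set d \<Gamma>"
    and d: "real DIM('a) - 1 < d" "d \<le> real DIM('a)" and \<Psi>: "\<Psi> \<in> Linf (surface d \<Gamma>)"
  shows "AE x in surface d \<Gamma>.
           integrable (surface d \<Gamma>) (\<lambda>y. fund_sol k (x, 0) (y, 0) * \<Psi> y) \<and>
           single_layer_dset k d \<Gamma> (L2_embed d \<Gamma> \<Psi>) x =
             (LINT y|surface d \<Gamma>. fund_sol k (x, 0) (y, 0) * \<Psi> y)"
proof -
  let ?M = "surface d \<Gamma>"
  have "DIM('a) \<le> 2" using N by auto
  then obtain c where "growth_measure ?M c d" by (rule d_set_growth_measure[OF \<Gamma> _ d])
  then interpret G: growth_measure ?M c d .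
  obtain C where m [measurable]: "\<Psi> \<in> borel_measurable ?M" and C: "AE x in ?M. norm (\<Psi> x) \<le> C" using \<Psi> by (auto simp: Linf_def)
  \<comment> \<open>A representative that is bounded at every point, as
    \<open>layer_potential\<close> requires. The truncation changes \<Psi> on a null set, which
    integrals do not see, so \<open>mdistr\<close> is literally the same distribution.\<close>
  define \<Psi>' where "\<Psi>' y = (if norm (\<Psi> y) \<le> C then \<Psi> y else 0)" for y
  have m' [measurable]: "\<Psi>' \<in> borel_measurable ?M" unfolding \<Psi>'_def[abs_def] by measurable
  have eq: "AE y in ?M. \<Psi>' y = \<Psi> y" using C by eventually_elim (simp add: \<Psi>'_def)
  obtain \<kappa> where \<kappa>: "\<kappa> holomorphic_on {z. 0 < Re z}" "\<And>x y :: 'a \<times> real. fund_sol k x y = \<kappa> (of_real ((norm (x - y))\<^sup>2))"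
    "\<And>R b. 0 < R \<Longrightarrow> (real DIM('a) - 1) / 2 < b \<Longrightarrow> \<exists>C\<ge>0. \<forall>s. 0 < s \<and> s \<le> R \<longrightarrow> norm (\<kappa> (of_real s)) \<le> C * s powr (- b) \<and>
        norm (deriv \<kappa> (of_real s)) \<le> C * s powr (- ((real DIM('a) + 1) / 2))"
    using fund_sol_kernel[OF k N] by blast
  have sp: "space ?M = \<Gamma>" by (simp add: surface_def space_restrict_space space_hausdorff_measure)
  interpret S: screen_layer \<Gamma> c d \<kappa> \<Psi>' "\<bar>C\<bar>" k
  proof unfold_locales
    show "bounded (space ?M)" unfolding sp by (rule compact_imp_bounded[OF \<Gamma>(1)])
    show "norm (\<Psi>' y) \<le> \<bar>C\<bar>" for y using abs_ge_self[of C] by (auto simp: \<Psi>'_def intro: order_trans)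
    show "\<exists>C\<ge>0. \<forall>s. 0 < s \<and> s \<le> R \<longrightarrow> norm (\<kappa> (of_real s)) \<le> C * s powr (- (G.\<beta> / 2)) \<and>
        norm (deriv \<kappa> (of_real s)) \<le> C * s powr (- ((real DIM('a) + 1) / 2))" if "0 < R" for R
      using G.beta(2) by (intro \<kappa>(3)[OF that]) auto
  qed (use \<kappa>(1,2) \<Gamma>(1) in auto)
  have L: "\<Psi> \<in> L2 ?M" by (rule L2_cong_AE[OF S.Psi_L2 m eq])
  have "mdistr ?M \<Psi> = mdistr ?M \<Psi>'"
  proof
    fix f :: "'a \<Rightarrow> complex"
    have "(LINT y|?M. f y * \<Psi> y) = (LINT y|?M. f y * \<Psi>' y)" if "f \<in> schwartz"
    proof (rule integral_cong_AE)
      have [measurable]: "f \<in> borel_measurable ?M" using G.schwartz_L2[OF that] by (simp add: L2_def)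
      show "(\<lambda>y. f y * \<Psi> y) \<in> borel_measurable ?M" "(\<lambda>y. f y * \<Psi>' y) \<in> borel_measurable ?M" by measurable
      show "AE y in ?M. f y * \<Psi> y = f y * \<Psi>' y" using eq by eventually_elim simp
    qed
    then show "mdistr ?M \<Psi> f = mdistr ?M \<Psi>' f" by (simp add: mdistr_def)
  qed
  then have dset: "single_layer_dset k d \<Gamma> (L2_embed d \<Gamma> \<Psi>) = trace_on d (1/2) \<Gamma> (single_layer_op k \<Gamma> (mdistr ?M \<Psi>'))"
    by (simp add: single_layer_dset_def G.trace_adj_L2_embed[OF refl L])
  have int: "integrable ?M (\<lambda>y. fund_sol k (x, 0) (y, 0) * \<Psi> y) \<and> (LINT y|?M. fund_sol k (x, 0) (y, 0) * \<Psi> y) = S.pot 0 (x, 0)" for x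
  proof -
    have ms: "(\<lambda>y. fund_sol k (x, 0) (y, 0) * \<Psi> y) \<in> borel_measurable ?M" "(\<lambda>y. fund_sol k (x, 0) (y, 0) * \<Psi>' y) \<in> borel_measurable ?M"
      unfolding S.fund_sol_K by measurable
    have ae: "AE y in ?M. fund_sol k (x, 0) (y, 0) * \<Psi> y = fund_sol k (x, 0) (y, 0) * \<Psi>' y" using eq by eventually_elim simp
    show ?thesis
      using S.pot_integrable[of 0 "(x, 0)"] integrable_cong_AE[OF ms ae] integral_cong_AE[OF ms ae]
      unfolding S.fund_sol_K S.pot_def by simp
  qed
  from S.trace_single_layer show ?thesis by eventually_elim (simp add: dset int)
qed

theorem theorem4p6:
  fixes \<Gamma> :: "(real ^ 'n) set" and k d :: real and \<Psi> :: "real ^ 'n \<Rightarrow> complex"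
  assumes "CARD('n) \<in> {1, 2}"
    and "k > 0"
    and "compact \<Gamma>"
    and "d_set d \<Gamma>"
    and "real CARD('n) - 1 < d" and "d \<le> real CARD('n)"
    and "\<Psi> \<in> Linf (surface d \<Gamma>)"
  shows "AE x in surface d \<Gamma>.
           integrable (surface d \<Gamma>) (\<lambda>y. fund_sol k (x, 0) (y, 0) * \<Psi> y) \<and>
           single_layer_dset k d \<Gamma> (L2_embed d \<Gamma> \<Psi>) x =
             (LINT y|surface d \<Gamma>. fund_sol k (x, 0) (y, 0) * \<Psi> y)"
  by (rule single_layer_dset_eq) (use assms in simp_all)

end
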